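(* Let $X=F^{-1}(0)\subseteq\mathbb K^{n+k}$ be the germ at the origin of an analytic space defined by $F$, let $Y$, $W$, $S$ be as described in the context, with $W$ dense in $X\setminus Y$ in the metric topology, and let $P$ be an analytic direct transversal to $Y$ at $0$. For the case $r=0$ assume in addition that $Y\subseteq X$. Let $r\ge 0$. (1) $W$ is $(t^r)$ for the transversal $P$ if and only if $$\mathfrak m_n^r\,JM_y(F)\subseteq\overline{\mathfrak m_n\,JM(F)_P+I(P)\,JM_y(F)},$$ the integral closure being taken in $\mathcal O_{X,0}^p$ (real integral closure in the real analytic situation). (2) Furthermore, $X$ is $(t^r)$ for the transversal $P$ if and only if $W$ is $(t^r)$ for the transversal $P$ and $$\mathfrak m_n^r\,\mathcal O_{S,0}\subseteq\overline{I(P)\,\mathcal O_{S,0}}.$$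
   Context: $\mathbb K$ is $\mathbb R$ or $\mathbb C$. $\mathbb K^{n+k}=\mathbb K^n\times\mathbb K^k$ has coordinates $(x_1,\dots,x_n,y_1,\dots,y_k)$ and $Y=\{0\}\times\mathbb K^k$. $F:(\mathbb K^{n+k},0)\to(\mathbb K^p,0)$ is an analytic map germ, $X=F^{-1}(0)$, $e$ is the codimension of $X\setminus Y$ (possibly $e<p$), $W$ is the Zariski open subset of $X\setminus Y$ of points where $F$ has rank $e$ (a smooth submanifold), and $S=X\setminus W$. $\mathcal O_{X,0}$ is the ring of analytic germs on $\mathbb K^{n+k}$ at $0$ modulo the ideal generated by the components of $F$; $\mathcal O_{S,0}$ is the ring of analytic function germs on $S$ at $0$. Jets and $(t^r)$. An analytic direct transversal to $Y$ at $0$ is a graph $P=\Gamma(f)$ with $f=(f_1,\dots,f_k):(\mathbb K^n,0)\to(\mathbb K^k,0)$ analytic. For $r\ge1$, graphs of two $C^r$ map germs vanishing at $0$ are $r$-equivalent if the maps have the same $r$-jet at $0$. For $r=0$ one considers map germs vanishing at $0$ of class $C^{0,-1}$, i.e. continuous, $C^1$ except possibly at $0$, with $|g'(x)|=O(|x|^{-1})$; graphs of $f,g$ are $0$-equivalent if $|f'(x)-g'(x)|=o(|x|^{-1})$. Write $j^rP=j^rQ$ for $r$-equivalence. If $\mathbb K=\mathbb C$, $\mathbb C^n,\mathbb C^k$ are regarded as $\mathbb R^{2n},\mathbb R^{2k}$ and the graphs $Q$ below are graphs of real $C^r$ (resp. $C^{0,-1}$) maps. $W$ is $(t^r)$ for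 $P$ if every $Q$ with $j^rQ=j^rP$ is transverse to $W$ at all points near (but not necessarily at) $0$. $X$ is $(t^r)$ for $P$ if $W$ is $(t^r)$ for $P$ and every $Q$ with $j^rQ=j^rP$ satisfies $Q\cap S=\{0\}$ as germs at $0$. Modules. $\mathfrak m_n$ is the ideal generated by $x_1,\dots,x_n$ ($\mathfrak m_n^0$ is the whole ring). $I(P)$ is the ideal generated by $y_j-f_j(x)$, $j=1,\dots,k$. As submodules of $\mathcal O_{X,0}^p$: $JM_y(F)$ is generated by the $\partial F/\partial y_j$, $j=1,\dots,k$, and $JM(F)_P$ is generated by $\partial F/\partial x_i+\sum_j\frac{\partial f_j}{\partial x_i}\frac{\partial F}{\partial y_j}$, $i=1,\dots,n$. Integral closure. For a $\mathbb K$-analytic set germ $(Z,z)$ and a submodule $M\subseteq\mathcal O_{Z,z}^q$, an element $h\in\mathcal O_{Z,z}^q$ is in $\overline M$ iff for every $\mathbb K$-analytic curve $\phi:(\mathbb K,0)\to(Z,z)$ one has $h\circ\phi\in(\phi^*M)\mathcal O_1$, where $\mathcal O_1$ is the ring of analytic germs on $(\mathbb K,0)$. (For $\mathbb K=\mathbb R$ this is the real integral closure.) In (2) the integral closure is that of an ideal of $\mathcal O_{S,0}$, taken in $\mathcal O_{S,0}$.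
   Formalization: In (2) with r=0 the integral closure is tested only on analytic curves in S not contained in Y, since along the constant curve 0 the stated inclusion always fails although X can be (t^0); W being a smooth submanifold is read as: of codimension e near 0. *)

theory Defs
  imports "HOL-Analysis.Analysis" "HOL-Library.Landau_Symbols"
begin

text \<open>
  The field \<open>K\<close> is a type \<open>'a\<close> of class \<open>{real_normed_field, euclidean_space}\<close>; the theorem uses
  the instances \<open>real\<close> and \<open>complex\<close>. The space \<open>K^(n+k)\<close> is \<open>'a^('n+'m)\<close> with \<open>n = CARD('n)\<close>,
  \<open>k = CARD('m)\<close>, and \<open>K\<close> as a domain of curves is \<open>'a^1\<close>. A map germ at 0 is represented by a
  total function, and only its values near 0 matter; a set germ at 0 is represented by a set in the
  same way. Library notions such as \<open>has_derivative\<close>, \<open>frechet_derivative\<close> and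
  \<open>has_vector_derivative\<close> are real ones, also on \<open>complex^'d\<close>.
\<close>

section \<open>Analytic functions and partial derivatives over \<open>K\<close>\<close>

definition analytic_at ::
  "('a::{real_normed_field,euclidean_space}^'d::finite \<Rightarrow> 'a) \<Rightarrow> 'a^'d \<Rightarrow> bool" where
  "analytic_at f z \<longleftrightarrow>
     (\<exists>\<rho>>0. \<exists>c :: ('d \<Rightarrow> nat) \<Rightarrow> 'a. \<forall>h. (\<forall>i. norm (h $ i) < \<rho>) \<longrightarrow>
        ((\<lambda>\<alpha>. c \<alpha> * (\<Prod>i\<in>UNIV. (h $ i) ^ \<alpha> i)) has_sum f (z + h)) UNIV)"

definition analytic_map_at ::
  "('a::{real_normed_field,euclidean_space}^'d::finite \<Rightarrow> 'a^'q::finite) \<Rightarrow> 'a^'d \<Rightarrow> bool" where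
  "analytic_map_at f z \<longleftrightarrow> (\<forall>l. analytic_at (\<lambda>w. f w $ l) z)"

definition pd ::
  "'d::finite \<Rightarrow> ('a::{real_normed_field,euclidean_space}^'d \<Rightarrow> 'a) \<Rightarrow> 'a^'d \<Rightarrow> 'a" where
  "pd i f z = deriv (\<lambda>t. f (z + axis i t)) 0"

definition partial_map ::
  "'d::finite \<Rightarrow> ('a::{real_normed_field,euclidean_space}^'d \<Rightarrow> 'a^'q::finite) \<Rightarrow> 'a^'d \<Rightarrow> 'a^'q" where
  "partial_map i f z = (\<chi> l. pd i (\<lambda>w. f w $ l) z)"

definition jacobian ::
  "('a::{real_normed_field,euclidean_space}^'d::finite \<Rightarrow> 'a^'q::finite) \<Rightarrow> 'a^'d \<Rightarrow> 'a^'d^'q" where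
  "jacobian f z = (\<chi> l i. pd i (\<lambda>w. f w $ l) z)"

section \<open>Submanifolds, codimension, transversality\<close>

text \<open>\<open>K\<close>-analytic submanifolds of codimension \<open>c\<close>, given locally by \<open>c\<close> analytic equations with
  linearly independent gradients.\<close>

definition submanifold ::
  "nat \<Rightarrow> ('a::{real_normed_field,euclidean_space}^'d::finite) set \<Rightarrow> bool" where
  "submanifold c N \<longleftrightarrow>
     (\<forall>z\<in>N. \<exists>V G. open V \<and> z \<in> V \<and> (\<forall>i<c. \<forall>w\<in>V. analytic_at (G i) w) \<and>
        (\<forall>a. (\<forall>j. (\<Sum>i<c. a i * pd j (G i) z) = 0) \<longrightarrow> (\<forall>i<c. a i = 0)) \<and>
        N \<inter> V = {w\<in>V. \<forall>i<c. G i w = 0})"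

text \<open>The dimension of a semianalytic germ is the largest dimension of a submanifold contained in
  it arbitrarily near 0. For the empty germ, the value of \<open>codim_germ\<close> is unspecified; the set \<open>W\<close>
  below is then empty near 0, whatever that value.\<close>

definition codim_germ :: "('a::{real_normed_field,euclidean_space}^'d::finite) set \<Rightarrow> nat" where
  "codim_germ A =
     (LEAST c. \<forall>V. open V \<and> 0 \<in> V \<longrightarrow> (\<exists>N. N \<noteq> {} \<and> N \<subseteq> A \<inter> V \<and> submanifold c N))"

definition tangent_space :: "'v::real_normed_vector set \<Rightarrow> 'v \<Rightarrow> 'v set" where
  "tangent_space N z =
     {v. \<exists>\<gamma> :: real \<Rightarrow> 'v. \<gamma> 0 = z \<and> (\<forall>\<^sub>F t in nhds 0. \<gamma> t \<in> N) \<and> (\<gamma> has_vector_derivative v) (at 0)}"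

definition transverse_at :: "'v::real_normed_vector set \<Rightarrow> 'v set \<Rightarrow> 'v \<Rightarrow> bool" where
  "transverse_at M N z \<longleftrightarrow> {u + v | u v. u \<in> tangent_space M z \<and> v \<in> tangent_space N z} = UNIV"

section \<open>The sets \<open>Y\<close>, \<open>X\<close>, \<open>W\<close>, \<open>S\<close>\<close>

definition join :: "'a^'n::finite \<Rightarrow> 'a^'m::finite \<Rightarrow> 'a^('n+'m)" where
  "join x y = (\<chi> s. case s of Inl i \<Rightarrow> x $ i | Inr j \<Rightarrow> y $ j)"

definition xpart :: "'a^('n::finite+'m::finite) \<Rightarrow> 'a^'n" where
  "xpart z = (\<chi> i. z $ Inl i)"

definition Yset :: "('a::zero^('n::finite+'m::finite)) set" where
  "Yset = {z. xpart z = 0}"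

definition Xset :: "('a::zero^'d::finite \<Rightarrow> 'a^'p::finite) \<Rightarrow> ('a^'d) set" where
  "Xset F = {z. F z = 0}"

definition Wset ::
  "('a::{real_normed_field,euclidean_space}^('n::finite+'m::finite) \<Rightarrow> 'a^'p::finite)
   \<Rightarrow> ('a^('n+'m)) set" where
  "Wset F = {z \<in> Xset F - Yset. rank (jacobian F z) = codim_germ (Xset F - Yset)}"

definition Sset ::
  "('a::{real_normed_field,euclidean_space}^('n::finite+'m::finite) \<Rightarrow> 'a^'p::finite)
   \<Rightarrow> ('a^('n+'m)) set" where
  "Sset F = Xset F - Wset F"

section \<open>Jets and the condition \<open>(t^r)\<close>\<close>

definition graph :: "('a^'n::finite \<Rightarrow> 'a^'m::finite) \<Rightarrow> ('a^('n+'m)) set" where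
  "graph g = range (\<lambda>x. join x (g x))"

text \<open>\<open>dderiv [v1, ..., vj] g\<close> is the iterated real directional derivative of \<open>g\<close> along
  \<open>v1\<close>, then \<open>v2\<close>, and so on.\<close>

primrec dderiv ::
  "'v::real_normed_vector list \<Rightarrow> ('v \<Rightarrow> 'w::real_normed_vector) \<Rightarrow> 'v \<Rightarrow> 'w" where
  "dderiv [] g = g"
| "dderiv (v # vs) g = dderiv vs (\<lambda>x. frechet_derivative g (at x) v)"

definition C_on ::
  "nat \<Rightarrow> 'v::euclidean_space set \<Rightarrow> ('v \<Rightarrow> 'w::euclidean_space) \<Rightarrow> bool" where
  "C_on r U g \<longleftrightarrow>
     (\<forall>vs. length vs < r \<longrightarrow> (\<forall>x\<in>U. dderiv vs g differentiable (at x))) \<and>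
     (\<forall>vs. length vs \<le> r \<longrightarrow> continuous_on U (dderiv vs g))"

text \<open>Map germs of class \<open>C^r\<close> (\<open>r \<ge> 1\<close>), resp. \<open>C^(0,-1)\<close> (\<open>r = 0\<close>), vanishing at 0.\<close>

definition r_germ :: "nat \<Rightarrow> ('v::euclidean_space \<Rightarrow> 'w::euclidean_space) \<Rightarrow> bool" where
  "r_germ r g \<longleftrightarrow> g 0 = 0 \<and>
     (\<exists>U. open U \<and> 0 \<in> U \<and>
        (if r = 0
         then continuous_on U g \<and> C_on 1 (U - {0}) g \<and>
              (\<lambda>x. onorm (frechet_derivative g (at x))) \<in> O[at 0](\<lambda>x. inverse (norm x))
         else C_on r U g))"

definition r_equivalent ::
  "nat \<Rightarrow> ('v::euclidean_space \<Rightarrow> 'w::euclidean_space) \<Rightarrow> ('v \<Rightarrow> 'w) \<Rightarrow> bool" where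
  "r_equivalent r f g \<longleftrightarrow>
     (if r = 0
      then (\<lambda>x. onorm (\<lambda>v. frechet_derivative f (at x) v - frechet_derivative g (at x) v))
             \<in> o[at 0](\<lambda>x. inverse (norm x))
      else (\<forall>vs. length vs \<le> r \<longrightarrow> dderiv vs f 0 = dderiv vs g 0))"

definition W_is_t ::
  "nat \<Rightarrow> ('a::{real_normed_field,euclidean_space}^('n::finite+'m::finite) \<Rightarrow> 'a^'p::finite)
   \<Rightarrow> ('a^'n \<Rightarrow> 'a^'m) \<Rightarrow> bool" where
  "W_is_t r F f \<longleftrightarrow>
     (\<forall>g. r_germ r g \<and> r_equivalent r f g \<longrightarrow>
        (\<forall>\<^sub>F z in nhds 0. z \<in> graph g \<inter> Wset F \<longrightarrow> transverse_at (graph g) (Wset F) z))"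

definition X_is_t ::
  "nat \<Rightarrow> ('a::{real_normed_field,euclidean_space}^('n::finite+'m::finite) \<Rightarrow> 'a^'p::finite)
   \<Rightarrow> ('a^'n \<Rightarrow> 'a^'m) \<Rightarrow> bool" where
  "X_is_t r F f \<longleftrightarrow> W_is_t r F f \<and>
     (\<forall>g. r_germ r g \<and> r_equivalent r f g \<longrightarrow>
        (\<forall>\<^sub>F z in nhds 0. z \<in> graph g \<inter> Sset F \<longleftrightarrow> z = 0))"

section \<open>Ideals, modules, integral closure\<close>

text \<open>Let \<open>O\<close> be the ring of analytic germs at 0 on \<open>'a^'d\<close>. A quotient ring \<open>O/R\<close>
  (such as \<open>O_(X,0)\<close> or \<open>O_(S,0)\<close>) is given by its ideal \<open>R\<close> of relations, and a submodule of
  \<open>(O/R)^q\<close> is represented by its preimage in \<open>O^q\<close>, that is, by a submodule of \<open>O^q\<close> containing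
  \<open>R O^q\<close>.\<close>

definition ideal_gen ::
  "('a::{real_normed_field,euclidean_space}^'d::finite \<Rightarrow> 'a) set \<Rightarrow> ('a^'d \<Rightarrow> 'a) set" where
  "ideal_gen G = {h. \<exists>(N::nat) a g. (\<forall>i<N. analytic_at (a i) 0 \<and> g i \<in> G) \<and>
                      analytic_at h 0 \<and> (\<forall>\<^sub>F z in nhds 0. h z = (\<Sum>i<N. a i z * g i z))}"

definition module_gen ::
  "('a::{real_normed_field,euclidean_space}^'d::finite \<Rightarrow> 'a^'q::finite) set \<Rightarrow> ('a^'d \<Rightarrow> 'a^'q) set" where
  "module_gen G = {h. \<exists>(N::nat) a g. (\<forall>i<N. analytic_at (a i) 0 \<and> g i \<in> G) \<and>
                      analytic_map_at h 0 \<and> (\<forall>\<^sub>F z in nhds 0. h z = (\<Sum>i<N. a i z *s g i z))}"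

definition submodule_gen ::
  "('a::{real_normed_field,euclidean_space}^'d::finite \<Rightarrow> 'a) set
   \<Rightarrow> ('a^'d \<Rightarrow> 'a^'q::finite) set \<Rightarrow> ('a^'d \<Rightarrow> 'a^'q) set" where
  "submodule_gen R G = module_gen (G \<union> {(\<lambda>z. axis l (a z)) | a l. a \<in> R})"

definition ideal_times ::
  "('a::{real_normed_field,euclidean_space}^'d::finite \<Rightarrow> 'a) set \<Rightarrow> ('a^'d \<Rightarrow> 'a) set
   \<Rightarrow> ('a^'d \<Rightarrow> 'a^'q::finite) set \<Rightarrow> ('a^'d \<Rightarrow> 'a^'q) set" where
  "ideal_times R J M = submodule_gen R {(\<lambda>z. a z *s h z) | a h. a \<in> J \<and> h \<in> M}"

definition relX ::
  "('a::{real_normed_field,euclidean_space}^'d::finite \<Rightarrow> 'a^'p::finite) \<Rightarrow> ('a^'d \<Rightarrow> 'a) set" where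
  "relX F = ideal_gen (range (\<lambda>l z. F z $ l))"

definition relS ::
  "('a::{real_normed_field,euclidean_space}^('n::finite+'m::finite) \<Rightarrow> 'a^'p::finite)
   \<Rightarrow> ('a^('n+'m) \<Rightarrow> 'a) set" where
  "relS F = {a. analytic_at a 0 \<and> (\<forall>\<^sub>F z in nhds 0. z \<in> Sset F \<longrightarrow> a z = 0)}"

definition m_ideal :: "('a::{real_normed_field,euclidean_space}^('n::finite+'m::finite) \<Rightarrow> 'a) set" where
  "m_ideal = ideal_gen (range (\<lambda>i z. z $ Inl i))"

primrec m_pow ::
  "nat \<Rightarrow> ('a::{real_normed_field,euclidean_space}^('n::finite+'m::finite) \<Rightarrow> 'a) set" where
  "m_pow 0 = {a. analytic_at a 0}"
| "m_pow (Suc r) = ideal_gen {(\<lambda>z. a z * b z) | a b. a \<in> m_ideal \<and> b \<in> m_pow r}"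

definition I_P ::
  "('a::{real_normed_field,euclidean_space}^'n::finite \<Rightarrow> 'a^'m::finite) \<Rightarrow> ('a^('n+'m) \<Rightarrow> 'a) set" where
  "I_P f = ideal_gen (range (\<lambda>j z. z $ Inr j - f (xpart z) $ j))"

definition JM_y ::
  "('a::{real_normed_field,euclidean_space}^('n::finite+'m::finite) \<Rightarrow> 'a^'p::finite)
   \<Rightarrow> ('a^('n+'m) \<Rightarrow> 'a^'p) set" where
  "JM_y F = submodule_gen (relX F) (range (\<lambda>j. partial_map (Inr j) F))"

definition JM_P ::
  "('a::{real_normed_field,euclidean_space}^('n::finite+'m::finite) \<Rightarrow> 'a^'p::finite)
   \<Rightarrow> ('a^'n \<Rightarrow> 'a^'m) \<Rightarrow> ('a^('n+'m) \<Rightarrow> 'a^'p) set" where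
  "JM_P F f = submodule_gen (relX F)
     (range (\<lambda>i z. partial_map (Inl i) F z
                   + (\<Sum>j\<in>UNIV. partial_map i f (xpart z) $ j *s partial_map (Inr j) F z)))"

definition module_sum ::
  "('v \<Rightarrow> 'w::plus) set \<Rightarrow> ('v \<Rightarrow> 'w) set \<Rightarrow> ('v \<Rightarrow> 'w) set" where
  "module_sum M N = {(\<lambda>z. g z + h z) | g h. g \<in> M \<and> h \<in> N}"

text \<open>The ring \<open>O_(S,0)\<close> as a module over itself; scalar germs are germs of maps into \<open>'a^1\<close>.\<close>

definition O_S ::
  "('a::{real_normed_field,euclidean_space}^('n::finite+'m::finite) \<Rightarrow> 'a^'p::finite)
   \<Rightarrow> ('a^('n+'m) \<Rightarrow> 'a^1) set" where
  "O_S F = {h. analytic_map_at h 0}"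

definition curves ::
  "('a::{real_normed_field,euclidean_space}^'d::finite) set \<Rightarrow> ('a^1 \<Rightarrow> 'a^'d) set" where
  "curves Z = {\<phi>. analytic_map_at \<phi> 0 \<and> \<phi> 0 = 0 \<and> (\<forall>\<^sub>F t in nhds 0. \<phi> t \<in> Z)}"

text \<open>Integral closure tested along a set \<open>C\<close> of curves; the integral closure in \<open>O_(Z,0)^q\<close> is
  the case \<open>C = curves Z\<close>. The condition does not depend on the representative of \<open>h\<close>, because
  the relations vanish along the curves in \<open>Z\<close>.

  In the criterion for \<open>X\<close> with \<open>r = 0\<close>, the set \<open>C\<close> has to be \<open>curves (Sset F) - curves Yset\<close>:
  along the constant curve 0 (and every other curve in \<open>Y\<close>) the ideal \<open>I(P)\<close> pulls back to a
  proper ideal, so over \<open>curves (Sset F)\<close> the inclusion fails for every \<open>F\<close>, although \<open>X\<close> can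
  be \<open>(t^0)\<close>, e.g. for \<open>F = x\<close> on \<open>K^(1+1)\<close>. For \<open>r \<ge> 1\<close> the curves in \<open>Y\<close> impose no condition.\<close>

definition int_closure ::
  "('a::{real_normed_field,euclidean_space}^1 \<Rightarrow> 'a^'d::finite) set
   \<Rightarrow> ('a^'d \<Rightarrow> 'a^'q::finite) set \<Rightarrow> ('a^'d \<Rightarrow> 'a^'q) set" where
  "int_closure C M = {h. analytic_map_at h 0 \<and>
                         (\<forall>\<phi>\<in>C. h \<circ> \<phi> \<in> module_gen ((\<lambda>g. g \<circ> \<phi>) ` M))}"

section \<open>Standing assumptions\<close>

text \<open>\<open>W\<close> is required to be a submanifold of codimension \<open>e\<close> near 0. This does not follow from
  the rank condition: for \<open>F = (x2 h, y^2 h)\<close> on \<open>K^(2+1)\<close> with \<open>h = x1 - x2\<close> one has \<open>e = 1\<close>, and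
  the line \<open>x2 = y = 0\<close> without the origin is contained in \<open>W\<close>.\<close>

definition setting ::
  "nat \<Rightarrow> ('a::{real_normed_field,euclidean_space}^('n::finite+'m::finite) \<Rightarrow> 'a^'p::finite)
   \<Rightarrow> ('a^'n \<Rightarrow> 'a^'m) \<Rightarrow> bool" where
  "setting r F f \<longleftrightarrow>
     analytic_map_at F 0 \<and> F 0 = 0 \<and>
     analytic_map_at f 0 \<and> f 0 = 0 \<and>
     (\<exists>U. open U \<and> 0 \<in> U \<and>
          submanifold (codim_germ (Xset F - Yset)) (Wset F \<inter> U) \<and>
          (Xset F - Yset) \<inter> U \<subseteq> closure (Wset F)) \<and>
     (r = 0 \<longrightarrow> (\<forall>\<^sub>F z in nhds 0. z \<in> Yset \<longrightarrow> z \<in> Xset F))"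

end

theory Submission
  imports Defs "HOL-Computational_Algebra.Fundamental_Theorem_Algebra"
begin

text \<open>Integral dependence in (1) amounts to an inequality between the pairings of a covector with
  the generators on both sides, which holds uniformly on \<open>X\<close> near 0: a sequence of violations can
  be replaced by an analytic curve (curve selection), on which the inequality is a statement about
  modules over a discrete valuation ring. A covector that kills the tangent spaces of \<open>W\<close> and of a
  graph \<open>r\<close>-equivalent to \<open>P\<close> violates the inequality; conversely, violations along a sequence allow one
  to add to \<open>f\<close> bumps of size \<open>o(|x|^r)\<close>, supported around the points of the sequence, so that the
  new graph is not transverse to \<open>W\<close> there. Part (2) is the same argument for the functions
  \<open>y - f(x)\<close> on \<open>S\<close>, which is again analytic.\<close>

text \<open>Two points shape the proof. Curve selection is proved for sign conditions on real
  analytic germs, by induction on the number of variables: after a linear change of coordinates the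
  germs become Weierstrass polynomials in one variable; the signs of finitely many germs in the
  other variables determine the order and sign pattern of the real roots, so the induction
  hypothesis yields a curve in those variables, and the last coordinate is found by a Puiseux
  argument. The complex case is obtained from real and imaginary parts and from complexification of
  the real curve. The second point is uniformity in the covector. Failure of integral dependence
  yields covectors along a curve that need not be analytic in the parameter, and the inequality must
  hold for all covectors at once. Covectors are therefore normalised to the unit sphere, which is
  compact, and near a limit covector they become additional analytic variables. Since the graphs in
  \<open>(t^r)\<close> are only real differentiable, real covectors have to be converted into
  covectors over the field, by means of \<open>conjugable\<close>.\<close>

abbreviation near0 :: "('v::{zero,topological_space} \<Rightarrow> bool) \<Rightarrow> bool" (binder "NEAR " 10) where
  "near0 P \<equiv> eventually P (nhds 0)"

abbreviation punctured :: "('v::{zero,topological_space} \<Rightarrow> bool) \<Rightarrow> bool" (binder "PUNCT " 10) where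
  "punctured P \<equiv> eventually P (at 0)"

abbreviation right0 :: "(real \<Rightarrow> bool) \<Rightarrow> bool" (binder "RIGHT " 10) where
  "right0 P \<equiv> eventually P (at_right 0)"

abbreviation fder :: "('v::real_normed_vector \<Rightarrow> 'w::real_normed_vector) \<Rightarrow> 'v \<Rightarrow> 'v \<Rightarrow> 'w" where
  "fder f x \<equiv> frechet_derivative f (at x)"

abbreviation (input) iff_ascii :: "[bool, bool] \<Rightarrow> bool" (infixr "<->" 25) where
  "A <-> B \<equiv> A = B"

notation tendsto (infixr "--->" 55)

abbreviation lims :: "(nat \<Rightarrow> 'a::topological_space) \<Rightarrow> 'a \<Rightarrow> bool" ("((_)/ ----> (_))" [60, 60] 60) where
  "X ----> L \<equiv> tendsto X L sequentially"

lemmas eventually_compose = eventually_compose_filterlim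
lemmas norm_nth_le = Finite_Cartesian_Product.norm_nth_le

section \<open>Power series with a majorant\<close>

definition mon :: "('d::finite => nat) => 'a::comm_ring_1^'d => 'a" where
 "mon e z = (\<Prod>k\<in>UNIV. (z $ k) ^ e k)"

definition rmon :: "('d::finite => nat) => ('d => real) => real" where
 "rmon e rho = (\<Prod>k\<in>UNIV. rho k ^ e k)"

definition pdisc :: "('d::finite => real) => ('a::real_normed_field^'d) set" where
 "pdisc rho = {z. ALL k. norm (z $ k) <= rho k}"

text \<open>The same exponent may occur for several indices; this makes sums and products of series
  immediate, and the terms are collected only in \<open>ps_imp_analytic_at\<close>.\<close>

definition rep :: "'i set => ('i => 'a::{real_normed_field,euclidean_space}) => ('i => 'd::finite => nat)
  => ('d => real) => real => ('a^'d => 'a) => bool" where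
 "rep I c e rho M f <->
   (ALL J. finite J --> J <= I --> (SUM i:J. norm (c i) * rmon (e i) rho) <= M) &
   (ALL z:pdisc rho. ((%i. c i * mon (e i) z) has_sum f z) I)"

text \<open>The index type is fixed to \<open>nat\<close>, since it cannot be quantified over;
  \<open>psI\<close> admits every countable index type, so that double series can be indexed by
  pairs.\<close>

definition ps :: "('d::finite => real) => real => ('a::{real_normed_field,euclidean_space}^'d => 'a) => bool" where
 "ps rho M f <-> (EX (c::nat => 'a) e. rep UNIV c e rho M f)"

lemma rmon_nonneg: "(ALL k. rho k >= 0) ==> rmon e rho >= 0"
 by (simp add: rmon_def prod_nonneg)

lemma rmon_pos: "(ALL k. rho k > 0) ==> rmon e rho > 0"
 by (simp add: rmon_def prod_pos)

lemma norm_mon_le: "z : pdisc rho ==> norm (mon e z) <= rmon e rho"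
 by (auto simp: mon_def rmon_def pdisc_def prod_norm[symmetric] norm_power intro!: prod_mono power_mono)

lemma mon_add: "mon (%k. a k + b k) z = mon a z * mon b z"
 by (simp add: mon_def power_add prod.distrib)

lemma rmon_add: "rmon (%k. a k + b k) z = rmon a z * rmon b z"
 by (simp add: rmon_def power_add prod.distrib)

lemma mon_0 [simp]: "mon (%k. 0) z = 1" "rmon (%k. 0) rho = 1"
 by (simp_all add: mon_def rmon_def)

lemma mon_at_0: "mon e 0 = (if e = (%k. 0) then 1 else 0)"
proof (cases "e = (%k. 0)")
 case False
 then obtain k where "e k ~= 0" by auto
 thus ?thesis using False by (auto simp: mon_def power_0_left intro!: prod_zero exI[of _ k])
qed simp

lemma mon_single: "mon (%j. if j = k then n else 0) z = (z $ k) ^ n"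
proof -
 have "mon (%j. if j = k then n else 0) z = (\<Prod>j\<in>UNIV. if j = k then (z $ k) ^ n else 1)"
  unfolding mon_def by (intro prod.cong) auto
 thus ?thesis by (simp add: prod.delta)
qed

lemma rmon_single: "rmon (%j. if j = k then n else 0) rho = rho k ^ n"
proof -
 have "rmon (%j. if j = k then n else 0) rho = (\<Prod>j\<in>UNIV. if j = k then rho k ^ n else 1)"
  unfolding rmon_def by (intro prod.cong) auto
 thus ?thesis by (simp add: prod.delta)
qed

lemma psI:
 fixes c :: "'i::countable => 'a::{real_normed_field,euclidean_space}" and f :: "'a^'d::finite => 'a"
 assumes "rep I c e rho M f"
 shows "ps rho M f"
proof -
 define c' where "c' n = (if n : to_nat ` I then c (from_nat n) else 0)" for n
 define e' where "e' n = e (from_nat n)" for n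
 have "rep UNIV c' e' rho M f"
  unfolding rep_def
 proof (intro conjI allI impI ballI)
  fix J :: "nat set" assume J: "finite J"
  define J' where "J' = {i : I. to_nat i : J}"
  have im: "to_nat ` J' = J \<inter> to_nat ` I" by (auto simp: J'_def)
  have "finite (to_nat ` J')" unfolding im using J by auto
  hence fin: "finite J'" by (rule finite_imageD) (auto intro: inj_on_subset[OF inj_to_nat])
  have "(SUM i:J. norm (c' i) * rmon (e' i) rho) = (SUM i:to_nat ` J'. norm (c' i) * rmon (e' i) rho)"
   unfolding im by (rule sum.mono_neutral_right) (use J in \<open>auto simp: c'_def\<close>)
  also have "... = (SUM i:J'. norm (c i) * rmon (e i) rho)"
   by (subst sum.reindex) (auto intro: inj_on_subset[OF inj_to_nat] simp: c'_def e'_def J'_def intro!: sum.cong)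
  also have "... <= M" using assms fin by (auto simp: rep_def J'_def)
  finally show "(SUM i:J. norm (c' i) * rmon (e' i) rho) <= M" .
 next
  fix z :: "'a^'d" assume "z : pdisc rho"
  hence "((%i. c i * mon (e i) z) has_sum f z) I" using assms by (auto simp: rep_def)
  hence "(((%i. c' i * mon (e' i) z) o to_nat) has_sum f z) I"
   by (subst has_sum_cong[where g = "%i. c i * mon (e i) z"]) (auto simp: c'_def e'_def)
  hence "((%i. c' i * mon (e' i) z) has_sum f z) (to_nat ` I)"
   by (subst has_sum_reindex) (auto intro: inj_on_subset[OF inj_to_nat])
  thus "((%i. c' i * mon (e' i) z) has_sum f z) UNIV"
   by (subst has_sum_cong_neutral[where T = "to_nat ` I" and g = "%i. c' i * mon (e' i) z"]) (auto simp: c'_def)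
 qed
 thus ?thesis unfolding ps_def by blast
qed

lemma has_sum_norm_le:
 fixes f :: "'i => 'a::real_normed_vector"
 assumes "(f has_sum s) I" "!!J. finite J ==> J <= I ==> norm (sum f J) <= M"
 shows "norm s <= M"
proof -
 have "((%F. norm (sum f F)) ---> norm s) (finite_subsets_at_top I)"
  using assms(1) unfolding has_sum_def by (rule tendsto_norm)
 thus ?thesis
  by (rule tendsto_upperbound) (auto intro!: eventually_finite_subsets_at_top_weakI assms)
qed

lemma rep_terms_le:
 assumes "rep I c e rho M f" "z : pdisc rho" "finite J" "J <= I"
 shows "(SUM i:J. norm (c i * mon (e i) z)) <= M"
proof -
 have "(SUM i:J. norm (c i * mon (e i) z)) <= (SUM i:J. norm (c i) * rmon (e i) rho)"
  by (intro sum_mono) (auto simp: norm_mult intro!: mult_left_mono norm_mon_le assms(2))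
 also have "... <= M" using assms by (auto simp: rep_def)
 finally show ?thesis .
qed

lemma rep_bound:
 assumes "rep I c e rho M f" "z : pdisc rho" shows "norm (f z) <= M"
proof (rule has_sum_norm_le)
 show "((%i. c i * mon (e i) z) has_sum f z) I" using assms by (auto simp: rep_def)
 fix J assume J: "finite J" "J <= I"
 have "norm (SUM i:J. c i * mon (e i) z) <= (SUM i:J. norm (c i * mon (e i) z))" by (rule norm_sum)
 also have "... <= M" using rep_terms_le[OF assms J] .
 finally show "norm (SUM i:J. c i * mon (e i) z) <= M" .
qed

lemma ps_bound: "ps rho M f ==> z : pdisc rho ==> norm (f z) <= M"
 unfolding ps_def using rep_bound by blast

lemma ps_nonneg: "ps rho M f ==> M >= 0"
 unfolding ps_def rep_def by (auto dest!: spec[of _ "{}"])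

lemma pdisc_mono: "(ALL k. rho' k <= rho k) ==> pdisc rho' <= pdisc rho"
 unfolding pdisc_def using order_trans by blast

lemma ps_mono:
 fixes f :: "'b::{real_normed_field,euclidean_space}^'a::finite => 'b"
 assumes "ps rho M f" "ALL k. 0 <= rho' k" "ALL k. rho' k <= rho k" "M <= M'" shows "ps rho' M' f"
proof -
 from assms(1) obtain c e where r: "rep (UNIV::nat set) c e rho M f" unfolding ps_def by blast
 have "rep UNIV c e rho' M' f"
  unfolding rep_def
 proof (intro conjI allI impI ballI)
  fix J :: "nat set" assume J: "finite J"
  have "(SUM i:J. norm (c i) * rmon (e i) rho') <= (SUM i:J. norm (c i) * rmon (e i) rho)"
   by (intro sum_mono mult_left_mono) (use assms in \<open>auto simp: rmon_def intro!: prod_mono power_mono zero_le_power\<close>)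
  also have "... <= M" using r J by (auto simp: rep_def)
  finally show "(SUM i:J. norm (c i) * rmon (e i) rho') <= M'" using assms by simp
 next
  fix z :: "'b^'a" assume "z : pdisc rho'"
  hence "z : pdisc rho" using pdisc_mono[of rho' rho, OF assms(3)] by blast
  thus "((%i. c i * mon (e i) z) has_sum f z) UNIV" using r by (auto simp: rep_def)
 qed
 thus ?thesis unfolding ps_def by blast
qed

lemma ps_cong: "ps rho M f ==> (!!z. z : pdisc rho ==> g z = f z) ==> ps rho M g"
 unfolding ps_def rep_def by auto

text \<open>Sums, products and compositions are all reduced to this rule. Indexing the terms by
  pairs \<open>(n, i)\<close> gives a double family with majorant at most \<open>B\<close>, hence
  absolutely summable, and the inner sums are the \<open>f n\<close>.\<close>

lemma ps_suminf:
 fixes f :: "nat => 'a::{real_normed_field,euclidean_space}^'d::finite => 'a"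
 assumes f: "!!n. ps rho (M n) (f n)" and rho: "ALL k. rho k >= 0"
  and M: "!!N. finite N ==> sum M N <= B"
  and F: "!!z. z : pdisc rho ==> ((%n. f n z) has_sum F z) UNIV"
 shows "ps rho B F"
proof -
 from f obtain c e where r: "!!n. rep (UNIV::nat set) (c n) (e n) rho (M n) (f n)" unfolding ps_def by metis
 have M0: "M n >= 0" for n using ps_nonneg f by blast
 have fin: "(SUM p:J. norm (c (fst p) (snd p)) * rmon (e (fst p) (snd p)) rho) <= B"
  if J: "finite J" for J :: "(nat \<times> nat) set"
 proof -
  have "(SUM p:J. norm (c (fst p) (snd p)) * rmon (e (fst p) (snd p)) rho)
    <= (SUM p:fst ` J \<times> snd ` J. norm (c (fst p) (snd p)) * rmon (e (fst p) (snd p)) rho)"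
   using J subset_fst_snd[of J] by (intro sum_mono2) (auto intro!: mult_nonneg_nonneg rmon_nonneg rho)
  also have "... = (SUM n:fst ` J. SUM i:snd ` J. norm (c n i) * rmon (e n i) rho)"
   by (simp add: sum.cartesian_product case_prod_unfold)
  also have "... <= (SUM n:fst ` J. M n)" using r J by (intro sum_mono) (auto simp: rep_def)
  also have "... <= B" using J by (intro M) auto
  finally show ?thesis .
 qed
 have "rep UNIV (%p. c (fst p) (snd p)) (%p. e (fst p) (snd p)) rho B F"
  unfolding rep_def
 proof (intro conjI allI impI ballI)
  fix z :: "'a^'d" assume z: "z : pdisc rho"
  have "(%p. norm (c (fst p) (snd p) * mon (e (fst p) (snd p)) z)) summable_on UNIV"
   unfolding abs_summable_iff_bdd_above
  proof (rule bdd_aboveI2)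
   fix J :: "(nat \<times> nat) set" assume "J : {F. F <= UNIV & finite F}"
   hence J: "finite J" by auto
   have "(SUM p:J. norm (c (fst p) (snd p) * mon (e (fst p) (snd p)) z))
    <= (SUM p:J. norm (c (fst p) (snd p)) * rmon (e (fst p) (snd p)) rho)"
    by (intro sum_mono) (auto simp: norm_mult intro!: mult_left_mono norm_mon_le z)
   thus "(SUM p:J. norm (c (fst p) (snd p) * mon (e (fst p) (snd p)) z)) <= B" using fin[OF J] by simp
  qed
  hence s: "(%p. c (fst p) (snd p) * mon (e (fst p) (snd p)) z) summable_on (UNIV \<times> UNIV)"
   using abs_summable_summable by auto
  have "((%p. c (fst p) (snd p) * mon (e (fst p) (snd p)) z) has_sum F z) (UNIV \<times> UNIV)"
   by (rule has_sum_SigmaI[OF _ F[OF z] s]) (use r z in \<open>auto simp: rep_def\<close>)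
  thus "((%p. c (fst p) (snd p) * mon (e (fst p) (snd p)) z) has_sum F z) UNIV" by simp
 qed (use fin in auto)
 thus ?thesis by (rule psI)
qed

lemma ps_const: "(ALL k. rho k >= 0) ==> ps rho (norm a) (%z. a)"
proof -
 have "rep {()} (%_. a) (%_ _. 0) rho (norm a) (%z. a)"
  unfolding rep_def by (auto simp: subset_singleton_iff intro!: has_sum_finiteI)
 thus ?thesis by (rule psI)
qed

lemma ps_coord: "(ALL k. rho k >= 0) ==> ps rho (rho k) (%z. z $ k)"
proof -
 assume rho: "ALL k. rho k >= 0"
 have "rep {()} (%_. 1) (%_ j. if j = k then 1 else 0) rho (rho k) (%z. z $ k)"
  unfolding rep_def using spec[OF rho, of k] by (auto simp: subset_singleton_iff rmon_single mon_single intro!: has_sum_finiteI)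
 thus ?thesis by (rule psI)
qed

lemma ps_0: "(ALL k. rho k >= 0) ==> ps rho 0 (%z. 0)"
 using ps_const[of rho 0] by simp

lemma ps_add:
 assumes "ps rho A f" "ps rho B g" and rho: "ALL k. rho k >= 0"
 shows "ps rho (A + B) (%z. f z + g z)"
proof (rule ps_suminf[where f = "%n. if n = 0 then f else if n = 1 then g else (%_. 0)"
  and M = "%n. if n = 0 then A else if n = 1 then B else 0"])
 have AB: "A >= 0" "B >= 0" using assms ps_nonneg by auto
 show "ps rho (if n = 0 then A else if n = 1 then B else 0)
    (if n = 0 then f else if n = 1 then g else (%_. 0))" for n :: nat
  using assms ps_0[OF rho] by auto
 show "(SUM n:N. if n = 0 then A else if n = 1 then B else 0) <= A + B" if "finite N" for N :: "nat set"
 proof -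
  have "(SUM n:N. if n = 0 then A else if n = 1 then B else 0)
   <= (SUM n:N \<union> {0,1}. if n = 0 then A else if n = 1 then B else 0)"
   using that AB by (intro sum_mono2) auto
  also have "... = (SUM n:{0,1::nat}. if n = 0 then A else if n = 1 then B else 0)"
   by (rule sum.mono_neutral_right) (use that in auto)
  finally show ?thesis by simp
 qed
 show "((%n::nat. (if n = 0 then f else if n = 1 then g else (%_. 0)) z) has_sum (f z + g z)) UNIV" for z
  by (rule has_sum_finite_neutralI[of "{0,1::nat}"]) auto
qed (use rho in auto)

lemma ps_monomial_mult:
 fixes g :: "'b::{real_normed_field,euclidean_space}^'a::finite => 'b"
 assumes "ps rho M g" and rho: "ALL k. rho k >= 0"
 shows "ps rho (norm a * rmon e rho * M) (%z. a * mon e z * g z)"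
proof -
 from assms(1) obtain c e' where r: "rep (UNIV::nat set) c e' rho M g" unfolding ps_def by blast
 have "rep UNIV (%i. a * c i) (%i k. e k + e' i k) rho (norm a * rmon e rho * M) (%z. a * mon e z * g z)"
  unfolding rep_def
 proof (intro conjI allI impI ballI)
  fix J :: "nat set" assume J: "finite J"
  have "(SUM i:J. norm (a * c i) * rmon (%k. e k + e' i k) rho) = norm a * rmon e rho * (SUM i:J. norm (c i) * rmon (e' i) rho)"
   by (simp add: sum_distrib_left rmon_add norm_mult mult_ac)
  also have "... <= norm a * rmon e rho * M"
   using r J by (intro mult_left_mono) (auto simp: rep_def intro!: mult_nonneg_nonneg rmon_nonneg rho)
  finally show "(SUM i:J. norm (a * c i) * rmon (%k. e k + e' i k) rho) <= norm a * rmon e rho * M" .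
 next
  fix z :: "'b^'a" assume z: "z : pdisc rho"
  have "((%i. (a * mon e z) * (c i * mon (e' i) z)) has_sum (a * mon e z) * g z) UNIV"
   using r z by (intro has_sum_cmult_right) (auto simp: rep_def)
  thus "((%i. a * c i * mon (%k. e k + e' i k) z) has_sum a * mon e z * g z) UNIV"
   by (simp add: mon_add mult_ac)
 qed
 thus ?thesis by (rule psI)
qed

lemma ps_mult:
 assumes f: "ps rho A f" and g: "ps rho B g" and rho: "ALL k. rho k >= 0"
 shows "ps rho (A * B) (%z. f z * g z)"
proof -
 from f obtain c e where r: "rep (UNIV::nat set) c e rho A f" unfolding ps_def by blast
 show ?thesis
 proof (rule ps_suminf[where f = "%n z. c n * mon (e n) z * g z" and M = "%n. norm (c n) * rmon (e n) rho * B"])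
  show "(SUM n:N. norm (c n) * rmon (e n) rho * B) <= A * B" if "finite N" for N
   unfolding sum_distrib_right[symmetric] using r that ps_nonneg[OF g]
   by (intro mult_right_mono) (auto simp: rep_def)
  show "((%n. c n * mon (e n) z * g z) has_sum f z * g z) UNIV" if "z : pdisc rho" for z
   using r that by (intro has_sum_cmult_left) (auto simp: rep_def)
 qed (intro ps_monomial_mult g rho, rule rho)
qed

lemma ps_cmult: "ps rho M g ==> (ALL k. rho k >= 0) ==> ps rho (norm a * M) (%z. a * g z)"
 using ps_mult[OF ps_const] by blast

lemma ps_sum:
 assumes "!!i. i : I ==> ps rho (M i) (f i)" and rho: "ALL k. rho k >= 0"
 shows "ps rho (sum M I) (%z. SUM i:I. f i z)"
 using assms(1)
proof (induction I rule: infinite_finite_induct)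
 case (insert x F) thus ?case using ps_add rho by (simp add: ps_add)
qed (use ps_0 rho in auto)

lemma ps_prod:
 assumes "!!i. i : I ==> ps rho (M i) (f i)" and rho: "ALL k. rho k >= 0"
 shows "ps rho (prod M I) (%z. \<Prod>i\<in>I. f i z)"
 using assms(1)
proof (induction I rule: infinite_finite_induct)
 case (insert x F) thus ?case using rho by (simp add: ps_mult)
qed (use ps_const[of rho 1] rho in auto)

lemma ps_power: "ps rho M f ==> (ALL k. rho k >= 0) ==> ps rho (M ^ n) (%z. f z ^ n)"
 using ps_prod[of "{..<n}" rho "%_. M" "%_. f"] by simp

text \<open>Each monomial of \<open>f\<close> becomes a product of powers of the \<open>g k\<close>,
  with majorant \<open>norm (c n) * rmon (e n) sig\<close>. These majorants sum to at most
  \<open>M\<close>, so the bound of \<open>f\<close> survives unchanged.\<close>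

lemma ps_compose:
 assumes f: "ps sig M f" and g: "!!k. ps rho (sig k) (g k)" and rho: "ALL k. rho k >= 0"
 shows "ps rho M (%z. f (\<chi> k. g k z))"
proof -
 from f obtain c e where r: "rep (UNIV::nat set) c e sig M f" unfolding ps_def by blast
 show ?thesis
 proof (rule ps_suminf[where f = "%n z. c n * mon (e n) (\<chi> k. g k z)" and M = "%n. norm (c n) * rmon (e n) sig"])
  show "ps rho (norm (c n) * rmon (e n) sig) (%z. c n * mon (e n) (\<chi> k. g k z))" for n
   unfolding mon_def rmon_def by (intro ps_cmult ps_prod) (auto intro!: ps_power g rho)
  show "((%n. c n * mon (e n) (\<chi> k. g k z)) has_sum f (\<chi> k. g k z)) UNIV" if "z : pdisc rho" for z
   using r ps_bound[OF g that] by (auto simp: rep_def pdisc_def)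
 qed (use r rho in \<open>auto simp: rep_def\<close>)
qed

lemma ps_translate:
 assumes f: "ps rho M f" and w: "ALL k. norm (w $ k) + rho' k <= rho k" and rho': "ALL k. rho' k >= 0"
 shows "ps rho' M (%z. f (w + z))"
proof -
 have "ps rho' M (%z. f (\<chi> k. w $ k + z $ k))"
 proof (rule ps_compose[OF _ _ rho'])
  show "ps (%k. norm (w $ k) + rho' k) M f" by (rule ps_mono[OF f]) (use w rho' in auto)
  show "ps rho' (norm (w $ k) + rho' k) (%z. w $ k + z $ k)" for k
   by (intro ps_add ps_const ps_coord rho')
 qed
 moreover have "(\<chi> k. w $ k + z $ k) = w + z" for z by (simp add: vec_eq_iff)
 ultimately show ?thesis by simp
qed

section \<open>Division of power series by a coordinate\<close>

lemma mon_dec: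
 assumes "e k > 0" shows "mon e z = z $ k * mon (e(k := e k - 1)) z"
proof -
 obtain n where "e k = Suc n" using assms gr0_conv_Suc by blast
 moreover have "(\<Prod>j\<in>UNIV - {k}. (z $ j) ^ (e(k := n)) j) = (\<Prod>j\<in>UNIV - {k}. (z $ j) ^ e j)"
  by (intro prod.cong) auto
 ultimately show ?thesis by (simp add: mon_def prod.remove[of UNIV k] mult.assoc)
qed

lemma rmon_dec:
 assumes "e k > 0" shows "rmon e z = z k * rmon (e(k := e k - 1)) z"
proof -
 obtain n where "e k = Suc n" using assms gr0_conv_Suc by blast
 moreover have "(\<Prod>j\<in>UNIV - {k}. z j ^ (e(k := n)) j) = (\<Prod>j\<in>UNIV - {k}. z j ^ e j)"
  by (intro prod.cong) auto
 ultimately show ?thesis by (simp add: rmon_def prod.remove[of UNIV k] mult.assoc)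
qed

definition zero_coord :: "'d => 'a::zero^'d::finite => 'a^'d" where
 "zero_coord k z = (\<chi> j. if j = k then 0 else z $ j)"

lemma mon_zero_coord: "mon e (zero_coord k z) = (if e k = 0 then mon e z else 0)"
 by (auto simp: mon_def zero_coord_def prod.remove[of UNIV k] zero_power)

lemma pdisc_zero_coord: "z : pdisc rho ==> zero_coord k z : pdisc rho"
 by (auto simp: pdisc_def zero_coord_def intro: order_trans[OF norm_ge_zero])

text \<open>Every selected monomial contains \<open>z $ k\<close>; lowering that exponent by one
  divides its majorant by \<open>rho k\<close>. Selecting all monomials that contain
  \<open>z $ k\<close> gives \<open>ps_div\<close>; selecting the classes of a partition of the
  nonconstant monomials gives \<open>ps_hadamard\<close>.\<close>

lemma ps_partial_quotient:
 fixes f :: "'b::{real_normed_field,euclidean_space}^'a::finite => 'b"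
 assumes r: "rep UNIV c e rho M f" and rho: "ALL k. rho k > 0" and S: "!!i::nat. S i ==> e i k > 0"
 shows "EX g. ps rho (M / rho k) g &
  (ALL z:pdisc rho. ((%i. if S i then c i * mon (e i) z else 0) has_sum (z $ k * g z)) UNIV)"
proof -
 define c' where "c' i = (if S i then c i else 0)" for i
 define e' where "e' i = (e i)(k := e i k - 1)" for i
 define g where "g z = infsum (%i. c' i * mon (e' i) z) UNIV" for z
 have bd: "(SUM i:J. norm (c' i) * rmon (e' i) rho) <= M / rho k" if J: "finite J" for J
 proof -
  have "rho k * (SUM i:J. norm (c' i) * rmon (e' i) rho) <= (SUM i:J. norm (c i) * rmon (e i) rho)"
   unfolding sum_distrib_left
  proof (rule sum_mono)
   fix i
   show "rho k * (norm (c' i) * rmon (e' i) rho) <= norm (c i) * rmon (e i) rho"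
   proof (cases "S i")
    case True
    have "rho k * (norm (c' i) * rmon (e' i) rho) = norm (c i) * (rho k * rmon (e' i) rho)"
    using True by (simp add: c'_def)
    also have "rho k * rmon (e' i) rho = rmon (e i) rho"
    unfolding e'_def by (rule rmon_dec[of "e i" k, OF S[OF True], symmetric])
    finally show ?thesis by simp
   next
    case False
    have "rmon (e i) rho >= 0" using rho by (intro rmon_nonneg) (simp add: less_imp_le)
    thus ?thesis using False by (simp add: c'_def)
   qed
  qed
  also have "... <= M" using r J by (auto simp: rep_def)
  finally show ?thesis using spec[OF rho, of k] by (simp add: field_simps)
 qed
 have rg: "rep UNIV c' e' rho (M / rho k) g"
  unfolding rep_def
 proof (intro conjI allI impI ballI)
  fix z :: "'b^'a" assume z: "z : pdisc rho"
  have "(%i. norm (c' i * mon (e' i) z)) summable_on UNIV"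
   unfolding abs_summable_iff_bdd_above
  proof (rule bdd_aboveI2)
   fix J :: "nat set" assume "J : {F. F <= UNIV & finite F}"
   hence J: "finite J" by auto
   have "(SUM p:J. norm (c' p * mon (e' p) z)) <= (SUM p:J. norm (c' p) * rmon (e' p) rho)"
    by (intro sum_mono) (auto simp: norm_mult intro!: mult_left_mono norm_mon_le z)
   thus "(SUM p:J. norm (c' p * mon (e' p) z)) <= M / rho k" using bd[OF J] by simp
  qed
  thus "((%i. c' i * mon (e' i) z) has_sum g z) UNIV"
   unfolding g_def by (rule has_sum_infsum[OF abs_summable_summable])
 qed (use bd in auto)
 show ?thesis
 proof (intro exI conjI ballI)
  show "ps rho (M / rho k) g" using rg unfolding ps_def by blast
  fix z :: "'b^'a" assume z: "z : pdisc rho"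
  have "((%i. z $ k * (c' i * mon (e' i) z)) has_sum (z $ k * g z)) UNIV"
   using rg z by (intro has_sum_cmult_right) (auto simp: rep_def)
  moreover have "z $ k * (c' i * mon (e' i) z) = (if S i then c i * mon (e i) z else 0)" for i
  proof (cases "S i")
   case True
   have "mon (e i) z = z $ k * mon (e' i) z" unfolding e'_def by (rule mon_dec[of "e i" k, OF S[OF True]])
   thus ?thesis using True by (simp add: c'_def mult_ac)
  qed (simp add: c'_def)
  ultimately show "((%i. if S i then c i * mon (e i) z else 0) has_sum (z $ k * g z)) UNIV" by simp
 qed
qed

lemma ps_div:
 fixes f :: "'b::{real_normed_field,euclidean_space}^'a::finite => 'b"
 assumes f: "ps rho M f" and rho: "ALL k. rho k > 0"
 shows "EX g. ps rho (M / rho k) g & (ALL z:pdisc rho. f z = f (zero_coord k z) + z $ k * g z)"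
proof -
 from f obtain c e where r: "rep (UNIV::nat set) c e rho M f" unfolding ps_def by blast
 obtain g where g: "ps rho (M / rho k) g"
  "ALL z:pdisc rho. ((%i. if e i k > 0 then c i * mon (e i) z else 0) has_sum (z $ k * g z)) UNIV"
  using ps_partial_quotient[OF r rho, of "%i. e i k > 0" k] by blast
 show ?thesis
 proof (intro exI conjI ballI)
  show "ps rho (M / rho k) g" by (rule g(1))
  fix z :: "'b^'a" assume z: "z : pdisc rho"
  have "((%i. c i * mon (e i) (zero_coord k z) + (if e i k > 0 then c i * mon (e i) z else 0))
    has_sum (f (zero_coord k z) + z $ k * g z)) UNIV"
   using r pdisc_zero_coord[OF z] by (intro has_sum_add bspec[OF g(2) z]) (auto simp: rep_def)
  moreover have "c i * mon (e i) (zero_coord k z) + (if e i k > 0 then c i * mon (e i) z else 0) = c i * mon (e i) z" for i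
   by (simp add: mon_zero_coord)
  moreover have "((%i. c i * mon (e i) z) has_sum f z) UNIV" using r z by (auto simp: rep_def)
  ultimately show "f z = f (zero_coord k z) + z $ k * g z" using has_sum_unique by auto
 qed
qed

lemma ps_hadamard:
 fixes f :: "'b::{real_normed_field,euclidean_space}^'a::finite => 'b"
 assumes f: "ps rho M f" and rho: "ALL k. rho k > 0"
 shows "EX g. (ALL k. ps rho (M / rho k) (g k)) & (ALL z:pdisc rho. f z = f 0 + (SUM k:UNIV. z $ k * g k z))"
proof -
 from f obtain c e where r: "rep (UNIV::nat set) c e rho M f" unfolding ps_def by blast
 \<comment> \<open>Each nonconstant monomial is assigned to one coordinate occurring in it, so that
   no term is counted twice.\<close>
 define s where "s i = (SOME k. e i k > 0)" for i
 have s: "e i (s i) > 0" if "e i ~= (%_. 0)" for i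
 proof -
  from that obtain k where "e i k > 0" by (auto simp: fun_eq_iff)
  thus ?thesis unfolding s_def by (rule someI)
 qed
 have ex: "EX g. ps rho (M / rho k) g & (ALL z:pdisc rho.
   ((%i. if e i ~= (%_. 0) & s i = k then c i * mon (e i) z else 0) has_sum (z $ k * g z)) UNIV)" for k
  by (rule ps_partial_quotient[OF r rho, of "%i. e i ~= (%_. 0) & s i = k" k]) (use s in auto)
 from choice[OF allI[OF ex]] obtain g where G: "ALL k. ps rho (M / rho k) (g k) & (ALL z:pdisc rho.
   ((%i. if e i ~= (%_. 0) & s i = k then c i * mon (e i) z else 0) has_sum (z $ k * g k z)) UNIV)" ..
 note g = conjunct1[OF spec[OF G]] bspec[OF conjunct2[OF spec[OF G]]]
 show ?thesis
 proof (intro exI conjI allI ballI)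
  show "ps rho (M / rho k) (g k)" for k
   by (rule g(1))
  fix z :: "'b^'a" assume z: "z : pdisc rho"
  have z0: "0 : pdisc rho" using rho by (auto simp: pdisc_def less_imp_le)
  have sm: "((%i. SUM k:K. if e i ~= (%_. 0) & s i = k then c i * mon (e i) z else 0)
   has_sum (SUM k:K. z $ k * g k z)) UNIV" for K :: "'a set"
  proof (induction K rule: infinite_finite_induct)
   case (insert x F)
   thus ?case using has_sum_add[OF g(2)[OF z, of x] insert.IH] by simp
  qed auto
  have "((%i. c i * mon (e i) 0 + (SUM k:UNIV. if e i ~= (%_. 0) & s i = k then c i * mon (e i) z else 0))
    has_sum (f 0 + (SUM k:UNIV. z $ k * g k z))) UNIV"
   using r z0 by (intro has_sum_add sm) (auto simp: rep_def)
  moreover have "c i * mon (e i) 0 + (SUM k:UNIV. if e i ~= (%_. 0) & s i = k then c i * mon (e i) z else 0) = c i * mon (e i) z" for i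
   by (cases "e i = (%_. 0)") (auto simp: mon_at_0)
  moreover have "((%i. c i * mon (e i) z) has_sum f z) UNIV" using r z by (auto simp: rep_def)
  ultimately show "f z = f 0 + (SUM k:UNIV. z $ k * g k z)" using has_sum_unique by auto
 qed
qed

text \<open>In the expansion of \<open>f\<close> by \<open>ps_hadamard\<close>, the factor
  \<open>z $ k\<close> has majorant \<open>t * rho k\<close> on the smaller polydisc and its
  cofactor \<open>M / rho k\<close>, so each of the \<open>CARD('d)\<close> products contributes
  \<open>t * M\<close>. This is the source of small majorants in composition, inversion and
  preparation.\<close>

lemma ps_shrink:
 fixes f :: "'a::{real_normed_field,euclidean_space}^'d::finite => 'a"
 assumes f: "ps rho M f" and rho: "ALL k. rho k > 0" and f0: "f 0 = 0" and t: "0 <= t" "t <= 1"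
 shows "ps (%k. t * rho k) (real CARD('d) * t * M) f"
proof -
 obtain g where g: "ALL k. ps rho (M / rho k) (g k)" "ALL z:pdisc rho. f z = f 0 + (SUM k:UNIV. z $ k * g k z)"
  using ps_hadamard[OF f rho] by blast
 define sig where "sig k = t * rho k" for k
 have le: "ALL k. sig k <= rho k"
  unfolding sig_def using mult_right_mono[OF t(2)] rho by (metis less_imp_le mult_1)
 have nn: "ALL k. 0 <= sig k" using t rho by (simp add: less_imp_le sig_def)
 have gt: "ps sig (M / rho j) (g j)" for j
  by (rule ps_mono[OF spec[OF g(1), of j] nn le order_refl])
 have "ps sig (SUM k:UNIV. sig k * (M / rho k)) (%z. SUM k:UNIV. z $ k * g k z)"
  by (rule ps_sum[OF ps_mult[OF ps_coord[OF nn] gt nn] nn])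
 moreover have "(SUM k:UNIV. sig k * (M / rho k)) = real CARD('d) * t * M"
 proof -
  have "sig k * (M / rho k) = t * M" for k using spec[OF rho, of k] by (simp add: sig_def)
  thus ?thesis by simp
 qed
 ultimately have "ps sig (real CARD('d) * t * M) (%z. SUM k:UNIV. z $ k * g k z)" by simp
 hence "ps sig (real CARD('d) * t * M) f"
 proof (rule ps_cong)
  fix z :: "'a^'d" assume "z : pdisc sig"
  hence "z : pdisc rho" using pdisc_mono[OF le] by blast
  thus "f z = (SUM k:UNIV. z $ k * g k z)" using g(2) f0 by simp
 qed
 thus ?thesis by (simp add: sig_def[abs_def])
qed

section \<open>Analytic functions\<close>

text \<open>Unconditional summability in a finite-dimensional space is absolute: this holds for the
  real coordinates with respect to \<open>Basis\<close>, and the norm is at most the sum of their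
  absolute values.\<close>

lemma summable_on_imp_norm_summable_on:
 fixes f :: "'i => 'b::euclidean_space"
 assumes "f summable_on I"
 shows "(%i. norm (f i)) summable_on I"
proof -
 have b: "(%i. \<bar>f i \<bullet> b\<bar>) summable_on I" for b
 proof -
  have "(%i. f i \<bullet> b) summable_on I"
   using assms has_sum_bounded_linear[OF bounded_linear_inner_left] unfolding summable_on_def by blast
  thus ?thesis using summable_on_iff_abs_summable_on_real by force
 qed
 have "(%i. SUM b:B. \<bar>f i \<bullet> b\<bar>) summable_on I" for B :: "'b set"
 proof (induction B rule: infinite_finite_induct)
  case (insert x F) thus ?case using summable_on_add[OF b[of x]] by simp
 qed auto
 from this[of Basis] show ?thesis by (rule summable_on_comparison_test) (auto simp: norm_le_l1)
qed

lemma norm_le_sum_nth: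
 fixes z :: "'a::real_normed_vector^'d::finite"
 shows "norm z <= (SUM k:UNIV. norm (z $ k))"
 unfolding norm_vec_def by (rule L2_set_le_sum) auto

lemma eventually_pdisc:
 fixes rho :: "'d::finite => real"
 assumes "ALL k. rho k > 0"
 shows "\<forall>\<^sub>F z in nhds (0::'a::real_normed_field^'d). z : pdisc rho"
proof -
 have "\<forall>\<^sub>F z in nhds (0::'a^'d). norm (z $ k) < rho k" for k
 proof -
  have "((%z. norm (z $ k)) ---> norm ((0::'a^'d) $ k)) (nhds (0::'a^'d))"
   by (rule tendsto_norm[OF tendsto_vec_nth[OF filterlim_ident]])
  thus ?thesis using assms by (intro order_tendstoD(2)[of _ "norm ((0::'a^'d) $ k)"]) auto
 qed
 hence "\<forall>\<^sub>F z in nhds (0::'a^'d). ALL k:UNIV. norm (z $ k) < rho k"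
  by (intro eventually_ball_finite) auto
 thus ?thesis by eventually_elim (auto simp: pdisc_def less_imp_le)
qed

lemma eventually_nhds_translate:
 fixes z :: "'v::real_normed_vector"
 shows "(\<forall>\<^sub>F w in nhds z. P w) <-> (NEAR h. P (z + h))"
proof -
 have "nhds z = filtermap (%h. z + h) (nhds 0)"
  using filtermap_nhds_shift[of "- z" 0] by (simp add: add.commute)
 thus ?thesis by (simp add: eventually_filtermap)
qed

lemma pdisc_in_nhds_0:
 assumes "\<forall>\<^sub>F z in nhds (0::'a::real_normed_field^'d::finite). P z"
 shows "\<exists>rho>0. ALL z:pdisc (%_. rho). P z"
proof -
 from assms obtain e where e: "e > 0" "!!z. dist z 0 < e ==> P z"
  unfolding eventually_nhds_metric by blast
 define rho where "rho = e / (2 * real CARD('d))"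
 have "P z" if "z : pdisc (%_. rho)" for z
 proof (rule e(2))
  have "norm z <= (SUM k:UNIV. norm (z $ k))" by (rule norm_le_sum_nth)
  also have "... <= (SUM k:(UNIV::'d set). rho)" using that by (intro sum_mono) (auto simp: pdisc_def)
  also have "... = e / 2" by (simp add: rho_def)
  also have "... < e" using e(1) by simp
  finally show "dist z 0 < e" by simp
 qed
 moreover have "rho > 0" using e(1) by (simp add: rho_def)
 ultimately show ?thesis by blast
qed

text \<open>For a fixed exponent \<open>alp\<close> the factor \<open>rmon alp\<close> is a positive
  constant, so the majorant makes the coefficients with this exponent absolutely summable; summing
  them first gives the coefficient \<open>C alp\<close>.\<close>

lemma ps_imp_analytic_at:
 assumes f: "ps (%_. rho) M (%h. f (z + h))" and rho: "rho > 0"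
 shows "analytic_at f z"
proof -
 from f obtain c e where r: "rep (UNIV::nat set) c e (%_. rho) M (%h. f (z + h))" unfolding ps_def by blast
 define C where "C alp = infsum c {i. e i = alp}" for alp
 have C: "(c has_sum C alp) {i. e i = alp}" for alp
 proof -
  have pos: "rmon alp (%_. rho) > 0" using rho by (intro rmon_pos) auto
  have "(%i. norm (c i)) summable_on {i. e i = alp}"
   unfolding abs_summable_iff_bdd_above
  proof (rule bdd_aboveI2)
   fix J assume J: "J : {F. F <= {i. e i = alp} & finite F}"
   have "rmon alp (%_. rho) * (SUM i:J. norm (c i)) = (SUM i:J. norm (c i) * rmon (e i) (%_. rho))"
    unfolding sum_distrib_left using J by (intro sum.cong) auto
   also have "... <= M" using r J by (auto simp: rep_def)
   finally show "(SUM i:J. norm (c i)) <= M / rmon alp (%_. rho)" using pos by (simp add: field_simps)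
  qed
  thus ?thesis unfolding C_def by (rule has_sum_infsum[OF abs_summable_summable])
 qed
 have "((%alp. C alp * (\<Prod>i\<in>UNIV. (h $ i) ^ alp i)) has_sum f (z + h)) UNIV"
  if h: "ALL i. norm (h $ i) < rho" for h
 proof -
  have "((%i. c i * mon (e i) h) has_sum f (z + h)) UNIV"
   using r h by (auto simp: rep_def pdisc_def less_imp_le)
  moreover have "bij_betw snd (SIGMA alp:UNIV. {i. e i = alp}) UNIV"
   by (rule bij_betwI[where g = "%i. (e i, i)"]) auto
  ultimately have "((%p. c (snd p) * mon (e (snd p)) h) has_sum f (z + h)) (SIGMA alp:UNIV. {i. e i = alp})"
   using has_sum_reindex_bij_betw[of snd _ UNIV "%i. c i * mon (e i) h"] by blast
  hence "((%alp. C alp * mon alp h) has_sum f (z + h)) UNIV"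
  proof (rule has_sum_SigmaD)
   fix alp
   have "((%i. c i * mon alp h) has_sum C alp * mon alp h) {i. e i = alp}" by (rule has_sum_cmult_left[OF C])
   thus "((%i. c (snd (alp, i)) * mon (e (snd (alp, i))) h) has_sum C alp * mon alp h) {i. e i = alp}"
    by (subst has_sum_cong[where g = "%i. c i * mon alp h"]) auto
  qed
  thus ?thesis by (simp add: mon_def)
 qed
 thus ?thesis unfolding analytic_at_def using rho by blast
qed

lemma analytic_at_imp_ps:
 fixes f :: "'a::{real_normed_field,euclidean_space}^'d::finite => 'a"
 assumes "analytic_at f z"
 shows "\<exists>rho>0. EX M. ps (%_. rho) M (%h. f (z + h))"
proof -
 from assms obtain rho c where rho: "rho > 0"
  and c: "!!h. (ALL i. norm (h $ i) < rho) ==> ((%alp. c alp * mon alp h) has_sum f (z + h)) UNIV"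
  unfolding analytic_at_def mon_def by blast
 define sig where "sig = rho / 2"
 \<comment> \<open>Convergence at the single point with all coordinates \<open>sig\<close> is
   unconditional, hence absolute, and the absolute series there is the majorant.\<close>
 define M where "M = infsum (%alp. norm (c alp) * rmon alp (%_. sig)) UNIV"
 have sig: "sig > 0" "sig < rho" using rho by (auto simp: sig_def)
 have "((%alp. c alp * mon alp (\<chi> k. of_real sig)) has_sum f (z + (\<chi> k. of_real sig))) UNIV"
  using sig by (intro c) auto
 hence "(%alp. norm (c alp * mon alp (\<chi> k. of_real sig))) summable_on UNIV"
  by (intro summable_on_imp_norm_summable_on) (auto simp: summable_on_def)
 moreover have "norm (c alp * mon alp (\<chi> k. of_real sig)) = norm (c alp) * rmon alp (%_. sig)" for alp
  using sig by (simp add: norm_mult mon_def rmon_def prod_norm[symmetric] norm_power)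
 ultimately have s: "(%alp. norm (c alp) * rmon alp (%_. sig)) summable_on UNIV" by simp
 have "rep UNIV c (%alp. alp) (%_. sig) M (%h. f (z + h))"
  unfolding rep_def
 proof (intro conjI allI impI ballI)
  fix J :: "('d => nat) set" assume "finite J"
  thus "(SUM i:J. norm (c i) * rmon i (%_. sig)) <= M"
   unfolding M_def using sig by (intro finite_sum_le_infsum s) (auto intro!: mult_nonneg_nonneg rmon_nonneg)
 next
  fix h :: "'a^'d" assume "h : pdisc (%_. sig)"
  thus "((%alp. c alp * mon alp h) has_sum f (z + h)) UNIV"
   using sig by (intro c) (auto simp: pdisc_def intro: le_less_trans)
 qed
 hence "ps (%_. sig) M (%h. f (z + h))" by (rule psI)
 thus ?thesis using sig by blast
qed

lemma analytic_at_iff_ps: "analytic_at f z <-> (\<exists>rho>0. EX M. ps (%_. rho) M (%h. f (z + h)))"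
 using analytic_at_imp_ps ps_imp_analytic_at by blast

lemma analytic_at_translate: "analytic_at f z <-> analytic_at (%h. f (z + h)) 0"
 by (simp add: analytic_at_iff_ps)

lemma ps_common_radius:
 assumes "finite K" "ALL k:K. analytic_at (g k) z" "R > 0"
 shows "\<exists>rho>0. EX M>=0. rho <= R & (ALL k:K. ps (%_. rho) M (%h. g k (z + h)))"
 using assms(1,2)
proof (induction K rule: finite_induct)
 case empty thus ?case using assms(3) by (intro exI[of _ R]) auto
next
 case (insert x F)
 then obtain rho M where 1: "rho > 0" "M >= 0" "rho <= R" "ALL k:F. ps (%_. rho) M (%h. g k (z + h))" by auto
 obtain rho' M' where 2: "rho' > 0" "ps (%_. rho') M' (%h. g x (z + h))"
  using insert.prems analytic_at_imp_ps by blast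
 have "ps (%_. min rho rho') (max M M') (%h. g x (z + h))" by (rule ps_mono[OF 2(2)]) (use 1 2 in auto)
 moreover have "ps (%_. min rho rho') (max M M') (%h. g k (z + h))" if "k : F" for k
  by (rule ps_mono[OF bspec[OF 1(4) that]]) (use 1 2 in auto)
 ultimately show ?case using 1 2 by (intro exI[of _ "min rho rho'"] conjI exI[of _ "max M M'"]) auto
qed

lemma ps_small_radius:
 fixes g :: "'k => 'a::{real_normed_field,euclidean_space}^'d::finite => 'a"
 assumes "finite K" "ALL k:K. analytic_at (g k) z" "ALL k:K. g k z = 0" "R > 0" "ep > 0"
 shows "\<exists>rho>0. rho <= R & (ALL k:K. ps (%_. rho) ep (%h. g k (z + h)))"
proof -
 obtain rho M where 1: "rho > 0" "M >= 0" "rho <= R" "ALL k:K. ps (%_. rho) M (%h. g k (z + h))"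
  using ps_common_radius[OF assms(1,2,4)] by blast
 \<comment> \<open>Makes the majorant \<open>CARD('d) * t * M\<close> of \<open>ps_shrink\<close> at
   most \<open>ep\<close>; the summand 1 avoids division by zero when \<open>M = 0\<close>.\<close>
 define t where "t = min 1 (ep / (real CARD('d) * (M + 1)))"
 have t: "0 < t" "t <= 1" using 1 assms(5) by (auto simp: t_def)
 have "t * (real CARD('d) * (M + 1)) <= ep"
 proof -
  have "t <= ep / (real CARD('d) * (M + 1))" by (simp add: t_def)
  thus ?thesis using 1 by (subst (asm) pos_le_divide_eq) auto
 qed
 moreover have "real CARD('d) * t * M <= t * (real CARD('d) * (M + 1))"
  using t 1 by (simp add: algebra_simps)
 ultimately have le: "real CARD('d) * t * M <= ep" by linarith
 have "ps (%_. t * rho) ep (%h. g k (z + h))" if "k : K" for k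
 proof -
  have "ps (%_. t * rho) (real CARD('d) * t * M) (%h. g k (z + h))"
   by (rule ps_shrink) (use 1 assms t that in auto)
  thus ?thesis by (rule ps_mono) (use le t 1 in auto)
 qed
 moreover have "t * rho <= R" using t 1 mult_right_mono[of t 1 rho] by linarith
 ultimately show ?thesis using t 1 by (intro exI[of _ "t * rho"]) auto
qed

lemma analytic_at_cong:
 assumes f: "analytic_at f z" and e: "\<forall>\<^sub>F w in nhds z. g w = f w"
 shows "analytic_at g z"
proof -
 obtain rho M where 1: "rho > 0" "ps (%_. rho) M (%h. f (z + h))" using f analytic_at_imp_ps by blast
 obtain sig where 2: "sig > 0" "ALL h:pdisc (%_. sig). g (z + h) = f (z + h)"
  using e pdisc_in_nhds_0 unfolding eventually_nhds_translate[of _ z] by blast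
 have "ps (%_. min rho sig) M (%h. f (z + h))" by (rule ps_mono[OF 1(2)]) (use 1 2 in auto)
 hence "ps (%_. min rho sig) M (%h. g (z + h))"
  by (rule ps_cong) (use 2 in \<open>auto simp: pdisc_def\<close>)
 thus ?thesis using 1 2 by (intro ps_imp_analytic_at[of "min rho sig"]) auto
qed

lemma analytic_at_const [simp]: "analytic_at (%_. c) z"
 by (rule ps_imp_analytic_at[of 1 "norm c"]) (auto intro: ps_const)

lemma analytic_at_nth [simp]: "analytic_at (%w. w $ k) (z::'a::{real_normed_field,euclidean_space}^'d::finite)"
proof (rule ps_imp_analytic_at[of 1])
 have "ps (%_. 1) (norm (z $ k) + 1) (%h. z $ k + h $ k)"
  by (rule ps_add[OF ps_const ps_coord]) auto
 thus "ps (%_. 1) (norm (z $ k) + 1) (%h. (z + h) $ k)" by simp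
qed auto

lemma analytic_at_add:
 assumes "analytic_at f z" "analytic_at g z" shows "analytic_at (%w. f w + g w) z"
proof -
 obtain rho M where r: "rho > 0" "ALL k:{f,g}. ps (%_. rho) M (%h. k (z + h))"
  using ps_common_radius[of "{f,g}" "%k. k" z 1] assms by auto
 hence "ps (%_. rho) (M + M) (%h. f (z + h) + g (z + h))" by (intro ps_add) auto
 thus ?thesis by (rule ps_imp_analytic_at[OF _ r(1)])
qed

lemma analytic_at_mult:
 assumes "analytic_at f z" "analytic_at g z" shows "analytic_at (%w. f w * g w) z"
proof -
 obtain rho M where r: "rho > 0" "ALL k:{f,g}. ps (%_. rho) M (%h. k (z + h))"
  using ps_common_radius[of "{f,g}" "%k. k" z 1] assms by auto
 hence "ps (%_. rho) (M * M) (%h. f (z + h) * g (z + h))" by (intro ps_mult) auto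
 thus ?thesis by (rule ps_imp_analytic_at[OF _ r(1)])
qed

lemma analytic_at_uminus:
 assumes "analytic_at f z" shows "analytic_at (%w. - f w) z"
 using analytic_at_mult[OF analytic_at_const[of "-1"] assms] by simp

lemma analytic_at_diff:
 assumes "analytic_at f z" "analytic_at g z" shows "analytic_at (%w. f w - g w) z"
 using analytic_at_add[OF assms(1) analytic_at_uminus[OF assms(2)]] by simp

lemma analytic_at_sum:
 assumes "!!i. i : I ==> analytic_at (f i) z" shows "analytic_at (%w. SUM i:I. f i w) z"
 using assms by (induction I rule: infinite_finite_induct) (simp_all add: analytic_at_add)

lemma analytic_at_prod:
 assumes "!!i. i : I ==> analytic_at (f i) z" shows "analytic_at (%w. \<Prod>i\<in>I. f i w) z"
 using assms by (induction I rule: infinite_finite_induct) (simp_all add: analytic_at_mult)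

lemma analytic_at_power:
 assumes "analytic_at f z" shows "analytic_at (%w. f w ^ n) z"
 by (induction n) (simp_all add: analytic_at_mult assms)

lemmas analytic_intros = analytic_at_const analytic_at_nth analytic_at_add analytic_at_mult analytic_at_uminus
 analytic_at_diff analytic_at_sum analytic_at_prod analytic_at_power

text \<open>The increments of \<open>g\<close> vanish at \<open>z\<close>, so on a small polydisc
  their majorants are at most the radius \<open>sig\<close> of \<open>f\<close>, and
  \<open>ps_compose\<close> applies.\<close>

lemma analytic_at_compose:
 assumes f: "analytic_at f (g z)" and g: "analytic_map_at g z"
 shows "analytic_at (%w. f (g w)) z"
proof -
 obtain sig M where 1: "sig > 0" "ps (%_. sig) M (%h. f (g z + h))" using f analytic_at_imp_ps by blast
 have "ALL k:UNIV. analytic_at (%w. g w $ k - g z $ k) z"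
  using g unfolding analytic_map_at_def by (auto intro!: analytic_intros)
 then obtain rho where 2: "rho > 0" "ALL k:UNIV. ps (%_. rho) sig (%h. g (z + h) $ k - g z $ k)"
  using ps_small_radius[of UNIV "%k w. g w $ k - g z $ k" z 1 sig] 1 by auto
 have "ps (%_. rho) M (%h. f (g z + (\<chi> k. g (z + h) $ k - g z $ k)))"
  by (rule ps_compose[OF 1(2)]) (use 2 in auto)
 moreover have "g z + (\<chi> k. g (z + h) $ k - g z $ k) = g (z + h)" for h by (simp add: vec_eq_iff)
 ultimately show ?thesis using 2 by (simp add: ps_imp_analytic_at)
qed

lemma analytic_map_at_compose:
 assumes "analytic_map_at f (g z)" "analytic_map_at g z"
 shows "analytic_map_at (%w. f (g w)) z"
 using assms analytic_at_compose[of "%w. f w $ _"] unfolding analytic_map_at_def by blast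

lemma analytic_at_nhds:
 fixes f :: "'a::{real_normed_field,euclidean_space}^'d::finite => 'a"
 assumes f: "analytic_at f z"
 shows "\<forall>\<^sub>F w in nhds z. analytic_at f w"
proof -
 obtain rho M where 1: "rho > 0" "ps (%_. rho) M (%h. f (z + h))" using f analytic_at_imp_ps by blast
 have "NEAR h. h : pdisc (%_::'d. rho / 2)" by (rule eventually_pdisc) (use 1 in auto)
 hence "NEAR h. analytic_at f (z + h)"
 proof eventually_elim
  case (elim h)
  have "norm (h $ k) + rho / 2 <= rho" for k
  proof -
   have "norm (h $ k) <= rho / 2" using elim by (simp add: pdisc_def)
   thus ?thesis by linarith
  qed
  hence "ps (%_. rho / 2) M (%u. f (z + (h + u)))"
   by (intro ps_translate[OF 1(2)]) (use 1 in auto)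
  thus ?case using 1 by (intro ps_imp_analytic_at[of "rho / 2"]) (auto simp: add_ac)
 qed
 thus ?thesis by (simp add: eventually_nhds_translate[of _ z])
qed

lemma analytic_map_at_nhds:
 assumes "analytic_map_at f z" shows "\<forall>\<^sub>F w in nhds z. analytic_map_at f w"
 using assms unfolding analytic_map_at_def by (intro eventually_all_finite analytic_at_nhds) auto

lemma ps_bounded_continuous_0:
 fixes f :: "'a::{real_normed_field,euclidean_space}^'d::finite => 'a"
 assumes f: "ps rho M f" and rho: "ALL k. rho k > 0"
 shows "(f ---> f 0) (nhds 0)"
proof -
 obtain g where g: "ALL k. ps rho (M / rho k) (g k)" "ALL z:pdisc rho. f z = f 0 + (SUM k:UNIV. z $ k * g k z)"
  using ps_hadamard[OF f rho] by blast
 have lim: "((%z::'a^'d. SUM k:UNIV. norm (z $ k) * (M / rho k)) ---> (SUM k:UNIV. norm ((0::'a^'d) $ k) * (M / rho k))) (nhds 0)"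
  by (intro tendsto_intros filterlim_ident)
 have "((%z. f z - f 0) ---> 0) (nhds 0)"
 proof (rule Lim_null_comparison)
  show "NEAR z. norm (f z - f 0) <= (SUM k:UNIV. norm (z $ k) * (M / rho k))"
   using eventually_pdisc[OF rho]
  proof eventually_elim
   case (elim z)
   have "norm (f z - f 0) = norm (SUM k:UNIV. z $ k * g k z)" using g(2) elim by simp
   also have "... <= (SUM k:UNIV. norm (z $ k * g k z))" by (rule norm_sum)
   also have "... <= (SUM k:UNIV. norm (z $ k) * (M / rho k))"
    unfolding norm_mult by (intro sum_mono mult_left_mono ps_bound[OF spec[OF g(1)] elim] norm_ge_zero)
   finally show ?case .
  qed
 qed (use lim in simp)
 thus ?thesis by (simp add: LIM_zero_iff)
qed

lemma analytic_at_imp_tendsto: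
 assumes f: "analytic_at f z" shows "(f ---> f z) (nhds z)"
proof -
 obtain rho M where 1: "rho > 0" "ps (%_. rho) M (%h. f (z + h))" using f analytic_at_imp_ps by blast
 have "((%h. f (z + h)) ---> f (z + 0)) (nhds 0)" by (rule ps_bounded_continuous_0[OF 1(2)]) (use 1 in auto)
 thus ?thesis unfolding tendsto_def eventually_nhds_translate[of _ z] by simp
qed

lemma analytic_at_isCont:
 assumes "analytic_at f z" shows "isCont f z"
 using analytic_at_imp_tendsto[OF assms] by (simp add: isCont_def tendsto_at_iff_tendsto_nhds)

lemma analytic_map_at_imp_tendsto:
 assumes "analytic_map_at f z" shows "(f ---> f z) (nhds z)"
 using assms analytic_at_imp_tendsto unfolding analytic_map_at_def by (intro vec_tendstoI) blast

text \<open>The geometric series in \<open>u = 1 - f / f z\<close>, which vanishes at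
  \<open>z\<close> and therefore has majorant 1/2 on a small polydisc.\<close>

lemma analytic_at_inverse:
 assumes f: "analytic_at f z" and nz: "f z ~= 0"
 shows "analytic_at (%w. inverse (f w)) z"
proof -
 define u where "u w = 1 - inverse (f z) * f w" for w
 have "analytic_at u z" unfolding u_def by (intro analytic_intros f)
 moreover have "u z = 0" using nz by (simp add: u_def)
 ultimately obtain rho where rho: "rho > 0" "ps (%_. rho) (1/2) (%h. u (z + h))"
  using ps_small_radius[of "{u}" "%k. k" z 1 "1/2"] by auto
 have "ps (%_. rho) 2 (%h. 1 / (1 - u (z + h)))"
 proof (rule ps_suminf[where f = "%n h. u (z + h) ^ n" and M = "%n. (1/2) ^ n"])
  show "ps (%_. rho) ((1 / 2) ^ n) (%h. u (z + h) ^ n)" for n using rho by (intro ps_power) auto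
  show "(SUM n:N. (1 / 2 :: real) ^ n) <= 2" if "finite N" for N
  proof -
   have "(SUM n:N. (1 / 2 :: real) ^ n) <= suminf (%n. (1 / 2 :: real) ^ n)"
    using that by (intro sum_le_suminf summable_geometric) auto
   thus ?thesis by (simp add: suminf_geometric)
  qed
  show "((%n. u (z + h) ^ n) has_sum 1 / (1 - u (z + h))) UNIV" if "h : pdisc (%_. rho)" for h
  proof (rule norm_summable_imp_has_sum)
   have b: "norm (u (z + h)) <= 1/2" using ps_bound[OF rho(2) that] .
   show "summable (%n. norm (u (z + h) ^ n))" using b by (simp add: norm_power summable_geometric)
   show "(%n. u (z + h) ^ n) sums (1 / (1 - u (z + h)))" using b by (intro geometric_sums) auto
  qed
 qed (use rho in auto)
 hence "analytic_at (%w. 1 / (1 - u w)) z" by (rule ps_imp_analytic_at[OF _ rho(1)])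
 hence "analytic_at (%w. inverse (f z) * (1 / (1 - u w))) z" by (intro analytic_intros)
 \<comment> \<open>Where \<open>f w = 0\<close>, both sides are 0, because division by zero gives
   0.\<close>
 moreover have "inverse (f z) * (1 / (1 - u w)) = inverse (f w)" for w
  using nz by (cases "f w = 0") (auto simp: u_def field_simps)
 ultimately show ?thesis by simp
qed

section \<open>Partial derivatives and the total derivative\<close>

lemma tendsto_axis: "((%s. axis k s :: 'a::real_normed_field^'d::finite) ---> 0) (nhds 0)"
proof (rule vec_tendstoI)
 fix j
 have "((%s::'a. if j = k then s else 0) ---> 0) (nhds 0)"
  by (cases "j = k") (auto intro: filterlim_ident)
 thus "((%s. (axis k s :: 'a^'d) $ j) ---> (0::'a^'d) $ j) (nhds 0)"
  by (simp add: axis_def)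
qed

lemma pd_eqI:
 fixes f :: "'a::{real_normed_field,euclidean_space}^'d::finite => 'a"
 assumes "NEAR s. f (z + axis k s) = f z + s * G s" and "(G ---> G 0) (nhds 0)"
 shows "((%s. f (z + axis k s)) has_field_derivative G 0) (at 0)" "pd k f z = G 0"
proof -
 have "((%s. (f (z + axis k s) - f (z + axis k 0)) / (s - 0)) ---> G 0) (at 0)"
 proof (rule Lim_transform_eventually)
  show "(G ---> G 0) (at 0)" using assms(2) by (simp add: tendsto_at_iff_tendsto_nhds)
  have "PUNCT s. f (z + axis k s) = f z + s * G s"
   using assms(1) by (simp add: eventually_nhds_conv_at)
  moreover have "\<forall>\<^sub>F s in at (0::'a). s ~= 0" by (simp add: eventually_at_filter)
  ultimately show "PUNCT s. G s = (f (z + axis k s) - f (z + axis k 0)) / (s - 0)"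
   by eventually_elim (auto simp: axis_def zero_vec_def[symmetric])
 qed
 thus "((%s. f (z + axis k s)) has_field_derivative G 0) (at 0)"
  unfolding has_field_derivative_iff by simp
 thus "pd k f z = G 0" unfolding pd_def by (rule DERIV_imp_deriv)
qed

lemma pdisc_axis: "0 <= rho ==> norm s <= rho ==> axis k s : pdisc (%_. rho)"
 by (auto simp: pdisc_def axis_def)

text \<open>The step \<open>s\<close> in direction \<open>k\<close> is made a further variable.
  Division of \<open>f (z + h + axis k s) - f (z + h)\<close> by \<open>s\<close> leaves a power
  series \<open>G\<close> in \<open>(h, s)\<close>, and the partial derivative at
  \<open>z + h\<close> is its restriction to \<open>s = 0\<close>.\<close>

lemma analytic_at_pd:
 fixes f :: "'a::{real_normed_field,euclidean_space}^'d::finite => 'a"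
 assumes f: "analytic_at f z" shows "analytic_at (pd k f) z"
proof -
 define L :: "'a^('d + 1) => 'a^'d" where "L w = (\<chi> j. w $ Inl j + (if j = k then w $ Inr 1 else 0))" for w
 have "analytic_at (%h. f (z + h)) (L 0)" using f unfolding analytic_at_translate[of f z]
  by (simp add: L_def zero_vec_def[symmetric] if_distrib cong: if_cong)
 moreover have "analytic_map_at L 0"
 proof -
  have "analytic_at (%w::'a^('d + 1). if j = k then w $ Inr 1 else 0) 0" for j
   by (cases "j = k") auto
  thus ?thesis unfolding analytic_map_at_def L_def by (auto intro!: analytic_intros)
 qed
 ultimately have "analytic_at (%w. f (z + L w)) 0" by (rule analytic_at_compose)
 then obtain rho M where 1: "rho > 0" "ps (%_. rho) M (%w. f (z + L w))" using analytic_at_imp_ps by force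
 then obtain G where G: "ps (%_. rho) (M / rho) G"
  "ALL w:pdisc (%_. rho). f (z + L w) = f (z + L (zero_coord (Inr 1) w)) + w $ Inr 1 * G w"
  using ps_div[OF 1(2), of "Inr 1"] by auto
 define J :: "'a^'d => 'a => 'a^('d + 1)" where "J h s = (\<chi> i. case i of Inl j => h $ j | Inr _ => s)" for h s
 have "G = (%w. G (0 + w))" by simp
 hence aG: "NEAR w. analytic_at G w"
  using G(1) 1(1) analytic_at_nhds ps_imp_analytic_at by metis
 have Jlim: "((%h. J h 0) ---> 0) (nhds 0)"
 proof (rule vec_tendstoI)
  fix i :: "'d + 1"
  have "((%h::'a^'d. case i of Inl j => h $ j | Inr _ => 0) ---> 0) (nhds 0)"
  proof (cases i)
   case (Inl j)
   have "((%h::'a^'d. h $ j) ---> (0::'a^'d) $ j) (nhds 0)" by (intro tendsto_intros filterlim_ident)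
   thus ?thesis using Inl by simp
  qed simp
  thus "((%h. J h 0 $ i) ---> 0 $ i) (nhds 0)" by (simp add: J_def)
 qed
 have evrho: "\<forall>\<^sub>F h in nhds (0::'a^'d). h : pdisc (%_. rho)" by (rule eventually_pdisc) (use 1 in auto)
 have "NEAR h. pd k f (z + h) = G (J h 0)"
  using eventually_compose[OF aG Jlim] evrho
 proof eventually_elim
  case (elim h)
  have hp: "norm (h $ j) <= rho" for j using elim(2) 1 by (auto simp: pdisc_def)
  have "pd k f (z + h) = (%s. G (J h s)) 0"
  proof (rule pd_eqI(2))
   have "\<forall>\<^sub>F s in nhds (0::'a). norm s < rho"
   proof -
    have "((%s::'a. norm s) ---> norm (0::'a)) (nhds 0)" by (intro tendsto_intros filterlim_ident)
    thus ?thesis using 1(1) by (intro order_tendstoD(2)[of _ "norm (0::'a)"]) auto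
   qed
   thus "NEAR s. f (z + h + axis k s) = f (z + h) + s * G (J h s)"
   proof eventually_elim
    case (elim s)
    have "J h s : pdisc (%_. rho)" using hp elim by (auto simp: pdisc_def J_def split: sum.split)
    from bspec[OF G(2) this]
    have "f (z + L (J h s)) = f (z + L (zero_coord (Inr 1) (J h s))) + s * G (J h s)" by (simp add: J_def)
    moreover have "L (J h s) = h + axis k s" "L (zero_coord (Inr 1) (J h s)) = h"
    by (auto simp: L_def J_def vec_eq_iff axis_def zero_coord_def)
    ultimately show ?case by (simp add: add.assoc)
   qed
   have "((%s. J h s) ---> J h 0) (nhds 0)"
   proof (rule vec_tendstoI)
    fix i :: "'d + 1"
    show "((%s. J h s $ i) ---> J h 0 $ i) (nhds 0)"
    by (cases i) (auto simp: J_def intro: filterlim_ident)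
   qed
   thus "((%s. G (J h s)) ---> G (J h 0)) (nhds 0)"
    using filterlim_compose[OF analytic_at_imp_tendsto[OF elim(1)]] by blast
  qed
  thus ?case .
 qed
 moreover have "analytic_at (%h. G (J h 0)) 0"
 proof (rule analytic_at_compose)
  have "J 0 0 = 0" by (auto simp: J_def vec_eq_iff split: sum.split)
  thus "analytic_at G (J 0 0)" using eventually_nhds_x_imp_x[OF aG] by simp
  have "analytic_at (%h::'a^'d. case i of Inl j => h $ j | Inr _ => 0) 0" for i :: "'d + 1"
   by (cases i) auto
  thus "analytic_map_at (%h. J h 0) 0"
   unfolding analytic_map_at_def J_def by simp
 qed
 ultimately have "analytic_at (%h. pd k f (z + h)) 0" by (rule analytic_at_cong[rotated])
 thus ?thesis by (simp add: analytic_at_translate[of "pd k f" z])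
qed

text \<open>The cofactors of the expansion by \<open>ps_hadamard\<close> satisfy
  \<open>g k 0 = pd k f z\<close>, and the remainder is at most \<open>norm h\<close> times the sum
  of the \<open>norm (g k h - g k 0)\<close>, which tends to 0.\<close>

lemma analytic_at_has_derivative:
 fixes f :: "'a::{real_normed_field,euclidean_space}^'d::finite => 'a"
 assumes f: "analytic_at f z"
 shows "(f has_derivative (%h. SUM k:UNIV. h $ k * pd k f z)) (at z)"
proof -
 obtain rho M where 1: "rho > 0" "ps (%_. rho) M (%h. f (z + h))" using f analytic_at_imp_ps by blast
 then obtain g where g: "ALL k. ps (%_. rho) (M / rho) (g k)"
  "ALL h:pdisc (%_. rho). f (z + h) = f z + (SUM k:UNIV. h $ k * g k h)"
  using ps_hadamard[OF 1(2)] by auto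
 have gc: "(g k ---> g k 0) (nhds 0)" for k
  by (rule ps_bounded_continuous_0[OF spec[OF g(1)]]) (use 1 in auto)
 have pd: "pd k f z = g k 0" for k
 proof -
  have "pd k f z = (%s. g k (axis k s)) 0"
  proof (rule pd_eqI(2))
   have "NEAR s. (axis k s :: 'a^'d) : pdisc (%_. rho)"
    by (rule eventually_compose[OF eventually_pdisc tendsto_axis]) (use 1 in auto)
   thus "NEAR s. f (z + axis k s) = f z + s * g k (axis k s)"
   proof eventually_elim
    case (elim s)
    have "(SUM j:UNIV. axis k s $ j * g j (axis k s)) = (SUM j:UNIV. if j = k then s * g k (axis k s) else 0)"
    by (intro sum.cong) (auto simp: axis_def)
    thus ?case using bspec[OF g(2) elim] by simp
   qed
   have ax: "(axis k 0 :: 'a^'d) = 0" by (simp add: vec_eq_iff axis_def)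
   show "((%s. g k (axis k s)) ---> g k (axis k 0)) (nhds 0)"
    unfolding ax by (rule filterlim_compose[OF gc[of k] tendsto_axis[of k]])
  qed
  thus ?thesis by (simp add: axis_def zero_vec_def[symmetric])
 qed
 have lin: "bounded_linear (%h::'a^'d. SUM k:UNIV. h $ k * g k 0)"
  by (intro bounded_linear_sum bounded_linear_mult_const bounded_linear_vec_nth)
 have "((%h. (f (z + h) - f z - (SUM k:UNIV. h $ k * g k 0)) /\<^sub>R norm h) ---> 0) (at 0)"
 proof (rule Lim_null_comparison)
  have "((%h. SUM k:UNIV. norm (g k h - g k 0)) ---> (SUM k:(UNIV::'d set). norm (g k 0 - g k 0))) (nhds 0)"
   by (intro tendsto_intros gc)
  thus "((%h. SUM k:UNIV. norm (g k h - g k 0)) ---> 0) (at 0)"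
   by (intro tendsto_mono[OF at_within_le_nhds]) simp
  have "\<forall>\<^sub>F h in nhds (0::'a^'d). h : pdisc (%_. rho)" by (rule eventually_pdisc) (use 1 in auto)
  hence "\<forall>\<^sub>F h in at (0::'a^'d). h : pdisc (%_. rho)" by (simp add: eventually_nhds_conv_at)
  thus "PUNCT h. norm ((f (z + h) - f z - (SUM k:UNIV. h $ k * g k 0)) /\<^sub>R norm h)
    <= (SUM k:UNIV. norm (g k h - g k 0))"
  proof eventually_elim
   case (elim h)
   have "f (z + h) - f z - (SUM k:UNIV. h $ k * g k 0) = (SUM k:UNIV. h $ k * (g k h - g k 0))"
    using bspec[OF g(2) elim] by (simp add: right_diff_distrib sum_subtractf)
   also have "norm ... <= (SUM k:UNIV. norm (h $ k * (g k h - g k 0)))" by (rule norm_sum)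
   also have "... <= (SUM k:UNIV. norm h * norm (g k h - g k 0))"
    by (intro sum_mono) (auto simp: norm_mult intro!: mult_right_mono norm_nth_le)
   finally show ?case
    by (cases "h = 0") (auto simp: sum_distrib_left[symmetric] divide_simps mult.commute)
  qed
 qed
 from tendsto_norm_zero[OF this] show ?thesis unfolding has_derivative_at pd using lin
  by (simp add: divide_inverse mult.commute)
qed

section \<open>Weierstrass preparation\<close>

text \<open>Repeated division by \<open>z $ k\<close>: the restrictions
  \<open>F j (zero_coord k z)\<close> are the coefficients of the powers \<open>(z $ k) ^ j\<close>
  in \<open>f\<close>.\<close>

lemma ps_chain:
 assumes f: "ps rho M f" and rho: "ALL k. rho k > 0"
 shows "EX F. F 0 = f & (ALL j. ps rho (M / rho k ^ j) (F j)) &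
  (ALL j. ALL z:pdisc rho. F j z = F j (zero_coord k z) + z $ k * F (Suc j) z)"
proof -
 have "EX F. ALL j. (ps rho (M / rho k ^ j) (F j) & (j = 0 --> F j = f)) &
  (ALL z:pdisc rho. F j z = F j (zero_coord k z) + z $ k * F (Suc j) z)"
 proof (rule dependent_nat_choice)
  show "EX g. ps rho (M / rho k ^ 0) g & (0 = 0 --> g = f)" using f by auto
  fix g and j :: nat assume "ps rho (M / rho k ^ j) g & (j = 0 --> g = f)"
  hence g: "ps rho (M / rho k ^ j) g" ..
  obtain h where "ps rho (M / rho k ^ j / rho k) h" "ALL z:pdisc rho. g z = g (zero_coord k z) + z $ k * h z"
   using ps_div[OF g rho, of k] by blast
  thus "EX h. (ps rho (M / rho k ^ Suc j) h & (Suc j = 0 --> h = f)) &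
    (ALL z:pdisc rho. g z = g (zero_coord k z) + z $ k * h z)"
   by (intro exI[of _ h]) (simp add: field_simps)
 qed
 then obtain F where F: "ALL j. (ps rho (M / rho k ^ j) (F j) & (j = 0 --> F j = f)) &
  (ALL z:pdisc rho. F j z = F j (zero_coord k z) + z $ k * F (Suc j) z)" ..
 thus ?thesis by (intro exI[of _ F]) blast
qed

lemma chain_expand:
 assumes "ALL j. F j z = F j (zero_coord k z) + z $ k * F (Suc j) z"
 shows "F 0 z = (SUM j<n. (z $ k) ^ j * F j (zero_coord k z)) + (z $ k) ^ n * F n (z::'a::comm_ring_1^'d::finite)"
proof (induction n)
 case (Suc n)
 have "(z $ k) ^ n * F n z = (z $ k) ^ n * F n (zero_coord k z) + (z $ k) ^ Suc n * F (Suc n) z"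
  by (subst spec[OF assms, of n]) (simp add: algebra_simps)
 thus ?case using Suc by simp
qed simp

lemma zero_coord_axis [simp]: "zero_coord k (axis k t) = 0"
 by (simp add: zero_coord_def axis_def vec_eq_iff)

lemma zero_coord_idem [simp]: "zero_coord k (zero_coord k z) = zero_coord k z"
 by (simp add: zero_coord_def vec_eq_iff)

lemma zero_coord_0 [simp]: "zero_coord k 0 = 0"
 by (simp add: zero_coord_def vec_eq_iff)

lemma axis_nth_self [simp]: "axis k t $ k = t"
 by (simp add: axis_def)

text \<open>By \<open>chain_expand\<close>, only the remainder term survives on the axis, and it is
  at most \<open>M * (norm t / rho) ^ n\<close> for every \<open>n\<close>.\<close>

lemma chain_axis_zero:
 assumes F: "ALL j. ps (%_. rho) (M / rho ^ j) (F j)" "ALL j. ALL z:pdisc (%_. rho). F j z = F j (zero_coord k z) + z $ k * F (Suc j) z"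
  and rho: "rho > 0" and 0: "ALL j. F j 0 = 0" and t: "norm t < rho"
 shows "F 0 (axis k t) = 0"
proof -
 have z: "axis k t : pdisc (%_. rho)" using t rho by (intro pdisc_axis) auto
 have b: "norm (F 0 (axis k t)) <= M * (norm t / rho) ^ n" for n
 proof -
  have "F 0 (axis k t) = (SUM j<n. (axis k t $ k) ^ j * F j (zero_coord k (axis k t))) + (axis k t $ k) ^ n * F n (axis k t)"
   by (rule chain_expand) (use F(2) z in blast)
  hence "norm (F 0 (axis k t)) = norm t ^ n * norm (F n (axis k t))"
   using 0 by (simp add: norm_mult norm_power)
  also have "... <= norm t ^ n * (M / rho ^ n)"
   using ps_bound[OF spec[OF F(1)] z] by (intro mult_left_mono) auto
  finally show ?thesis by (simp add: power_divide mult.commute)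
 qed
 have "(%n. M * (norm t / rho) ^ n) ----> M * 0"
  using t rho by (intro tendsto_mult tendsto_const LIMSEQ_power_zero) auto
 hence "norm (F 0 (axis k t)) <= M * 0"
  by (rule tendsto_lowerbound) (use b in auto)
 thus ?thesis by simp
qed

lemma eventually_norm_less:
 assumes "ep > 0" shows "\<forall>\<^sub>F t in nhds (0::'a::real_normed_vector). norm t < ep"
 using assms eventually_nhds_metric[of "%t. norm t < ep" 0] by auto

lemma vec1_eq_axis: "(t :: 'a::zero^1) = axis 1 (t $ 1)"
 by (simp add: vec_eq_iff axis_def forall_1)

lemma analytic_at_order:
 fixes u :: "'a::{real_normed_field,euclidean_space}^1 => 'a"
 assumes u: "analytic_at u 0"
 shows "(NEAR t. u t = 0) |
  (EX m v. analytic_at v 0 & v 0 ~= 0 & (NEAR t. u t = (t $ 1) ^ m * v t))"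
proof -
 obtain rho M where 1: "rho > 0" "ps (%_. rho) M u" using u analytic_at_imp_ps[of u 0] by auto
 have pos: "ALL k. rho > 0" using 1 by simp
 obtain F where F: "F 0 = u" "ALL j. ps (%_. rho) (M / rho ^ j) (F j)"
  "ALL j. ALL z:pdisc (%_. rho). F j z = F j (zero_coord 1 z) + z $ 1 * F (Suc j) z"
  using ps_chain[OF 1(2) pos, of 1] by blast
 have zc: "zero_coord 1 z = 0" for z :: "'a^1" by (simp add: zero_coord_def vec_eq_iff forall_1)
 show ?thesis
 proof (cases "ALL j. F j 0 = 0")
  case True
  have "\<forall>\<^sub>F t in nhds (0::'a^1). u t = 0"
   using eventually_norm_less[OF 1(1)]
  proof eventually_elim
   case (elim t)
   hence "norm (t $ 1) < rho" using norm_nth_le[of t 1] by linarith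
   from chain_axis_zero[OF F(2,3) 1(1) True this] F(1) show ?case using vec1_eq_axis[of t] by simp
  qed
  thus ?thesis ..
 next
  case False
  define m where "m = (LEAST j. F j 0 ~= 0)"
  have m: "F m 0 ~= 0" unfolding m_def by (rule LeastI_ex) (use False in auto)
  have m': "F j 0 = 0" if "j < m" for j using not_less_Least[of j "%j. F j 0 ~= 0"] that by (auto simp: m_def)
  have "\<forall>\<^sub>F t in nhds (0::'a^1). t : pdisc (%_. rho)" by (rule eventually_pdisc) (use 1 in auto)
  hence "\<forall>\<^sub>F t in nhds (0::'a^1). u t = (t $ 1) ^ m * F m t"
  proof eventually_elim
   case (elim t)
   have "F 0 t = (SUM j<m. (t $ 1) ^ j * F j (zero_coord 1 t)) + (t $ 1) ^ m * F m t"
    by (rule chain_expand) (use F(3) elim in blast)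
   thus ?case using F(1) m' by (simp add: zc)
  qed
  moreover have "analytic_at (F m) 0"
   using spec[OF F(2), of m] by (intro ps_imp_analytic_at[OF _ 1(1)]) simp
  ultimately show ?thesis using m by blast
 qed
qed

text \<open>The sum tends to 0 at 0, so \<open>b 0 = 0\<close>; then a factor \<open>t\<close> can
  be cancelled on both sides.\<close>

lemma poly_coeffs_zero:
 fixes b :: "nat => 'a::real_normed_field"
 assumes "PUNCT t. norm (SUM j<n. b j * t ^ j) <= C * norm t ^ n"
 shows "ALL j<n. b j = 0"
 using assms
proof (induction n arbitrary: b)
 case (Suc n)
 have lim: "((%t. SUM j<Suc n. b j * t ^ j) ---> (SUM j<Suc n. b j * 0 ^ j)) (at 0)"
  by (intro tendsto_intros)
 have "((%t::'a. C * norm t ^ Suc n) ---> C * norm (0::'a) ^ Suc n) (at 0)"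
  by (intro tendsto_intros)
 hence "((%t. SUM j<Suc n. b j * t ^ j) ---> 0) (at 0)"
  by (intro Lim_null_comparison[OF Suc.prems]) simp
 from LIM_unique[OF lim this] have b0: "b 0 = 0"
  by (simp add: sum.lessThan_Suc_shift del: sum.lessThan_Suc)
 have "\<forall>\<^sub>F t in at (0::'a). t ~= 0" by (simp add: eventually_at_filter)
 hence "PUNCT t. norm (SUM j<n. b (Suc j) * t ^ j) <= C * norm t ^ n"
  using Suc.prems
 proof eventually_elim
  case (elim t)
  have "(SUM j<Suc n. b j * t ^ j) = t * (SUM j<n. b (Suc j) * t ^ j)"
   by (simp add: sum.lessThan_Suc_shift b0 sum_distrib_left mult_ac del: sum.lessThan_Suc)
  hence "norm t * norm (SUM j<n. b (Suc j) * t ^ j) <= norm t * (C * norm t ^ n)"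
   using elim(2) by (simp add: norm_mult mult_ac)
  thus ?case using elim(1) by simp
 qed
 from Suc.IH[OF this] b0 show ?case using less_Suc_eq_0_disj by auto
qed simp

lemma geometric_has_sum:
 fixes h :: "nat => 'b::banach"
 assumes "ALL i. norm (h i) <= C * (1/4) ^ i"
 shows "(h has_sum suminf h) UNIV" "h sums suminf h"
proof -
 have s: "summable (%i. norm (h i))"
  by (rule summable_comparison_test'[where g = "%i. C * (1/4) ^ i"])
   (use assms in \<open>auto intro: summable_mult summable_geometric\<close>)
 show 1: "h sums suminf h" by (rule summable_sums[OF summable_norm_cancel[OF s]])
 show "(h has_sum suminf h) UNIV" by (rule norm_summable_imp_has_sum[OF s 1])
qed

lemma geometric_sum_le:
 assumes "finite N" "C >= 0" shows "(SUM i:N. C * (1/4::real) ^ i) <= C * (4/3)"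
proof -
 have "(SUM n:N. (1 / 4 :: real) ^ n) <= suminf (%n. (1 / 4 :: real) ^ n)"
  using assms by (intro sum_le_suminf summable_geometric) auto
 also have "... = 4/3" by (simp add: suminf_geometric)
 finally have "C * (SUM n:N. (1 / 4 :: real) ^ n) <= C * (4/3)" using assms(2) by (rule mult_left_mono)
 thus ?thesis by (simp only: sum_distrib_left)
qed

lemma ps_geometric:
 assumes h: "ALL i. ps rho (C * (1/4) ^ i) (h i)" and C: "C >= 0" and rho: "ALL k. rho k >= 0"
 shows "ps rho (C * (4/3)) (%z. \<Sum>i. h i z)"
  "ALL z:pdisc rho. (%i. h i z) sums (\<Sum>i. h i z)"
proof -
 have *: "ALL i. norm (h i z) <= C * (1/4) ^ i" if "z : pdisc rho" for z
  using ps_bound[OF spec[OF h] that] by blast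
 show "ps rho (C * (4/3)) (%z. \<Sum>i. h i z)"
  by (rule ps_suminf[where f = h and M = "%i. C * (1/4) ^ i"])
   (use h rho geometric_sum_le[OF _ C] geometric_has_sum(1)[OF *] in auto)
 show "ALL z:pdisc rho. (%i. h i z) sums (\<Sum>i. h i z)" using geometric_has_sum(2)[OF *] by blast
qed

lemma ps_zero_coord:
 assumes f: "ps sig M f" and 1: "ALL i. i ~= k --> rho i = sig i" and rho: "ALL i. rho i >= 0" "ALL i. sig i >= 0"
 shows "ps rho M (%z. f (zero_coord k z))"
proof -
 have "ps rho M (%z. f (\<chi> j. (if j = k then (%_. 0) else (%z. z $ j)) z))"
 proof (rule ps_compose[OF f _ rho(1)])
  fix j
  show "ps rho (sig j) (if j = k then (%_. 0) else (%z. z $ j))"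
  proof (cases "j = k")
   case True
   thus ?thesis using ps_mono[OF ps_0[OF rho(1)] rho(1), of "sig k"] rho by auto
  next
   case False
   thus ?thesis using ps_coord[OF rho(1), of j] 1 by simp
  qed
 qed
 thus ?thesis by (simp add: zero_coord_def if_distrib[of "%f. f _"])
qed

text \<open>Let \<open>n\<close> be the order of \<open>f\<close> on the axis. After division by the
  unit \<open>v\<close>, \<open>f\<close> is \<open>(z $ k) ^ n + R\<close> with \<open>R\<close>
  small. Division of \<open>- R\<close> by \<open>(z $ k) ^ n + R\<close> is done by iteration:
  split \<open>g i\<close> into a part of degree below \<open>n\<close> in \<open>z $ k\<close> and
  \<open>(z $ k) ^ n * T i\<close>, and continue with \<open>g (Suc i) = - T i * R\<close>.
  Extracting \<open>T i\<close> costs the factor \<open>1 / kap ^ n\<close>, multiplication by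
  \<open>R\<close> gains \<open>kap ^ n / 4\<close>, so each round gains 1/4 and the sums
  converge.\<close>

lemma weierstrass_preparation:
 fixes f :: "'a::{real_normed_field,euclidean_space}^'d::finite => 'a"
 assumes f: "analytic_at f 0" and nz: "~(NEAR t. f (axis k t) = 0)"
 shows "EX n a Q. (ALL j<n. analytic_at (a j) 0 & a j 0 = 0 & (ALL z. a j (zero_coord k z) = a j z)) &
  analytic_at Q 0 & Q 0 ~= 0 & (NEAR z. Q z * f z = (z $ k) ^ n + (SUM j<n. a j z * (z $ k) ^ j))"
proof -
 obtain rho0 M where 1: "rho0 > 0" "ps (%_. rho0) M f" using f analytic_at_imp_ps[of f 0] by auto
 have pos: "ALL k. rho0 > 0" using 1 by simp
 obtain F where F: "F 0 = f" "ALL j. ps (%_. rho0) (M / rho0 ^ j) (F j)"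
  "ALL j. ALL z:pdisc (%_. rho0). F j z = F j (zero_coord k z) + z $ k * F (Suc j) z"
  using ps_chain[OF 1(2) pos, of k] by blast
 have Fa: "analytic_at (F j) 0" for j
  using spec[OF F(2), of j] by (intro ps_imp_analytic_at[OF _ 1(1)]) simp
 have ex: "EX j. F j 0 ~= 0"
 proof (rule ccontr)
  assume "~(EX j. F j 0 ~= 0)"
  hence "ALL j. F j 0 = 0" by simp
  from chain_axis_zero[OF F(2,3) 1(1) this] F(1)
  have "NEAR t. f (axis k t) = 0" by (intro eventually_mono[OF eventually_norm_less[OF 1(1)]]) simp
  thus False using nz by simp
 qed
 define n where "n = (LEAST j. F j 0 ~= 0)"
 have n: "F n 0 ~= 0" unfolding n_def by (rule LeastI_ex[OF ex])
 have n': "F j 0 = 0" if "j < n" for j using not_less_Least[of j "%j. F j 0 ~= 0"] that by (auto simp: n_def)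
 define v where "v = F n"
 have va: "analytic_at v 0" "v 0 ~= 0" using Fa n by (auto simp: v_def)
 define iv where "iv z = inverse (v z)" for z
 have iva: "analytic_at iv 0" unfolding iv_def by (rule analytic_at_inverse[OF va])
 have "NEAR z. v z ~= 0"
  using tendsto_imp_eventually_ne[OF analytic_at_imp_tendsto[OF va(1)] va(2)] .
 then obtain rho1 where rho1: "rho1 > 0" "ALL z:pdisc (%_. rho1). v z ~= 0" using pdisc_in_nhds_0 by blast
 obtain kap C where kap: "kap > 0" "C >= 0" "kap <= min 1 (min rho0 rho1)" "ps (%_. kap) C iv"
  using ps_common_radius[of "{iv}" "%k. k" 0 "min 1 (min rho0 rho1)"] iva 1 rho1 by auto
 define r where "r j z = F j (zero_coord k z)" for j z
 have r0: "r j 0 = 0" if "j < n" for j using n'[OF that] by (simp add: r_def)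
 have rzc: "r j (zero_coord k z) = r j z" for j z by (simp add: r_def)
 have ra: "analytic_at (r j) 0" for j
 proof -
  have "ps (%_. rho0) (M / rho0 ^ j) (r j)"
   unfolding r_def by (rule ps_zero_coord[OF spec[OF F(2)]]) (use 1 in auto)
  thus ?thesis by (intro ps_imp_analytic_at[OF _ 1(1)]) simp
 qed
 \<comment> \<open>Chosen so that \<open>R\<close> gets majorant \<open>kap ^ n / 4\<close>: each of
   its \<open>n\<close> summands contributes at most \<open>ep * C\<close>, as \<open>kap\<close> is
   at most 1.\<close>
 define ep where "ep = kap ^ n / (4 * (real n * C + 1))"
 have ep: "ep > 0" using kap by (auto simp: ep_def intro!: divide_pos_pos add_nonneg_pos)
 obtain tau where tau: "tau > 0" "tau <= kap" "ALL j:{..<n}. ps (%_. tau) ep (r j)"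
  using ps_small_radius[of "{..<n}" r 0 kap ep] ra r0 kap ep by auto
 \<comment> \<open>Only the other coordinates are shrunk: the \<open>r j\<close> with
   \<open>j < n\<close> do not depend on \<open>z $ k\<close> and vanish at 0, so they become small
   while the radius \<open>kap\<close> in direction \<open>k\<close> is kept.\<close>
 define rho where "rho i = (if i = k then kap else tau)" for i
 have rho: "ALL i. rho i > 0" "ALL i. rho i >= 0" "ALL i. rho i <= kap" "rho k = kap" using kap tau by (auto simp: rho_def less_imp_le)
 have pdrho: "pdisc rho <= pdisc (%_. rho0)" "pdisc rho <= pdisc (%_. rho1)"
 proof -
  have "ALL i. rho i <= rho0" "ALL i. rho i <= rho1" using kap(3) tau(2) by (auto simp: rho_def)
  thus "pdisc rho <= pdisc (%_. rho0)" "pdisc rho <= pdisc (%_. rho1)"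
   by - (rule pdisc_mono, assumption)+
 qed
 have pr: "ps rho ep (r j)" if "j < n" for j
 proof -
  have "ps rho ep (%z. r j (zero_coord k z))"
   by (rule ps_zero_coord[where sig = "%_. tau"]) (use tau that rho in \<open>auto simp: rho_def\<close>)
  thus ?thesis by (simp add: rzc)
 qed
 have piv: "ps rho C iv" by (rule ps_mono[OF kap(4)]) (use rho in auto)
 define R where "R z = (SUM j<n. (z $ k) ^ j * r j z) * iv z" for z
 have pR: "ps rho (kap ^ n / 4) R"
 proof -
  have "ps rho ((SUM j<n. kap ^ j * ep) * C) R"
   unfolding R_def
  proof (rule ps_mult[OF ps_sum piv rho(2)])
   fix j assume "j : {..<n}"
   hence "ps rho ep (r j)" using pr by simp
   moreover have "ps rho (kap ^ j) (%z. (z $ k) ^ j)" using ps_power[OF ps_coord[OF rho(2), of k] rho(2)] rho(4) by simp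
   ultimately show "ps rho (kap ^ j * ep) (%z. (z $ k) ^ j * r j z)" using ps_mult rho(2) by blast
  qed (rule rho(2))
  thus ?thesis
  proof (rule ps_mono)
   have "(SUM j<n. kap ^ j * ep) <= (SUM j<n. 1 * ep)"
    using ep kap by (intro sum_mono mult_right_mono power_le_one) auto
   hence "(SUM j<n. kap ^ j * ep) * C <= real n * ep * C" using kap by (intro mult_right_mono) auto
   also have "... <= ep * (real n * C + 1)" using ep by (simp add: algebra_simps)
   also have "... = kap ^ n / 4"
   proof -
    have "real n * C + 1 ~= 0" using kap by (smt (verit) mult_nonneg_nonneg of_nat_0_le_iff)
    moreover have "x / (4 * D) * D = x / 4" if "D ~= 0" for x D :: real using that by simp
    ultimately show ?thesis unfolding ep_def by blast
   qed
   finally show "(SUM j<n. kap ^ j * ep) * C <= kap ^ n / 4" .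
  qed (use rho in auto)
 qed
 have fR: "f z * iv z = (z $ k) ^ n + R z" if z: "z : pdisc rho" for z
 proof -
  have "F 0 z = (SUM j<n. (z $ k) ^ j * F j (zero_coord k z)) + (z $ k) ^ n * F n z"
   by (rule chain_expand) (use F(3) z pdrho in blast)
  moreover have "v z ~= 0" using rho1 z pdrho by blast
  ultimately show ?thesis by (simp add: F(1) r_def R_def v_def iv_def distrib_right)
 qed
 define B where "B i = kap ^ n / 4 * (1/4::real) ^ i" for i
 \<comment> \<open>One round of the iteration: \<open>g\<close> is split into the coefficients
   \<open>S j\<close> of the powers below \<open>n\<close> and the quotient
   \<open>T\<close>.\<close>
 define P where "P i p <-> (case p of (g, T, S) => ps rho (B i) g & ps rho (1/4 * (1/4) ^ i) T &
   (ALL j<n. ps rho (kap ^ n / 4 / kap ^ j * (1/4) ^ i) (S j) & (ALL z. S j (zero_coord k z) = S j z)) &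
   (ALL z:pdisc rho. g z = (SUM j<n. (z $ k) ^ j * S j z) + (z $ k) ^ n * T z))"
  for i :: nat and p :: "('a^'d => 'a) \<times> ('a^'d => 'a) \<times> (nat => 'a^'d => 'a)"
 have decomp: "EX T S. P i (g, T, S)" if g: "ps rho (B i) g" for g i
 proof -
  obtain G where G: "G 0 = g" "ALL j. ps rho (B i / kap ^ j) (G j)"
   "ALL j. ALL z:pdisc rho. G j z = G j (zero_coord k z) + z $ k * G (Suc j) z"
   using ps_chain[OF g rho(1), of k] unfolding rho(4) by blast
  have "P i (g, G n, %j z. G j (zero_coord k z))"
   unfolding P_def prod.case
  proof (intro conjI allI impI ballI)
   show "ps rho (B i) g" by (rule g)
   have "B i / kap ^ n = 1/4 * (1/4) ^ i" using kap(1) by (simp add: B_def)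
   thus "ps rho (1/4 * (1/4) ^ i) (G n)" using spec[OF G(2), of n] by (simp only:)
   fix j
   have "B i / kap ^ j = kap ^ n / 4 / kap ^ j * (1/4) ^ i" by (simp add: B_def)
   moreover have "ps rho (B i / kap ^ j) (%z. G j (zero_coord k z))"
    by (rule ps_zero_coord[OF spec[OF G(2)]]) (use rho in auto)
   ultimately show "ps rho (kap ^ n / 4 / kap ^ j * (1/4) ^ i) (%z. G j (zero_coord k z))" by simp
   show "G j (zero_coord k (zero_coord k z)) = G j (zero_coord k z)" for z by simp
  next
   fix z :: "'a^'d" assume z: "z : pdisc rho"
   have "G 0 z = (SUM j<n. (z $ k) ^ j * G j (zero_coord k z)) + (z $ k) ^ n * G n z"
    by (rule chain_expand) (use G(3) z in blast)
   thus "g z = (SUM j<n. (z $ k) ^ j * G j (zero_coord k z)) + (z $ k) ^ n * G n z" using G(1) by simp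
  qed
  thus ?thesis by blast
 qed
 have "EX p. ALL i. (P i (p i) & (i = 0 --> fst (p i) = (%z. - R z))) &
   fst (p (Suc i)) = (%z. - (fst (snd (p i)) z * R z))"
 proof (rule dependent_nat_choice)
  have "ps rho (B 0) (%z. - R z)"
   using ps_cmult[OF pR rho(2), of "-1"] by (simp add: B_def)
  from decomp[OF this] show "EX p. P 0 p & (0 = 0 --> fst p = (%z. - R z))" by fastforce
  fix p and i :: nat assume "P i p & (i = 0 --> fst p = (%z. - R z))"
  hence T: "ps rho (1/4 * (1/4) ^ i) (fst (snd p))" by (auto simp: P_def split: prod.splits)
  have "ps rho (norm (-1::'a) * ((1/4 * (1/4) ^ i) * (kap ^ n / 4))) (%z. -1 * (fst (snd p) z * R z))"
   by (rule ps_cmult[OF ps_mult[OF T pR rho(2)] rho(2)])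
  moreover have "norm (-1::'a) * ((1/4 * (1/4) ^ i) * (kap ^ n / 4)) = B (Suc i)" by (simp add: B_def)
  ultimately have "ps rho (B (Suc i)) (%z. - (fst (snd p) z * R z))" by simp
  from decomp[OF this] show "EX q. (P (Suc i) q & (Suc i = 0 --> fst q = (%z. - R z))) &
    fst q = (%z. - (fst (snd p) z * R z))" by fastforce
 qed
 then obtain p where p: "ALL i. (P i (p i) & (i = 0 --> fst (p i) = (%z. - R z))) &
   fst (p (Suc i)) = (%z. - (fst (snd (p i)) z * R z))" ..
 define g T S where "g i = fst (p i)" and "T i = fst (snd (p i))" and "S i = snd (snd (p i))" for i
 have pP: "P i (g i, T i, S i)" for i using p by (simp add: g_def T_def S_def)
 have g: "ALL i. ps rho (kap ^ n / 4 * (1/4) ^ i) (g i)" using pP by (simp add: P_def B_def)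
 have T: "ALL i. ps rho (1/4 * (1/4) ^ i) (T i)" using pP by (simp add: P_def)
 have S: "ALL i. ps rho (kap ^ n / 4 / kap ^ j * (1/4) ^ i) (S i j)" if "j < n" for j using pP that by (simp add: P_def)
 have Szc: "S i j (zero_coord k z) = S i j z" if "j < n" for i j z using pP that by (simp add: P_def)
 have g_eq: "g i z = (SUM j<n. (z $ k) ^ j * S i j z) + (z $ k) ^ n * T i z" if "z : pdisc rho" for i z
  using pP that by (simp add: P_def)
 have g0: "g 0 = (%z. - R z)" and gSuc: "g (Suc i) = (%z. - (T i z * R z))" for i
  using p by (auto simp: g_def T_def)
 define Ts where "Ts = (%z. \<Sum>i. T i z)"
 have Ts: "ps rho (1/4 * (4/3)) Ts" "ALL z:pdisc rho. (%i. T i z) sums Ts z"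
 proof -
  have c: "0 <= (1/4::real)" by simp
  show "ps rho (1/4 * (4/3)) Ts" unfolding Ts_def by (rule ps_geometric(1)[OF T c rho(2)])
  show "ALL z:pdisc rho. (%i. T i z) sums Ts z" unfolding Ts_def by (rule ps_geometric(2)[OF T c rho(2)])
 qed
 have Ts_bd: "norm (Ts z) <= 1/3" if "z : pdisc rho" for z using ps_bound[OF Ts(1) that] by simp
 define a where "a j z = - (\<Sum>i. S i j z)" for j z
 have asum: "ps rho (kap ^ n / 4 / kap ^ j * (4/3)) (%z. \<Sum>i. S i j z)" "ALL z:pdisc rho. (%i. S i j z) sums (- a j z)"
  if "j < n" for j
 proof -
  have c: "0 <= kap ^ n / 4 / kap ^ j" using kap(1) by simp
  show "ps rho (kap ^ n / 4 / kap ^ j * (4/3)) (%z. \<Sum>i. S i j z)" by (rule ps_geometric(1)[OF S[OF that] c rho(2)])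
  show "ALL z:pdisc rho. (%i. S i j z) sums (- a j z)"
   unfolding a_def minus_minus by (rule ps_geometric(2)[OF S[OF that] c rho(2)])
 qed
 have main: "(z $ k) ^ n + (SUM j<n. a j z * (z $ k) ^ j) = (1 + Ts z) * iv z * f z" if z: "z : pdisc rho" for z
 proof -
  have A: "(%i. (SUM j<n. (z $ k) ^ j * S i j z) + T i z * ((z $ k) ^ n + R z))
    sums ((SUM j<n. (z $ k) ^ j * (- a j z)) + Ts z * ((z $ k) ^ n + R z))"
  proof (rule sums_add)
   show "(%i. SUM j<n. (z $ k) ^ j * S i j z) sums (SUM j<n. (z $ k) ^ j * (- a j z))"
    by (rule sums_sum, rule sums_mult, rule bspec[OF asum(2) z]) simp
   show "(%i. T i z * ((z $ k) ^ n + R z)) sums (Ts z * ((z $ k) ^ n + R z))"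
    by (rule sums_mult2, rule bspec[OF Ts(2) z])
  qed
  \<comment> \<open>Telescoping: the differences sum to \<open>g 0 = - R\<close>. By
    \<open>C\<close> each difference is also the corresponding term of the series in
    \<open>A\<close>.\<close>
  have B: "(%i. g i z - g (Suc i) z) sums (g 0 z - 0)"
  proof (rule telescope_sums')
   have "(%i. kap ^ n / 4 * (1/4) ^ i) ----> kap ^ n / 4 * 0"
    by (intro tendsto_mult tendsto_const LIMSEQ_power_zero) auto
   hence l: "(%i. kap ^ n / 4 * (1/4) ^ i) ----> 0" by simp
   have "\<forall>\<^sub>F i in sequentially. norm (g i z) <= kap ^ n / 4 * (1/4) ^ i"
    by (rule always_eventually, rule allI, rule ps_bound[OF spec[OF g] z])
   thus "(%i. g i z) ----> 0" by (rule Lim_null_comparison[OF _ l])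
  qed
  have C: "g i z - g (Suc i) z = (SUM j<n. (z $ k) ^ j * S i j z) + T i z * ((z $ k) ^ n + R z)" for i
   using g_eq[OF z, of i] by (simp add: gSuc algebra_simps)
  have "- R z = (SUM j<n. (z $ k) ^ j * (- a j z)) + Ts z * ((z $ k) ^ n + R z)"
   using sums_unique2[OF A B[unfolded C]] by (simp add: g0)
  hence "(z $ k) ^ n + (SUM j<n. a j z * (z $ k) ^ j) = (1 + Ts z) * ((z $ k) ^ n + R z)"
   by (simp add: sum_negf algebra_simps)
  thus ?thesis by (simp add: fR[OF z, symmetric] mult_ac)
 qed
 have an: "analytic_at h 0" if "ps rho N h" for h :: "'a^'d => 'a" and N
 proof -
  have "ps (%_. tau) N h" by (rule ps_mono[OF that]) (use tau kap in \<open>auto simp: rho_def\<close>)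
  thus ?thesis by (intro ps_imp_analytic_at[OF _ tau(1)]) simp
 qed
 have ev: "NEAR z. z : pdisc rho" by (rule eventually_pdisc[OF rho(1)])
 have azc: "a j (zero_coord k z) = a j z" if "j < n" for j z by (simp add: a_def Szc[OF that])
 have z0: "0 : pdisc rho" using rho by (simp add: pdisc_def)
 \<comment> \<open>On the axis \<open>R\<close> vanishes, so the identity reduces to
   \<open>(SUM j<n. a j 0 * t ^ j) = Ts * t ^ n\<close>, and a polynomial of degree below
   \<open>n\<close> that is \<open>O(t ^ n)\<close> is zero.\<close>
 have a0: "ALL j<n. a j 0 = 0"
 proof (rule poly_coeffs_zero)
  have "\<forall>\<^sub>F t in nhds (0::'a). norm t < kap" by (rule eventually_norm_less[OF kap(1)])
  hence "\<forall>\<^sub>F t in at (0::'a). norm t < kap" by (simp add: eventually_nhds_conv_at)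
  thus "PUNCT t. norm (SUM j<n. a j 0 * t ^ j) <= 1/3 * norm t ^ n"
  proof eventually_elim
   case (elim t)
   have z: "axis k t : pdisc rho" using elim rho by (auto simp: pdisc_def axis_def)
   have "r j (axis k t) = 0" if "j < n" for j using rzc[of j "axis k t"] r0[OF that] by simp
   hence "R (axis k t) = 0" by (simp add: R_def)
   moreover have "a j (axis k t) = a j 0" if "j < n" for j using azc[OF that, of "axis k t"] by simp
   ultimately have "(SUM j<n. a j 0 * t ^ j) = Ts (axis k t) * t ^ n"
    using main[OF z] fR[OF z] by (simp add: algebra_simps)
   thus ?case using mult_right_mono[OF Ts_bd[OF z], of "norm t ^ n"] by (simp add: norm_mult norm_power)
  qed
 qed
 have aa: "analytic_at (a j) 0" if "j < n" for j
 proof -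
  have "analytic_at (%z. - (\<Sum>i. S i j z)) 0" by (rule analytic_at_uminus[OF an[OF asum(1)[OF that]]])
  thus ?thesis by (simp add: a_def[abs_def])
 qed
 show ?thesis
 proof (intro exI conjI)
  show "ALL j<n. analytic_at (a j) 0 & a j 0 = 0 & (ALL z. a j (zero_coord k z) = a j z)"
   using a0 azc aa by simp
  have "analytic_at Ts 0" by (rule an[OF Ts(1)])
  thus "analytic_at (%z. (1 + Ts z) * iv z) 0" by (intro analytic_intros iva)
  have "1 + Ts 0 ~= 0"
  proof
   assume "1 + Ts 0 = 0"
   hence "Ts 0 = - 1" using add_eq_0_iff by fastforce
   thus False using Ts_bd[OF z0] by simp
  qed
  thus "(1 + Ts 0) * iv 0 ~= 0" using va(2) by (simp add: iv_def)
  show "NEAR z. (1 + Ts z) * iv z * f z = (z $ k) ^ n + (SUM j<n. a j z * (z $ k) ^ j)"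
   using ev by eventually_elim (simp add: main)
 qed
qed

section \<open>Sign patterns of real polynomials with parameters\<close>

text \<open>\<open>s\<close> and \<open>t\<close> lie in the same component of the complement of
  \<open>Z\<close>.\<close>

definition gap :: "real set => real => real => bool" where
 "gap Z s t <-> (ALL z:Z. z < s & z < t | s < z & t < z)"

lemma gap_sym: "gap Z s t ==> gap Z t s" by (auto simp: gap_def)
lemma gap_trans:
 assumes "gap Z s t" "gap Z t u" shows "gap Z s u"
 unfolding gap_def
proof
 fix z assume z: "z : Z"
 have "z < s & z < t | s < z & t < z" "z < t & z < u | t < z & u < z" using assms z unfolding gap_def by blast+
 thus "z < s & z < u | s < z & u < z" by auto
qed
lemma gap_between:
 assumes "gap Z s t" "s <= u" "u <= t" shows "gap Z s u"
 unfolding gap_def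
proof
 fix z assume z: "z : Z"
 have "z < s & z < t | s < z & t < z" using assms z unfolding gap_def by blast
 thus "z < s & z < u | s < z & u < z" using assms by auto
qed
lemma gap_notin: "gap Z s t ==> s ~: Z & t ~: Z" by (auto simp: gap_def)

lemma gapI:
 assumes "ALL z:Z. z < s --> z < u" "ALL z:Z. s < z --> u < z" "s ~: Z"
 shows "gap Z s u"
 unfolding gap_def
proof
 fix z assume z: "z : Z"
 then consider "z < s" | "s < z" using assms(3) by (metis linorder_neqE_linordered_idom)
 thus "z < s & z < u | s < z & u < z" using assms z by cases auto
qed

lemma gap_refl: "s ~: Z ==> gap Z s s" by (rule gapI) auto

lemma poly_increasing:
 fixes p :: "real poly"
 assumes "a < b" "ALL u. a < u & u < b --> poly (pderiv p) u > 0"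
 shows "poly p a < poly p b"
proof -
 obtain x where "a < x" "x < b" "poly p b - poly p a = (b - a) * poly (pderiv p) x"
  using poly_MVT[OF assms(1)] by blast
 moreover have "(b - a) * poly (pderiv p) x > 0" using assms `a < x` `x < b` by simp
 ultimately show ?thesis by linarith
qed

lemma gap_sgn:
 fixes r :: "real poly"
 assumes "gap Z s t" "ALL u. poly r u = 0 --> u : Z"
 shows "sgn (poly r s) = sgn (poly r t)"
proof -
 have *: "sgn (poly r a) = sgn (poly r b)" if g: "gap Z a b" and ab: "a < b" for a b
 proof (rule ccontr)
  assume ne: "sgn (poly r a) ~= sgn (poly r b)"
  have "poly r a ~= 0" "poly r b ~= 0" using gap_notin[OF g] assms(2) by auto
  moreover from this have "poly r a > 0 | poly r a < 0" "poly r b > 0 | poly r b < 0" by linarith+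
  ultimately have "poly r a * poly r b < 0" using ne by (auto simp: mult_less_0_iff)
  then obtain u where "a < u" "u < b" "poly r u = 0" using poly_IVT[OF ab] by blast
  moreover have "u ~: Z" using gap_notin[OF gap_between[OF g, of u]] `a < u` `u < b` by simp
  ultimately show False using assms(2) by blast
 qed
 show ?thesis
 proof (cases s t rule: linorder_cases)
  case less thus ?thesis by (rule *[OF assms(1)])
 next
  case greater thus ?thesis by (rule *[OF gap_sym[OF assms(1)], symmetric])
 qed simp
qed

text \<open>Negativity at the left end of the component of \<open>s\<close>; vacuous if the
  component is unbounded to the left. \<open>rpos\<close> is the counterpart at the right
  end.\<close>

definition lneg :: "real set => real poly => real => bool" where
 "lneg Z p s <-> (ALL a:Z. a < s --> (ALL z:Z. z < s --> z <= a) --> poly p a < 0)"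

definition rpos :: "real set => real poly => real => bool" where
 "rpos Z p s <-> (ALL b:Z. s < b --> (ALL z:Z. s < z --> b <= z) --> 0 < poly p b)"

lemma gap_left_end:
 assumes "gap Z s t" "a : Z" "a < s" "ALL z:Z. z < s --> z <= a" "ALL u. gap Z s u --> poly (pderiv p) u > 0"
 shows "poly p a < poly p t"
proof (rule poly_increasing)
 show "a < t" using assms by (auto simp: gap_def)
 have "gap Z s u" if "a < u" "u < t" for u
  unfolding gap_def
 proof
  fix z assume z: "z : Z"
  then consider "z < s" "z < t" | "s < z" "t < z" using assms(1) unfolding gap_def by blast
  thus "z < s & z < u | s < z & u < z"
  proof cases
   case 1
   hence "z <= a" using assms(4) z by blast
   thus ?thesis using 1 that by simp
  qed (use that in simp)
 qed
 thus "ALL u. a < u & u < t --> 0 < poly (pderiv p) u" using assms(5) by blast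
qed

lemma gap_right_end:
 assumes "gap Z s t" "b : Z" "s < b" "ALL z:Z. s < z --> b <= z" "ALL u. gap Z s u --> poly (pderiv p) u > 0"
 shows "poly p t < poly p b"
proof (rule poly_increasing)
 show "t < b" using assms by (auto simp: gap_def)
 have "gap Z s u" if "t < u" "u < b" for u
  unfolding gap_def
 proof
  fix z assume z: "z : Z"
  then consider "z < s" "z < t" | "s < z" "t < z" using assms(1) unfolding gap_def by blast
  thus "z < s & z < u | s < z & u < z"
  proof cases
   case 2
   hence "b <= z" using assms(4) z by blast
   thus ?thesis using 2 that by simp
  qed (use that in simp)
 qed
 thus "ALL u. t < u & u < b --> 0 < poly (pderiv p) u" using assms(5) by blast
qed

lemma gap_increasing:
 assumes "gap Z s t" "gap Z s u" "t < u" "ALL u. gap Z s u --> poly (pderiv p) u > 0"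
 shows "poly p t < poly p u"
proof (rule poly_increasing[OF assms(3)])
 have "gap Z s v" if "t < v" "v < u" for v
  using gap_trans[OF assms(1) gap_between[OF gap_trans[OF gap_sym[OF assms(1)] assms(2)], of v]] that by auto
 thus "ALL v. t < v & v < u --> 0 < poly (pderiv p) v" using assms(4) by blast
qed

lemma poly_unbounded:
 fixes p :: "real poly"
 assumes "degree p > 0"
 shows "EX r. ALL z. r <= \<bar>z\<bar> --> d <= \<bar>poly p z\<bar>"
proof -
 obtain a q where p: "p = pCons a q" by (cases p) auto
 hence "q ~= 0" using assms by auto
 from poly_infinity[OF this, of d a] show ?thesis by (simp add: p)
qed

text \<open>On the gap \<open>p\<close> is strictly increasing, so a root exists exactly if
  \<open>p\<close> is negative at the left end and positive at the right end. At an infinite end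
  nothing has to be assumed, because a polynomial of positive degree is unbounded. Either
  obstruction fixes the sign of \<open>p\<close> on the whole gap.\<close>

lemma gap_root_iff:
 assumes Z: "finite Z" "s ~: Z" and p: "degree p > 0" and d: "ALL u. gap Z s u --> poly (pderiv p) u > 0"
 shows "(EX c. gap Z s c & poly p c = 0) <-> lneg Z p s & rpos Z p s"
  "~lneg Z p s ==> gap Z s t ==> poly p t > 0"
  "~rpos Z p s ==> gap Z s t ==> poly p t < 0"
proof -
 show "~lneg Z p s ==> gap Z s t ==> poly p t > 0"
 proof -
  assume "~lneg Z p s" and t: "gap Z s t"
  then obtain a where a: "a : Z" "a < s" "ALL z:Z. z < s --> z <= a" "~poly p a < 0" unfolding lneg_def by blast
  show "poly p t > 0" using gap_left_end[OF t a(1-3) d] a(4) by linarith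
 qed
 show "~rpos Z p s ==> gap Z s t ==> poly p t < 0"
 proof -
  assume "~rpos Z p s" and t: "gap Z s t"
  then obtain b where b: "b : Z" "s < b" "ALL z:Z. s < z --> b <= z" "~poly p b > 0" unfolding rpos_def by blast
  show "poly p t < 0" using gap_right_end[OF t b(1-3) d] b(4) by linarith
 qed
 show "(EX c. gap Z s c & poly p c = 0) <-> lneg Z p s & rpos Z p s"
 proof
  assume "EX c. gap Z s c & poly p c = 0"
  then obtain c where c: "gap Z s c" "poly p c = 0" by blast
  show "lneg Z p s & rpos Z p s"
  proof
   show "lneg Z p s" unfolding lneg_def
   proof (intro ballI impI)
    fix a assume "a : Z" "a < s" "ALL z:Z. z < s --> z <= a"
    from gap_left_end[OF c(1) this d] c(2) show "poly p a < 0" by simp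
   qed
   show "rpos Z p s" unfolding rpos_def
   proof (intro ballI impI)
    fix b assume "b : Z" "s < b" "ALL z:Z. s < z --> b <= z"
    from gap_right_end[OF c(1) this d] c(2) show "poly p b > 0" by simp
   qed
  qed
 next
  assume lr: "lneg Z p s & rpos Z p s"
  obtain r where r: "!!z. r <= \<bar>z\<bar> ==> \<bar>poly p s\<bar> + 1 <= \<bar>poly p z\<bar>" using poly_unbounded[OF p] by blast
  \<comment> \<open>For a gap that is unbounded to the left: the absolute value of \<open>p\<close>
    at \<open>S\<close> exceeds that at \<open>s\<close>; as \<open>p\<close> increases, the value
    at \<open>S\<close> is negative.\<close>
  define S where "S = - \<bar>s\<bar> - \<bar>r\<bar> - 1"
  obtain a where a: "a < s" "poly p a < 0" "ALL u. a < u & u < s --> gap Z s u"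
  proof (cases "EX z:Z. z < s")
   case True
   define a where "a = Max {z:Z. z < s}"
   have "finite {z:Z. z < s}" "{z:Z. z < s} ~= {}" using Z True by auto
   from Max_in[OF this(1,2)] Max_ge[OF this(1)] have a: "a : Z" "a < s" "ALL z:Z. z < s --> z <= a"
    by (auto simp: a_def)
   have "gap Z s u" if "a < u" "u < s" for u
    by (rule gapI) (use a that Z(2) in force)+
   moreover have "poly p a < 0" using lr a by (auto simp: lneg_def)
   ultimately show thesis using a that by blast
  next
   case False
   have g: "gap Z s u" if "u <= s" for u
    by (rule gapI) (use False that Z(2) in force)+
   have S: "S < s" "r <= \<bar>S\<bar>" by (auto simp: S_def)
   have "poly p S < poly p s" by (rule gap_increasing[OF g g S(1) d]) (use S in auto)
   hence "poly p S < 0" using r[OF S(2)] by linarith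
   thus thesis using that[of S] S g by auto
  qed
  define S' where "S' = \<bar>s\<bar> + \<bar>r\<bar> + 1"
  obtain b where b: "s < b" "poly p b > 0" "ALL u. s < u & u < b --> gap Z s u"
  proof (cases "EX z:Z. s < z")
   case True
   define b where "b = Min {z:Z. s < z}"
   have "finite {z:Z. s < z}" "{z:Z. s < z} ~= {}" using Z True by auto
   from Min_in[OF this(1,2)] Min_le[OF this(1)] have b: "b : Z" "s < b" "ALL z:Z. s < z --> b <= z"
    by (auto simp: b_def)
   have "gap Z s u" if "s < u" "u < b" for u
    by (rule gapI) (use b that Z(2) in force)+
   moreover have "poly p b > 0" using lr b by (auto simp: rpos_def)
   ultimately show thesis using b that by blast
  next
   case False
   have g: "gap Z s u" if "s <= u" for u
    by (rule gapI) (use False that Z(2) in force)+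
   have S: "s < S'" "r <= \<bar>S'\<bar>" by (auto simp: S'_def)
   have "poly p s < poly p S'" by (rule gap_increasing[OF g g S(1) d]) (use S in auto)
   hence "poly p S' > 0" using r[OF S(2)] by linarith
   thus thesis using that[of S'] S g by auto
  qed
  obtain c where c: "a < c" "c < b" "poly p c = 0" using poly_IVT_pos[of a b p] a b by auto
  have "gap Z s c" using a(3) b(3) c gap_refl[OF Z(2)] by (cases c s rule: linorder_cases) auto
  thus "EX c. gap Z s c & poly p c = 0" using c by blast
 qed
qed

text \<open>The arctangent rescaled to a strictly increasing map of the line into the open interval
  from \<open>u\<close> to \<open>v\<close>.\<close>

definition squeeze :: "real => real => real => real" where
 "squeeze u v s = u + (v - u) * (1/2 + arctan s / pi)"

lemma squeeze_props:
 assumes "u < v" shows "u < squeeze u v s" "squeeze u v s < v" "s < t ==> squeeze u v s < squeeze u v t"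
proof -
 have b: "0 < 1/2 + arctan s / pi" "1/2 + arctan s / pi < 1"
  using arctan_bounded[of s] pi_gt_zero by (auto simp: field_simps)
 show "u < squeeze u v s" using b assms by (simp add: squeeze_def)
 have "(v - u) * (1/2 + arctan s / pi) < (v - u) * 1" using b assms by (intro mult_strict_left_mono) auto
 thus "squeeze u v s < v" by (simp add: squeeze_def)
 show "s < t ==> squeeze u v s < squeeze u v t"
  using assms arctan_monotone[of s t] pi_gt_zero by (simp add: squeeze_def divide_strict_right_mono)
qed

text \<open>\<open>P\<close> and \<open>Q\<close> are the members of a family at two parameter
  values, and \<open>h\<close>, \<open>g\<close> match their signs in both directions. The family
  contains the derivative of \<open>p\<close>, so \<open>p\<close> is monotone between neighbouring
  roots of the members in \<open>I0\<close>, and its signs at those roots are signs of remainders,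
  which \<open>h\<close> already matches. Thus a gap contains a root of \<open>p\<close> exactly if
  the corresponding gap contains one of \<open>q\<close>, and \<open>h\<close> only has to be
  changed inside these gaps so that the new roots correspond. Continuity of the map is not claimed,
  only monotonicity.\<close>

lemma insert_polynomial:
 fixes p q :: "real poly" and P Q :: "'i => real poly"
 assumes fin: "finite I0" and sub: "I0 <= I"
  and h: "strict_mono h" "ALL i:I. ALL s. sgn (poly (P i) s) = sgn (poly (Q i) (h s))"
  and g: "strict_mono g" "ALL i:I. ALL s. sgn (poly (Q i) s) = sgn (poly (P i) (g s))"
  and deg: "degree p > 0" "degree q > 0"
  and d: "d : I0" "P d = pderiv p" "Q d = pderiv q"
  and rem: "ALL i:I0. P i ~= 0 --> (EX j:I. (ALL s. poly (P i) s = 0 --> sgn (poly p s) = sgn (poly (P j) s)) &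
    (ALL s. poly (Q i) s = 0 --> sgn (poly q s) = sgn (poly (Q j) s)))"
 shows "EX h'. strict_mono h' & (ALL i:I0. ALL s. sgn (poly (P i) s) = sgn (poly (Q i) (h' s))) &
   (ALL s. sgn (poly p s) = sgn (poly q (h' s)))"
proof -
 define X where "X = (\<Union>i\<in>{i:I0. P i ~= 0}. {s. poly (P i) s = 0})"
 define Y where "Y = (\<Union>i\<in>{i:I0. Q i ~= 0}. {s. poly (Q i) s = 0})"
 have finX: "finite X" and finY: "finite Y" unfolding X_def Y_def using fin by (simp_all add: poly_roots_finite)
 have inf: "infinite (range f)" if "strict_mono f" for f :: "real => real"
 proof -
  have inj: "inj f" using that by (rule strict_mono_imp_inj_on)
  show ?thesis
  proof
   assume "finite (range f)"
   from finite_imageD[OF this inj] show False using infinite_UNIV_char_0[where 'a = real] by simp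
  qed
 qed
 have hz: "poly (P i) s = 0 <-> poly (Q i) (h s) = 0" if "i : I" for i s
  using bspec[OF h(2) that, THEN spec, of s] by (metis sgn_0_0)
 have gz: "poly (Q i) s = 0 <-> poly (P i) (g s) = 0" if "i : I" for i s
  using bspec[OF g(2) that, THEN spec, of s] by (metis sgn_0_0)
 have zero: "P i = 0 <-> Q i = 0" if i0: "i : I0" for i
 proof
  assume 0: "P i = 0"
  have "poly (Q i) (h s) = 0" for s using hz[OF subsetD[OF sub i0], of s] 0 by simp
  hence sub: "range h <= {s. poly (Q i) s = 0}" by auto
  show "Q i = 0"
  proof (rule ccontr)
   assume "Q i ~= 0"
   from finite_subset[OF sub poly_roots_finite[OF this]] inf[OF h(1)] show False by simp
  qed
 next
  assume 0: "Q i = 0"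
  have "poly (P i) (g s) = 0" for s using gz[OF subsetD[OF sub i0], of s] 0 by simp
  hence sub: "range g <= {s. poly (P i) s = 0}" by auto
  show "P i = 0"
  proof (rule ccontr)
   assume "P i ~= 0"
   from finite_subset[OF sub poly_roots_finite[OF this]] inf[OF g(1)] show False by simp
  qed
 qed
 have hXY: "h s : Y" if sX: "s : X" for s
 proof -
  obtain i where i: "i : I0" "P i ~= 0" "poly (P i) s = 0" using sX unfolding X_def by blast
  hence "poly (Q i) (h s) = 0" using hz[OF subsetD[OF sub i(1)], of s] by simp
  thus ?thesis using i zero by (auto simp: Y_def)
 qed
 have gYX: "g s : X" if sY: "s : Y" for s
 proof -
  obtain i where i: "i : I0" "Q i ~= 0" "poly (Q i) s = 0" using sY unfolding Y_def by blast
  hence "poly (P i) (g s) = 0" using gz[OF subsetD[OF sub i(1)], of s] by simp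
  thus ?thesis using i zero by (auto simp: X_def)
 qed
 have injh: "inj h" "inj g" using strict_mono_imp_inj_on[OF h(1)] strict_mono_imp_inj_on[OF g(1)] by auto
 \<comment> \<open>Each of \<open>h\<close> and \<open>g\<close> embeds one finite root set into the
   other, so the cardinalities agree and \<open>h\<close> is onto.\<close>
 have hX: "h ` X = Y"
 proof (rule card_subset_eq[OF finY])
  show "h ` X <= Y" using hXY by blast
  have "card (h ` X) = card X" using injh by (intro card_image) (auto intro: inj_on_subset)
  moreover have "card (g ` Y) = card Y" using injh by (intro card_image) (auto intro: inj_on_subset)
  moreover have "card (g ` Y) <= card X" using gYX finX by (intro card_mono) auto
  moreover have "card (h ` X) <= card Y" using hXY finY by (intro card_mono) auto
  ultimately show "card (h ` X) = card Y" by simp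
 qed
 have hlt: "h s < h t <-> s < t" for s t using strict_mono_less[OF h(1)] by simp
 have hle: "h s <= h t <-> s <= t" for s t using strict_mono_less_eq[OF h(1)] by simp
 have hmem: "h s : Y <-> s : X" for s using hX injh(1) by (metis inj_image_mem_iff)
 have hgap: "gap Y (h s) (h t) <-> gap X s t" for s t unfolding gap_def hX[symmetric] by (simp add: hlt)
 have pX: "sgn (poly p z) = sgn (poly q (h z))" if z: "z : X" for z
 proof -
  obtain i where i: "i : I0" "P i ~= 0" "poly (P i) z = 0" using z by (auto simp: X_def)
  obtain j where j: "j : I" "sgn (poly p z) = sgn (poly (P j) z)" and
   "ALL s. poly (Q i) s = 0 --> sgn (poly q s) = sgn (poly (Q j) s)" using rem i by blast
  moreover have "poly (Q i) (h z) = 0" using hz[OF subsetD[OF sub i(1)], of z] i(3) by simp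
  ultimately have "sgn (poly q (h z)) = sgn (poly (Q j) (h z))" by blast
  thus ?thesis using j h(2) by simp
 qed
 have Pd: "P d ~= 0" "Q d ~= 0" using deg d by (auto simp: pderiv_eq_0_iff)
 have rootX: "ALL u. poly (P i) u = 0 --> u : X" if "i : I0" "P i ~= 0" for i using that by (auto simp: X_def)
 have rootY: "ALL u. poly (Q i) u = 0 --> u : Y" if "i : I0" "Q i ~= 0" for i using that by (auto simp: Y_def)
 \<comment> \<open>Sign of the derivative on the gap of \<open>s\<close>; multiplying
   \<open>p\<close> and \<open>q\<close> by it makes both increasing there.\<close>
 define ep where "ep s = sgn (poly (P d) s)" for s
 have eps: "ep s ~= 0" "ep s = 1 | ep s = -1" if "s ~: X" for s
  using rootX[OF d(1) Pd(1)] that by (auto simp: ep_def sgn_if split: if_splits)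
 define p' where "p' s = smult (ep s) p" for s
 define q' where "q' s = smult (ep s) q" for s
 have dp: "ALL u. gap X s u --> poly (pderiv (p' s)) u > 0" for s
 proof (intro allI impI)
  fix u assume u: "gap X s u"
  have "ep s = sgn (poly (P d) u)" unfolding ep_def by (rule gap_sgn[OF u rootX[OF d(1) Pd(1)]])
  moreover have "poly (P d) u ~= 0" using gap_notin[OF u] rootX[OF d(1) Pd(1)] by auto
  ultimately show "poly (pderiv (p' s)) u > 0" using d(2)
   by (auto simp: p'_def pderiv_smult sgn_if split: if_splits)
 qed
 have dq: "ALL u. gap Y (h s) u --> poly (pderiv (q' s)) u > 0" for s
 proof (intro allI impI)
  fix u assume u: "gap Y (h s) u"
  have "ep s = sgn (poly (Q d) (h s))" using h(2) d(1) sub by (auto simp: ep_def)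
  hence "ep s = sgn (poly (Q d) u)" using gap_sgn[OF u rootY[OF d(1) Pd(2)]] by simp
  moreover have "poly (Q d) u ~= 0" using gap_notin[OF u] rootY[OF d(1) Pd(2)] by auto
  ultimately show "poly (pderiv (q' s)) u > 0" using d(3)
   by (auto simp: q'_def pderiv_smult sgn_if split: if_splits)
 qed
 have degp: "degree (p' s) > 0" "degree (q' s) > 0" if "s ~: X" for s
  using deg eps[OF that] by (auto simp: p'_def q'_def)
 have sgnp': "sgn (poly (p' s) z) = sgn (poly (q' s) (h z))" if "z : X" for s z
  using pX[OF that] by (simp add: p'_def q'_def sgn_mult)
 have sgnlt: "poly (p' s) z < 0 <-> poly (q' s) (h z) < 0" "poly (p' s) z > 0 <-> poly (q' s) (h z) > 0"
  if "z : X" for s z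
  using sgnp'[OF that, of s] by (metis sgn_less, metis sgn_greater)
 have lneg: "lneg X (p' s) s <-> lneg Y (q' s) (h s)" for s
  unfolding lneg_def hX[symmetric] by (auto simp: hlt hle sgnlt)
 have rpos: "rpos X (p' s) s <-> rpos Y (q' s) (h s)" for s
  unfolding rpos_def hX[symmetric] by (auto simp: hlt hle sgnlt)
 define has where "has s <-> (EX c. gap X s c & poly p c = 0)" for s
 have rt: "poly (p' s) c = 0 <-> poly p c = 0" "poly (q' s) c = 0 <-> poly q c = 0" if "s ~: X" for s c
  using eps[OF that] by (auto simp: p'_def q'_def)
 have has_iff: "has s <-> (EX c. gap Y (h s) c & poly q c = 0)" "has s <-> lneg X (p' s) s & rpos X (p' s) s"
  if s: "s ~: X" for s
 proof -
  show "has s <-> lneg X (p' s) s & rpos X (p' s) s"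
   using gap_root_iff(1)[OF finX s degp(1)[OF s] dp] rt[OF s] by (simp add: has_def)
  thus "has s <-> (EX c. gap Y (h s) c & poly q c = 0)"
   using gap_root_iff(1)[OF finY _ degp(2)[OF s] dq] hmem s rt[OF s] lneg rpos by simp
 qed
 have no_root: "sgn (poly p s) = sgn (poly q (h s))" if s: "s ~: X" and "~has s" for s
 proof -
  have gx: "gap X s s" "gap Y (h s) (h s)" using s hmem by (auto intro: gap_refl)
  have "~lneg X (p' s) s | ~rpos X (p' s) s" using that has_iff(2)[OF s] by simp
  hence "sgn (poly (p' s) s) = sgn (poly (q' s) (h s))"
  proof
   assume "~lneg X (p' s) s"
   thus ?thesis using gap_root_iff(2)[OF finX s degp(1)[OF s] dp _ gx(1)]
    gap_root_iff(2)[OF finY _ degp(2)[OF s] dq _ gx(2)] hmem s lneg by simp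
  next
   assume "~rpos X (p' s) s"
   thus ?thesis using gap_root_iff(3)[OF finX s degp(1)[OF s] dp _ gx(1)]
    gap_root_iff(3)[OF finY _ degp(2)[OF s] dq _ gx(2)] hmem s rpos by simp
  qed
  thus ?thesis using eps(2)[OF s] by (auto simp: p'_def q'_def)
 qed
 \<comment> \<open>The predicates depend only on the gap of \<open>s\<close>, so \<open>SOME\<close>
   picks the same root for all points of a gap; this is \<open>same\<close> below.\<close>
 define c where "c s = (SOME c. gap X s c & poly p c = 0)" for s
 define e where "e s = (SOME c. gap Y (h s) c & poly q c = 0)" for s
 have c: "gap X s (c s)" "poly p (c s) = 0" if "has s" for s
  using someI_ex[of "%c. gap X s c & poly p c = 0"] that by (auto simp: c_def has_def)
 have e: "gap Y (h s) (e s)" "poly q (e s) = 0" if "has s" "s ~: X" for s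
  using someI_ex[of "%c. gap Y (h s) c & poly q c = 0"] has_iff(1)[OF that(2)] that(1) by (auto simp: e_def)
 have gap_eq: "gap X s = gap X t" if "gap X s t" for s t
  using that gap_trans gap_sym by blast
 have gapY_eq: "gap Y s = gap Y t" if "gap Y s t" for s t
  using that gap_trans gap_sym by blast
 have same: "has s = has t" "c s = c t" "e s = e t" if "gap X s t" for s t
 proof -
  show "has s = has t" "c s = c t" unfolding has_def c_def by (simp_all add: gap_eq[OF that])
  have "gap Y (h s) (h t)" using that hgap by simp
  from gapY_eq[OF this] show "e s = e t" unfolding e_def by (simp only:)
 qed
 \<comment> \<open>The open interval from \<open>u y\<close> to \<open>w y\<close> contains no point
   of \<open>Y\<close> other than possibly \<open>y\<close>; the added points \<open>y - 1\<close>
   and \<open>y + 1\<close> keep the sets nonempty.\<close>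
 define u where "u y = Max (insert (y - 1) {z:Y. z < y})" for y
 define w where "w y = Min (insert (y + 1) {z:Y. y < z})" for y
 have u: "u y < y" "ALL z:Y. z < y --> z <= u y" for y using finY by (auto simp: u_def intro: Max_ge)
 have w: "y < w y" "ALL z:Y. y < z --> w y <= z" for y using finY by (auto simp: w_def intro: Min_le)
 \<comment> \<open>In a gap with a root \<open>c s\<close> of \<open>p\<close>, this root goes to
   the root \<open>e s\<close> of \<open>q\<close>, and the points to its left and right are
   squeezed into the intervals next to \<open>e s\<close>.\<close>
 define h' where "h' s = (if s : X | ~has s then h s else if s = c s then e s
   else if s < c s then squeeze (u (e s)) (e s) s else squeeze (e s) (w (e s)) s)" for s
 have gap_h': "gap Y (h s) (h' s)" if s: "s ~: X" for s
 proof (cases "has s")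
  case True
  have ge: "gap Y (h s) (e s)" by (rule e(1)[OF True s])
  have eY: "e s ~: Y" using gap_notin[OF ge] by simp
  have "gap Y (e s) (h' s)"
  proof -
   consider "s = c s" | "s < c s" | "c s < s" by linarith
   thus ?thesis
   proof cases
    case 1 thus ?thesis using True s gap_refl[OF eY] by (simp add: h'_def)
   next
    case 2
    hence "h' s = squeeze (u (e s)) (e s) s" using True s by (simp add: h'_def)
    hence "u (e s) < h' s" "h' s < e s" using squeeze_props(1,2)[OF u(1)] by auto
    thus ?thesis using u(2)[of "e s"] eY by (intro gapI) force+
   next
    case 3
    hence "h' s = squeeze (e s) (w (e s)) s" using True s by (simp add: h'_def)
    hence "e s < h' s" "h' s < w (e s)" using squeeze_props(1,2)[OF w(1)] by auto
    thus ?thesis using w(2)[of "e s"] eY by (intro gapI) force+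
   qed
  qed
  thus ?thesis using gap_trans[OF ge] by blast
 next
  case False
  thus ?thesis using s hmem by (simp add: h'_def gap_refl)
 qed
 have h'X: "h' z = h z" if "z : X" for z using that by (simp add: h'_def)
 have pos: "s < z <-> h' s < h z" "z < s <-> h z < h' s" if z: "z : X" for s z
 proof -
  have "(s < z <-> h' s < h z) & (z < s <-> h z < h' s)"
  proof (cases "s : X")
   case False
   from gap_h'[OF False] have "h z < h s & h z < h' s | h s < h z & h' s < h z"
    using hXY[OF z] by (auto simp: gap_def)
   thus ?thesis by (auto simp: hlt)
  qed (simp add: h'X hlt)
  thus "s < z <-> h' s < h z" "z < s <-> h z < h' s" by auto
 qed
 have "strict_mono h'"
 proof (rule strict_monoI)
  fix s t :: real assume st: "s < t"
  show "h' s < h' t"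
  proof (cases "EX z:X. s <= z & z <= t")
   case True
   then obtain z where z: "z : X" "s <= z" "z <= t" by blast
   have "h' s <= h z" using pos(1)[OF z(1), of s] h'X z by (cases "s = z") auto
   moreover have "h z <= h' t" using pos(2)[OF z(1), of t] h'X z by (cases "t = z") auto
   moreover have "h' s < h z | h z < h' t" using pos[OF z(1)] z st by (metis le_less)
   ultimately show ?thesis by linarith
  next
   case False
   hence gst: "gap X s t" by (intro gapI) (use st in force)+
   have sX: "s ~: X" "t ~: X" using gap_notin[OF gst] by auto
   note same[OF gst]
   thus ?thesis
    using st sX squeeze_props(1,2,3)[OF u(1)[of "e t"]] squeeze_props(1,2,3)[OF w(1)[of "e t"]] hlt[of s t]
    by (auto simp: h'_def) (metis less_trans)+
  qed
 qed
 moreover have "sgn (poly (P i) s) = sgn (poly (Q i) (h' s))" if i: "i : I0" for i s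
 proof (cases "P i = 0 | s : X")
  case True
  have "sgn (poly (P i) s) = sgn (poly (Q i) (h s))" using h(2) i sub by blast
  thus ?thesis using True zero[OF i] by (auto simp: h'X)
 next
  case False
  have "sgn (poly (Q i) (h s)) = sgn (poly (Q i) (h' s))"
   by (rule gap_sgn[OF gap_h']) (use False rootY i zero in auto)
  moreover have "sgn (poly (P i) s) = sgn (poly (Q i) (h s))" using h(2) i sub by blast
  ultimately show ?thesis by simp
 qed
 moreover have "sgn (poly p s) = sgn (poly q (h' s))" for s
 proof (cases "s : X | ~has s")
  case True
  thus ?thesis using pX no_root by (cases "s : X") (auto simp: h'_def)
 next
  case False
  hence s: "s ~: X" "has s" by auto
  note c = c[OF s(2)] note e = e[OF s(2,1)]
  have gs: "gap X s s" using gap_refl[OF s(1)] .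
  have c': "poly (p' s) (c s) = 0" "poly (q' s) (e s) = 0" using c e rt[OF s(1)] by auto
  consider "s = c s" | "s < c s" | "c s < s" by linarith
  hence "sgn (poly (p' s) s) = sgn (poly (q' s) (h' s))"
  proof cases
   case 1
   hence "h' s = e s" using s by (simp add: h'_def)
   thus ?thesis using 1 c' by simp
  next
   case 2
   hence "h' s < e s" using s squeeze_props(2)[OF u(1)] by (simp add: h'_def)
   hence "poly (q' s) (h' s) < 0" using gap_increasing[OF gap_h'[OF s(1)] e(1) _ dq] c' by simp
   moreover have "poly (p' s) s < 0" using gap_increasing[OF gs c(1) 2 dp] c' by simp
   ultimately show ?thesis by simp
  next
   case 3
   hence "e s < h' s" using s squeeze_props(1)[OF w(1)] by (simp add: h'_def)
   hence "poly (q' s) (h' s) > 0" using gap_increasing[OF e(1) gap_h'[OF s(1)] _ dq] c' by simp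
   moreover have "poly (p' s) s > 0" using gap_increasing[OF c(1) gs 3 dp] c' by simp
   ultimately show ?thesis by simp
  qed
  thus ?thesis using eps(2)[OF s(1)] by (auto simp: p'_def q'_def)
 qed
 ultimately show ?thesis by blast
qed

section \<open>Polynomials whose coefficients are functions of a parameter\<close>

definition fun_ring :: "('x => real) set => bool" where
 "fun_ring R <-> (ALL c. (%_. c) : R) &
   (ALL f:R. ALL g:R. (%x. f x + g x) : R & (%x. f x * g x) : R)"

lemma fun_ring_rules:
 assumes "fun_ring R"
 shows "(%_. c) : R" "f : R ==> g : R ==> (%x. f x + g x) : R"
  "f : R ==> g : R ==> (%x. f x * g x) : R" "f : R ==> g : R ==> (%x. f x - g x) : R"
proof -
 show 1: "(%_. c) : R" "f : R ==> g : R ==> (%x. f x + g x) : R"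
  "f : R ==> g : R ==> (%x. f x * g x) : R" for c f g
  using assms by (auto simp: fun_ring_def)
 assume fg: "f : R" "g : R"
 have "(%x. f x + (-1) * g x) : R" by (intro 1 fg)
 thus "(%x. f x - g x) : R" by simp
qed

lemma fun_ring_power:
 assumes R: "fun_ring R" and "f : R" shows "(%x. f x ^ n) : R"
 using assms(2) by (induction n) (simp_all add: fun_ring_rules[OF R])

definition par_poly :: "('x => real) set => nat => ('x => real poly) => bool" where
 "par_poly R n P <-> (ALL x. degree (P x) <= n) & (ALL i. (%x. coeff (P x) i) : R)"

lemma par_poly_mono: "par_poly R n P ==> n <= m ==> par_poly R m P"
 unfolding par_poly_def using order_trans by blast

lemma par_poly_diff:
 assumes R: "fun_ring R" and "par_poly R n P" "par_poly R n Q" shows "par_poly R n (%x. P x - Q x)"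
 using assms(2,3) unfolding par_poly_def by (auto intro: degree_diff_le fun_ring_rules[OF R])

lemma par_poly_smult:
 assumes R: "fun_ring R" and "par_poly R n P" "c : R" shows "par_poly R n (%x. smult (c x) (P x))"
 using assms(2,3) unfolding par_poly_def
 by (auto intro: fun_ring_rules[OF R] order_trans[OF degree_smult_le])

lemma par_poly_monom_mult:
 assumes R: "fun_ring R" and P: "par_poly R n P" and c: "c : R"
 shows "par_poly R (k + n) (%x. monom (c x) k * P x)"
 unfolding par_poly_def
proof (intro conjI allI)
 fix x show "degree (monom (c x) k * P x) <= k + n"
  using degree_mult_le[of "monom (c x) k" "P x"] degree_monom_le[of "c x" k] P unfolding par_poly_def
  by (meson add_mono order_trans)
next
 fix i
 have "(%x. c x * coeff (P x) (i - k)) : R" using P c by (intro fun_ring_rules[OF R]) (auto simp: par_poly_def)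
 thus "(%x. coeff (monom (c x) k * P x) i) : R"
  by (cases "k <= i") (simp_all add: coeff_monom_mult fun_ring_rules[OF R])
qed

lemma degree_lessI: "degree p <= Suc n ==> coeff p (Suc n) = 0 ==> degree p <= n"
 by (intro degree_le allI impI) (metis Suc_lessI coeff_eq_0 le_less_trans)

lemma par_poly_drop:
 assumes R: "fun_ring R" and P: "par_poly R (Suc n) P" and 0: "ALL x. coeff (P x) (Suc n) = 0"
 shows "par_poly R n P"
 using P 0 degree_lessI unfolding par_poly_def by blast

text \<open>Pseudo-division by the truncation of \<open>Q\<close> to degree \<open>j\<close>; even powers of the leading
  coefficient keep the sign.\<close>

lemma pseudo_remainder:
 assumes R: "fun_ring R" and Q: "par_poly R m Q" and j: "j > 0" and P: "par_poly R n P"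
 shows "EX S e. par_poly R (j - 1) S &
  (ALL x. degree (Q x) <= j --> (EX A. smult (coeff (Q x) j ^ (2 * e)) (P x) = A * Q x + S x))"
 using P
proof (induction n arbitrary: P)
 case 0
 thus ?case using j by (intro exI[of _ P] exI[of _ 0]) (auto intro: par_poly_mono exI[of _ 0])
next
 case (Suc n)
 show ?case
 proof (cases "Suc n < j")
  case True
  thus ?thesis using par_poly_mono[OF Suc.prems, of "j - 1"]
   by (intro exI[of _ P] exI[of _ 0]) (auto intro: exI[of _ 0])
 next
  case False
  \<comment> \<open>A family of degree at most \<open>j\<close> at every parameter, equal to
    \<open>Q\<close> where the degree of \<open>Q\<close> is at most \<open>j\<close>; so one
    division step works for all parameters at once.\<close>
  define T where "T x = poly_cutoff (Suc j) (Q x)" for x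
  have TQ: "T x = Q x" if "degree (Q x) <= j" for x
   unfolding T_def by (rule poly_eqI) (use that coeff_eq_0[of "Q x"] in \<open>auto simp: coeff_poly_cutoff\<close>)
  have T: "par_poly R j T" unfolding par_poly_def
  proof (intro conjI allI)
   show "degree (T x) <= j" for x unfolding T_def by (rule degree_le) (auto simp: coeff_poly_cutoff)
   show "(%x. coeff (T x) i) : R" for i
    using Q fun_ring_rules(1)[OF R, of 0] by (cases "i <= j") (auto simp: T_def coeff_poly_cutoff par_poly_def less_Suc_eq_le)
  qed
  define q where "q x = coeff (Q x) j" for x
  define a where "a x = coeff (P x) (Suc n)" for x
  have qa: "q : R" "a : R" using Q Suc.prems by (auto simp: par_poly_def q_def[abs_def] a_def[abs_def])
  define M where "M x = monom (q x * a x) (Suc n - j) * T x" for x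
  define P1 where "P1 x = smult (q x ^ 2) (P x) - M x" for x
  have M: "par_poly R (Suc n) M"
   using par_poly_monom_mult[OF R T fun_ring_rules(3)[OF R qa], of "Suc n - j"] False by (simp add: M_def[abs_def])
  have "par_poly R (Suc n) P1" unfolding P1_def[abs_def]
   by (intro par_poly_diff[OF R] par_poly_smult[OF R] Suc.prems M fun_ring_power[OF R] qa)
  moreover have "coeff (P1 x) (Suc n) = 0" for x
   using False by (simp add: P1_def M_def coeff_monom_mult T_def coeff_poly_cutoff q_def a_def power2_eq_square)
  ultimately have "par_poly R n P1" using par_poly_drop[OF R] by blast
  from Suc.IH[OF this] obtain S e where S: "par_poly R (j - 1) S"
   "ALL x. degree (Q x) <= j --> (EX A. smult (coeff (Q x) j ^ (2 * e)) (P1 x) = A * Q x + S x)" by blast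
  have "EX A. smult (coeff (Q x) j ^ (2 * Suc e)) (P x) = A * Q x + S x" if d: "degree (Q x) <= j" for x
  proof -
   obtain A where A: "smult (q x ^ (2 * e)) (P1 x) = A * Q x + S x" using S(2) d unfolding q_def by blast
   have "smult (q x ^ (2 * Suc e)) (P x) = smult (q x ^ (2 * e)) (P1 x + M x)"
    by (simp add: P1_def power_add power2_eq_square mult_ac)
   also have "... = (A + smult (q x ^ (2 * e)) (monom (q x * a x) (Suc n - j))) * Q x + S x"
    unfolding smult_add_right A by (simp add: M_def TQ[OF d] algebra_simps)
   finally show ?thesis unfolding q_def by blast
  qed
  thus ?thesis using S(1) by blast
 qed
qed

text \<open>Parameters at which the finitely many functions in \<open>G\<close> have equal signs
  give the same sign pattern up to an increasing change of the variable. A map in the opposite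
  direction comes from exchanging \<open>x\<close> and \<open>y\<close>.\<close>

definition sign_determined :: "('x => real) set => ('x => real poly) set => bool" where
 "sign_determined R \<P> <-> (EX G<=R. finite G & (ALL x y. (ALL g:G. sgn (g x) = sgn (g y)) -->
   (EX h. strict_mono h & (ALL P:\<P>. ALL s. sgn (poly (P x) s) = sgn (poly (P y) (h s))))))"

text \<open>Where the coefficient of \<open>p\<close> of degree \<open>n\<close> vanishes,
  \<open>p\<close> is its truncation and \<open>trunc\<close> applies. Elsewhere
  \<open>insert_polynomial\<close> applies to \<open>p\<close>, with its derivative and with the
  pseudo-remainders of \<open>p\<close> by the other members and by the derivative; these auxiliary
  polynomials have degree below \<open>n\<close>, so they fall under \<open>rem\<close>.\<close>

lemma sign_determined_step:
 assumes R: "fun_ring R" and fin: "finite \<P>" and P: "ALL Q:\<P>. par_poly R n Q" and p: "par_poly R n p" and n: "n > 0"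
  and trunc: "sign_determined R (insert (%x. p x - monom (coeff (p x) n) n) \<P>)"
  and rem: "ALL \<S>. finite \<S> --> (ALL S:\<S>. par_poly R (n - 1) S) --> sign_determined R (\<S> \<union> \<P>)"
 shows "sign_determined R (insert p \<P>)"
proof -
 define p' where "p' x = pderiv (p x)" for x
 have p': "par_poly R (n - 1) p'" unfolding par_poly_def
 proof (intro conjI allI)
  show "degree (p' x) <= n - 1" for x using p by (auto simp: p'_def degree_pderiv par_poly_def diff_le_mono)
  show "(%x. coeff (p' x) i) : R" for i
   using p fun_ring_rules(1,3)[OF R] by (simp add: p'_def coeff_pderiv par_poly_def)
 qed
 define \<Q> where "\<Q> = insert p' \<P>"
 have \<Q>: "finite \<Q>" "ALL Q:\<Q>. par_poly R n Q"
  using fin P par_poly_mono[OF p', of n] by (auto simp: \<Q>_def)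
 define D where "D Q j S <-> par_poly R (n - 1) S & (EX e. ALL x. degree (Q x) <= j -->
   (EX A. smult (coeff (Q x) j ^ (2 * e)) (p x) = A * Q x + S x))" for Q :: "'a => real poly" and j S
 define S where "S Q j = (SOME S. D Q j S)" for Q j
 have S: "D Q j (S Q j)" if Q: "Q : \<Q>" and j: "j : {1..n}" for Q j
 proof -
  have j0: "0 < j" using j by simp
  from pseudo_remainder[OF R bspec[OF \<Q>(2) Q] j0 p]
  obtain S e where S: "par_poly R (j - 1) S" "ALL x. degree (Q x) <= j --> (EX A. smult (coeff (Q x) j ^ (2 * e)) (p x) = A * Q x + S x)"
   by blast
  have "par_poly R (n - 1) S" by (rule par_poly_mono[OF S(1)]) (use j in auto)
  hence "D Q j S" using S(2) unfolding D_def by blast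
  thus ?thesis unfolding S_def by (rule someI[of "D Q j"])
 qed
 define \<S> where "\<S> = insert p' ((%(Q, j). S Q j) ` (\<Q> \<times> {1..n}))"
 have "sign_determined R (\<S> \<union> \<P>)"
 proof -
  have "ALL T:\<S>. par_poly R (n - 1) T" using S p' unfolding \<S>_def D_def by auto
  moreover have "finite \<S>" using \<Q>(1) by (simp add: \<S>_def)
  ultimately show ?thesis using rem by blast
 qed
 then obtain G1 where G1: "G1 <= R" "finite G1" and h1: "!!x y. (ALL g:G1. sgn (g x) = sgn (g y)) ==>
   (EX h. strict_mono h & (ALL P:\<S> \<union> \<P>. ALL s. sgn (poly (P x) s) = sgn (poly (P y) (h s))))"
  unfolding sign_determined_def by blast
 obtain G0 where G0: "G0 <= R" "finite G0" and h0: "!!x y. (ALL g:G0. sgn (g x) = sgn (g y)) ==>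
   (EX h. strict_mono h & (ALL P:insert (%x. p x - monom (coeff (p x) n) n) \<P>. ALL s. sgn (poly (P x) s) = sgn (poly (P y) (h s))))"
  using trunc unfolding sign_determined_def by blast
 \<comment> \<open>The signs of all coefficients tell which of them vanish, hence the degrees of all
   members.\<close>
 define C where "C = (%(Q, i) x. coeff (Q x) i) ` (insert p \<Q> \<times> {0..n})"
 have C: "C <= R" "finite C" using \<Q> p by (auto simp: C_def par_poly_def)
 show ?thesis
  unfolding sign_determined_def
 proof (intro exI[of _ "G0 \<union> G1 \<union> C"] conjI allI impI)
  show "G0 \<union> G1 \<union> C <= R" "finite (G0 \<union> G1 \<union> C)" using G0 G1 C by auto
  fix x y assume sg: "ALL g:G0 \<union> G1 \<union> C. sgn (g x) = sgn (g y)"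
  have cf: "sgn (coeff (Q x) i) = sgn (coeff (Q y) i)" if "Q : insert p \<Q>" "i <= n" for Q i
  proof -
   have "(%x. coeff (Q x) i) : C" using that by (force simp: C_def)
   thus ?thesis using sg by (metis UnI2)
  qed
  have cf0: "coeff (Q x) i = 0 <-> coeff (Q y) i = 0" if "Q : insert p \<Q>" "i <= n" for Q i
   using cf[OF that] by (metis sgn_0_0)
  show "EX h. strict_mono h & (ALL P:insert p \<P>. ALL s. sgn (poly (P x) s) = sgn (poly (P y) (h s)))"
  proof (cases "coeff (p x) n = 0")
   case True
   hence "coeff (p y) n = 0" using cf0[of p n] by simp
   thus ?thesis using h0[of x y] sg True by simp
  next
   case False
   hence ny: "coeff (p y) n ~= 0" using cf0[of p n] by simp
   have deg: "degree (p x) > 0" "degree (p y) > 0" using le_degree[OF False] le_degree[OF ny] n by auto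
   obtain h where h: "strict_mono h" "ALL P:\<S> \<union> \<P>. ALL s. sgn (poly (P x) s) = sgn (poly (P y) (h s))"
    using h1[of x y] sg by blast
   obtain g where g: "strict_mono g" "ALL P:\<S> \<union> \<P>. ALL s. sgn (poly (P y) s) = sgn (poly (P x) (g s))"
    using h1[of y x] sg by (metis UnCI)
   have rt: "EX j:\<S> \<union> \<P>. (ALL s. poly (Q x) s = 0 --> sgn (poly (p x) s) = sgn (poly (j x) s)) &
    (ALL s. poly (Q y) s = 0 --> sgn (poly (p y) s) = sgn (poly (j y) s))" if Q: "Q : \<Q>" and nz: "Q x ~= 0" for Q
   proof -
    define j where "j = degree (Q x)"
    have jn: "j <= n" using \<Q>(2) Q by (auto simp: j_def par_poly_def)
    have lx: "coeff (Q x) j ~= 0" using nz by (simp add: j_def)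
    have ly: "coeff (Q y) j ~= 0" using cf0[of Q j] Q jn lx by simp
    have dy: "degree (Q y) = j"
    proof (rule antisym)
    show "degree (Q y) <= j"
    proof (rule degree_le, intro allI impI)
    fix i assume i: "j < i"
    show "coeff (Q y) i = 0"
    proof (cases "i <= n")
    case True
    have "coeff (Q x) i = 0" using i by (simp add: j_def coeff_eq_0)
    thus ?thesis using cf0[of Q i] Q True by simp
    next
    case False
    thus ?thesis using \<Q>(2) Q coeff_eq_0[of "Q y" i] unfolding par_poly_def by (meson le_less_trans not_le)
    qed
    qed
    qed (rule le_degree[OF ly])
    show ?thesis
    proof (cases "j = 0")
    case True
    \<comment> \<open>A nonzero constant has no roots, so any member of the family serves as its
      remainder.\<close>
    have "poly (Q z) s ~= 0" if d: "degree (Q z) = 0" and l: "coeff (Q z) 0 ~= 0" for z s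
    using degree_0_id[OF d] l poly_0_coeff_0[of "Q z"] by (metis poly_pCons mult_zero_right poly_0 add.right_neutral)
    hence "ALL s. poly (Q x) s ~= 0" "ALL s. poly (Q y) s ~= 0" using True j_def dy lx ly by auto
    moreover have "p' : \<S> \<union> \<P>" by (simp add: \<S>_def)
    ultimately show ?thesis by blast
    next
    case False
    hence j: "j : {1..n}" using jn by simp
    have mem: "S Q j : \<S> \<union> \<P>" using Q j by (auto simp: \<S>_def)
    obtain e where e: "ALL x. degree (Q x) <= j --> (EX A. smult (coeff (Q x) j ^ (2 * e)) (p x) = A * Q x + S Q j x)"
    using S[OF Q j] unfolding D_def by blast
    have "sgn (poly (p z) s) = sgn (poly (S Q j z) s)"
    if d: "degree (Q z) <= j" and l: "coeff (Q z) j ~= 0" and s: "poly (Q z) s = 0" for z s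
    proof -
    obtain A where A: "smult (coeff (Q z) j ^ (2 * e)) (p z) = A * Q z + S Q j z" using e d by blast
    have "coeff (Q z) j ^ (2 * e) * poly (p z) s = poly (S Q j z) s"
    using arg_cong[OF A, of "%p. poly p s"] s by simp
    moreover have "coeff (Q z) j ^ (2 * e) > 0" using l by (simp add: power_mult)
    ultimately show ?thesis by (metis sgn_mult sgn_pos mult_1)
    qed
    thus ?thesis using mem lx ly dy j_def by (intro bexI[of _ "S Q j"]) auto
    qed
   qed
   have "EX h'. strict_mono h' & (ALL i:\<Q>. ALL s. sgn (poly (i x) s) = sgn (poly (i y) (h' s))) &
    (ALL s. sgn (poly (p x) s) = sgn (poly (p y) (h' s)))"
   proof (rule insert_polynomial[OF _ _ h g deg, of \<Q> p'])
    show "finite \<Q>" by (rule \<Q>(1))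
    show "\<Q> <= \<S> \<union> \<P>" by (auto simp: \<S>_def \<Q>_def)
    show "p' : \<Q>" "p' x = pderiv (p x)" "p' y = pderiv (p y)" by (auto simp: \<Q>_def p'_def)
    show "ALL i:\<Q>. i x ~= 0 --> (EX j:\<S> \<union> \<P>. (ALL s. poly (i x) s = 0 --> sgn (poly (p x) s) = sgn (poly (j x) s)) &
    (ALL s. poly (i y) s = 0 --> sgn (poly (p y) s) = sgn (poly (j y) s)))" using rt by blast
   qed
   thus ?thesis by (auto simp: \<Q>_def)
  qed
 qed
qed

text \<open>By induction on the degree and on the number of polynomials of maximal degree, the signs of
  finitely many functions of the parameter determine the sign patterns of a family of polynomials.\<close>

lemma sign_determined:
 assumes R: "fun_ring R" and "finite \<P>" "ALL P:\<P>. par_poly R n P"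
 shows "sign_determined R \<P>"
 using assms(2,3)
proof (induction n arbitrary: \<P>)
 case 0
 show ?case unfolding sign_determined_def
 proof (intro exI[of _ "(%P x. coeff (P x) 0) ` \<P>"] conjI allI impI)
  show "(%P x. coeff (P x) 0) ` \<P> <= R" "finite ((%P x. coeff (P x) 0) ` \<P>)" using 0 by (auto simp: par_poly_def)
  fix x y assume sg: "ALL g:(%P x. coeff (P x) 0) ` \<P>. sgn (g x) = sgn (g y)"
  have "poly (P z) s = coeff (P z) 0" if "P : \<P>" for P z s
  proof -
   have "degree (P z) = 0" using 0 that by (auto simp: par_poly_def)
   from degree_0_id[OF this] show ?thesis by (metis poly_pCons mult_zero_right poly_0 add.right_neutral)
  qed
  thus "EX h. strict_mono h & (ALL P:\<P>. ALL s. sgn (poly (P x) s) = sgn (poly (P y) (h s)))"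
   using sg by (intro exI[of _ "%s. s"]) (auto simp: strict_mono_def)
 qed
next
 case (Suc n)
 \<comment> \<open>\<open>\<T>\<close> collects members of degree up to \<open>Suc n\<close>,
   \<open>\<L>\<close> those of degree up to \<open>n\<close>. The inner induction on
   \<open>\<T>\<close> is for arbitrary \<open>\<L>\<close>, because removing one member of
   \<open>\<T>\<close> adds many polynomials of lower degree.\<close>
 have "sign_determined R (\<T> \<union> \<L>)" if "finite \<T>" "ALL P:\<T>. par_poly R (Suc n) P" "finite \<L>" "ALL P:\<L>. par_poly R n P" for \<T> \<L>
  using that
 proof (induction \<T> arbitrary: \<L> rule: finite_induct)
  case empty thus ?case using Suc.IH by simp
 next
  case (insert p \<T>)
  have "sign_determined R (insert p (\<T> \<union> \<L>))"
  proof (rule sign_determined_step[OF R, where n = "Suc n"])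
   show "finite (\<T> \<union> \<L>)" using insert by simp
   show "ALL Q:\<T> \<union> \<L>. par_poly R (Suc n) Q" using insert.prems par_poly_mono[of R n _ "Suc n"] by auto
   show p: "par_poly R (Suc n) p" using insert by simp
   define p0 where "p0 x = p x - monom (coeff (p x) (Suc n)) (Suc n)" for x
   have "par_poly R (Suc n) (%x. monom (coeff (p x) (Suc n)) (Suc n))"
    unfolding par_poly_def
   proof (intro conjI allI)
    fix i
    have "(%x. coeff (p x) (Suc n)) : R" using p by (simp add: par_poly_def)
    thus "(%x. coeff (monom (coeff (p x) (Suc n)) (Suc n)) i) : R"
    using fun_ring_rules(1)[OF R] by (cases "i = Suc n") (simp_all add: coeff_monom)
   qed (rule degree_monom_le)
   hence "par_poly R (Suc n) p0" unfolding p0_def[abs_def] by (rule par_poly_diff[OF R p])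
   moreover have "ALL x. coeff (p0 x) (Suc n) = 0" by (simp add: p0_def)
   ultimately have "par_poly R n p0" by (rule par_poly_drop[OF R])
   hence "sign_determined R (\<T> \<union> insert p0 \<L>)" using insert.prems by (intro insert.IH) auto
   thus "sign_determined R (insert (%x. p x - monom (coeff (p x) (Suc n)) (Suc n)) (\<T> \<union> \<L>))"
    by (simp add: p0_def[abs_def])
   show "ALL \<S>. finite \<S> --> (ALL S:\<S>. par_poly R (Suc n - 1) S) --> sign_determined R (\<S> \<union> (\<T> \<union> \<L>))"
   proof (intro allI impI)
    fix \<S> assume "finite \<S>" "ALL S:\<S>. par_poly R (Suc n - 1) S"
    hence "sign_determined R (\<T> \<union> (\<S> \<union> \<L>))" using insert.prems by (intro insert.IH) auto
    thus "sign_determined R (\<S> \<union> (\<T> \<union> \<L>))" by (simp add: Un_left_commute)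
   qed
  qed simp
  thus ?case by simp
 qed
 from this[of \<P> "{}"] show ?case using Suc.prems by simp
qed

section \<open>Puiseux expansion along a sequence of roots\<close>

lemma poly_taylor_shift:
 fixes A :: "nat => 'a::comm_ring_1"
 shows "(SUM i<=n. A i * (w + b) ^ i) = (SUM j<=n. (SUM i<=n. A i * of_nat (i choose j) * b ^ (i - j)) * w ^ j)"
proof -
 have "(SUM i<=n. A i * (w + b) ^ i) = (SUM i<=n. SUM j<=n. A i * of_nat (i choose j) * b ^ (i - j) * w ^ j)"
 proof (intro sum.cong refl)
  fix i assume i: "i : {..n}"
  have "(w + b) ^ i = (SUM j<=i. of_nat (i choose j) * w ^ j * b ^ (i - j))" by (rule binomial_ring)
  also have "... = (SUM j<=n. of_nat (i choose j) * w ^ j * b ^ (i - j))"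
   by (rule sum.mono_neutral_left) (use i in \<open>auto simp: not_le binomial_eq_0\<close>)
  finally show "A i * (w + b) ^ i = (SUM j<=n. A i * of_nat (i choose j) * b ^ (i - j) * w ^ j)"
   by (simp add: sum_distrib_left mult_ac)
 qed
 also have "... = (SUM j<=n. SUM i<=n. A i * of_nat (i choose j) * b ^ (i - j) * w ^ j)" by (rule sum.swap)
 finally show ?thesis by (simp add: sum_distrib_right)
qed

text \<open>Coefficients of the monic polynomial of degree \<open>n\<close> with lower coefficients
  \<open>a\<close>, after the substitution of \<open>w + b\<close>.\<close>

definition shift_coeff :: "nat => (nat => 'a::comm_ring_1) => 'a => nat => 'a" where
 "shift_coeff n a b j = (SUM i<=n. (if i = n then 1 else a i) * of_nat (i choose j) * b ^ (i - j))"

lemma monic_shift: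
 fixes a :: "nat => 'a::comm_ring_1"
 shows "(w + b) ^ n + (SUM j<n. a j * (w + b) ^ j) = w ^ n + (SUM j<n. shift_coeff n a b j * w ^ j)"
proof -
 define A where "A i = (if i = n then 1 else a i)" for i
 have *: "(SUM i<=n. B i * x ^ i) = B n * x ^ n + (SUM j<n. B j * x ^ j)" for B and x :: 'a
  by (simp add: lessThan_Suc_atMost[symmetric] add.commute)
 have "(SUM i<=n. A i * of_nat (i choose n) * b ^ (i - n)) = (SUM i:{n}. A i * of_nat (i choose n) * b ^ (i - n))"
  by (rule sum.mono_neutral_right) (auto simp: binomial_eq_0)
 hence n1: "(SUM i<=n. A i * of_nat (i choose n) * b ^ (i - n)) = 1" by (simp add: A_def)
 have "(w + b) ^ n + (SUM j<n. a j * (w + b) ^ j) = (SUM i<=n. A i * (w + b) ^ i)"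
  unfolding * by (simp add: A_def)
 also have "... = (SUM j<=n. (SUM i<=n. A i * of_nat (i choose j) * b ^ (i - j)) * w ^ j)" by (rule poly_taylor_shift)
 also have "... = w ^ n + (SUM j<n. shift_coeff n a b j * w ^ j)"
  unfolding * n1 by (simp add: shift_coeff_def A_def)
 finally show ?thesis .
qed

lemma shift_coeff_top: "shift_coeff (Suc k) a b k = a k + of_nat (Suc k) * b"
proof -
 have "shift_coeff (Suc k) a b k = (SUM i:{k, Suc k}. (if i = Suc k then 1 else a i) * of_nat (i choose k) * b ^ (i - k))"
  unfolding shift_coeff_def by (rule sum.mono_neutral_right) (auto simp: binomial_eq_0)
 thus ?thesis by simp
qed

lemma shift_coeff_b0: "j < n ==> shift_coeff n a 0 j = a j"
proof -
 assume j: "j < n"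
 have "shift_coeff n a 0 j = (SUM i:{j}. (if i = n then 1 else a i) * of_nat (i choose j) * 0 ^ (i - j))"
  unfolding shift_coeff_def
 proof (rule sum.mono_neutral_right)
  show "ALL i:{..n} - {j}. (if i = n then 1 else a i) * of_nat (i choose j) * 0 ^ (i - j) = 0"
   by (auto simp: power_0_left binomial_eq_0)
 qed (use j in auto)
 thus ?thesis using j by simp
qed

lemma monic_root_bound:
 fixes v :: "'a::real_normed_field"
 assumes "v ^ n + (SUM j<n. c j * v ^ j) = 0"
 shows "norm v <= max 1 (SUM j<n. norm (c j))"
proof (cases "norm v <= 1")
 case False
 hence v: "norm v > 1" by simp
 obtain m where n: "n = Suc m" using assms by (cases n) auto
 have "norm v ^ n = norm (SUM j<n. c j * v ^ j)"
  using assms by (metis add_eq_0_iff norm_minus_cancel norm_power)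
 also have "... <= (SUM j<n. norm (c j * v ^ j))" by (rule norm_sum)
 also have "... <= (SUM j<n. norm (c j) * norm v ^ m)"
  unfolding norm_mult norm_power using v n by (intro sum_mono mult_left_mono power_increasing) auto
 also have "... = (SUM j<n. norm (c j)) * norm v ^ m" by (simp add: sum_distrib_right)
 finally have "norm v * norm v ^ m <= (SUM j<n. norm (c j)) * norm v ^ m" by (simp add: n)
 moreover have "norm v ^ m > 0" by (rule zero_less_power) (use v in linarith)
 ultimately have "norm v <= (SUM j<n. norm (c j))" by (rule mult_right_le_imp_le)
 thus ?thesis by simp
qed simp

lemma vec1_tendsto: "((%x. vec (f x) :: real^1) ---> 0) F <-> (f ---> 0) F"
proof
 assume "((%x. vec (f x) :: real^1) ---> 0) F"
 from tendsto_vec_nth[OF this, of 1] show "(f ---> 0) F" by simp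
next
 assume "(f ---> 0) F"
 thus "((%x. vec (f x) :: real^1) ---> 0) F" by (intro vec_tendstoI) simp
qed

lemma eventually_along:
 assumes "NEAR z. P z" "x ----> 0"
 shows "\<forall>\<^sub>F i in sequentially. P (x i)"
 using eventually_compose[OF assms] .

lemma infinite_eventually:
 assumes "\<forall>\<^sub>F i in sequentially. P i" shows "infinite {i. P i}"
proof -
 obtain N where "ALL i>=N. P i" using assms unfolding eventually_sequentially by blast
 hence "{N..} <= {i. P i}" by auto
 thus ?thesis using infinite_Ici infinite_super by blast
qed

lemma vec_0_eq [simp]: "(vec 0 :: 'a::zero^'d::finite) = 0"
 by (simp add: vec_eq_iff)

text \<open>Newton's construction along a sequence, by induction on the degree. After removal of the
  coefficient of degree \<open>n - 1\<close>, the smallest slope \<open>p / q\<close> of the Newton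
  polygon suggests \<open>s = th ^ p * v\<close> with \<open>th = root q t\<close>. The
  \<open>v i\<close> stay bounded, and at a limit \<open>v0\<close> preparation gives a polynomial
  of smaller degree. Passing to convergent subsequences is why the conclusion speaks of infinitely
  many indices.\<close>

lemma puiseux_sequence:
 fixes a :: "nat => real^1 => real"
 assumes "ALL j<n. analytic_at (a j) 0 & a j 0 = 0"
  and "ALL i. t i > 0" "t ----> 0" "s ----> 0"
  and "ALL i. s i ^ n + (SUM j<n. a j (vec (t i)) * s i ^ j) = 0"
 shows "EX q>0. EX r::real^1 => real. analytic_at r 0 & r 0 = 0 & infinite {i. s i = r (vec (root q (t i)))}"
 using assms
proof (induction n arbitrary: a t s rule: less_induct)
 case (less n)
 note a = less.prems(1) and t = less.prems(2,3) and s = less.prems(4) and eq = less.prems(5)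
 obtain k where n: "n = Suc k" using eq by (cases n) auto
 \<comment> \<open>Tschirnhaus shift by the mean of the roots: it makes the coefficient of degree
   \<open>k = n - 1\<close> vanish.\<close>
 define b where "b x = - a k x / real n" for x
 have ba: "analytic_at b 0" unfolding b_def divide_inverse by (intro analytic_intros) (use a n in auto)
 have b0: "b 0 = 0" using a n by (simp add: b_def)
 define a' where "a' j x = shift_coeff n (%i. a i x) (b x) j" for j x
 have a'a: "analytic_at (a' j) 0" for j
  unfolding a'_def shift_coeff_def
 proof (intro analytic_intros ba)
  fix i assume "i : {..n}"
  thus "analytic_at (%x. if i = n then 1 else a i x) 0" using a by (cases "i = n") auto
 qed
 have a'0: "a' j 0 = 0" if "j < n" for j using a that by (simp add: a'_def b0 shift_coeff_b0)
 have a'k: "a' k x = 0" for x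
  unfolding a'_def n shift_coeff_top by (simp add: b_def n)
 define s' where "s' i = s i - b (vec (t i))" for i
 have eq': "s' i ^ n + (SUM j<n. a' j (vec (t i)) * s' i ^ j) = 0" for i
  using monic_shift[of "s' i" "b (vec (t i))" n "%j. a j (vec (t i))"] eq by (simp add: s'_def a'_def)
 have tv: "(%i. vec (t i) :: real^1) ----> 0" using t by (simp add: vec1_tendsto)
 show ?case
 proof (cases "ALL j<n. NEAR x. a' j x = 0")
  case True
  hence "NEAR x. ALL j:{..<n}. a' j x = 0" by (intro eventually_ball_finite) auto
  from eventually_along[OF this tv] have "\<forall>\<^sub>F i in sequentially. s i = b (vec (root 1 (t i)))"
  proof eventually_elim
   case (elim i)
   hence "s' i ^ n = 0" using eq'[of i] by simp
   thus ?case by (simp add: s'_def)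
  qed
  from infinite_eventually[OF this] ba b0
  have "EX r::real^1 => real. analytic_at r 0 & r 0 = 0 & infinite {i. s i = r (vec (root 1 (t i)))}" by blast
  thus ?thesis by (intro exI[of _ "1::nat"]) simp
 next
  case False
  define J where "J = {j. j < n & ~(NEAR x. a' j x = 0)}"
  have J: "finite J" "J ~= {}" using False by (auto simp: J_def)
  define D where "D j m v <-> analytic_at v 0 & v 0 ~= 0 & (NEAR x. a' j x = (x $ 1) ^ m * v x)" for j m v
  have "ALL j:J. EX m. EX v. D j m v"
   using analytic_at_order[OF a'a] unfolding D_def J_def by blast
  then obtain kk where "ALL j:J. EX v. D j (kk j) v" using bchoice[of J "%j m. EX v. D j m v"] by blast
  then obtain u where u: "ALL j:J. D j (kk j) (u j)" using bchoice[of J "%j v. D j (kk j) v"] by blast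
  have ku: "!!j. j : J ==> analytic_at (u j) 0" "!!j. j : J ==> u j 0 ~= 0"
   "!!j. j : J ==> NEAR x. a' j x = (x $ 1) ^ kk j * u j x" using u by (auto simp: D_def)
  \<comment> \<open>Realises the minimal slope \<open>kk j / (n - j)\<close>; by minimality, which
    is \<open>pq\<close> below, the differences of exponents in \<open>c\<close> are not
    truncated.\<close>
  define j0 where "j0 = arg_min_on (%j. real (kk j) / real (n - j)) J"
  have j0: "j0 : J" unfolding j0_def by (rule arg_min_if_finite(1)[OF J])
  have j0_le: "real (kk j0) / real (n - j0) <= real (kk j) / real (n - j)" if "j : J" for j
   unfolding j0_def by (rule arg_min_least[OF J that])
  define q where "q = n - j0"
  define p where "p = kk j0"
  have q0: "q > 0" using j0 by (simp add: q_def J_def)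
  have pq: "p * (n - j) <= kk j * q" if "j : J" for j
  proof -
   have "n - j > 0" using that by (simp add: J_def)
   hence "real p * real (n - j) <= real (kk j) * real q"
    using j0_le[OF that] q0 by (simp add: p_def q_def[symmetric] divide_simps)
   thus ?thesis by (simp only: of_nat_mult[symmetric] of_nat_le_iff)
  qed
  have p0: "p > 0"
  proof (rule ccontr)
   assume "~p > 0"
   hence "a' j0 0 = u j0 0" using eventually_nhds_x_imp_x[OF ku(3)[OF j0]] by (simp add: p_def)
   thus False using ku(2)[OF j0] a'0[of j0] j0 by (simp add: J_def)
  qed
  \<comment> \<open>The coefficients of the equation for \<open>v\<close>, after division by
    \<open>th ^ (p * n)\<close>.\<close>
  define c where "c j x = (if j : J then (x $ 1) ^ (kk j * q - p * (n - j)) * u j (vec ((x $ 1) ^ q)) else 0)"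
   for j and x :: "real^1"
  have powa: "analytic_map_at (%x::real^1. vec ((x $ 1) ^ q) :: real^1) 0"
   unfolding analytic_map_at_def by (simp add: analytic_intros)
  have ca: "analytic_at (c j) 0" for j
  proof (cases "j : J")
   case True
   have "analytic_at (%x::real^1. u j (vec ((x $ 1) ^ q))) 0"
    by (rule analytic_at_compose[OF _ powa]) (use ku(1)[OF True] q0 in \<open>simp add: power_0_left\<close>)
   thus ?thesis using True unfolding c_def by (simp add: analytic_intros)
  qed (simp add: c_def[abs_def])
  have ck: "c k x = 0" for x using a'k by (simp add: c_def J_def)
  have cj0: "c j0 0 ~= 0"
  proof -
   have "kk j0 * q - p * (n - j0) = 0" by (simp add: p_def q_def)
   moreover have "(vec (0 ^ q) :: real^1) = 0" using q0 by (simp add: vec_eq_iff)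
   ultimately show ?thesis using j0 ku(2)[OF j0] by (simp add: c_def)
  qed
  define th where "th i = root q (t i)" for i
  have th: "th i > 0" "th i ^ q = t i" for i using t q0 by (auto simp: th_def real_root_gt_zero real_root_pow_pos)
  have "(%i. root q (t i)) ----> root q 0" by (intro tendsto_real_root t)
  hence thl: "th ----> 0" using q0 by (simp add: th_def[abs_def])
  hence thv: "(%i. vec (th i) :: real^1) ----> 0" by (simp add: vec1_tendsto)
  define v where "v i = s' i / th i ^ p" for i
  have s'v: "s' i = th i ^ p * v i" for i using th(1)[of i] by (simp add: v_def)
  have "NEAR x. ALL j:J. a' j x = (x $ 1) ^ kk j * u j x"
   using J ku(3) by (intro eventually_ball_finite) auto
  moreover have "NEAR x. ALL j:{..<n} - J. a' j x = 0"
   by (intro eventually_ball_finite) (auto simp: J_def)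
  ultimately have "NEAR x. (ALL j:J. a' j x = (x $ 1) ^ kk j * u j x) & (ALL j:{..<n} - J. a' j x = 0)"
   by (rule eventually_conj)
  from eventually_along[OF this tv]
  have veq: "\<forall>\<^sub>F i in sequentially. v i ^ n + (SUM j<n. c j (vec (th i)) * v i ^ j) = 0"
  proof eventually_elim
   case (elim i)
   have "a' j (vec (t i)) * s' i ^ j = th i ^ (p * n) * (c j (vec (th i)) * v i ^ j)" if j: "j < n" for j
   proof (cases "j : J")
    case True
    have "kk j * q + p * j = p * n + (kk j * q - p * (n - j))"
    proof -
    have "p * n = p * (n - j) + p * j" using j by (simp flip: add_mult_distrib2)
    thus ?thesis using pq[OF True] by linarith
    qed
    hence e: "th i ^ (kk j * q) * th i ^ (p * j) = th i ^ (p * n) * th i ^ (kk j * q - p * (n - j))"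
    by (simp flip: power_add)
    have "a' j (vec (t i)) * s' i ^ j = (th i ^ (kk j * q) * th i ^ (p * j)) * (u j (vec (t i)) * v i ^ j)"
    using elim True by (simp add: s'v th(2)[symmetric] power_mult_distrib power_mult[symmetric] mult_ac)
    thus ?thesis unfolding e using True by (simp add: c_def th(2) mult_ac)
   next
    case False thus ?thesis using elim j by (simp add: c_def)
   qed
   hence "(SUM j<n. a' j (vec (t i)) * s' i ^ j) = th i ^ (p * n) * (SUM j<n. c j (vec (th i)) * v i ^ j)"
    by (simp add: sum_distrib_left)
   moreover have "s' i ^ n = th i ^ (p * n) * v i ^ n" by (simp add: s'v power_mult_distrib power_mult)
   ultimately have "th i ^ (p * n) * (v i ^ n + (SUM j<n. c j (vec (th i)) * v i ^ j)) = 0"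
    using eq'[of i] by (simp add: distrib_left)
   thus ?case using th(1)[of i] by simp
  qed
  have "(%i. SUM j<n. norm (c j (vec (th i)))) ----> (SUM j<n. norm (c j 0))"
   by (intro tendsto_intros filterlim_compose[OF analytic_at_imp_tendsto[OF ca] thv])
  hence "\<forall>\<^sub>F i in sequentially. (SUM j<n. norm (c j (vec (th i)))) < (SUM j<n. norm (c j 0)) + 1"
   by (rule order_tendstoD) simp
  with veq have "\<forall>\<^sub>F i in sequentially. norm (v i) <= max 1 ((SUM j<n. norm (c j 0)) + 1) & v i ^ n + (SUM j<n. c j (vec (th i)) * v i ^ j) = 0"
  proof eventually_elim
   case (elim i)
   have "norm (v i) <= max 1 (SUM j<n. norm (c j (vec (th i))))" by (rule monic_root_bound[OF elim(1)])
   also have "... <= max 1 ((SUM j<n. norm (c j 0)) + 1)" using elim(2) by (intro max.mono) auto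
   finally show ?case using elim(1) by simp
  qed
  then obtain N where N: "ALL i>=N. norm (v i) <= max 1 ((SUM j<n. norm (c j 0)) + 1) & v i ^ n + (SUM j<n. c j (vec (th i)) * v i ^ j) = 0"
   unfolding eventually_sequentially by blast
  have "ALL i. v (i + N) : cball 0 (max 1 ((SUM j<n. norm (c j 0)) + 1))" using N by auto
  then obtain v0 sig where sig: "strict_mono (sig :: nat => nat)" "((%i. v (i + N)) o sig) ----> v0"
   using compact_cball unfolding compact_def by (metis (no_types, lifting))
  define rho where "rho i = sig i + N" for i
  have rho: "strict_mono rho" "(%i. v (rho i)) ----> v0" "!!i. v (rho i) ^ n + (SUM j<n. c j (vec (th (rho i))) * v (rho i) ^ j) = 0"
   using sig N by (auto simp: rho_def strict_mono_def o_def)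
  \<comment> \<open>The equation for \<open>v\<close> recentred at \<open>v0\<close>: coordinate 1
    is \<open>th\<close>, coordinate 2 is \<open>v - v0\<close>.\<close>
  define G where "G z = (z $ 2 + v0) ^ n + (SUM j<n. c j (vec (z $ 1)) * (z $ 2 + v0) ^ j)" for z :: "real^2"
  have vz: "analytic_map_at (%z::real^2. vec (z $ 1) :: real^1) 0" unfolding analytic_map_at_def by simp
  have Ga: "analytic_at G 0" unfolding G_def
   by (intro analytic_intros analytic_at_compose[OF _ vz]) (use ca in simp)
  have ax1: "(axis 2 x :: real^2) $ 1 = 0" "(axis 2 x :: real^2) $ 2 = x" for x by (auto simp: axis_def)
  define e where "e = shift_coeff n (%j. c j 0) v0"
  have v00: "(vec 0 :: real^1) = 0" by (simp add: vec_eq_iff)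
  have Gax: "G (axis 2 x) = x ^ n + (SUM j<n. e j * x ^ j)" for x
   unfolding G_def ax1 e_def by (simp add: monic_shift v00)
  \<comment> \<open>At \<open>th = 0\<close> the polynomial is not \<open>(v - v0) ^ n\<close>: as
    its coefficient of degree \<open>n - 1\<close> is 0, this would force \<open>v0 = 0\<close> and
    then \<open>c j0 0 = 0\<close>.\<close>
  have ene: "~(ALL j<n. e j = 0)"
  proof
   assume e0: "ALL j<n. e j = 0"
   have "e k = real n * v0" unfolding e_def n shift_coeff_top by (simp add: ck)
   hence "v0 = 0" using e0 n by simp
   hence "e j0 = c j0 0" using j0 by (simp add: e_def shift_coeff_b0 J_def)
   thus False using cj0 e0 j0 by (simp add: J_def)
  qed
  have Gnz: "~(NEAR x. G (axis 2 x) = 0)"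
  proof
   assume "NEAR x. G (axis 2 x) = 0"
   hence "PUNCT x. G (axis 2 x) = 0" by (simp add: eventually_nhds_conv_at)
   hence "PUNCT x. norm (SUM j<n. e j * x ^ j) <= 1 * norm x ^ n"
   proof eventually_elim
    case (elim x)
    have "(SUM j<n. e j * x ^ j) = - (x ^ n)" using Gax[of x] elim by linarith
    thus ?case by (simp add: power_abs)
   qed
   from poly_coeffs_zero[OF this] show False using ene by simp
  qed
  obtain m A Q where W: "ALL j<m. analytic_at (A j) 0 & A j 0 = 0 & (ALL z. A j (zero_coord 2 z) = A j z)"
   "analytic_at Q 0" "Q 0 ~= 0" "NEAR z. Q z * G z = (z $ 2) ^ m + (SUM j<m. A j z * (z $ 2) ^ j)"
   using weierstrass_preparation[OF Ga Gnz] by blast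
  \<comment> \<open>Otherwise \<open>G\<close> on the second axis is \<open>O(x ^ n)\<close>, which
    makes all \<open>e j\<close> vanish. This drop of the degree drives the induction.\<close>
  have mn: "m < n"
  proof (rule ccontr)
   assume "~m < n"
   hence mn: "n <= m" by simp
   have ax0: "((%x. axis 2 x :: real^2) ---> 0) (at 0)" by (rule tendsto_mono[OF at_within_le_nhds tendsto_axis])
   have 1: "PUNCT x. Q (axis 2 x) * G (axis 2 x) = x ^ m"
    using eventually_compose[OF W(4) ax0]
   proof eventually_elim
    case (elim x)
    have "A j (axis 2 x) = 0" if "j < m" for j using W(1) that zero_coord_axis by metis
    thus ?case using elim by (simp add: ax1)
   qed
   have "((%x. Q (axis 2 x)) ---> Q 0) (at 0)" by (rule filterlim_compose[OF analytic_at_imp_tendsto[OF W(2)] ax0])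
   hence "((%x. norm (Q (axis 2 x))) ---> norm (Q 0)) (at 0)" by (rule tendsto_norm)
   hence 2: "PUNCT x. norm (Q (axis 2 x)) > norm (Q 0) / 2" using W(3) by (intro order_tendstoD) auto
   have "\<forall>\<^sub>F x in nhds (0::real). norm x < 1" by (rule eventually_norm_less) simp
   hence 3: "\<forall>\<^sub>F x in at (0::real). norm x < 1" by (simp add: eventually_nhds_conv_at)
   from 1 2 3 have "PUNCT x. norm (SUM j<n. e j * x ^ j) <= (2 / norm (Q 0) + 1) * norm x ^ n"
   proof eventually_elim
    case (elim x)
    have "norm (Q 0) / 2 * norm (G (axis 2 x)) <= norm (Q (axis 2 x)) * norm (G (axis 2 x))"
    using elim(2) by (intro mult_right_mono) auto
    also have "... = norm x ^ m" using elim(1) by (metis norm_mult norm_power)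
    also have "... <= norm x ^ n" using mn elim(3) by (intro power_decreasing) auto
    finally have "norm (G (axis 2 x)) <= 2 / norm (Q 0) * norm x ^ n" using W(3) by (simp add: field_simps)
    moreover have "norm (SUM j<n. e j * x ^ j) <= norm (G (axis 2 x)) + norm x ^ n"
    using norm_triangle_ineq4[of "G (axis 2 x)" "x ^ n"] by (simp add: Gax power_abs)
    ultimately show ?case by (simp add: distrib_right)
   qed
   from poly_coeffs_zero[OF this] show False using ene by simp
  qed
  define z where "z i = ((\<chi> l. if l = 1 then th (rho i) else v (rho i) - v0) :: real^2)" for i
  have z12: "z i $ 1 = th (rho i)" "z i $ 2 = v (rho i) - v0" for i by (auto simp: z_def)
  have thrho: "(%i. th (rho i)) ----> 0" using LIMSEQ_subseq_LIMSEQ[OF thl rho(1)] by (simp add: o_def)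
  have vrho: "(%i. v (rho i) - v0) ----> 0" using rho(2) LIM_zero by blast
  have zl: "z ----> 0"
  proof (rule vec_tendstoI)
   fix l :: 2
   have "l = 1 | l = 2" by (rule exhaust_2)
   thus "(%i. z i $ l) ----> 0 $ l" using thrho vrho z12 by auto
  qed
  define A' where "A' j x = A j (\<chi> l. if l = 1 then x $ 1 else 0)" for j and x :: "real^1"
  have A'z: "A j (z i) = A' j (vec (th (rho i)))" if "j < m" for i j
  proof -
   have "zero_coord 2 (z i) = (\<chi> l. if l = 1 then (vec (th (rho i)) :: real^1) $ 1 else 0)"
    using exhaust_2 by (auto simp: zero_coord_def vec_eq_iff z12)
   thus ?thesis using W(1) that unfolding A'_def by metis
  qed
  have A'a: "ALL j<m. analytic_at (A' j) 0 & A' j 0 = 0"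
  proof (intro allI impI)
   fix j assume j: "j < m"
   have 0: "(\<chi> l. if l = 1 then (0::real^1) $ 1 else 0) = (0 :: real^2)" by (simp add: vec_eq_iff)
   have "analytic_map_at (%x::real^1. (\<chi> l. if l = 1 then x $ 1 else 0) :: real^2) 0"
    unfolding analytic_map_at_def
   proof
    fix l :: 2
    show "analytic_at (%x::real^1. ((\<chi> l. if l = 1 then x $ 1 else 0) :: real^2) $ l) 0" by (cases "l = 1") auto
   qed
   hence "analytic_at (A' j) 0" unfolding A'_def by (rule analytic_at_compose[rotated]) (use W(1) j 0 in simp)
   moreover have "A' j 0 = 0" unfolding A'_def 0 using W(1) j by simp
   ultimately show "analytic_at (A' j) 0 & A' j 0 = 0" ..
  qed
  from eventually_along[OF W(4) zl] have "\<forall>\<^sub>F i in sequentially. (v (rho i) - v0) ^ m + (SUM j<m. A' j (vec (th (rho i))) * (v (rho i) - v0) ^ j) = 0"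
  proof eventually_elim
   case (elim i)
   have "G (z i) = 0" using rho(3)[of i] by (simp add: G_def z12)
   thus ?case using elim A'z by (simp add: z12)
  qed
  then obtain N' where N': "ALL i>=N'. (v (rho i) - v0) ^ m + (SUM j<m. A' j (vec (th (rho i))) * (v (rho i) - v0) ^ j) = 0"
   unfolding eventually_sequentially by blast
  have "EX q>0. EX r::real^1 => real. analytic_at r 0 & r 0 = 0 & infinite {i. v (rho (i + N')) - v0 = r (vec (root q (th (rho (i + N')))))}"
  proof (rule less.IH[OF mn A'a])
   show "(%i. th (rho (i + N'))) ----> 0" by (rule LIMSEQ_ignore_initial_segment[OF thrho])
   show "(%i. v (rho (i + N')) - v0) ----> 0" by (rule LIMSEQ_ignore_initial_segment[OF vrho])
  qed (use th(1) N' in auto)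
  then obtain q' and r :: "real^1 => real" where q': "q' > 0" and r: "analytic_at r 0" "r 0 = 0"
   and inf: "infinite {i. v (rho (i + N')) - v0 = r (vec (root q' (th (rho (i + N')))))}" by blast
  \<comment> \<open>Undoes the substitutions: with \<open>psi = root (q * q') t\<close> one has
    \<open>t = psi ^ (q * q')\<close> and \<open>th = psi ^ q'\<close>.\<close>
  define r' where "r' x = b (vec ((x $ 1) ^ (q * q'))) + (x $ 1) ^ (q' * p) * (v0 + r x)" for x :: "real^1"
  have "analytic_map_at (%x::real^1. vec ((x $ 1) ^ (q * q')) :: real^1) 0"
   unfolding analytic_map_at_def by (simp add: analytic_intros)
  hence "analytic_at (%x::real^1. b (vec ((x $ 1) ^ (q * q')))) 0"
   by (rule analytic_at_compose[rotated]) (use ba q0 q' in \<open>simp add: power_0_left\<close>)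
  hence r'a: "analytic_at r' 0" unfolding r'_def by (intro analytic_intros r)
  have r'0: "r' 0 = 0" using q0 q' p0 b0 by (simp add: r'_def v00 power_0_left)
  have "(%i. rho (i + N')) ` {i. v (rho (i + N')) - v0 = r (vec (root q' (th (rho (i + N')))))}
    <= {i. s i = r' (vec (root (q * q') (t i)))}"
  proof (rule image_subsetI, unfold mem_Collect_eq)
   fix i assume 1: "v (rho (i + N')) - v0 = r (vec (root q' (th (rho (i + N')))))"
   define l where "l = rho (i + N')"
   define psi where "psi = root q' (th l)"
   have psi: "psi ^ q' = th l" "psi = root (q * q') (t l)"
    using th(1)[of l] q' by (auto simp: psi_def real_root_pow_pos th_def real_root_mult_exp mult.commute)
   have tpsi: "psi ^ (q * q') = t l" using psi(1) th(2)[of l] by (metis mult.commute power_mult)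
   have vl: "v l = v0 + r (vec psi)" using 1 by (simp add: l_def psi_def algebra_simps)
   have "s l = b (vec (t l)) + th l ^ p * v l" using s'v[of l] by (simp add: s'_def)
   also have "... = r' (vec psi)" unfolding r'_def vl by (simp add: tpsi) (simp add: power_mult psi(1))
   finally show "s (rho (i + N')) = r' (vec (root (q * q') (t (rho (i + N')))))" by (simp add: psi(2) l_def)
  qed
  moreover have "inj (%i. rho (i + N'))" using rho(1) by (intro injI) (simp add: strict_mono_eq)
  ultimately have "infinite {i. s i = r' (vec (root (q * q') (t i)))}"
   using inf by (meson finite_imageD finite_subset inj_on_subset subset_UNIV)
  thus ?thesis using r'a r'0 q0 q' by (intro exI[of _ "q * q'"] conjI exI[of _ r']) auto
 qed
qed

section \<open>Curve selection over the reals\<close>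

definition proj :: "'d set => 'a::zero^'d::finite => 'a^'d" where
 "proj A z = (\<chi> j. if j : A then z $ j else 0)"

text \<open>\<open>f\<close> depends only on the coordinates in \<open>A\<close>. Subsets of one
  index type, instead of types of smaller dimension, allow induction on the number of
  variables.\<close>

definition dep :: "'d set => ('a::zero^'d::finite => 'b) => bool" where
 "dep A f <-> (ALL z. f (proj A z) = f z)"

lemma proj_0 [simp]: "proj A 0 = 0" by (simp add: proj_def vec_eq_iff)

lemma proj_nth: "proj A z $ j = (if j : A then z $ j else 0)" by (simp add: proj_def)

lemma analytic_map_at_proj: "analytic_map_at (proj A :: 'a::{real_normed_field,euclidean_space}^'d::finite => _) z"
 unfolding analytic_map_at_def
proof
 fix l show "analytic_at (%w::'a^'d. proj A w $ l) z" by (cases "l : A") (simp_all add: proj_nth)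
qed

lemma analytic_dep_ring: "fun_ring {g::real^'d::finite => real. analytic_at g 0 & dep A g}"
 unfolding fun_ring_def dep_def by (auto intro: analytic_intros)

lemma analytic_sgn_const:
 fixes u :: "real^1 => real"
 assumes "analytic_at u 0"
 shows "\<exists>sig. RIGHT t. sgn (u (vec t)) = sig"
proof -
 have "((%t::real. t) ---> 0) (at_right 0)" by (rule tendsto_ident_at)
 hence v: "((%t. vec t :: real^1) ---> 0) (at_right 0)" by (simp add: vec1_tendsto)
 from analytic_at_order[OF assms] show ?thesis
 proof (elim disjE exE conjE)
  assume "NEAR t. u t = 0"
  from eventually_compose[OF this v] show ?thesis
   by (intro exI[of _ 0]) (auto elim: eventually_mono)
 next
  fix m w assume w: "analytic_at w 0" "w 0 ~= 0" "NEAR t. u t = (t $ 1) ^ m * w t"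
  have l: "((%t. w (vec t)) ---> w 0) (at_right 0)" by (rule filterlim_compose[OF analytic_at_imp_tendsto[OF w(1)] v])
  have "RIGHT t. sgn (w (vec t)) = sgn (w 0)"
  proof (cases "w 0 > 0")
   case True
   from order_tendstoD(1)[OF l this] show ?thesis by eventually_elim (use True in simp)
  next
   case False
   hence neg: "w 0 < 0" using w(2) by simp
   from order_tendstoD(2)[OF l this] show ?thesis by eventually_elim (use neg in simp)
  qed
  moreover have "\<forall>\<^sub>F t in at_right (0::real). t > 0" by (rule eventually_at_right_less)
  ultimately have "RIGHT t. sgn (u (vec t)) = sgn (w 0)"
   using eventually_compose[OF w(3) v]
   by eventually_elim (simp add: sgn_mult)
  thus ?thesis by blast
 qed
qed

text \<open>The sign is constant for small positive parameters, so its value at infinitely many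
  \<open>t i\<close> is that constant.\<close>

lemma analytic_sgn_sequence:
 fixes u :: "real^1 => real"
 assumes u: "analytic_at u 0" and t: "ALL i. t i > 0" "t ----> 0" and inf: "infinite {i. sgn (u (vec (t i))) = eta}"
 shows "RIGHT t. sgn (u (vec t)) = eta"
proof -
 obtain sig where sig: "RIGHT t. sgn (u (vec t)) = sig" using analytic_sgn_const[OF u] by blast
 have "filterlim t (at_right 0) sequentially"
  by (rule tendsto_imp_filterlim_at_right[OF t(2)]) (use t(1) in simp)
 from eventually_compose[OF sig this] obtain N where N: "ALL i>=N. sgn (u (vec (t i))) = sig"
  unfolding eventually_sequentially by blast
 obtain i where "i >= N" "sgn (u (vec (t i))) = eta" using inf unfolding infinite_nat_iff_unbounded_le by blast
 thus ?thesis using N sig by auto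
qed

definition mpoly :: "nat => (nat => real) => real poly" where
 "mpoly n c = monom 1 n + (SUM j<n. monom (c j) j)"

lemma poly_mpoly: "poly (mpoly n c) w = w ^ n + (SUM j<n. c j * w ^ j)"
 by (simp add: mpoly_def poly_monom poly_sum)

lemma coeff_mpoly: "coeff (mpoly n c) i = (if i = n then 1 else if i < n then c i else 0)"
proof -
 have "(SUM j<n. coeff (monom (c j) j) i) = (SUM j<n. if j = i then c i else 0)"
  by (intro sum.cong) (auto simp: coeff_monom)
 thus ?thesis by (simp add: mpoly_def coeff_sum coeff_monom)
qed

lemma degree_mpoly: "degree (mpoly n c) <= n"
 by (rule degree_le) (simp add: coeff_mpoly)

lemma mpoly_nonzero: "mpoly n c ~= 0"
 using coeff_mpoly[of n c n] by auto

lemma roots_tendsto_0: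
 fixes a :: "nat => real^1 => real"
 assumes a: "ALL j<n. analytic_at (a j) 0 & a j 0 = 0" and t: "t ----> 0"
  and eq: "ALL i. s i ^ n + (SUM j<n. a j (vec (t i)) * s i ^ j) = 0"
 shows "s ----> 0"
proof -
 have n: "n > 0" using eq by (cases n) auto
 have tv: "(%i. vec (t i) :: real^1) ----> 0" using t by (simp add: vec1_tendsto)
 have l: "(%i. SUM j<n. norm (a j (vec (t i)))) ----> (SUM j<n. norm (0::real))"
 proof (intro tendsto_sum tendsto_norm)
  fix j assume "j : {..<n}"
  hence "analytic_at (a j) 0" "a j 0 = 0" using a by auto
  thus "(%i. a j (vec (t i))) ----> 0" using filterlim_compose[OF analytic_at_imp_tendsto tv] by metis
 qed
 hence l0: "(%i. SUM j<n. norm (a j (vec (t i)))) ----> 0" by simp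
 hence "\<forall>\<^sub>F i in sequentially. (SUM j<n. norm (a j (vec (t i)))) < 1" by (rule order_tendstoD) simp
 hence bd: "\<forall>\<^sub>F i in sequentially. norm (s i ^ n) <= (SUM j<n. norm (a j (vec (t i))))"
 proof eventually_elim
  case (elim i)
  have "norm (s i) <= max 1 (SUM j<n. norm (a j (vec (t i))))" by (rule monic_root_bound) (use eq in blast)
  hence s1: "norm (s i) <= 1" using elim by simp
  have "s i ^ n = - (SUM j<n. a j (vec (t i)) * s i ^ j)" using eq by (simp add: eq_neg_iff_add_eq_0)
  hence "norm (s i ^ n) = norm (SUM j<n. a j (vec (t i)) * s i ^ j)" by simp
  also have "... <= (SUM j<n. norm (a j (vec (t i)) * s i ^ j))" by (rule norm_sum)
  also have "... <= (SUM j<n. norm (a j (vec (t i))) * 1)"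
   unfolding norm_mult norm_power using s1 by (intro sum_mono mult_left_mono power_le_one) auto
  finally show ?case by simp
 qed
 have "(%i. s i ^ n) ----> 0" by (rule Lim_null_comparison[OF bd l0])
 hence "(%i. root n (norm (s i ^ n))) ----> root n 0" by (intro tendsto_real_root tendsto_norm_zero)
 moreover have "root n (norm (s i ^ n)) = norm (s i)" for i
  using n by (simp add: norm_power real_root_power_cancel power_abs)
 ultimately have "(%i. norm (s i)) ----> 0" by simp
 thus ?thesis by (rule tendsto_norm_zero_cancel)
qed

text \<open>One of the finitely many polynomials has the root \<open>l i\<close> for infinitely many
  \<open>i\<close>, and \<open>puiseux_sequence\<close> applies to this subsequence.\<close>

lemma track_roots:
 fixes a :: "'j => nat => real^1 => real"
 assumes J: "finite J" and a: "ALL f:J. ALL j<n f. analytic_at (a f j) 0 & a f j 0 = 0"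
  and t: "ALL i. t i > 0" "t ----> 0" and I: "infinite I"
  and l: "ALL i:I. EX f:J. poly (mpoly (n f) (%j. a f j (vec (t i)))) (l i) = 0"
 shows "EX I'<=I. infinite I' & (EX q>0. EX r::real^1 => real. analytic_at r 0 & r 0 = 0 & (ALL i:I'. l i = r (vec (root q (t i)))))"
proof -
 obtain ff where ff: "ALL i:I. ff i : J & poly (mpoly (n (ff i)) (%j. a (ff i) j (vec (t i)))) (l i) = 0"
  using l by metis
 have "finite (ff ` I)" using ff J by (meson finite_subset image_subsetI)
 from pigeonhole_infinite[OF I this] obtain i0 where i0: "i0 : I" "infinite {i:I. ff i = ff i0}" by blast
 define f where "f = ff i0"
 define I1 where "I1 = {i:I. ff i = f}"
 have I1: "infinite I1" "I1 <= I" using i0 by (auto simp: I1_def f_def)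
 define e where "e = enumerate I1"
 have e: "strict_mono e" "!!i. e i : I1" using I1 by (auto simp: e_def strict_mono_enumerate enumerate_in_set)
 have fJ: "f : J" using ff i0 by (simp add: f_def)
 have eq: "ALL i. l (e i) ^ n f + (SUM j<n f. a f j (vec (t (e i))) * l (e i) ^ j) = 0"
 proof
  fix i
  have "e i : I" and ffe: "ff (e i) = f" using e(2)[of i] by (auto simp: I1_def)
  hence "poly (mpoly (n (ff (e i))) (%j. a (ff (e i)) j (vec (t (e i))))) (l (e i)) = 0" using ff by blast
  thus "l (e i) ^ n f + (SUM j<n f. a f j (vec (t (e i))) * l (e i) ^ j) = 0" by (simp add: poly_mpoly ffe)
 qed
 have te: "(%i. t (e i)) ----> 0" using LIMSEQ_subseq_LIMSEQ[OF t(2) e(1)] by (simp add: o_def)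
 have af: "ALL j<n f. analytic_at (a f j) 0 & a f j 0 = 0" using a fJ by blast
 obtain q and r :: "real^1 => real" where q: "q > 0" and r: "analytic_at r 0" "r 0 = 0"
  and inf: "infinite {i. l (e i) = r (vec (root q (t (e i))))}"
  using puiseux_sequence[OF af _ te roots_tendsto_0[OF af te eq] eq] t by blast
 define I' where "I' = e ` {i. l (e i) = r (vec (root q (t (e i))))}"
 have 1: "I' <= I" using e(2) I1(2) by (auto simp: I'_def)
 have inje: "inj_on e A" for A using strict_mono_imp_inj_on[OF e(1)] inj_on_subset by blast
 have 2: "infinite I'" unfolding I'_def using inf finite_imageD[OF _ inje] by blast
 have 3: "ALL i:I'. l i = r (vec (root q (t i)))" by (auto simp: I'_def)
 have "EX r::real^1 => real. analytic_at r 0 & r 0 = 0 & (ALL i:I'. l i = r (vec (root q (t i))))"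
  using r 3 by (intro exI[of _ r]) simp
 thus ?thesis using 1 2 q by blast
qed

lemma finish_selection:
 fixes a :: "'j => nat => real^1 => real" and r :: "real^1 => real"
 assumes a: "ALL f:J. ALL j<n f. analytic_at (a f j) 0 & a f j 0 = 0"
  and t: "ALL i. t i > 0" "t ----> 0" and q: "q > 0" and r: "analytic_at r 0" "r 0 = 0"
  and I: "infinite I" "ALL i:I. ALL f:J. sgn (poly (mpoly (n f) (%j. a f j (vec (t i)))) (r (vec (root q (t i))))) = eta f"
 shows "EX q>0. EX r::real^1 => real. analytic_at r 0 & r 0 = 0 &
  (ALL f:J. RIGHT t. sgn (poly (mpoly (n f) (%j. a f j (vec (t ^ q)))) (r (vec t))) = eta f)"
proof (intro exI[of _ q] conjI exI[of _ r] ballI q r)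
 fix f assume f: "f : J"
 define u where "u x = r x ^ n f + (SUM j<n f. a f j (vec ((x $ 1) ^ q)) * r x ^ j)" for x :: "real^1"
 have powa: "analytic_map_at (%x::real^1. vec ((x $ 1) ^ q) :: real^1) 0"
  unfolding analytic_map_at_def by (simp add: analytic_intros)
 have "analytic_at (%x::real^1. a f j (vec ((x $ 1) ^ q))) 0" if "j < n f" for j
  by (rule analytic_at_compose[OF _ powa]) (use a f that q in \<open>simp add: power_0_left\<close>)
 hence ua: "analytic_at u 0" unfolding u_def by (intro analytic_intros r) auto
 define th where "th i = root q (t i)" for i
 have th: "th i > 0" "th i ^ q = t i" for i using t q by (auto simp: th_def real_root_gt_zero real_root_pow_pos)
 have "(%i. root q (t i)) ----> root q 0" by (intro tendsto_real_root t)
 hence thl: "th ----> 0" using q by (simp add: th_def[abs_def])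
 have "ALL i. th i > 0" using th by blast
 moreover have "I <= {i. sgn (u (vec (th i))) = eta f}"
 proof
  fix i assume "i : I"
  hence "sgn (poly (mpoly (n f) (%j. a f j (vec (t i)))) (r (vec (root q (t i))))) = eta f" using I(2) f by blast
  thus "i : {i. sgn (u (vec (th i))) = eta f}" by (simp add: u_def th poly_mpoly flip: th_def)
 qed
 hence "infinite {i. sgn (u (vec (th i))) = eta f}" using I(1) finite_subset by blast
 ultimately have "RIGHT t. sgn (u (vec t)) = eta f" using analytic_sgn_sequence[OF ua _ thl] by blast
 thus "RIGHT t. sgn (poly (mpoly (n f) (%j. a f j (vec (t ^ q)))) (r (vec t))) = eta f"
  by (simp add: u_def poly_mpoly)
qed

lemma root_mult_power: "m > 0 ==> x >= 0 ==> root (m * n) x ^ m = root n x"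
 by (simp add: real_root_mult_exp real_root_pow_pos2 real_root_ge_zero)

text \<open>If some required sign is 0, the chosen points are roots and follow a Puiseux series.
  Otherwise the point may be moved within its gap between the roots: to the mean of the neighbouring
  roots, to a single neighbouring root plus or minus a root of \<open>t\<close>, or to 0 if there
  are no roots at all. The neighbouring roots again follow Puiseux series.\<close>

lemma root_selection:
 fixes a :: "'j => nat => real^1 => real"
 assumes J: "finite J" and a: "ALL f:J. ALL j<n f. analytic_at (a f j) 0 & a f j 0 = 0"
  and ex: "RIGHT t. EX s. ALL f:J. sgn (poly (mpoly (n f) (%j. a f j (vec t))) s) = eta f"
 shows "EX q>0. EX r::real^1 => real. analytic_at r 0 & r 0 = 0 &
  (ALL f:J. RIGHT t. sgn (poly (mpoly (n f) (%j. a f j (vec (t ^ q)))) (r (vec t))) = eta f)"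
proof -
 define P where "P f i t = poly (mpoly (n f) (%j. a f j (vec (t i :: real))))" for f and i :: nat and t
 obtain d where d: "d > 0" "!!t. 0 < t ==> t < d ==> EX s. ALL f:J. sgn (poly (mpoly (n f) (%j. a f j (vec t))) s) = eta f"
  using ex unfolding eventually_at_right_field by auto
 define t where "t i = d / (2 + real i)" for i
 have t: "ALL i. t i > 0" "!!i. t i < d" using d(1) by (auto simp: t_def field_simps add_pos_nonneg)
 have tl: "t ----> 0"
 proof -
  have "(%i. d * inverse (real (i + 2))) ----> d * 0"
   by (intro tendsto_mult tendsto_const LIMSEQ_ignore_initial_segment lim_inverse_n)
  thus ?thesis by (simp add: t_def[abs_def] divide_inverse add.commute)
 qed
 have "ALL i. EX s. ALL f:J. sgn (poly (mpoly (n f) (%j. a f j (vec (t i)))) s) = eta f" using d t by blast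
 then obtain s where s: "!!i f. f : J ==> sgn (poly (mpoly (n f) (%j. a f j (vec (t i)))) (s i)) = eta f" by metis
 show ?thesis
 proof (cases "EX f:J. eta f = 0")
  case True
  hence "ALL i:UNIV. EX f:J. poly (mpoly (n f) (%j. a f j (vec (t i)))) (s i) = 0"
   using s by (metis sgn_zero_iff)
  from track_roots[OF J a t(1) tl infinite_UNIV_nat this] obtain I q r where
   "infinite I" "q > 0" "analytic_at r 0" "r 0 = 0" "ALL i:I. s i = (r :: real^1 => real) (vec (root q (t i)))" by blast
  moreover from this have "ALL i:I. ALL f:J. sgn (poly (mpoly (n f) (%j. a f j (vec (t i)))) (r (vec (root q (t i))))) = eta f"
   using s by metis
  ultimately show ?thesis using finish_selection[OF a t(1) tl] by blast
 next
  case False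
  define Z where "Z i = (\<Union>f\<in>J. {x. poly (mpoly (n f) (%j. a f j (vec (t i)))) x = 0})" for i
  have Zf: "finite (Z i)" for i unfolding Z_def using J by (intro finite_UN_I) (auto simp: poly_roots_finite mpoly_nonzero)
  have sZ: "s i ~: Z i" for i
  proof
   assume "s i : Z i"
   then obtain f where "f : J" "poly (mpoly (n f) (%j. a f j (vec (t i)))) (s i) = 0" by (auto simp: Z_def)
   thus False using s[of f i] False by auto
  qed
  have fin: ?thesis if q: "q > 0" and r: "analytic_at r 0" "r 0 = 0" and I: "infinite I"
   and g: "ALL i:I. gap (Z i) (s i) ((r :: real^1 => real) (vec (root q (t i))))" for q r I
  proof (rule finish_selection[OF a t(1) tl q r I], intro ballI)
   fix i f assume i: "i : I" and f: "f : J"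
   have "sgn (poly (mpoly (n f) (%j. a f j (vec (t i)))) (s i)) = sgn (poly (mpoly (n f) (%j. a f j (vec (t i)))) (r (vec (root q (t i)))))"
    by (rule gap_sgn[OF bspec[OF g i]]) (use f in \<open>auto simp: Z_def\<close>)
   thus "sgn (poly (mpoly (n f) (%j. a f j (vec (t i)))) (r (vec (root q (t i))))) = eta f" using s[OF f, of i] by simp
  qed
  define L U where "L i = {x:Z i. x < s i}" and "U i = {x:Z i. s i < x}" for i
  have LU: "finite (L i)" "finite (U i)" for i using Zf by (auto simp: L_def U_def)
  \<comment> \<open>The existence of a neighbouring root on each side is made constant on an
    infinite set of indices.\<close>
  have "finite (range (%i. (L i = {}, U i = {})))" by simp
  from pigeonhole_infinite[OF infinite_UNIV_nat this] obtain i0 where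
   i0: "infinite {i. (L i = {}, U i = {}) = (L i0 = {}, U i0 = {})}" by auto
  define I where "I = {i. (L i = {}, U i = {}) = (L i0 = {}, U i0 = {})}"
  have I: "infinite I" "!!i. i : I ==> (L i = {}) = (L i0 = {})" "!!i. i : I ==> (U i = {}) = (U i0 = {})"
   using i0 by (auto simp: I_def)
  define l where "l i = Max (L i)" for i
  define u where "u i = Min (U i)" for i
  have l: "l i : Z i" "l i < s i" "ALL x:Z i. x < s i --> x <= l i" if "L i ~= {}" for i
   using Max_in[OF LU(1) that] Max_ge[OF LU(1)] by (auto simp: l_def L_def)
  have u: "u i : Z i" "s i < u i" "ALL x:Z i. s i < x --> u i <= x" if "U i ~= {}" for i
   using Min_in[OF LU(2) that] Min_le[OF LU(2)] by (auto simp: u_def U_def)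
  have Zr: "EX f:J. poly (mpoly (n f) (%j. a f j (vec (t i)))) x = 0" if "x : Z i" for i x
   using that by (auto simp: Z_def)
  have rt: "root q (t i) > 0" if "q > 0" for q i using t that by (simp add: real_root_gt_zero)
  have L0: "x > s i" if "L i = {}" "x : Z i" for i x using that sZ[of i] by (auto simp: L_def) (metis linorder_neqE_linordered_idom)
  have U0: "x < s i" if "U i = {}" "x : Z i" for i x using that sZ[of i] by (auto simp: U_def) (metis linorder_neqE_linordered_idom)
  show ?thesis
  proof (cases "L i0 = {}")
   case True
   show ?thesis
   proof (cases "U i0 = {}")
    case U: True
    have "ALL i:I. gap (Z i) (s i) ((%_. 0) (vec (root 1 (t i)) :: real^1))"
    proof
    fix i assume i: "i : I"
    have "Z i = {}" using L0[of i] U0[of i] I(2,3)[OF i] True U by force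
    thus "gap (Z i) (s i) ((%_. 0) (vec (root 1 (t i)) :: real^1))" by (simp add: gap_def)
    qed
    thus ?thesis by (intro fin[of 1 "%_. 0" I] I(1)) auto
   next
    case U: False
    have "ALL i:I. EX f:J. poly (mpoly (n f) (%j. a f j (vec (t i)))) (u i) = 0" using Zr u(1) I(3) U by blast
    from track_roots[OF J a t(1) tl I(1) this] obtain I' q r where
    r: "I' <= I" "infinite I'" "q > 0" "analytic_at r 0" "r 0 = 0" "ALL i:I'. u i = (r :: real^1 => real) (vec (root q (t i)))" by blast
    show ?thesis
    proof (rule fin[OF r(3) _ _ r(2), of "%x. r x - x $ 1"])
    show "analytic_at (%x. r x - x $ 1) 0" by (intro analytic_intros r)
    show "ALL i:I'. gap (Z i) (s i) (r (vec (root q (t i))) - vec (root q (t i)) $ 1)"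
    proof
    fix i assume i: "i : I'"
    hence iI: "i : I" using r by blast
    have Ui: "U i ~= {}" "L i = {}" using I(2,3)[OF iI] True U by auto
    show "gap (Z i) (s i) (r (vec (root q (t i))) - vec (root q (t i)) $ 1)"
    proof (rule gapI)
    show "ALL z:Z i. z < s i --> z < r (vec (root q (t i))) - vec (root q (t i)) $ 1" using L0[OF Ui(2)] by force
    show "ALL z:Z i. s i < z --> r (vec (root q (t i))) - vec (root q (t i)) $ 1 < z"
    using u(3)[OF Ui(1)] r(6) i rt[OF r(3), of i] by force
    qed (rule sZ)
    qed
    qed (use r in simp)
   qed
  next
   case L: False
   have "ALL i:I. EX f:J. poly (mpoly (n f) (%j. a f j (vec (t i)))) (l i) = 0" using Zr l(1) I(2) L by blast
   from track_roots[OF J a t(1) tl I(1) this] obtain I' q r where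
    r: "I' <= I" "infinite I'" "q > 0" "analytic_at r 0" "r 0 = 0" "ALL i:I'. l i = (r :: real^1 => real) (vec (root q (t i)))" by blast
   show ?thesis
   proof (cases "U i0 = {}")
    case U: True
    show ?thesis
    proof (rule fin[OF r(3) _ _ r(2), of "%x. r x + x $ 1"])
    show "analytic_at (%x. r x + x $ 1) 0" by (intro analytic_intros r)
    show "ALL i:I'. gap (Z i) (s i) (r (vec (root q (t i))) + vec (root q (t i)) $ 1)"
    proof
    fix i assume i: "i : I'"
    hence iI: "i : I" using r by blast
    have Ui: "L i ~= {}" "U i = {}" using I(2,3)[OF iI] L U by auto
    show "gap (Z i) (s i) (r (vec (root q (t i))) + vec (root q (t i)) $ 1)"
    proof (rule gapI)
    show "ALL z:Z i. s i < z --> r (vec (root q (t i))) + vec (root q (t i)) $ 1 < z" using U0[OF Ui(2)] by force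
    show "ALL z:Z i. z < s i --> z < r (vec (root q (t i))) + vec (root q (t i)) $ 1"
    using l(3)[OF Ui(1)] r(6) i rt[OF r(3), of i] by force
    qed (rule sZ)
    qed
    qed (use r in simp)
   next
    case U: False
    have "ALL i:I'. EX f:J. poly (mpoly (n f) (%j. a f j (vec (t i)))) (u i) = 0" using Zr u(1) I(3) U r(1) by blast
    from track_roots[OF J a t(1) tl r(2) this] obtain I2 q2 r2 where
    r2: "I2 <= I'" "infinite I2" "q2 > 0" "analytic_at r2 0" "r2 0 = 0" "ALL i:I2. u i = (r2 :: real^1 => real) (vec (root q2 (t i)))" by blast
    \<comment> \<open>The two series have different denominators \<open>q\<close> and
      \<open>q2\<close>; both are rewritten in terms of the root of order
      \<open>q * q2\<close>.\<close>
    define r3 where "r3 x = (r (vec ((x $ 1) ^ q2)) + r2 (vec ((x $ 1) ^ q))) * (1/2)" for x :: "real^1"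
    have powa: "analytic_map_at (%x::real^1. vec ((x $ 1) ^ q) :: real^1) 0" for q
    unfolding analytic_map_at_def by (simp add: analytic_intros)
    have "analytic_at (%x::real^1. r (vec ((x $ 1) ^ q2))) 0" "analytic_at (%x::real^1. r2 (vec ((x $ 1) ^ q))) 0"
    by (rule analytic_at_compose[OF _ powa]; use r r2 in \<open>simp add: power_0_left\<close>)+
    hence r3a: "analytic_at r3 0" unfolding r3_def by (intro analytic_intros)
    have r30: "r3 0 = 0" using r r2 by (simp add: r3_def power_0_left)
    show ?thesis
    proof (rule fin[OF _ r3a r30 r2(2), of "q * q2"])
    show "ALL i:I2. gap (Z i) (s i) (r3 (vec (root (q * q2) (t i))))"
    proof
    fix i assume i: "i : I2"
    hence iI: "i : I" "i : I'" using r r2 by auto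
    have Ui: "L i ~= {}" "U i ~= {}" using I(2,3)[OF iI(1)] L U by auto
    have "root (q * q2) (t i) ^ q2 = root q (t i)" "root (q * q2) (t i) ^ q = root q2 (t i)"
    using root_mult_power[OF r2(3), of "t i" q] root_mult_power[OF r(3), of "t i" q2] t(1)
    by (simp_all add: mult.commute less_imp_le)
    hence e: "r3 (vec (root (q * q2) (t i))) = (l i + u i) * (1/2)" using r(6) r2(6) i iI by (simp add: r3_def)
    have "l i < s i" "s i < u i" using l(2) u(2) Ui by auto
    thus "gap (Z i) (s i) (r3 (vec (root (q * q2) (t i))))"
    unfolding e by (intro gapI sZ) (use l(3)[OF Ui(1)] u(3)[OF Ui(2)] in force)+
    qed
    qed (use r r2 in simp)
   qed
  qed
 qed
qed

text \<open>The identity theorem on a segment. The parameters near which \<open>g\<close> vanishes,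
  and those with no zero of \<open>g\<close> nearby except possibly themselves, form disjoint open
  sets covering the connected interval, and 1 belongs to the second set.\<close>

lemma analytic_line_nonzero:
 fixes f :: "real^'d::finite => real"
 assumes f: "ALL s:{0..1}. analytic_at f (b + s *s (a - b))" and nz: "f a ~= 0"
 shows "PUNCT s. f (b + s *s (a - b)) ~= 0"
proof -
 define g where "g s = f (b + s *s (a - b))" for s
 define U where "U = {s. \<forall>\<^sub>F x in nhds s. g x = 0}"
 define V where "V = {s. \<forall>\<^sub>F x in at s. g x ~= 0}"
 have dich: "s : U \<union> V" if s: "s : {0..1}" for s
 proof -
  define u where "u x = f (b + (s + x $ 1) *s (a - b))" for x :: "real^1"
  have "analytic_map_at (%x::real^1. b + (s + x $ 1) *s (a - b)) 0"
   unfolding analytic_map_at_def by (auto intro!: analytic_intros)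
  hence "analytic_at u 0" unfolding u_def by (rule analytic_at_compose[rotated]) (use f s in simp)
  from analytic_at_order[OF this] show ?thesis
  proof (elim disjE exE conjE)
   assume u: "NEAR t. u t = 0"
   have "((%x. vec (x - s) :: real^1) ---> 0) (nhds s)" unfolding vec1_tendsto
    using filterlim_ident[of "nhds s"] LIM_zero by blast
   from eventually_compose[OF u this] show ?thesis by (simp add: u_def g_def U_def)
  next
   fix m v assume v: "analytic_at v 0" "v 0 ~= 0" "NEAR t. u t = (t $ 1) ^ m * v t"
   have "NEAR t. v t ~= 0" by (rule tendsto_imp_eventually_ne[OF analytic_at_imp_tendsto[OF v(1)] v(2)])
   with v(3) have "NEAR t. t $ 1 ~= 0 --> u t ~= 0" by eventually_elim simp
   moreover have "((%x. vec (x - s) :: real^1) ---> 0) (nhds s)" unfolding vec1_tendsto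
    using filterlim_ident[of "nhds s"] LIM_zero by blast
   ultimately have "\<forall>\<^sub>F x in nhds s. (vec (x - s) :: real^1) $ 1 ~= 0 --> u (vec (x - s)) ~= 0"
    by (rule eventually_compose)
   thus ?thesis by (simp add: u_def g_def V_def eventually_at_filter)
  qed
 qed
 have oU: "open U" unfolding open_subopen[of U]
 proof
  fix s assume "s : U"
  hence "\<forall>\<^sub>F y in nhds s. \<forall>\<^sub>F x in nhds y. g x = 0" by (simp add: U_def eventually_eventually)
  thus "EX T. open T & s : T & T <= U" unfolding eventually_nhds[of _ s] U_def by blast
 qed
 have oV: "open V" unfolding open_subopen[of V]
 proof
  fix s assume "s : V"
  then obtain T where T: "open T" "s : T" "ALL x:T. x ~= s --> g x ~= 0"
   unfolding V_def eventually_at_topological by blast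
  have "T <= V"
  proof
   fix y assume y: "y : T"
   show "y : V"
   proof (cases "y = s")
    case False
    have "open (T - {s})" using T by auto
    hence "\<forall>\<^sub>F x in at y. g x ~= 0" unfolding eventually_at_topological
    using T y False by (intro exI[of _ "T - {s}"]) auto
    thus ?thesis by (simp add: V_def)
   qed (use `s : V` in simp)
  qed
  thus "EX T. open T & s : T & T <= V" using T by blast
 qed
 have UV: "U \<inter> V = {}"
 proof (rule ccontr)
  assume "U \<inter> V ~= {}"
  then obtain s where s: "\<forall>\<^sub>F x in nhds s. g x = 0" "\<forall>\<^sub>F x in at s. g x ~= 0" by (auto simp: U_def V_def)
  from s(1) have "\<forall>\<^sub>F x in at s. g x = 0" by (simp add: eventually_nhds_conv_at)
  with s(2) have "\<forall>\<^sub>F x in at s. False" by eventually_elim simp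
  thus False by simp
 qed
 have "1 ~: U"
 proof
  assume "1 : U"
  hence "g 1 = 0" unfolding U_def using eventually_nhds_x_imp_x by blast
  thus False using nz by (simp add: g_def)
 qed
 have "0 ~: U"
 proof
  assume 0: "0 : U"
  have "connected {0..1::real}" by simp
  moreover have "U \<inter> V \<inter> {0..1} = {}" using UV by blast
  moreover have "{0..1} <= U \<union> V" using dich by blast
  ultimately have "U \<inter> {0..1} = {} | V \<inter> {0..1} = {}" using connectedD[OF _ oU oV] by blast
  moreover have "0 : U \<inter> {0..1}" using 0 by simp
  moreover have "1 : V \<inter> {0..1}" using dich[of 1] `1 ~: U` by simp
  ultimately show False by blast
 qed
 thus ?thesis using dich[of 0] by (simp add: V_def g_def)
qed

text \<open>For one germ after the other, the point is moved slightly towards a point where the new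
  germ does not vanish; the earlier germs stay nonzero by continuity. By
  \<open>analytic_line_nonzero\<close> the germs then do not vanish identically on the line through
  0, so preparation is possible for all of them in one common direction.\<close>

lemma common_direction:
 fixes Psi :: "(real^'d::finite => real) set"
 assumes fin: "finite Psi" and Psi: "ALL f:Psi. analytic_at f 0 & dep B f & ~(NEAR z. f z = 0)"
 shows "EX v. proj B v = v & (ALL f:Psi. ~(NEAR t. f (t *s v) = 0))"
proof -
 obtain rho M where rho: "rho > 0" "ALL f:Psi. ps (%_. rho) M f"
  using ps_common_radius[OF fin, of "%f. f" 0 1] Psi by auto
 define Om where "Om = {z::real^'d. ALL k. norm (z $ k) < rho}"
 have an: "analytic_at f z" if f: "f : Psi" and z: "z : Om" for f z
 proof -
  define dlt where "dlt = rho - Max (range (%k. norm (z $ k)))"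
  have "Max (range (%k. norm (z $ k))) < rho" using z by (subst Max_less_iff) (auto simp: Om_def)
  hence dlt: "dlt > 0" by (simp add: dlt_def)
  have mx: "norm (z $ k) <= Max (range (%k. norm (z $ k)))" for k by (rule Max_ge) auto
  have "ALL k. norm (z $ k) + dlt <= rho"
  proof
   fix k show "norm (z $ k) + dlt <= rho" using mx[of k] unfolding dlt_def by linarith
  qed
  from ps_translate[OF bspec[OF rho(2) f] this] dlt show ?thesis by (intro ps_imp_analytic_at[of dlt]) auto
 qed
 have conv: "b + s *s (a - b) : Om" if "a : Om" "b : Om" "s : {0..1}" for a b s
 proof -
  have "norm ((b + s *s (a - b)) $ k) < rho" for k
  proof -
   have ab: "\<bar>a $ k\<bar> < rho" "\<bar>b $ k\<bar> < rho" using that by (auto simp: Om_def)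
   have "a $ k : {-rho<..<rho}" "b $ k : {-rho<..<rho}" using ab by auto
   from convexD_alt[OF convex_real_interval(8) this(2,1), of s] that(3)
   have "(1 - s) * b $ k + s * a $ k : {-rho<..<rho}" by simp
   moreover have "(b + s *s (a - b)) $ k = (1 - s) * b $ k + s * a $ k" by (simp add: algebra_simps)
   ultimately show ?thesis by auto
  qed
  thus ?thesis by (simp add: Om_def)
 qed
 have line: "PUNCT s. f (b + s *s (a - b)) ~= 0" if "f : Psi" "a : Om" "b : Om" "f a ~= 0" for f a b
  by (rule analytic_line_nonzero) (use an conv that in auto)
 have ex: "EX a:Om. proj B a = a & f a ~= 0" if f: "f : Psi" for f
 proof (rule ccontr)
  assume *: "~?thesis"
  have "\<forall>\<^sub>F z in nhds (0::real^'d). z : pdisc (%_. rho / 2)" by (rule eventually_pdisc) (use rho in simp)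
  hence "NEAR z. f z = 0"
  proof eventually_elim
   case (elim z)
   have "norm (proj B z $ k) < rho" for k
   proof -
    have "norm (z $ k) <= rho / 2" using elim by (simp add: pdisc_def)
    thus ?thesis using rho(1) by (auto simp: proj_nth)
   qed
   hence "proj B z : Om" by (simp add: Om_def)
   moreover have "proj B (proj B z) = proj B z" by (simp add: proj_def vec_eq_iff)
   ultimately have "f (proj B z) = 0" using * by blast
   moreover have "f (proj B z) = f z" using Psi f unfolding dep_def by blast
   ultimately show ?case by simp
  qed
  thus False using Psi f by blast
 qed
 have "EX v:Om. proj B v = v & (ALL f:Phi. f v ~= 0)" if "Phi <= Psi" for Phi
  using finite_subset[OF that fin] that
 proof (induction Phi rule: finite_induct)
  case empty
  thus ?case using rho by (intro bexI[of _ 0]) (auto simp: Om_def)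
 next
  case (insert f Phi)
  then obtain v where v: "v : Om" "proj B v = v" "ALL g:Phi. g v ~= 0" by auto
  obtain a where a: "a : Om" "proj B a = a" "f a ~= 0" using ex insert.prems by auto
  have "PUNCT s. f (v + s *s (a - v)) ~= 0" using line insert.prems a v by auto
  moreover have "PUNCT s. ALL g:Phi. g (v + s *s (a - v)) ~= 0"
  proof (intro eventually_ball_finite insert.hyps ballI)
   fix g assume g: "g : Phi"
   have "((%s::real. v + s *s (a - v)) ---> v + 0 *s (a - v)) (at 0)"
   proof (rule vec_tendstoI)
    fix i
    have "((%s::real. v $ i + s * (a - v) $ i) ---> v $ i + 0 * (a - v) $ i) (at 0)" by (intro tendsto_intros)
    thus "((%s::real. (v + s *s (a - v)) $ i) ---> (v + 0 *s (a - v)) $ i) (at 0)"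
    by (simp only: vector_add_component vector_smult_component)
   qed
   hence l: "((%s::real. v + s *s (a - v)) ---> v) (at 0)" by simp
   have "(g ---> g v) (nhds v)" using an[of g v] g insert.prems v by (intro analytic_at_imp_tendsto) auto
   from filterlim_compose[OF this l] show "PUNCT s. g (v + s *s (a - v)) ~= 0"
    by (rule tendsto_imp_eventually_ne) (use v g in auto)
  qed
  moreover have "\<forall>\<^sub>F s in at (0::real). s : {-1<..<1}"
   using eventually_at_in_open'[of "{-1<..<1}" "0::real"] by auto
  ultimately have "RIGHT s. f (v + s *s (a - v)) ~= 0 & (ALL g:Phi. g (v + s *s (a - v)) ~= 0) & s : {-1<..<1} & s > 0"
   using eventually_at_right_less[of "0::real"] by (auto simp: eventually_at_split eventually_conj_iff)
  from eventually_happens'[OF _ this] obtain s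
   where s: "f (v + s *s (a - v)) ~= 0" "ALL g:Phi. g (v + s *s (a - v)) ~= 0" "s : {-1<..<1}" "s > 0"
   by auto
  have "proj B (v + s *s (a - v)) = v + s *s (a - v)"
  proof -
   have "proj B (v + s *s (a - v)) = proj B v + s *s (proj B a - proj B v)" by (simp add: proj_def vec_eq_iff)
   thus ?thesis using v(2) a(2) by simp
  qed
  moreover have "v + s *s (a - v) : Om" using conv[of a v s] a v s by simp
  ultimately show ?case using s by auto
 qed
 from this[of Psi] obtain v where v: "v : Om" "proj B v = v" "ALL f:Psi. f v ~= 0" by auto
 have "~(NEAR t. f (t *s v) = 0)" if f: "f : Psi" for f
 proof
  assume "NEAR t. f (t *s v) = 0"
  hence "PUNCT t. f (t *s v) = 0" by (simp add: eventually_nhds_conv_at)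
  moreover have "PUNCT s. f (0 + s *s (v - 0)) ~= 0" by (rule line) (use f v rho in \<open>auto simp: Om_def\<close>)
  ultimately have "\<forall>\<^sub>F s in at (0::real). False" by eventually_elim simp
  thus False by simp
 qed
 thus ?thesis using v(2) by blast
qed

lemma eventually_sgn_const:
 fixes f :: "'v::topological_space => real"
 assumes "(f ---> l) F" "l ~= 0" shows "\<forall>\<^sub>F z in F. sgn (f z) = sgn l"
proof (cases "l > 0")
 case True
 from order_tendstoD(1)[OF assms(1) this] show ?thesis by eventually_elim (use True in simp)
next
 case False
 hence neg: "l < 0" using assms(2) by simp
 from order_tendstoD(2)[OF assms(1) this] show ?thesis by eventually_elim (use neg in simp)
qed

lemma tendsto_proj: "(proj A ---> (0::'a::{real_normed_field,euclidean_space}^'d::finite)) (nhds 0)"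
 using analytic_map_at_imp_tendsto[OF analytic_map_at_proj, of A 0] by simp

text \<open>Induction on the coordinates, with Weierstrass polynomials in coordinate
  \<open>k\<close>. The signs of finitely many germs \<open>G\<close> in the coordinates
  \<open>A\<close> fix the pattern of the roots; along a curve \<open>phi\<close> with these signs a
  suitable value of coordinate \<open>k\<close> therefore exists, and \<open>root_selection\<close>
  makes it analytic after the substitution of \<open>t ^ q\<close>.\<close>

theorem curve_selection_signs:
 fixes Phi :: "(real^'d::finite => real) set" and A :: "'d set"
 assumes "finite Phi" "ALL f:Phi. analytic_at f 0 & dep A f"
  and "z ----> 0" "ALL i. ALL f:Phi. sgn (f (z i)) = sig f"
 shows "\<exists>phi::real^1 => real^'d. analytic_map_at phi 0 & phi 0 = 0 &
  (ALL f:Phi. RIGHT t. sgn (f (phi (vec t))) = sig f)"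
proof -
 have "finite A" by simp
 thus ?thesis using assms
 proof (induction A arbitrary: Phi z sig rule: finite_induct)
  case empty
  have "sgn (f 0) = sig f" if "f : Phi" for f
  proof -
   have "f (proj {} (z 0)) = f (z 0)" using empty.prems(2) that by (simp add: dep_def)
   moreover have "proj {} (z 0) = 0" by (simp add: proj_def vec_eq_iff)
   ultimately show ?thesis using empty.prems(4) that by simp
  qed
  thus ?case by (intro exI[of _ "%_. 0"]) (auto simp: analytic_map_at_def)
 next
  case (insert k A)
  note Phi = insert.prems(1,2) and z = insert.prems(3,4)
  define B where "B = insert k A"
  \<comment> \<open>Germs that vanish identically near 0 cannot be prepared; their sign is 0 on
    every curve through 0, and they are treated at the end.\<close>
  define Phi0 where "Phi0 = {f:Phi. ~(NEAR x. f x = 0)}"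
  \<comment> \<open>Adding the coordinate function to the family ensures \<open>v $ k ~= 0\<close>,
    so that \<open>L\<close> below is invertible.\<close>
  define ck where "ck = (%x::real^'d. x $ k)"
  have cknz: "~(NEAR x. ck x = 0)"
  proof
   assume "NEAR x. ck x = 0"
   from eventually_compose[OF this tendsto_axis[of k]]
   have "NEAR s. s = (0::real)" by (simp add: ck_def)
   hence "\<forall>\<^sub>F s in at (0::real). False" by (auto simp: eventually_at_filter elim: eventually_mono)
   thus False by simp
  qed
  have "EX v. proj B v = v & (ALL f:insert ck Phi0. ~(NEAR t. f (t *s v) = 0))"
  proof (rule common_direction)
   show "finite (insert ck Phi0)" using Phi by (simp add: Phi0_def)
   show "ALL f:insert ck Phi0. analytic_at f 0 & dep B f & ~(NEAR z. f z = 0)"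
    using Phi cknz by (auto simp: Phi0_def B_def) (auto simp: ck_def dep_def proj_nth)
  qed
  then obtain v where v: "proj B v = v" "ALL f:Phi0. ~(NEAR t. f (t *s v) = 0)"
   "~(NEAR t. ck (t *s v) = 0)" by auto
  have vk: "v $ k ~= 0" using v(3) by (auto simp: ck_def)
  have vB: "v $ j = 0" if "j ~: B" for j using v(1) that by (metis proj_nth)
  \<comment> \<open>The linear automorphism that maps \<open>axis k 1\<close> to \<open>v\<close>;
    \<open>Li\<close> is its inverse.\<close>
  define L where "L w = w + w $ k *s (v - axis k 1)" for w :: "real^'d"
  define Li where "Li y = y - (y $ k / v $ k) *s (v - axis k 1)" for y :: "real^'d"
  have Lik: "Li y $ k = y $ k / v $ k" for y using vk by (simp add: Li_def axis_def field_simps)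
  have LLi: "L (Li y) = y" for y unfolding L_def Lik by (simp add: Li_def)
  have Lax: "L (axis k t) = t *s v" for t by (simp add: L_def vec_eq_iff axis_def algebra_simps)
  have Lp: "L (proj B w) = proj B (L w)" for w
   using vB by (auto simp: L_def vec_eq_iff proj_nth axis_def B_def)
  have La: "analytic_map_at L z" for z
   unfolding analytic_map_at_def L_def by (auto intro!: analytic_intros)
  have Lia: "analytic_map_at Li z" for z
   unfolding analytic_map_at_def Li_def divide_inverse by (auto intro!: analytic_intros)
  have L0: "L 0 = 0" "Li 0 = 0" by (auto simp: L_def Li_def)
  have Llim: "(L ---> 0) (nhds 0)" "(Li ---> 0) (nhds 0)"
   using analytic_map_at_imp_tendsto[OF La] analytic_map_at_imp_tendsto[OF Lia] L0 by metis+
  define D where "D f n a Q <-> (ALL j<n. analytic_at (a j) 0 & a j 0 = 0 & dep A (a j)) &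
   analytic_at Q 0 & Q 0 ~= 0 & (NEAR w. Q w * f (L w) = (w $ k) ^ n + (SUM j<n. a j w * (w $ k) ^ j))"
   for f n a Q
  have "ALL f:Phi0. EX p. D f (fst p) (fst (snd p)) (snd (snd p))"
  proof
   fix f assume f: "f : Phi0"
   hence fa: "analytic_at f 0" "dep B f" using Phi by (auto simp: Phi0_def B_def)
   have "analytic_at (%w. f (L w)) 0" by (rule analytic_at_compose[OF _ La]) (simp add: L0 fa)
   moreover have "~(NEAR t. f (L (axis k t)) = 0)" using v(2) f by (simp add: Lax)
   ultimately obtain n a Q where W: "ALL j<n. analytic_at (a j) 0 & a j 0 = 0 & (ALL z. a j (zero_coord k z) = a j z)"
    "analytic_at Q 0" "Q 0 ~= 0" "NEAR w. Q w * f (L w) = (w $ k) ^ n + (SUM j<n. a j w * (w $ k) ^ j)"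
    using weierstrass_preparation[of "%w. f (L w)" k] by blast
   have pp: "proj A (proj A w) = proj A w" for w :: "real^'d" by (simp add: proj_def vec_eq_iff)
   have zp: "zero_coord k (proj B w) = proj A w" for w :: "real^'d"
    using insert.hyps by (auto simp: zero_coord_def proj_def vec_eq_iff B_def)
   \<comment> \<open>Preparation gives independence of coordinate \<open>k\<close> only; composing
     with \<open>proj\<close> also removes the coordinates outside \<open>B\<close>, on which
     \<open>f\<close> does not depend.\<close>
   have "D f n (%j w. a j (proj A w)) (%w. Q (proj B w))"
    unfolding D_def
   proof (intro conjI allI impI)
    fix j assume j: "j < n"
    show "analytic_at (%w. a j (proj A w)) 0"
    by (rule analytic_at_compose[OF _ analytic_map_at_proj]) (use W(1) j in simp)
    show "a j (proj A 0) = 0" using W(1) j by simp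
    show "dep A (%w. a j (proj A w))" by (simp add: dep_def pp)
   next
    show "analytic_at (%w. Q (proj B w)) 0"
    by (rule analytic_at_compose[OF _ analytic_map_at_proj]) (simp add: W)
    show "Q (proj B 0) ~= 0" by (simp add: W)
    show "NEAR w. Q (proj B w) * f (L w) = (w $ k) ^ n + (SUM j<n. a j (proj A w) * (w $ k) ^ j)"
    using eventually_compose[OF W(4) tendsto_proj[of B]]
    proof eventually_elim
    case (elim w)
    have "a j (proj B w) = a j (proj A w)" if "j < n" for j using W(1) that zp[of w] by metis
    moreover have "f (L (proj B w)) = f (L w)" using fa(2) by (simp add: Lp dep_def)
    moreover have "proj B w $ k = w $ k" by (simp add: proj_nth B_def)
    ultimately show ?case using elim by simp
    qed
   qed
   thus "EX p. D f (fst p) (fst (snd p)) (snd (snd p))"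
    by (intro exI[of _ "(n, %j w. a j (proj A w), %w. Q (proj B w))"]) simp
  qed
  from bchoice[OF this] obtain p where p: "ALL f:Phi0. D f (fst (p f)) (fst (snd (p f))) (snd (snd (p f)))" ..
  define n a Q where "n f = fst (p f)" and "a f = fst (snd (p f))" and "Q f = snd (snd (p f))" for f
  have D: "D f (n f) (a f) (Q f)" if "f : Phi0" for f using p that by (simp add: n_def a_def Q_def)
  have aD: "analytic_at (a f j) 0" "a f j 0 = 0" "dep A (a f j)" if "f : Phi0" "j < n f" for f j
   using D[OF that(1)] that(2) unfolding D_def by auto
  have QD: "analytic_at (Q f) 0" "Q f 0 ~= 0"
   "NEAR w. Q f w * f (L w) = (w $ k) ^ n f + (SUM j<n f. a f j w * (w $ k) ^ j)" if "f : Phi0" for f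
   using D[OF that] unfolding D_def by auto
  define P where "P f w = mpoly (n f) (%j. a f j w)" for f w
  have fin0: "finite Phi0" using Phi by (simp add: Phi0_def)
  have sgnP: "NEAR w. ALL f:Phi0. sgn (poly (P f w) (w $ k)) = sgn (Q f 0) * sgn (f (L w))"
  proof (intro eventually_ball_finite fin0 ballI)
   fix f assume f: "f : Phi0"
   have "NEAR w. sgn (Q f w) = sgn (Q f 0)"
    by (rule eventually_sgn_const[OF analytic_at_imp_tendsto[OF QD(1)[OF f]] QD(2)[OF f]])
   with QD(3)[OF f] show "NEAR w. sgn (poly (P f w) (w $ k)) = sgn (Q f 0) * sgn (f (L w))"
   proof eventually_elim
    case (elim w)
    have "poly (P f w) (w $ k) = Q f w * f (L w)" using elim by (simp add: P_def poly_mpoly)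
    thus ?case using elim(2) by (simp add: sgn_mult)
   qed
  qed
  define y where "y i = Li (z i)" for i
  have yl: "y ----> 0" unfolding y_def by (rule filterlim_compose[OF Llim(2) z(1)])
  from eventually_compose[OF sgnP yl] obtain N where
   N: "ALL i>=N. ALL f:Phi0. sgn (poly (P f (y i)) (y i $ k)) = sgn (Q f 0) * sgn (f (L (y i)))"
   unfolding eventually_sequentially by blast
  define eta where "eta f = sgn (Q f 0) * sig f" for f
  have N': "sgn (poly (P f (y i)) (y i $ k)) = eta f" if "i >= N" "f : Phi0" for i f
  proof -
   have "f : Phi" using that(2) by (simp add: Phi0_def)
   thus ?thesis using N that z(2) by (simp add: eta_def y_def LLi)
  qed
  define R where "R = {g::real^'d => real. analytic_at g 0 & dep A g}"
  have R: "fun_ring R" unfolding R_def by (rule analytic_dep_ring)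
  define m where "m = Max (insert 0 (n ` Phi0))"
  have "sign_determined R (P ` Phi0)"
  proof (rule sign_determined[OF R, where n = m])
   show "ALL P:P ` Phi0. par_poly R m P"
   proof (rule ballI, elim imageE, hypsubst)
    fix f assume f: "f : Phi0"
    have "n f <= m" unfolding m_def using fin0 f by (intro Max_ge) auto
    have "(%w. coeff (P f w) i) : R" for i
    using aD[OF f, of i] fun_ring_rules(1)[OF R]
    by (cases "i = n f"; cases "i < n f") (auto simp: P_def coeff_mpoly R_def)
    hence "par_poly R (n f) (P f)" by (simp add: par_poly_def P_def degree_mpoly)
    thus "par_poly R m (P f)" using `n f <= m` par_poly_mono by blast
   qed
  qed (use fin0 in simp)
  then obtain G where G: "G <= R" "finite G" and h: "!!x y. (ALL g:G. sgn (g x) = sgn (g y)) ==>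
   (EX h. strict_mono h & (ALL P:P ` Phi0. ALL s. sgn (poly (P x) s) = sgn (poly (P y) (h s))))"
   unfolding sign_determined_def by blast
  \<comment> \<open>The signs of \<open>G\<close> along the sequence take finitely many values, so
    they are constant on an infinite subsequence.\<close>
  define sg where "sg i = restrict (%g. sgn (g (y i))) G" for i
  have "sg ` {N..} <= (\<Pi>\<^sub>E g\<in>G. {-1, 0, 1})" unfolding sg_def by (auto simp: sgn_real_def split: if_splits)
  hence "finite (sg ` {N..})" using finite_subset finite_PiE[OF G(2), of "%_. {-1,0,1}"] by (metis finite.emptyI finite.insertI)
  from pigeonhole_infinite[OF infinite_Ici this] obtain i0 where i0: "i0 >= N" "infinite {i:{N..}. sg i = sg i0}" by auto
  define I where "I = {i:{N..}. sg i = sg i0}"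
  define e where "e = enumerate I"
  have infI: "infinite I" using i0 by (simp add: I_def)
  have e: "strict_mono e" "!!i. e i : I"
   unfolding e_def by (rule strict_mono_enumerate[OF infI], rule enumerate_in_set[OF infI])
  have "\<exists>phi::real^1 => real^'d. analytic_map_at phi 0 & phi 0 = 0 &
   (ALL g:G. RIGHT t. sgn (g (phi (vec t))) = sgn (g (y i0)))"
  proof (rule insert.IH[where z = "%i. y (e i)"])
   show "finite G" by (rule G(2))
   show "ALL f:G. analytic_at f 0 & dep A f" using G(1) by (auto simp: R_def)
   show "(%i. y (e i)) ----> 0" using LIMSEQ_subseq_LIMSEQ[OF yl e(1)] by (simp add: o_def)
   show "ALL i. ALL g:G. sgn (g (y (e i))) = sgn (g (y i0))"
   proof (intro allI ballI)
    fix i g assume g: "g : G"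
    have "sg (e i) = sg i0" using e(2)[of i] by (simp add: I_def)
    from fun_cong[OF this, of g] show "sgn (g (y (e i))) = sgn (g (y i0))" using g by (simp add: sg_def)
   qed
  qed
  then obtain phi :: "real^1 => real^'d" where phi: "analytic_map_at phi 0" "phi 0 = 0"
   "ALL g:G. RIGHT t. sgn (g (phi (vec t))) = sgn (g (y i0))" by blast
  define c where "c f j x = a f j (phi x)" for f j x
  have ca: "ALL f:Phi0. ALL j<n f. analytic_at (c f j) 0 & c f j 0 = 0"
  proof (intro ballI allI impI)
   fix f j assume fj: "f : Phi0" "j < n f"
   have "analytic_at (%x. a f j (phi x)) 0" by (rule analytic_at_compose[OF _ phi(1)]) (simp add: phi(2) aD[OF fj])
   thus "analytic_at (c f j) 0 & c f j 0 = 0" using aD[OF fj] phi(2) by (simp add: c_def[abs_def])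
  qed
  have "RIGHT t. ALL g:G. sgn (g (phi (vec t))) = sgn (g (y i0))"
   by (rule eventually_ball_finite[OF G(2) phi(3)])
  hence "RIGHT t. EX s. ALL f:Phi0. sgn (poly (mpoly (n f) (%j. c f j (vec t))) s) = eta f"
  proof eventually_elim
   case (elim t)
   hence "ALL g:G. sgn (g (y i0)) = sgn (g (phi (vec t)))" by simp
   from h[OF this] obtain hh where hh: "ALL P:P ` Phi0. ALL s. sgn (poly (P (y i0)) s) = sgn (poly (P (phi (vec t))) (hh s))" by blast
   \<comment> \<open>\<open>hh\<close> carries the coordinate of a sequence point to a value with
     the same signs over \<open>phi\<close>.\<close>
   have "sgn (poly (P f (phi (vec t))) (hh (y i0 $ k))) = eta f" if f: "f : Phi0" for f
    using hh f N'[OF i0(1) f] by auto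
   thus ?case by (auto simp: P_def c_def)
  qed
  from root_selection[OF fin0 ca this] obtain q and r :: "real^1 => real" where q: "q > 0" and r: "analytic_at r 0" "r 0 = 0"
   and sel: "ALL f:Phi0. RIGHT t. sgn (poly (mpoly (n f) (%j. c f j (vec (t ^ q)))) (r (vec t))) = eta f"
   by blast
  define psi where "psi x = (\<chi> j. if j = k then r x else proj A (phi (vec ((x $ 1) ^ q))) $ j)" for x :: "real^1"
  have powa: "analytic_map_at (%x::real^1. vec ((x $ 1) ^ q) :: real^1) 0"
   unfolding analytic_map_at_def by (simp add: analytic_intros)
  have phia: "analytic_map_at (%x::real^1. phi (vec ((x $ 1) ^ q))) 0"
   by (rule analytic_map_at_compose[of phi "%x. vec ((x $ 1) ^ q)", OF _ powa]) (use phi(1) q in \<open>simp add: power_0_left\<close>)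
  have psia: "analytic_map_at psi 0"
   unfolding analytic_map_at_def
  proof
   fix j
   show "analytic_at (%x. psi x $ j) 0"
    using r(1) spec[OF phia[unfolded analytic_map_at_def], of j]
    by (cases "j = k"; cases "j : A") (simp_all add: psi_def proj_nth)
  qed
  have "phi (vec ((0::real) ^ q)) = 0" using q phi(2) by (simp add: power_0_left)
  hence "psi 0 $ j = 0" for j by (simp add: psi_def r proj_0)
  hence psi0: "psi 0 = 0" by (simp add: vec_eq_iff)
  have vl: "((%t. vec t :: real^1) ---> 0) (at_right 0)" unfolding vec1_tendsto by (rule tendsto_ident_at)
  have psil: "((%t. psi (vec t)) ---> 0) (at_right 0)"
   using filterlim_compose[OF analytic_map_at_imp_tendsto[OF psia] vl] psi0 by simp
  have Ppsi: "P f (psi (vec t)) = mpoly (n f) (%j. c f j (vec (t ^ q)))" if f: "f : Phi0" for f t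
  proof -
   have "a f j (psi (vec t)) = a f j (phi (vec (t ^ q)))" if j: "j < n f" for j
   proof -
    have "proj A (psi (vec t)) = proj A (phi (vec (t ^ q)))"
    using insert.hyps by (auto simp: proj_def psi_def vec_eq_iff)
    thus ?thesis using aD(3)[OF f j] unfolding dep_def by metis
   qed
   thus ?thesis by (simp add: P_def c_def mpoly_def)
  qed
  have "ALL f:Phi. RIGHT t. sgn (f (L (psi (vec t)))) = sig f"
  proof
   fix f assume f: "f : Phi"
   show "RIGHT t. sgn (f (L (psi (vec t)))) = sig f"
   proof (cases "f : Phi0")
    case True
    have "RIGHT t. ALL f:Phi0. sgn (poly (P f (psi (vec t))) (psi (vec t) $ k)) = sgn (Q f 0) * sgn (f (L (psi (vec t))))"
    by (rule eventually_compose[OF sgnP psil])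
    with bspec[OF sel True] show ?thesis
    proof eventually_elim
    case (elim t)
    have 1: "psi (vec t) $ k = r (vec t)" by (simp add: psi_def)
    have "sgn (Q f 0) * sgn (f (L (psi (vec t)))) = sgn (Q f 0) * sig f"
    using bspec[OF elim(2) True] elim(1) unfolding 1 Ppsi[OF True] eta_def by (rule HOL.trans[OF sym])
    moreover have "sgn (Q f 0) ~= 0" using QD(2)[OF True] by (simp add: sgn_zero_iff)
    ultimately show ?case using mult_left_cancel by blast
    qed
   next
    case False
    hence f0: "NEAR x. f x = 0" using f by (simp add: Phi0_def)
    have "\<forall>\<^sub>F i in sequentially. f (z i) = 0" by (rule eventually_compose[OF f0 z(1)])
    then obtain i where "f (z i) = 0" by (auto simp: eventually_sequentially)
    hence "sig f = 0" using z(2) f by (metis sgn_0)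
    moreover have "((%t. L (psi (vec t))) ---> 0) (at_right 0)" by (rule filterlim_compose[OF Llim(1) psil])
    from eventually_compose[OF f0 this] have "RIGHT t. f (L (psi (vec t))) = 0" .
    ultimately show ?thesis by (auto elim: eventually_mono)
   qed
  qed
  moreover have "analytic_map_at (%x. L (psi x)) 0" by (rule analytic_map_at_compose[OF La psia])
  moreover have "L (psi 0) = 0" by (simp add: psi0 L0)
  ultimately show ?case by blast
 qed
qed

text \<open>Equations and one inequation: this form makes sense over both fields, and the results on
  \<open>W\<close> and \<open>S\<close> use curve selection only in this form. It is a predicate of
  the type because it is applied in spaces with additional coordinates.\<close>

definition curve_selection :: "('a::{real_normed_field,euclidean_space}^'d::finite) itself => bool" where
 "curve_selection (T :: ('a^'d) itself) <->
  (ALL (E::('a^'d => 'a) set) a z. finite E & (ALL f:E. analytic_at f 0) & analytic_at a 0 & z ----> 0 &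
   (ALL i. (ALL f:E. f (z i) = 0) & a (z i) ~= 0) -->
   (\<exists>phi::'a^1 => 'a^'d. analytic_map_at phi 0 & phi 0 = 0 & (ALL f:E. NEAR t. f (phi t) = 0) &
    (NEAR t. t ~= 0 --> a (phi t) ~= 0)))"

lemma frequently_zero_imp_zero:
 fixes u :: "'a::{real_normed_field,euclidean_space}^1 => 'a"
 assumes u: "analytic_at u 0" and F: "(gam ---> 0) F" "F ~= bot" "\<forall>\<^sub>F t in F. gam t ~= 0"
  and z: "\<exists>\<^sub>F t in F. u (gam t) = 0"
 shows "NEAR t. u t = 0"
proof -
 from analytic_at_order[OF u] show ?thesis
 proof (elim disjE exE conjE)
  fix m v assume v: "analytic_at v 0" "v 0 ~= 0" "NEAR t. u t = (t $ 1) ^ m * v t"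
  have "NEAR t. v t ~= 0" by (rule tendsto_imp_eventually_ne[OF analytic_at_imp_tendsto[OF v(1)] v(2)])
  with v(3) have "NEAR t. t ~= 0 --> u t ~= 0"
   by eventually_elim (auto simp: vec_eq_iff forall_1)
  from eventually_compose[OF this F(1)] F(3) have "\<forall>\<^sub>F t in F. u (gam t) ~= 0" by eventually_elim simp
  thus ?thesis using z by (simp add: frequently_def)
 qed
qed

lemma nonzero_near_0:
 fixes u :: "'a::{real_normed_field,euclidean_space}^1 => 'a"
 assumes u: "analytic_at u 0" and nz: "~(NEAR t. u t = 0)"
 shows "NEAR t. t ~= 0 --> u t ~= 0"
proof -
 from analytic_at_order[OF u] nz obtain m v where v: "analytic_at v 0" "v 0 ~= 0" "NEAR t. u t = (t $ 1) ^ m * v t"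
  by blast
 have "NEAR t. v t ~= 0" by (rule tendsto_imp_eventually_ne[OF analytic_at_imp_tendsto[OF v(1)] v(2)])
 with v(3) show ?thesis by eventually_elim (auto simp: vec_eq_iff forall_1)
qed

lemma curve_selection_real: "curve_selection TYPE(real^'d::finite)"
 unfolding curve_selection_def
proof (intro allI impI, elim conjE)
 fix E :: "(real^'d => real) set" and a z
 assume E: "finite E" "ALL f:E. analytic_at f 0" and a: "analytic_at a 0" and z: "z ----> 0"
  and eq: "ALL i. (ALL f:E. f (z i) = 0) & a (z i) ~= 0"
 \<comment> \<open>Over the reals \<open>a ~= 0\<close> becomes the sign condition that
   \<open>a * a\<close> is positive.\<close>
 define b where "b x = a x * a x" for x
 define sig where "sig f = (if f = b then 1 else 0 :: real)" for f
 have bE: "b ~: E"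
 proof
  assume "b : E"
  hence "b (z 0) = 0" using eq by blast
  thus False using eq by (simp add: b_def)
 qed
 have "\<exists>phi::real^1 => real^'d. analytic_map_at phi 0 & phi 0 = 0 &
  (ALL f:insert b E. RIGHT t. sgn (f (phi (vec t))) = sig f)"
 proof (rule curve_selection_signs[OF _ _ z, where A = UNIV])
  have "dep UNIV f" for f :: "real^'d => real" by (simp add: dep_def proj_def)
  thus "ALL f:insert b E. analytic_at f 0 & dep UNIV f" using E a unfolding b_def by (auto intro: analytic_intros)
  show "ALL i. ALL f:insert b E. sgn (f (z i)) = sig f" using eq bE by (auto simp: sig_def b_def sgn_mult sgn_if)
 qed (use E in simp)
 then obtain phi :: "real^1 => real^'d" where phi: "analytic_map_at phi 0" "phi 0 = 0"
  "ALL f:insert b E. RIGHT t. sgn (f (phi (vec t))) = sig f" by blast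
 have vl: "((%t. vec t :: real^1) ---> 0) (at_right 0)" unfolding vec1_tendsto by (rule tendsto_ident_at)
 have ne: "RIGHT t. (vec t :: real^1) ~= 0"
  using eventually_at_right_less[of "0::real"] by eventually_elim (simp add: vec_eq_iff)
 have an: "analytic_at (%t. f (phi t)) 0" if "analytic_at f 0" for f :: "real^'d => real"
  by (rule analytic_at_compose[OF _ phi(1)]) (simp add: phi(2) that)
 show "\<exists>phi::real^1 => real^'d. analytic_map_at phi 0 & phi 0 = 0 & (ALL f:E. NEAR t. f (phi t) = 0) &
    (NEAR t. t ~= 0 --> a (phi t) ~= 0)"
 proof (intro exI[of _ phi] conjI ballI phi)
  fix f assume f: "f : E"
  have "RIGHT t. f (phi (vec t)) = 0"
  proof -
   have "sig f = 0" using f bE by (auto simp: sig_def)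
   thus ?thesis using bspec[OF phi(3), of f] f by (simp add: sgn_zero_iff)
  qed
  hence "\<exists>\<^sub>F t in at_right 0. f (phi (vec t)) = 0" by (intro eventually_frequently) auto
  thus "NEAR t. f (phi t) = 0"
   using frequently_zero_imp_zero[OF an vl _ ne] E f by auto
 next
  have "~(NEAR t. a (phi t) = 0)"
  proof
   assume "NEAR t. a (phi t) = 0"
   from eventually_compose[OF this vl] bspec[OF phi(3), of b]
   have "\<forall>\<^sub>F t in at_right (0::real). ~(a (phi (vec t)) = 0)" 
    using bspec[OF phi(3), of b] by (auto simp: b_def sig_def elim: eventually_mono)
   from eventually_conj[OF this eventually_compose[OF `NEAR t. a (phi t) = 0` vl]]
   show False by simp
  qed
  thus "NEAR t. t ~= 0 --> a (phi t) ~= 0" by (rule nonzero_near_0[OF an[OF a]])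
 qed
qed

section \<open>From real to complex curves\<close>

lemma analytic_at_real_points:
 fixes g :: "complex^'e::finite => complex"
 assumes "analytic_at g 0"
 shows "analytic_at (%w::real^'e. Re (g (\<chi> i. of_real (w $ i)))) 0"
  "analytic_at (%w::real^'e. Im (g (\<chi> i. of_real (w $ i)))) 0"
proof -
 from assms obtain rho c where rho: "rho > 0" and
  c: "!!h. (ALL i. norm (h $ i) < rho) ==> ((%alp. c alp * (\<Prod>i\<in>UNIV. (h $ i) ^ alp i)) has_sum g (0 + h)) UNIV"
  unfolding analytic_at_def by blast
 have s: "((%alp. c alp * of_real (\<Prod>i\<in>UNIV. (h $ i) ^ alp i)) has_sum g (\<chi> i. of_real (h $ i))) UNIV"
  if h: "ALL i. norm (h $ i) < rho" for h :: "real^'e"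
  using c[of "\<chi> i. of_real (h $ i)"] h by simp
 show "analytic_at (%w::real^'e. Re (g (\<chi> i. of_real (w $ i)))) 0"
  unfolding analytic_at_def
 proof (intro exI[of _ rho] conjI rho exI[of _ "%alp. Re (c alp)"] allI impI)
  fix h :: "real^'e" assume "ALL i. norm (h $ i) < rho"
  from has_sum_bounded_linear[OF bounded_linear_Re s[OF this]]
  show "((%alp. Re (c alp) * (\<Prod>i\<in>UNIV. (h $ i) ^ alp i)) has_sum Re (g (\<chi> i. of_real ((0 + h) $ i)))) UNIV"
   by (simp add: o_def del: of_real_prod)
 qed
 show "analytic_at (%w::real^'e. Im (g (\<chi> i. of_real (w $ i)))) 0"
  unfolding analytic_at_def
 proof (intro exI[of _ rho] conjI rho exI[of _ "%alp. Im (c alp)"] allI impI)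
  fix h :: "real^'e" assume "ALL i. norm (h $ i) < rho"
  from has_sum_bounded_linear[OF bounded_linear_Im s[OF this]]
  show "((%alp. Im (c alp) * (\<Prod>i\<in>UNIV. (h $ i) ^ alp i)) has_sum Im (g (\<chi> i. of_real ((0 + h) $ i)))) UNIV"
   by (simp add: o_def del: of_real_prod)
 qed
qed

lemma analytic_at_complexify:
 fixes u :: "real^'d::finite => real"
 assumes "analytic_at u 0"
 shows "EX U::complex^'d => complex. analytic_at U 0 & (NEAR w. U (\<chi> i. of_real (w $ i)) = of_real (u w))"
proof -
 from assms obtain rho c where rho: "rho > 0" and
  c: "!!h. (ALL i. norm (h $ i) < rho) ==> ((%alp. c alp * (\<Prod>i\<in>UNIV. (h $ i) ^ alp i)) has_sum u (0 + h)) UNIV"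
  unfolding analytic_at_def by blast
 define U where "U h = (\<Sum>\<^sub>\<infinity>alp. of_real (c alp) * (\<Prod>i\<in>UNIV. (h $ i) ^ alp i))" for h :: "complex^'d"
 have s: "((%alp. of_real (c alp) * (\<Prod>i\<in>UNIV. (h $ i) ^ alp i)) has_sum U h) UNIV"
  if h: "ALL i. norm (h $ i) < rho" for h
 proof -
  have "(%alp. c alp * (\<Prod>i\<in>UNIV. norm (h $ i) ^ alp i)) summable_on UNIV"
   using has_sum_imp_summable[OF c[of "\<chi> i. norm (h $ i)"]] h by simp
  hence "(%alp. norm (c alp * (\<Prod>i\<in>UNIV. norm (h $ i) ^ alp i))) summable_on UNIV"
   by (rule summable_on_iff_abs_summable_on_real[THEN iffD1])
  hence "(%alp. norm (of_real (c alp) * (\<Prod>i\<in>UNIV. (h $ i) ^ alp i))) summable_on UNIV"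
   by (simp add: norm_mult prod_norm[symmetric] norm_power abs_mult abs_prod)
  from abs_summable_summable[OF this] show ?thesis unfolding U_def by (rule has_sum_infsum)
 qed
 have Ua: "analytic_at U 0"
  unfolding analytic_at_def using rho s by (intro exI[of _ rho] conjI exI[of _ "%alp. of_real (c alp)"]) auto
 have "NEAR w. U (\<chi> i. of_real (w $ i)) = of_real (u w)"
  using eventually_norm_less[OF rho]
 proof eventually_elim
  case (elim w)
  hence w: "ALL i. norm (w $ i) < rho" using norm_nth_le[of w] le_less_trans by blast
  have "((%alp. of_real (c alp * (\<Prod>i\<in>UNIV. (w $ i) ^ alp i)) :: complex) has_sum of_real (u w)) UNIV"
   using has_sum_of_real[OF c[OF w]] by (simp only: add_0)
  moreover have "((%alp. of_real (c alp * (\<Prod>i\<in>UNIV. (w $ i) ^ alp i))) has_sum U (\<chi> i. of_real (w $ i))) UNIV"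
   using s[of "\<chi> i. of_real (w $ i)"] w by simp
  ultimately show ?case by (rule has_sum_unique[rotated])
 qed
 with Ua show ?thesis by blast
qed

text \<open>Real and imaginary parts turn the problem into one on real space of twice the dimension.
  The real curve is complexified coordinate by coordinate and recombined by \<open>Lam\<close>; its
  equations hold for small positive real parameters, hence for all parameters near 0.\<close>

lemma curve_selection_complex: "curve_selection TYPE(complex^'d::finite)"
 unfolding curve_selection_def
proof (intro allI impI, elim conjE)
 fix E :: "(complex^'d => complex) set" and a z
 assume E: "finite E" "ALL f:E. analytic_at f 0" and a: "analytic_at a 0" and z: "z ----> 0"
  and eq: "ALL i. (ALL f:E. f (z i) = 0) & a (z i) ~= 0"
 define Lam :: "complex^('d + 'd) => complex^'d" where "Lam w = (\<chi> j. w $ Inl j + \<i> * w $ Inr j)" for w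
 define R where "R w = Lam (\<chi> i. of_real (w $ i))" for w :: "real^('d + 'd)"
 have Lama: "analytic_map_at Lam 0" unfolding analytic_map_at_def Lam_def by (auto intro!: analytic_intros)
 have Lam0: "Lam 0 = 0" by (simp add: Lam_def vec_eq_iff)
 have ri: "analytic_at (%w. Re (f (R w))) 0" "analytic_at (%w. Im (f (R w))) 0" if f: "analytic_at f 0" for f
 proof -
  have "analytic_at (%w. f (Lam w)) 0" by (rule analytic_at_compose[OF _ Lama]) (simp add: Lam0 f)
  from analytic_at_real_points[OF this] show "analytic_at (%w. Re (f (R w))) 0" "analytic_at (%w. Im (f (R w))) 0"
   by (simp_all add: R_def)
 qed
 define E' where "E' = (%f w. Re (f (R w))) ` E \<union> (%f w. Im (f (R w))) ` E"
 define a' where "a' w = (Re (a (R w)))^2 + (Im (a (R w)))^2" for w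
 have a'0: "a' w = 0 <-> a (R w) = 0" for w by (simp add: a'_def complex_eq_0)
 define z' where "z' i = (\<chi> s. case s of Inl j => Re (z i $ j) | Inr j => Im (z i $ j))" for i
 have Rz: "R (z' i) = z i" for i by (simp add: R_def Lam_def z'_def vec_eq_iff complex_eq_iff)
 have zj: "(%i. z i $ j) ----> 0" for j using tendsto_vec_nth[OF z, of j] by simp
 have z'l: "z' ----> 0"
 proof (rule vec_tendstoI)
  fix s
  show "(%i. z' i $ s) ----> 0 $ s"
   using tendsto_Re[OF zj] tendsto_Im[OF zj] by (cases s) (simp_all add: z'_def)
 qed
 have "\<exists>phi::real^1 => real^('d+'d). analytic_map_at phi 0 & phi 0 = 0 & (ALL f:E'. NEAR t. f (phi t) = 0) &
    (NEAR t. t ~= 0 --> a' (phi t) ~= 0)"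
 proof (rule curve_selection_real[unfolded curve_selection_def, rule_format, of E' a' z'], intro conjI z'l)
  show "finite E'" using E by (simp add: E'_def)
  show "ALL f:E'. analytic_at f 0" using E ri by (auto simp: E'_def)
  show "analytic_at a' 0" unfolding a'_def using ri[OF a] by (auto intro!: analytic_intros)
  show "ALL i. (ALL f:E'. f (z' i) = 0) & a' (z' i) ~= 0"     proof (intro allI conjI ballI)
   fix i show "a' (z' i) ~= 0" using eq by (simp add: a'0 Rz)
   fix f assume "f : E'"
   moreover have "ALL f:E. f (z i) = 0" using eq by blast
   ultimately show "f (z' i) = 0" unfolding E'_def by (auto simp: Rz)
  qed
 qed
 then obtain phi :: "real^1 => real^('d+'d)" where phi: "analytic_map_at phi 0" "phi 0 = 0"
  "ALL f:E'. NEAR t. f (phi t) = 0" "NEAR t. t ~= 0 --> a' (phi t) ~= 0" by blast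
 have "ALL s. EX U::complex^1 => complex. analytic_at U 0 & (NEAR w. U (\<chi> i. of_real (w $ i)) = of_real (phi w $ s))"
  using analytic_at_complexify phi(1) unfolding analytic_map_at_def by blast
 from choice[OF this] obtain U :: "'d + 'd => complex^1 => complex" where U: "!!s. analytic_at (U s) 0"
  "!!s. NEAR w. U s (\<chi> i. of_real (w $ i)) = of_real (phi w $ s)" by blast
 define Psi where "Psi t = Lam (\<chi> s. U s t)" for t
 have Ua: "analytic_map_at (%t. \<chi> s. U s t) 0" unfolding analytic_map_at_def using U(1) by simp
 have U0: "U s 0 = 0" for s
 proof -
  have "(\<chi> i. of_real ((0::real^1) $ i)) = (0::complex^1)" by (simp add: vec_eq_iff)
  thus ?thesis using eventually_nhds_x_imp_x[OF U(2)[of s]] phi(2) by simp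
 qed
 have U00: "(\<chi> s. U s 0) = 0" by (simp add: U0 vec_eq_iff)
 have Psia: "analytic_map_at Psi 0" unfolding Psi_def
  by (rule analytic_map_at_compose[of Lam, OF _ Ua]) (simp add: U00 Lama)
 have Psi0: "Psi 0 = 0" by (simp add: Psi_def U00 Lam0)
 have an: "analytic_at (%t. f (Psi t)) 0" if "analytic_at f 0" for f
  by (rule analytic_at_compose[OF _ Psia]) (simp add: Psi0 that)
 have "NEAR w. ALL s:UNIV. U s (\<chi> i. of_real (w $ i)) = of_real (phi w $ s)"
  by (intro eventually_ball_finite) (auto simp: U(2))
 hence PsiR: "NEAR w. Psi (\<chi> i. of_real (w $ i)) = R (phi w)"
  by eventually_elim (simp add: Psi_def R_def)
 define gam :: "real => complex^1" where "gam t = (\<chi> i. of_real ((vec t :: real^1) $ i))" for t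
 have vl: "((%t. vec t :: real^1) ---> 0) (at_right 0)" unfolding vec1_tendsto by (rule tendsto_ident_at)
 have gaml: "(gam ---> 0) (at_right 0)"
 proof (rule vec_tendstoI)
  fix i :: 1
  have "((%t::real. complex_of_real t) ---> of_real 0) (at_right 0)" by (rule tendsto_of_real[OF tendsto_ident_at])
  thus "((%t. gam t $ i) ---> 0 $ i) (at_right 0)" by (simp add: gam_def)
 qed
 have ne: "RIGHT t. (vec t :: real^1) ~= 0"
  using eventually_at_right_less[of "0::real"] by eventually_elim (simp add: vec_eq_iff)
 have ne': "RIGHT t. gam t ~= 0"
  using eventually_at_right_less[of "0::real"] by eventually_elim (simp add: vec_eq_iff gam_def)
 have Psigam: "RIGHT t. Psi (gam t) = R (phi (vec t))"
  using eventually_compose[OF PsiR vl] by (simp add: gam_def)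
 show "\<exists>phi::complex^1 => complex^'d. analytic_map_at phi 0 & phi 0 = 0 & (ALL f:E. NEAR t. f (phi t) = 0) &
    (NEAR t. t ~= 0 --> a (phi t) ~= 0)"
 proof (intro exI[of _ Psi] conjI ballI Psia Psi0)
  fix f assume f: "f : E"
  have "NEAR t. Re (f (R (phi t))) = 0" "NEAR t. Im (f (R (phi t))) = 0"
   using phi(3) f by (auto simp: E'_def)
  from eventually_compose[OF this(1) vl] eventually_compose[OF this(2) vl] Psigam
  have "RIGHT t. f (Psi (gam t)) = 0" by eventually_elim (simp add: complex_eq_iff)
  hence "\<exists>\<^sub>F t in at_right 0. f (Psi (gam t)) = 0" by (intro eventually_frequently) auto
  thus "NEAR t. f (Psi t) = 0"
   using frequently_zero_imp_zero[OF an gaml _ ne'] E f by auto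
 next
  have "~(NEAR t. a (Psi t) = 0)"
  proof
   assume 0: "NEAR t. a (Psi t) = 0"
   from eventually_compose[OF 0 gaml] eventually_compose[OF phi(4) vl] ne Psigam
   have "\<forall>\<^sub>F t in at_right (0::real). False" by eventually_elim (simp add: a'0)
   thus False by simp
  qed
  thus "NEAR t. t ~= 0 --> a (Psi t) ~= 0" by (rule nonzero_near_0[OF an[OF a]])
 qed
qed

text \<open>An inequality can be tested along analytic curves: the quotients \<open>b j / a\<close>, adjoined as
  new variables, tend to 0 along a sequence violating it.\<close>

lemma inequality_from_curves:
 fixes a :: "'a::{real_normed_field,euclidean_space}^'d::finite => 'a" and b :: "'q::finite => 'a^'d => 'a"
 assumes cs: "curve_selection TYPE('a^('d+'q))"
  and E: "finite E" "ALL f:E. analytic_at f 0" and a: "analytic_at a 0" and b: "ALL j. analytic_at (b j) 0"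
  and along: "!!phi::'a^1 => 'a^'d. analytic_map_at phi 0 ==> phi 0 = 0 ==> NEAR t. ALL f:E. f (phi t) = 0 ==>
   NEAR t. t ~= 0 --> a (phi t) ~= 0 ==> EX C>=0. NEAR t. norm (a (phi t)) <= C * (SUM j:UNIV. norm (b j (phi t)))"
 shows "EX C. NEAR z. (ALL f:E. f z = 0) --> norm (a z) <= C * (SUM j:UNIV. norm (b j z))"
proof (rule ccontr)
 assume fail: "~?thesis"
 have "EX z. norm z < inverse (real (Suc i)) & (ALL f:E. f z = 0) & norm (a z) > real i * (SUM j:UNIV. norm (b j z))" for i
 proof (rule ccontr)
  assume n: "\<nexists>z. norm z < inverse (real (Suc i)) & (ALL f:E. f z = 0) & norm (a z) > real i * (SUM j:UNIV. norm (b j z))"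
  have "NEAR z. (ALL f:E. f z = 0) --> norm (a z) <= real i * (SUM j:UNIV. norm (b j z))"
   by (rule eventually_mono[OF eventually_norm_less[of "inverse (real (Suc i))"]]) (simp, use n not_less in blast)
  with fail show False by blast
 qed
 then obtain z where z: "!!i. norm (z i) < inverse (real (Suc i))" "!!i. ALL f:E. f (z i) = 0"
  "!!i. norm (a (z i)) > real i * (SUM j:UNIV. norm (b j (z i)))" by metis
 have nz: "a (z i) ~= 0" for i
 proof -
  have "0 <= real i * (SUM j:UNIV. norm (b j (z i)))" by (intro mult_nonneg_nonneg sum_nonneg) auto
  thus ?thesis using z(3)[of i] by auto
 qed
 have zl: "z ----> 0"
 proof (rule Lim_null_comparison[OF _ LIMSEQ_inverse_real_of_nat])
  show "\<forall>\<^sub>F i in sequentially. norm (z i) <= inverse (real (Suc i))" by (intro always_eventually allI less_imp_le z(1))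
 qed
 have sl: "(%i. b j (z i) / a (z i)) ----> 0" for j
 proof (rule Lim_null_comparison)
  show "\<forall>\<^sub>F i in sequentially. norm (b j (z i) / a (z i)) <= inverse (real i)"
   using eventually_gt_at_top[of 0]
  proof eventually_elim
   case (elim i)
   have "real i * norm (b j (z i)) <= real i * (SUM j:UNIV. norm (b j (z i)))"
    by (intro mult_left_mono member_le_sum) auto
   with z(3)[of i] have "real i * norm (b j (z i)) <= norm (a (z i))" by linarith
   thus ?case using elim nz[of i] by (simp add: norm_divide divide_simps mult.commute)
  qed
  show "(%i. inverse (real i)) ----> 0" by (rule lim_inverse_n)
 qed
 define p where "p w = (\<chi> i. w $ Inl i)" for w :: "'a^('d+'q)"
 have pa: "analytic_map_at p 0" unfolding analytic_map_at_def p_def by (simp add: analytic_intros)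
 have p0: "p 0 = 0" by (simp add: p_def vec_eq_iff)
 have an: "analytic_at (%w. f (p w)) 0" if "analytic_at f 0" for f
  by (rule analytic_at_compose[OF _ pa]) (simp add: p0 that)
 define z' where "z' i = (\<chi> s. case s of Inl k => z i $ k | Inr j => b j (z i) / a (z i))" for i
 have pz: "p (z' i) = z i" for i by (simp add: p_def z'_def vec_eq_iff)
 \<comment> \<open>The new coordinates are tied to the quotients by
   \<open>b j = w $ Inr j * a\<close>, an equation that stays analytic where \<open>a\<close>
   vanishes.\<close>
 define E' where "E' = (%f w. f (p w)) ` E \<union> (%j w. b j (p w) - w $ Inr j * a (p w)) ` UNIV"
 have "\<exists>phi::'a^1 => 'a^('d+'q). analytic_map_at phi 0 & phi 0 = 0 & (ALL f:E'. NEAR t. f (phi t) = 0) &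
    (NEAR t. t ~= 0 --> a (p (phi t)) ~= 0)"
 proof (rule cs[unfolded curve_selection_def, rule_format, of E' "%w. a (p w)" z'], intro conjI an a)
  show "finite E'" using E by (simp add: E'_def)
  show "ALL f:E'. analytic_at f 0" using E an a b by (auto simp: E'_def intro!: analytic_intros)
  show "z' ----> 0"
  proof (rule vec_tendstoI)
   fix s show "(%i. z' i $ s) ----> 0 $ s"
    using tendsto_vec_nth[OF zl] sl by (cases s) (simp_all add: z'_def)
  qed
  show "ALL i. (ALL f:E'. f (z' i) = 0) & a (p (z' i)) ~= 0"
  proof (intro allI conjI ballI)
   fix i show "a (p (z' i)) ~= 0" by (simp add: pz nz)
   fix f assume "f : E'"
   thus "f (z' i) = 0" unfolding E'_def using z(2)[of i] nz[of i] by (auto simp: pz) (simp add: z'_def)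
  qed
 qed
 then obtain phi :: "'a^1 => 'a^('d+'q)" where phi: "analytic_map_at phi 0" "phi 0 = 0"
  "ALL f:E'. NEAR t. f (phi t) = 0" "NEAR t. t ~= 0 --> a (p (phi t)) ~= 0" by blast
 have E0: "NEAR t. ALL f:E'. f (phi t) = 0" by (intro eventually_ball_finite) (use phi(3) E in \<open>auto simp: E'_def\<close>)
 hence bs: "NEAR t. ALL j. b j (p (phi t)) = phi t $ Inr j * a (p (phi t))" by eventually_elim (simp add: E'_def ball_Un)
 have "EX C>=0. NEAR t. norm (a (p (phi t))) <= C * (SUM j:UNIV. norm (b j (p (phi t))))"
 proof (rule along)
  show "analytic_map_at (%t. p (phi t)) 0" by (rule analytic_map_at_compose[of p, OF _ phi(1)]) (simp add: phi(2) pa)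
  show "p (phi 0) = 0" by (simp add: phi(2) p0)
  show "NEAR t. ALL f:E. f (p (phi t)) = 0" using E0 by eventually_elim (auto simp: E'_def)
 qed (rule phi(4))
 then obtain C where C: "C >= 0" "NEAR t. norm (a (p (phi t))) <= C * (SUM j:UNIV. norm (b j (p (phi t))))" by blast
 \<comment> \<open>On the curve the quotients tend to 0, so \<open>C\<close> times the sum of their
   norms falls below 1, which contradicts the estimate along the curve.\<close>
 have "((%t. C * (SUM j:(UNIV::'q set). norm (phi t $ Inr j))) ---> C * (SUM j:(UNIV::'q set). norm (phi 0 $ Inr j))) (nhds 0)"
  by (intro tendsto_intros analytic_map_at_imp_tendsto[OF phi(1)])
 hence "NEAR t. C * (SUM j:(UNIV::'q set). norm (phi t $ Inr j)) < 1" using phi(2) by (auto dest: order_tendstoD(2)[of _ _ _ 1])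
 with bs C(2) phi(4) have "\<forall>\<^sub>F t in nhds (0::'a^1). t ~= 0 --> False"
 proof eventually_elim
  case (elim t)
  let ?A = "norm (a (p (phi t)))" and ?S = "C * (SUM j:(UNIV::'q set). norm (phi t $ Inr j))"
  have "?A <= ?S * ?A" using elim by (simp add: norm_mult sum_distrib_right mult.assoc)
  moreover have "t ~= 0 ==> ?S * ?A < 1 * ?A" using elim by (intro mult_strict_right_mono) auto
  ultimately show ?case by linarith
 qed
 hence "\<forall>\<^sub>F t in at (0::'a^1). False" by (simp add: eventually_at_filter)
 thus False by simp
qed

section \<open>Ranks and covectors\<close>

text \<open>Bilinear, without conjugation: covectors are elements of the same space, and the pairing
  is linear over the field in both arguments.\<close>

definition vdot :: "'a::comm_ring_1^'d::finite => 'a^'d => 'a" where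
 "vdot a v = (SUM l:UNIV. a $ l * v $ l)"

lemma vdot_simps [simp]:
 "vdot 0 v = 0" "vdot a 0 = 0" "vdot (axis l 1) v = v $ l" "vdot a (axis l c) = a $ l * c"
 by (simp_all add: vdot_def axis_def if_distrib if_distribR sum.delta cong: if_cong)

lemma vdot_add: "vdot a (v + w) = vdot a v + vdot a w" "vdot (a + b) v = vdot a v + vdot b v"
 by (simp_all add: vdot_def sum.distrib algebra_simps)

lemma vdot_diff: "vdot a (v - w) = vdot a v - vdot a w" "vdot (a - b) v = vdot a v - vdot b v"
 by (simp_all add: vdot_def sum_subtractf algebra_simps)

lemma vdot_smult: "vdot a (c *s v) = c * vdot a v" "vdot (c *s a) v = c * vdot a v"
 by (simp_all add: vdot_def sum_distrib_left algebra_simps)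

lemma vdot_sum: "vdot a (SUM i:I. v i) = (SUM i:I. vdot a (v i))"
 by (induction I rule: infinite_finite_induct) (simp_all add: vdot_add)

lemma vdot_commute: "vdot a v = vdot v a"
 by (simp add: vdot_def mult.commute)

text \<open>The vector of a linear functional that is 1 at \<open>r\<close> and 0 on a maximal
  independent subset of \<open>S\<close>.\<close>

lemma annihilator_exists:
 fixes S :: "('a::field^'d::finite) set"
 assumes "r ~: vec.span S"
 shows "EX v. (ALL s:S. vdot s v = 0) & vdot r v = 1"
proof -
 obtain B where B: "B <= S" "vec.independent B" "S <= vec.span B"
  using vec.maximal_independent_subset by blast
 have "r ~: vec.span B" using assms B(1) vec.span_mono by blast
 hence ind: "vec.independent (insert r B)" using B(2) vec.independent_insertI by blast
 obtain f :: "'a^'d => 'a^1" where f: "Vector_Spaces.linear (*s) (*s) f" "ALL x:insert r B. f x = (if x = r then vec 1 else 0)"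
  using vec.linear_independent_extend[OF ind, of "%x. if x = r then vec 1 else 0"] by blast
 define v where "v = row 1 (matrix f)"
 have fv: "f x $ 1 = vdot x v" for x
  using arg_cong[OF matrix_works[OF f(1), of x], of "%y. y $ 1"]
  by (simp add: matrix_vector_mult_def vdot_def v_def row_def mult.commute)
 have "r ~: B" using `r ~: vec.span B` vec.span_base by blast
 have b0: "vdot b v = 0" if "b : B" for b
 proof -
  have "b ~= r" using that `r ~: B` by blast
  hence "f b = 0" using f(2) that by simp
  thus ?thesis using fv[of b] by simp
 qed
 have "vdot s v = 0" if "s : S" for s
 proof -
  have "vec.subspace {x. vdot x v = 0}" by (simp add: vec.subspace_def vdot_add vdot_smult)
  hence "vec.span B <= {x. vdot x v = 0}" using b0 by (intro vec.span_minimal) auto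
  thus ?thesis using B(3) that by blast
 qed
 moreover have "vdot r v = 1" using f(2) fv[of r] by simp
 ultimately show ?thesis by blast
qed

lemma dual_family:
 fixes g :: "'i => 'a::field^'d::finite"
 assumes fin: "finite I" and ind: "!!c. (SUM i:I. c i *s g i) = 0 ==> ALL i:I. c i = 0"
 shows "EX b. ALL i:I. ALL k:I. vdot (g i) (b k) = (if i = k then 1 else 0)"
proof -
 have "EX v. ALL i:I. vdot (g i) v = (if i = k then 1 else 0)" if k: "k : I" for k
 proof -
  let ?T = "{SUM i:I - {k}. c i *s g i | c. True}"
  have "g k ~: vec.span (g ` (I - {k}))"
  proof
   assume "g k : vec.span (g ` (I - {k}))"
   moreover have "vec.span (g ` (I - {k})) <= ?T"
   proof (rule vec.span_minimal)
    show "g ` (I - {k}) <= ?T"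
    proof
    fix x assume "x : g ` (I - {k})"
    then obtain j where j: "j : I - {k}" "x = g j" by blast
    have "(SUM i:I - {k}. (if i = j then 1 else 0) *s g i) = x"
    using j fin by (subst sum.remove[of _ j]) (auto intro!: sum.neutral)
    thus "x : ?T" by (auto intro!: exI[of _ "%i. if i = j then 1 else 0"])
    qed
    show "vec.subspace ?T"
    proof (rule vec.subspaceI)
    show "0 : ?T" by (auto intro!: exI[of _ "%_. 0"])
    show "x + y : ?T" if "x : ?T" "y : ?T" for x y
    proof -
    from that obtain c d where "x = (SUM i:I - {k}. c i *s g i)" "y = (SUM i:I - {k}. d i *s g i)" by blast
    hence "x + y = (SUM i:I - {k}. (c i + d i) *s g i)" by (simp add: sum.distrib vector_sadd_rdistrib)
    thus ?thesis by (auto intro!: exI[of _ "%i. c i + d i"])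
    qed
    show "a *s x : ?T" if "x : ?T" for x a
    proof -
    from that obtain c where "x = (SUM i:I - {k}. c i *s g i)" by blast
    hence "a *s x = (SUM i:I - {k}. (a * c i) *s g i)" by (simp add: vec.scale_sum_right)
    thus ?thesis by (auto intro!: exI[of _ "%i. a * c i"])
    qed
    qed
   qed
   ultimately obtain c where c: "g k = (SUM i:I - {k}. c i *s g i)" by blast
   have "(SUM i:I. (if i = k then -1 else c i) *s g i) = - g k + (SUM i:I - {k}. c i *s g i)"
    using k fin by (subst sum.remove[of _ k]) (auto intro!: sum.cong)
   hence "(SUM i:I. (if i = k then -1 else c i) *s g i) = 0" using c by simp
   from ind[OF this] k show False by auto
  qed
  from annihilator_exists[OF this] show ?thesis by (auto simp: image_iff Ball_def)
 qed
 hence "ALL k:I. EX v. ALL i:I. vdot (g i) v = (if i = k then 1 else 0)" by (rule ballI)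
 from bchoice[OF this] obtain b where "ALL k:I. ALL i:I. vdot (g i) (b k) = (if i = k then 1 else 0)" ..
 thus ?thesis by (intro exI[of _ b]) simp
qed

section \<open>Rank and minors\<close>

lemma rank_ge_iff_rows:
 fixes A :: "'a::field^'d::finite^'p::finite"
 shows "e <= rank A <-> (EX I. card I = e & (ALL c. (SUM i:I. c i *s row i A) = 0 --> (ALL i:I. c i = 0)))"
proof
 assume e: "e <= rank A"
 obtain B where B: "B <= rows A" "vec.independent B" "card B = vec.dim (rows A)"
  using vec.basis_exists by metis
 have "e <= card B" using e B(3) by (simp add: row_rank_def_gen)
 then obtain B' where B': "B' <= B" "card B' = e" using obtain_subset_with_card_n by metis
 have indB': "vec.independent B'" using B(2) B'(1) vec.dependent_mono by blast
 have finB': "finite B'" using indB' vec.finiteI_independent by blast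
 have "ALL b:B'. EX i. row i A = b" using B(1) B'(1) by (auto simp: rows_def)
 from bchoice[OF this] obtain r where r: "ALL b:B'. row (r b) A = b" ..
 have inj: "inj_on r B'" using r by (metis inj_onI)
 show "EX I. card I = e & (ALL c. (SUM i:I. c i *s row i A) = 0 --> (ALL i:I. c i = 0))"
 proof (intro exI[of _ "r ` B'"] conjI allI impI)
  show "card (r ` B') = e" using B'(2) card_image[OF inj] by simp
  fix c assume "(SUM i:r ` B'. c i *s row i A) = 0"
  hence "(SUM b:B'. c (r b) *s b) = 0" using r by (simp add: sum.reindex[OF inj])
  from vec.independentD[OF indB' finB' subset_refl this] show "ALL i:r ` B'. c i = 0" by blast
 qed
next
 assume "EX I. card I = e & (ALL c. (SUM i:I. c i *s row i A) = 0 --> (ALL i:I. c i = 0))"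
 then obtain I :: "'p set" where I: "card I = e" "!!c. (SUM i:I. c i *s row i A) = 0 ==> ALL i:I. c i = 0" by blast
 have fin: "finite I" by simp
 from dual_family[of I "%i. row i A", OF fin I(2)] obtain b where b: "ALL i:I. ALL k:I. vdot (row i A) (b k) = (if i = k then 1 else 0)" by blast
 have inj: "inj_on (%i. row i A) I" using b by (intro inj_onI) (metis zero_neq_one)
 have "vec.independent ((%i. row i A) ` I)"
 proof
  assume "vec.dependent ((%i. row i A) ` I)"
  then obtain u v where u: "v : (%i. row i A) ` I" "u v ~= 0" "(SUM v:(%i. row i A) ` I. u v *s v) = 0"
   unfolding vec.dependent_finite[OF finite_imageI[OF fin]] by blast
  hence "(SUM i:I. u (row i A) *s row i A) = 0" by (simp add: sum.reindex[OF inj])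
  from I(2)[OF this] u show False by blast
 qed
 moreover have "(%i. row i A) ` I <= rows A" by (auto simp: rows_def)
 ultimately have "card ((%i. row i A) ` I) <= rank A"
  unfolding row_rank_def_gen by (intro vec.independent_card_le_dim)
 thus "e <= rank A" using card_image[OF inj] I(1) by simp
qed

text \<open>The minor of \<open>A\<close> with rows \<open>I\<close> and columns \<open>t ` I\<close>, bordered by an identity matrix.\<close>

definition bordered :: "'p::finite set => ('p => 'd) => 'a::field^'d::finite^'p => 'a^'p^'p" where
 "bordered I t A = (\<chi> j i. if j : I then (if i : I then A $ i $ t j else 0) else if i = j then 1 else 0)"

lemma det_sum_nonzero:
 fixes a :: "'p::finite => 'd::finite => 'a::field^'p" and c :: "'p => 'a^'p"
 assumes "finite T" "det (\<chi> j. if j : T then SUM k:UNIV. a j k else c j) ~= 0"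
 shows "EX t. det (\<chi> j. if j : T then a j (t j) else c j) ~= 0"
 using assms
proof (induction T arbitrary: c rule: finite_induct)
 case (insert k T)
 have "(\<chi> j. if j : insert k T then SUM k:UNIV. a j k else c j) =
  (\<chi> j. if j = k then SUM l:UNIV. a j l else if j : T then SUM k:UNIV. a j k else c j)" by (simp add: vec_eq_iff)
 with insert.prems have "(SUM l:UNIV. det (\<chi> j. if j = k then a j l else if j : T then SUM k:UNIV. a j k else c j)) ~= 0"
  using det_linear_row_sum[of "UNIV::'d set" k a "%j. if j : T then SUM k:UNIV. a j k else c j"] by simp
 then obtain l where l: "det (\<chi> j. if j = k then a j l else if j : T then SUM k:UNIV. a j k else c j) ~= 0"
  using sum.not_neutral_contains_not_neutral by blast
 have "(\<chi> j. if j = k then a j l else if j : T then SUM k:UNIV. a j k else c j) =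
  (\<chi> j. if j : T then SUM k:UNIV. a j k else if j = k then a j l else c j)" using insert.hyps by (simp add: vec_eq_iff)
 with l have "det (\<chi> j. if j : T then SUM k:UNIV. a j k else if j = k then a j l else c j) ~= 0" by simp
 from insert.IH[OF this] obtain t where t: "det (\<chi> j. if j : T then a j (t j) else if j = k then a j l else c j) ~= 0" ..
 have "(\<chi> j. if j : T then a j (t j) else if j = k then a j l else c j) =
  (\<chi> j. if j : insert k T then a j ((t(k := l)) j) else c j)" using insert.hyps by (auto simp: vec_eq_iff)
 with t show ?case by metis
qed simp

text \<open>If the rows in \<open>I\<close> are independent, they have dual vectors
  \<open>b\<close>, and combining the columns with the coefficients \<open>b j\<close> gives the
  identity matrix. Its determinant expands multilinearly over the choices of columns, so some choice
  \<open>t\<close> gives a nonzero minor. Conversely, a dependence of the rows gives a kernel vector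
  of the bordered matrix.\<close>

lemma rank_ge_iff_minor:
 fixes A :: "'a::field^'d::finite^'p::finite"
 shows "e <= rank A <-> (EX I t. card I = e & det (bordered I t A) ~= 0)"
proof
 assume "EX I t. card I = e & det (bordered I t A) ~= 0"
 then obtain I :: "'p set" and t where I: "card I = e" "det (bordered I t A) ~= 0" by blast
 have "EX B. B ** bordered I t A = mat 1" using I(2) invertible_det_nz[of "bordered I t A"] by (auto simp: invertible_def)
 hence ker: "!!x. bordered I t A *v x = 0 ==> x = 0" unfolding matrix_left_invertible_ker by blast
 show "e <= rank A" unfolding rank_ge_iff_rows
 proof (intro exI[of _ I] conjI allI impI I(1) ballI)
  fix c i assume c: "(SUM i:I. c i *s row i A) = 0" and i: "i : I"
  define x where "x = (\<chi> i. if i : I then c i else 0)"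
  have "bordered I t A *v x = 0"
  proof (simp add: vec_eq_iff, rule allI)
   fix j
   show "(bordered I t A *v x) $ j = 0"
   proof (cases "j : I")
    case True
    have "(bordered I t A *v x) $ j = (SUM i:UNIV. if i : I then A $ i $ t j * c i else 0)"
    using True by (auto simp: bordered_def matrix_vector_mult_def x_def intro!: sum.cong)
    also have "... = (SUM i:I. A $ i $ t j * c i)" by (simp add: sum.If_cases)
    also have "... = (SUM i:I. c i *s row i A) $ t j" by (simp add: row_def mult.commute)
    finally show ?thesis using c by simp
   next
    case False
    hence "(bordered I t A *v x) $ j = (SUM i:UNIV. (if i = j then 1 else 0) * x $ i)"
    unfolding bordered_def matrix_vector_mult_def by simp
    also have "... = (SUM i:UNIV. if i = j then x $ i else 0)" by (rule sum.cong) auto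
    finally have "(bordered I t A *v x) $ j = (SUM i:UNIV. if i = j then x $ i else 0)" .
    thus ?thesis using False by (simp add: x_def)
   qed
  qed
  from ker[OF this] have "x $ i = 0" by simp
  thus "c i = 0" using i by (simp add: x_def)
 qed
next
 assume "e <= rank A"
 then obtain I :: "'p set" where I: "card I = e" "!!c. (SUM i:I. c i *s row i A) = 0 ==> ALL i:I. c i = 0"
  unfolding rank_ge_iff_rows by blast
 have "finite I" by simp
 from dual_family[of I "%i. row i A", OF this I(2)]
 obtain b where b: "ALL i:I. ALL k:I. vdot (row i A) (b k) = (if i = k then 1 else 0)" by blast
 define k0 :: 'd where "k0 = undefined"
 define M where "M j k = (if j : I then (\<chi> i. if i : I then A $ i $ k else 0) else axis j 1)" for j k
 \<comment> \<open>For rows outside \<open>I\<close> all weight is put on the single index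
   \<open>k0\<close>, so that the sum over the columns is \<open>axis j 1\<close>.\<close>
 define C where "C j k = (if j : I then b j $ k else if k = k0 then 1 else 0)" for j k
 have "(\<chi> j. SUM k:UNIV. C j k *s M j k) = (mat 1 :: 'a^'p^'p)"
 proof -
  have "(SUM k:UNIV. C j k *s M j k) $ i = (if j = i then 1 else 0)" for i j
  proof (cases "j : I")
   case True
   hence "(SUM k:UNIV. C j k *s M j k) $ i = (SUM k:UNIV. if i : I then A $ i $ k * b j $ k else 0)"
    by (auto simp: C_def M_def mult.commute intro!: sum.cong)
   also have "... = (if i : I then vdot (row i A) (b j) else 0)" by (simp add: vdot_def row_def)
   finally show ?thesis using b True by auto
  next
   case False
   hence "C j k *s M j k = (if k = k0 then axis j 1 else 0)" for k by (simp add: C_def M_def)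
   hence "(SUM k:UNIV. C j k *s M j k) = (SUM k:UNIV. if k = k0 then axis j 1 else 0)" by simp
   thus ?thesis by (simp add: axis_def)
  qed
  thus ?thesis by (simp add: vec_eq_iff mat_def)
 qed
 hence "det (\<chi> j. SUM k:UNIV. C j k *s M j k) ~= 0" by simp
 hence "det (\<chi> j. if j : UNIV then SUM k:UNIV. C j k *s M j k else 0) ~= 0" by simp
 from det_sum_nonzero[OF _ this] obtain t where "det (\<chi> j. C j (t j) *s M j (t j)) ~= 0" by auto
 hence "det (\<chi> j. M j (t j)) ~= 0" unfolding det_rows_mul by auto
 moreover have "(\<chi> j. M j (t j)) = bordered I t A" by (auto simp: vec_eq_iff M_def bordered_def axis_def)
 ultimately show "EX I t. card I = e & det (bordered I t A) ~= 0" using I(1) by auto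
qed

lemma analytic_at_minor:
 assumes "ALL i j. analytic_at (%z. A z $ i $ j) z"
 shows "analytic_at (%z. det (bordered I t (A z))) z"
proof -
 have "analytic_at (%w. bordered I t (A w) $ i $ j) z" for i j
  using assms by (cases "i : I"; cases "j : I") (simp_all add: bordered_def)
 thus ?thesis unfolding det_def by (auto intro!: analytic_intros)
qed

lemma eventually_rank_ge:
 fixes A :: "'v::t2_space => 'a::{real_normed_field}^'d::finite^'p::finite"
 assumes "ALL i j. isCont (%z. A z $ i $ j) z" "e <= rank (A z)"
 shows "\<forall>\<^sub>F w in nhds z. e <= rank (A w)"
proof -
 from assms(2) obtain I t where I: "card I = e" "det (bordered I t (A z)) ~= 0" unfolding rank_ge_iff_minor by blast
 have c: "((%w. A w $ i $ j) ---> A z $ i $ j) (nhds z)" for i j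
  using assms(1) tendsto_at_iff_tendsto_nhds[of "%w. A w $ i $ j" z] unfolding isCont_def by simp
 have "((%w. det (bordered I t (A w))) ---> det (bordered I t (A z))) (nhds z)"
  unfolding det_def bordered_def by (intro tendsto_intros) (auto intro!: tendsto_intros c)
 from tendsto_imp_eventually_ne[OF this I(2)] show ?thesis
  by (rule eventually_mono) (use I(1) in \<open>auto simp: rank_ge_iff_minor\<close>)
qed

section \<open>Modules over germs of curves\<close>

text \<open>Over the discrete valuation ring of germs in one variable, membership in a submodule can be
  tested by scalar equations: eliminate one coordinate with a pivot of minimal order.\<close>

definition germ_module :: "('a::{real_normed_field,euclidean_space}^1 => 'a^'p::finite) set => bool" where
 "germ_module N <-> (ALL g:N. analytic_map_at g 0) &
   (ALL g:N. ALL h:N. ALL c. analytic_at c 0 --> (%t. h t - c t *s g t) : N) &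
   (ALL g:N. ALL h. analytic_map_at h 0 & (NEAR t. h t = g t) --> h : N)"

lemma order_division:
 assumes "analytic_at u 0" "analytic_at v 0" "u 0 ~= 0" "NEAR t. f t = (t $ 1) ^ m * u t"
  "NEAR t. g t = (t $ 1) ^ n * v t" "m <= n"
 shows "EX c. analytic_at c 0 & (NEAR t. g t = c t * f t)"
proof (intro exI conjI)
 show "analytic_at (%t. (t $ 1) ^ (n - m) * (v t * inverse (u t))) 0"
  using assms(1-3) by (auto intro!: analytic_intros analytic_at_inverse)
 have "NEAR t. u t ~= 0" by (rule tendsto_imp_eventually_ne[OF analytic_at_imp_tendsto[OF assms(1)] assms(3)])
 with assms(4,5) show "NEAR t. g t = (t $ 1) ^ (n - m) * (v t * inverse (u t)) * f t"
 proof eventually_elim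
  case (elim t)
  have "(t $ 1) ^ n = (t $ 1) ^ (n - m) * (t $ 1) ^ m" using assms(6) by (simp flip: power_add)
  thus ?case using elim by (simp add: field_simps)
 qed
qed

lemma order_smallo:
 fixes u v :: "'a::{real_normed_field,euclidean_space}^1 => 'a"
 assumes "analytic_at u 0" "analytic_at v 0" "u 0 ~= 0" "NEAR t. f t = (t $ 1) ^ m * u t"
  "NEAR t. g t = (t $ 1) ^ n * v t" "m < n"
 shows "g : o[at 0](f)"
proof (rule smalloI_tendsto)
 from order_division[OF assms(1-5)] assms(6) have *: "m <= n" by simp
 have un: "NEAR t. u t ~= 0" by (rule tendsto_imp_eventually_ne[OF analytic_at_imp_tendsto[OF assms(1)] assms(3)])
 with assms(4) have "NEAR t. t ~= 0 --> f t ~= 0"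
  by eventually_elim (auto simp: vec_eq_iff forall_1)
 thus fn: "PUNCT t. f t ~= 0" by (simp add: eventually_at_filter)
 define w where "w t = (t $ 1) ^ (n - m) * (v t * inverse (u t))" for t :: "'a^1"
 have "analytic_at w 0" unfolding w_def using assms(1-3) by (auto intro!: analytic_intros analytic_at_inverse)
 hence "(w ---> w 0) (nhds 0)" by (rule analytic_at_imp_tendsto)
 moreover have "w 0 = 0" using assms(6) by (simp add: w_def)
 ultimately have "(w ---> 0) (at 0)" using tendsto_mono[OF at_le] by (simp add: tendsto_nhds_iff)
 moreover have "NEAR t. t ~= 0 --> g t / f t = w t"
  using assms(4,5) un
 proof eventually_elim
  case (elim t)
  have "(t $ 1) ^ n = (t $ 1) ^ (n - m) * (t $ 1) ^ m" using * by (simp flip: power_add)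
  thus ?case using elim by (auto simp: field_simps w_def vec_eq_iff forall_1)
 qed
 ultimately show "((%t. g t / f t) ---> 0) (at 0)"
  by (subst tendsto_cong[of _ w]) (auto simp: eventually_at_filter)
qed

text \<open>Induction on the coordinates, eliminating one of them with a pivot \<open>g\<close>
  whose entry has minimal order in \<open>N\<close>. If the entry of \<open>h\<close> has smaller
  order than those of all members of \<open>N\<close>, this coordinate itself separates. Otherwise
  \<open>h\<close> and the members of \<open>N\<close> are reduced by multiples of \<open>g\<close>.
  Only the growth of the pairings matters; \<open>alp\<close> is an arbitrary function of the
  parameter.\<close>

lemma germ_module_separation:
 fixes N :: "('a::{real_normed_field,euclidean_space}^1 => 'a^'p::finite) set" and A :: "'p set"
 assumes "germ_module N" "analytic_map_at h 0" "h ~: N" "N ~= {}"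
  "ALL g:insert h N. ALL k. k ~: A --> (NEAR t. g t $ k = 0)"
 shows "\<exists>alp. (PUNCT t. vdot (alp t) (h t) ~= 0) &
  (ALL g:N. (%t. vdot (alp t) (g t)) : o[at 0](%t. vdot (alp t) (h t)))"
proof -
 have "finite A" by simp
 thus ?thesis using assms
 proof (induction A arbitrary: N h rule: finite_induct)
  case empty
  have "NEAR t. ALL k:UNIV. h t $ k = 0" by (intro eventually_ball_finite) (use empty in auto)
  hence h0: "NEAR t. h t = 0" by (rule eventually_mono) (simp add: vec_eq_iff)
  obtain g where g: "g : N" using empty by blast
  have "(%t. g t - 1 *s g t) : N" using empty.prems(1) g analytic_at_const[of 1] unfolding germ_module_def by blast
  hence "(%t. 0) : N" by simp
  moreover have "ALL g:N. ALL h. analytic_map_at h 0 & (NEAR t. h t = g t) --> h : N"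
   using empty.prems(1) unfolding germ_module_def by (elim conjE)
  ultimately have "h : N" using empty.prems(2) h0 by (elim ballE allE[of _ h]) auto
  thus ?case using empty.prems(3) by (elim notE)
 next
  case (insert k A)
  note N = insert.prems(1)
  have an: "analytic_at (%t. g t $ k) 0" if "g : insert h N" for g
   using N insert.prems(2) that by (auto simp: germ_module_def analytic_map_at_def)
  define ord where "ord u m <-> (EX v. analytic_at v 0 & v 0 ~= 0 & (NEAR t. u t = (t $ 1) ^ m * v t))"
   for u :: "'a^1 => 'a" and m
  have ordc: "(NEAR t. g t $ k = 0) | (EX m. ord (%t. g t $ k) m)" if "g : insert h N" for g
   using analytic_at_order[OF an[OF that]] by (auto simp only: ord_def)
  have zero_case: ?case if z: "ALL g:N. NEAR t. g t $ k = 0" "NEAR t. h t $ k = 0"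
  proof (rule insert.IH[OF N insert.prems(2-4)], intro ballI allI impI)
   fix g l assume "g : insert h N" "l ~: A"
   thus "NEAR t. g t $ l = 0" using insert.prems(5) z by (cases "l = k") auto
  qed
  have coord_case: ?case if m: "ord (%t. h t $ k) m"
   and less: "ALL g:N. (NEAR t. g t $ k = 0) | (EX n>m. ord (%t. g t $ k) n)" for m
  proof (intro exI[of _ "%_. axis k 1"] conjI ballI)
   from m obtain v where v: "analytic_at v 0" "v 0 ~= 0" "NEAR t. h t $ k = (t $ 1) ^ m * v t" by (auto simp: ord_def)
   have "NEAR t. v t ~= 0" by (rule tendsto_imp_eventually_ne[OF analytic_at_imp_tendsto[OF v(1)] v(2)])
   with v(3) have "NEAR t. t ~= 0 --> h t $ k ~= 0" by eventually_elim (auto simp: vec_eq_iff forall_1)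
   thus "PUNCT t. vdot (axis k 1) (h t) ~= 0" by (simp add: eventually_at_filter)
   fix g assume "g : N"
   with less consider "NEAR t. g t $ k = 0" | n where "n > m" "ord (%t. g t $ k) n" by blast
   thus "(%t. vdot (axis k 1) (g t)) : o[at 0](%t. vdot (axis k 1) (h t))"
   proof cases
    case 1
    hence "PUNCT t. g t $ k = 0" by (auto simp: eventually_at_filter elim: eventually_mono)
    thus ?thesis by (simp add: landau_o.small.in_cong)
   next
    case 2
    then obtain w where "analytic_at w 0" "NEAR t. g t $ k = (t $ 1) ^ n * w t" by (auto simp: ord_def)
    from order_smallo[OF v(1) this(1) v(2,3) this(2) 2(1)] show ?thesis by simp
   qed
  qed
  show ?case
  proof (cases "ALL g:N. NEAR t. g t $ k = 0")
   case True
   show ?thesis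
   proof (cases "NEAR t. h t $ k = 0")
    case False
    then obtain m where "ord (%t. h t $ k) m" using ordc by blast
    thus ?thesis using coord_case True by blast
   qed (use zero_case True in blast)
  next
   case False
   define m where "m = (LEAST m. EX g:N. ord (%t. g t $ k) m)"
   have "EX m. EX g:N. ord (%t. g t $ k) m" using False ordc by blast
   from LeastI_ex[OF this] obtain g where g: "g : N" "ord (%t. g t $ k) m" unfolding m_def by blast
   have least: "m <= n" if "f : N" "ord (%t. f t $ k) n" for f n unfolding m_def using that by (intro Least_le) blast
   from g(2) obtain u where u: "analytic_at u 0" "u 0 ~= 0" "NEAR t. g t $ k = (t $ 1) ^ m * u t"
    by (auto simp: ord_def)
   have un: "NEAR t. u t ~= 0" by (rule tendsto_imp_eventually_ne[OF analytic_at_imp_tendsto[OF u(1)] u(2)])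
   with u(3) have gn: "PUNCT t. g t $ k ~= 0"
    unfolding eventually_at_filter by eventually_elim (auto simp: vec_eq_iff forall_1)
   have div: "EX c. analytic_at c 0 & (NEAR t. f t $ k = c t * g t $ k)"
    if "(NEAR t. f t $ k = 0) | (EX n>=m. ord (%t. f t $ k) n)" for f :: "'a^1 => 'a^'p"
    using that
   proof
    assume "NEAR t. f t $ k = 0"
    thus ?thesis by (intro exI[of _ "%_. 0"]) simp
   next
    assume "EX n>=m. ord (%t. f t $ k) n"
    then obtain n w where "n >= m" "analytic_at w 0" "NEAR t. f t $ k = (t $ 1) ^ n * w t" by (auto simp: ord_def)
    from order_division[OF u(1) this(2) u(2,3) this(3,1)] show ?thesis .
   qed
   show ?thesis
   proof (cases "(NEAR t. h t $ k = 0) | (EX n>=m. ord (%t. h t $ k) n)")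
    case False
    then obtain n where n: "ord (%t. h t $ k) n" "n < m" using ordc[of h] by (metis insertI1 not_le)
    show ?thesis
    proof (rule coord_case[OF n(1)], rule ballI)
    fix f assume f: "f : N"
    show "(NEAR t. f t $ k = 0) | (EX n'>n. ord (%t. f t $ k) n')"
    using ordc[of f] least[OF f] f n(2) by (meson insertI2 le_less_trans not_le less_le_trans)
    qed
   next
    case True
    from div[OF this] obtain c where c: "analytic_at c 0" "NEAR t. h t $ k = c t * g t $ k" by blast
    define h' where "h' t = h t - c t *s g t" for t
    define N' where "N' = {f:N. NEAR t. f t $ k = 0}"
    have h'k: "NEAR t. h' t $ k = 0" using c(2) by eventually_elim (simp add: h'_def)
    have ga: "analytic_map_at g 0" using N g(1) by (simp add: germ_module_def)
    have h'a: "analytic_map_at h' 0"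
    using insert.prems(2) ga c(1) unfolding analytic_map_at_def h'_def by (auto intro!: analytic_intros)
    have sub: "(%t. f t - d t *s e t) : N" if "f : N" "e : N" "analytic_at d 0" for f d e
    using N that unfolding germ_module_def by blast
    have h'N: "h' ~: N"
    proof
    assume "h' : N"
    from sub[OF this g(1), of "%t. - c t"] c(1) have "(%t. h' t - (- c t) *s g t) : N" by (auto intro: analytic_intros)
    moreover have "(%t. h' t - (- c t) *s g t) = h" by (simp add: fun_eq_iff h'_def)
    ultimately show False using insert.prems(3) by simp
    qed
    have gg: "(%t. g t - 1 *s g t) : N" using sub[OF g(1) g(1), of "%_. 1"] by simp
    have gm: "germ_module N'"
    unfolding germ_module_def
    proof (intro conjI ballI allI impI)
    show "analytic_map_at f 0" if "f : N'" for f using that N by (simp add: N'_def germ_module_def)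
    fix e f and d :: "'a^1 => 'a" assume ef: "e : N'" "f : N'" "analytic_at d 0"
    have "NEAR t. e t $ k = 0" "NEAR t. f t $ k = 0" using ef by (simp_all add: N'_def)
    hence "NEAR t. (f t - d t *s e t) $ k = 0" by eventually_elim simp
    thus "(%t. f t - d t *s e t) : N'" using sub[of f e d] ef by (simp add: N'_def)
    next
    fix e f assume ef: "e : N'" "analytic_map_at f 0 & (NEAR t. f t = e t)"
    have "NEAR t. e t $ k = 0" "NEAR t. f t = e t" using ef by (simp_all add: N'_def)
    hence "NEAR t. f t $ k = 0" by eventually_elim simp
    moreover have "f : N" using N ef unfolding germ_module_def N'_def by blast
    ultimately show "f : N'" by (simp add: N'_def)
    qed
    have supp: "NEAR t. f t $ l = 0" if f: "f : insert h' N'" and l: "l ~: A" for f l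
    proof (cases "l = k")
    case True
    thus ?thesis using f h'k by (auto simp: N'_def)
    next
    case False
    hence z: "NEAR t. e t $ l = 0" if "e : insert h N" for e using insert.prems(5) that l by auto
    show ?thesis
    proof (cases "f = h'")
    case True
    from z[of h] z[of g] g(1) have "NEAR t. h t $ l = 0" "NEAR t. g t $ l = 0" by auto
    hence "NEAR t. h' t $ l = 0" by eventually_elim (simp add: h'_def)
    thus ?thesis by (simp add: True)
    qed (use f z in \<open>auto simp: N'_def\<close>)
    qed
    have "\<exists>alp. (PUNCT t. vdot (alp t) (h' t) ~= 0) &
    (ALL g:N'. (%t. vdot (alp t) (g t)) : o[at 0](%t. vdot (alp t) (h' t)))"
    proof (rule insert.IH[OF gm h'a])
    show "h' ~: N'" using h'N by (simp add: N'_def)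
    have "(%t. g t - 1 *s g t) : N'" using gg by (simp add: N'_def)
    thus "N' ~= {}" by blast
    show "ALL g:insert h' N'. ALL k. k ~: A --> (NEAR t. g t $ k = 0)" using supp by blast
    qed
    then obtain alp where alp: "PUNCT t. vdot (alp t) (h' t) ~= 0"
    "ALL g:N'. (%t. vdot (alp t) (g t)) : o[at 0](%t. vdot (alp t) (h' t))" by blast
    \<comment> \<open>Corrects \<open>alp\<close> in coordinate \<open>k\<close> so that it kills
      \<open>g\<close>; reduction by multiples of \<open>g\<close> then does not change the
      pairing.\<close>
    define bet where "bet t = alp t - axis k (vdot (alp t) (g t) / g t $ k)" for t
    have betg: "PUNCT t. vdot (bet t) (g t) = 0"
    using gn by eventually_elim (simp add: bet_def vdot_diff vdot_commute[of "axis _ _"])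
    have bet0: "vdot (bet t) v = vdot (alp t) v" if "v $ k = 0" for t v
    using that by (simp add: bet_def vdot_diff vdot_commute[of "axis _ _"])
    have toat: "PUNCT t. Q t" if "NEAR t. Q t" for Q :: "'a^1 => bool"
    using that by (auto simp: eventually_at_filter elim: eventually_mono)
    have beth: "PUNCT t. vdot (bet t) (h t) = vdot (alp t) (h' t)"
    using toat[OF h'k] betg
    proof eventually_elim
    case (elim t)
    have "vdot (bet t) (h' t) = vdot (bet t) (h t)" unfolding h'_def using elim(2) by (simp add: vdot_diff vdot_smult)
    thus ?case using bet0[OF elim(1)] by simp
    qed
    show ?thesis
    proof (intro exI[of _ bet] conjI ballI)
    show "PUNCT t. vdot (bet t) (h t) ~= 0" using beth alp(1) by eventually_elim simp
    fix f assume f: "f : N"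
    have "(NEAR t. f t $ k = 0) | (EX n>=m. ord (%t. f t $ k) n)" using ordc[of f] least[OF f] f by blast
    from div[OF this] obtain d where d: "analytic_at d 0" "NEAR t. f t $ k = d t * g t $ k" by blast
    define f' where "f' t = f t - d t *s g t" for t
    have f'k: "NEAR t. f' t $ k = 0" using d(2) by eventually_elim (simp add: f'_def)
    have "f' : N'" using f'k sub[OF f g(1) d(1)] by (simp add: N'_def f'_def[abs_def])
    hence o: "(%t. vdot (alp t) (f' t)) : o[at 0](%t. vdot (alp t) (h' t))" using alp(2) by blast
    have "PUNCT t. vdot (bet t) (f t) = vdot (alp t) (f' t)"
    using toat[OF f'k] betg
    proof eventually_elim
    case (elim t)
    have "vdot (bet t) (f' t) = vdot (bet t) (f t)" unfolding f'_def using elim(2) by (simp add: vdot_diff vdot_smult)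
    thus ?case using bet0[OF elim(1)] by simp
    qed
    from landau_o.small.cong_ex[OF this beth] o
    show "(%t. vdot (bet t) (f t)) : o[at 0](%t. vdot (bet t) (h t))" by simp
    qed
   qed
  qed
 qed
qed

section \<open>Iterated derivatives\<close>

lemma frechet_derivative_cong:
 assumes "open U" "x : U" "!!y. y : U ==> f y = g y"
 shows "fder f x = fder g x"
 unfolding frechet_derivative_def
 using has_derivative_transform_within_open[OF _ assms(1,2), of f _ UNIV g] assms(3)
  has_derivative_transform_within_open[OF _ assms(1,2), of g _ UNIV f] by (metis (no_types, lifting))

lemma dderiv_cong:
 assumes "open U" "!!y. y : U ==> f y = g y" "x : U"
 shows "dderiv vs f x = dderiv vs g x"
 using assms(2)
proof (induction vs arbitrary: f g)
 case Nil
 thus ?case using assms by simp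
next
 case (Cons v vs)
 have "fder f y v = fder g y v" if "y : U" for y
  using frechet_derivative_cong[OF assms(1) that Cons.prems] by simp
 from Cons.IH[OF this] show ?case by simp
qed

lemma C_on_0: "C_on 0 U g <-> continuous_on U g"
 by (simp add: C_on_def)

lemma C_on_Suc: "C_on (Suc r) U g <-> continuous_on U g & (ALL x:U. g differentiable at x) &
  (ALL v. C_on r U (%x. fder g x v))"
proof -
 have 1: "(ALL vs. length vs < Suc r --> Q vs) <-> Q [] & (ALL v vs. length vs < r --> Q (v # vs))" for Q :: "'a list => bool"
  by (metis Suc_less_eq length_Cons length_greater_0_conv list.exhaust list.size(3) zero_less_Suc)
 have 2: "(ALL vs. length vs <= Suc r --> Q vs) <-> Q [] & (ALL v vs. length vs <= r --> Q (v # vs))" for Q :: "'a list => bool"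
  by (metis Suc_le_mono length_Cons le0 list.exhaust list.size(3))
 show ?thesis unfolding C_on_def 1 2 dderiv.simps by blast
qed

lemma C_on_continuous: "C_on r U g ==> continuous_on U g"
 by (cases r) (simp_all add: C_on_0 C_on_Suc)

lemma C_on_subset: "C_on r U g ==> V <= U ==> C_on r V g"
 unfolding C_on_def using continuous_on_subset by blast

lemma C_on_le: "C_on r U g ==> k <= r ==> C_on k U g"
 unfolding C_on_def by auto

lemma C_on_cong:
 assumes "open U" "!!y. y : U ==> f y = g y" "C_on r U f"
 shows "C_on r U g"
proof -
 have eq: "dderiv vs f x = dderiv vs g x" if "x : U" for vs x by (rule dderiv_cong[OF assms(1,2) that])
 have "dderiv vs g differentiable at x" if x: "x : U" and d: "dderiv vs f differentiable at x" for vs x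
 proof -
  from d obtain D where "(dderiv vs f has_derivative D) (at x)" by (auto simp: differentiable_def)
  from has_derivative_transform_within_open[OF this assms(1) x eq] show ?thesis by (auto simp: differentiable_def)
 qed
 moreover have "continuous_on U (dderiv vs g)" if "continuous_on U (dderiv vs f)" for vs
  using that eq by (simp cong: continuous_on_cong)
 ultimately show ?thesis using assms(3) unfolding C_on_def by blast
qed

lemma C_on_SucI:
 assumes "open U" "!!x. x : U ==> (g has_derivative D x) (at x)" "!!v. C_on r U (%x. D x v)"
 shows "C_on (Suc r) U g"
 unfolding C_on_Suc
proof (intro conjI ballI allI)
 show "continuous_on U g"
  using assms(2) by (intro continuous_at_imp_continuous_on) (auto dest: has_derivative_continuous)
 show "g differentiable at x" if "x : U" for x using assms(2)[OF that] by (auto simp: differentiable_def)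
 show "C_on r U (%x. fder g x v)" for v
  by (rule C_on_cong[OF assms(1) _ assms(3)[of v]]) (simp flip: frechet_derivative_at[OF assms(2)])
qed

lemma C_on_local:
 assumes "!!x. x : U ==> EX V. open V & x : V & C_on r V g"
 shows "C_on r U g"
 unfolding C_on_def
proof (intro conjI allI impI ballI)
 fix vs :: "'a list" and x assume "length vs < r" "x : U"
 with assms[of x] obtain V where "x : V" "C_on r V g" by blast
 thus "dderiv vs g differentiable at x" using `length vs < r` unfolding C_on_def by blast
next
 fix vs :: "'a list" assume vs: "length vs <= r"
 show "continuous_on U (dderiv vs g)"
 proof (intro continuous_at_imp_continuous_on ballI)
  fix x assume "x : U"
  with assms[of x] obtain V where V: "open V" "x : V" "C_on r V g" by blast
  hence "continuous_on V (dderiv vs g)" using vs unfolding C_on_def by blast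
  thus "isCont (dderiv vs g) x" using V continuous_on_eq_continuous_at by blast
 qed
qed

lemma C_on_derivative:
 assumes "C_on (Suc r) U g" "x : U"
 shows "(g has_derivative fder g x) (at x)"
 using assms frechet_derivative_works unfolding C_on_Suc by blast

lemma C_on_add:
 assumes "open U" "C_on r U f" "C_on r U g"
 shows "C_on r U (%x. f x + g x)"
 using assms(2,3)
proof (induction r arbitrary: f g)
 case 0
 thus ?case by (simp add: C_on_0 continuous_on_add)
next
 case (Suc r)
 show ?case
 proof (rule C_on_SucI[OF assms(1) has_derivative_add[OF C_on_derivative[OF Suc.prems(1)] C_on_derivative[OF Suc.prems(2)]]])
  show "C_on r U (%x. fder f x v + fder g x v)" for v
   using Suc unfolding C_on_Suc by blast
 qed
qed

lemma dderiv_add: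
 assumes "open U" "C_on (length vs) U f" "C_on (length vs) U g" "x : U"
 shows "dderiv vs (%x. f x + g x) x = dderiv vs f x + dderiv vs g x"
 using assms(2,3)
proof (induction vs arbitrary: f g)
 case (Cons v vs)
 note C = Cons.prems[simplified]
 have "dderiv (v # vs) (%x. f x + g x) x = dderiv vs (%x. fder f x v + fder g x v) x"
  unfolding dderiv.simps
 proof (rule dderiv_cong[OF assms(1) _ assms(4)])
  fix y assume y: "y : U"
  from frechet_derivative_at[OF has_derivative_add[OF C_on_derivative[OF C(1) y] C_on_derivative[OF C(2) y]]]
  show "fder (%x. f x + g x) y v = fder f y v + fder g y v" by metis
 qed
 also have "... = dderiv (v # vs) f x + dderiv (v # vs) g x"
  using Cons.IH[of "%x. fder f x v" "%x. fder g x v"] C by (simp add: C_on_Suc)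
 finally show ?case .
qed simp

lemma onorm_le_sum_Basis:
 fixes L :: "'v::euclidean_space => 'w::real_normed_vector"
 assumes "linear L"
 shows "onorm L <= (SUM b:Basis. norm (L b))"
proof (rule onorm_le)
 fix v
 have "L v = (SUM b:Basis. (v \<bullet> b) *\<^sub>R L b)"
  by (subst euclidean_representation[of v, symmetric]) (simp only: linear_sum[OF assms] linear_cmul[OF assms])
 also have "norm ... <= (SUM b:Basis. norm v * norm (L b))"
  by (intro sum_norm_le) (simp add: Basis_le_norm mult_right_mono)
 finally show "norm (L v) <= (SUM b:Basis. norm (L b)) * norm v" by (simp add: sum_distrib_left mult.commute)
qed

lemma small_sum:
 fixes f :: "'b => 'v => real"
 assumes "finite A" "!!b eta. b : A ==> eta > 0 ==> \<forall>\<^sub>F x in F. f b x <= eta * w x" "eta > 0" "!!x. w x >= 0"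
 shows "\<forall>\<^sub>F x in F. (SUM b:A. f b x) <= eta * w x"
proof -
 define k where "k = eta / (1 + card A)"
 have k: "k > 0" using assms(3) by (simp add: k_def)
 have "\<forall>\<^sub>F x in F. ALL b:A. f b x <= k * w x" by (intro eventually_ball_finite assms(1) ballI assms(2) k)
 thus ?thesis
 proof eventually_elim
  case (elim x)
  have "(SUM b:A. f b x) <= of_nat (card A) * (k * w x)" using elim by (intro sum_bounded_above) auto
  also have "... = (card A * k) * w x" by simp
  also have "... <= eta * w x"
   by (intro mult_right_mono assms(4)) (use assms(3) in \<open>auto simp: k_def divide_simps\<close>)
  finally show ?case .
 qed
qed

text \<open>Induction on \<open>r\<close>: the derivative of the difference is small of order
  \<open>r\<close>, so the mean value inequality on the ball of radius \<open>norm x\<close> gives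
  order \<open>Suc r\<close>. The continuity of the highest derivatives enters in the base
  case.\<close>

lemma taylor_difference:
 fixes f g :: "'v::euclidean_space => 'w::euclidean_space"
 assumes U: "open U" "0 : U" and "C_on r U f" "C_on r U g" "!!vs. length vs <= r ==> dderiv vs f 0 = dderiv vs g 0" "eta > 0"
 shows "NEAR x. norm (g x - f x) <= eta * norm x ^ r"
 using assms(3-)
proof (induction r arbitrary: f g eta)
 case 0
 have "isCont f 0" "isCont g 0" using 0(1,2) U by (auto simp: C_on_0 continuous_on_eq_continuous_at)
 hence "((%x. g x - f x) ---> g 0 - f 0) (nhds 0)"
  unfolding isCont_def tendsto_at_iff_tendsto_nhds by (intro tendsto_diff)
 moreover have "f 0 = g 0" using 0(3)[of "[]"] by simp
 ultimately show ?case using 0(4) by (auto simp: tendsto_iff dist_norm elim!: eventually_mono allE[of _ eta])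
next
 case (Suc r)
 let ?D = "%x v. fder g x v - fder f x v"
 have "NEAR x. norm (?D x b) <= eta' * norm x ^ r" if "eta' > 0" for b eta'
 proof (rule Suc.IH)
  show "dderiv vs (%x. fder f x b) 0 = dderiv vs (%x. fder g x b) 0"
   if "length vs <= r" for vs using Suc.prems(3)[of "b # vs"] that by simp
 qed (use Suc.prems that in \<open>simp_all add: C_on_Suc\<close>)
 from small_sum[OF finite_Basis this Suc.prems(4)]
 have "NEAR x. (SUM b:Basis. norm (?D x b)) <= eta * norm x ^ r" by simp
 hence "NEAR x. x : U & (SUM b:Basis. norm (?D x b)) <= eta * norm x ^ r"
  using eventually_nhds_in_open[OF U] by eventually_elim auto
 then obtain d where d: "d > 0" "!!x. norm x < d ==> x : U & (SUM b:Basis. norm (?D x b)) <= eta * norm x ^ r"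
  by (auto simp: eventually_nhds_metric dist_norm)
 have "norm (g x - f x) <= eta * norm x ^ Suc r" if x: "norm x < d" for x
 proof -
  have der: "((%x. g x - f x) has_derivative ?D y) (at y)" if "norm y < d" for y
   using Suc.prems(1,2) d(2)[OF that] by (intro has_derivative_diff C_on_derivative) auto
  have "norm ((%x. g x - f x) x - (%x. g x - f x) 0) <= (eta * norm x ^ r) * norm (x - 0)"
  proof (rule differentiable_bound[of "cball 0 (norm x)" _ ?D])
   fix y :: 'v assume "y : cball 0 (norm x)"
   hence y: "norm y <= norm x" by simp
   hence yd: "norm y < d" using x by simp
   show "((%x. g x - f x) has_derivative ?D y) (at y within cball 0 (norm x))"
    by (rule has_derivative_at_withinI[OF der[OF yd]])
   have "onorm (?D y) <= (SUM b:Basis. norm (?D y b))"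
    by (rule onorm_le_sum_Basis[OF has_derivative_linear[OF der[OF yd]]])
   also have "... <= eta * norm y ^ r" using d(2)[OF yd] by blast
   also have "... <= eta * norm x ^ r" using y Suc.prems(4) by (intro mult_left_mono power_mono) auto
   finally show "onorm (?D y) <= eta * norm x ^ r" .
  qed auto
  moreover have "f 0 = g 0" using Suc.prems(3)[of "[]"] by simp
  ultimately show ?thesis by (simp add: mult_ac)
 qed
 thus ?case using d(1) unfolding eventually_nhds_metric by (auto simp: dist_norm)
qed

lemma has_derivative_vector:
 fixes f :: "'v::real_normed_vector => 'a::euclidean_space^'m::finite"
 assumes "!!l. ((%x. f x $ l) has_derivative (%v. D v $ l)) F"
 shows "(f has_derivative D) F"
proof -
 have lin: "bounded_linear (axis l :: 'a => 'a^'m)" for l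
  unfolding linear_conv_bounded_linear[symmetric] by (rule linearI) (auto simp: axis_def vec_eq_iff)
 have eq: "(SUM l:UNIV. axis l (v $ l)) = v" for v :: "'a^'m"
  by (simp add: vec_eq_iff axis_def sum.delta' cong: if_cong)
 have "((%x. SUM l:UNIV. axis l (f x $ l)) has_derivative (%v. SUM l:UNIV. axis l (D v $ l))) F"
  by (intro has_derivative_sum bounded_linear.has_derivative[OF lin] assms)
 thus ?thesis by (simp add: eq)
qed

lemma analytic_map_at_has_derivative:
 assumes "analytic_map_at f z"
 shows "(f has_derivative (%v. SUM k:UNIV. v $ k *s partial_map k f z)) (at z)"
 using assms by (intro has_derivative_vector) (simp add: partial_map_def analytic_map_at_def analytic_at_has_derivative)

lemma C_on_analytic:
 fixes f :: "'a::{real_normed_field,euclidean_space}^'d::finite => 'a^'m::finite"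
 assumes "open U" "!!x. x : U ==> analytic_map_at f x"
 shows "C_on r U f"
 using assms(2)
proof (induction r arbitrary: f)
 case 0
 show ?case unfolding C_on_0
  using has_derivative_continuous[OF analytic_map_at_has_derivative[OF 0]] by (intro continuous_at_imp_continuous_on) blast
next
 case (Suc r)
 show ?case
 proof (rule C_on_SucI[OF assms(1) analytic_map_at_has_derivative[OF Suc.prems]])
  fix v :: "'a^'d"
  show "C_on r U (%x. SUM k:UNIV. v $ k *s partial_map k f x)"
  proof (rule Suc.IH)
   fix x assume "x : U"
   from Suc.prems[OF this] show "analytic_map_at (%x. SUM k:UNIV. v $ k *s partial_map k f x) x"
    unfolding analytic_map_at_def by (auto simp: partial_map_def intro!: analytic_intros analytic_at_pd)
  qed
 qed
qed

section \<open>Bumps along a sequence\<close>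

lemma max_power_has_derivative:
 assumes "k >= 2"
 shows "((%s::real. (max 0 s) ^ k) has_real_derivative (of_nat k * (max 0 s) ^ (k - 1))) (at s)"
proof -
 consider "s > 0" | "s < 0" | "s = 0" by linarith
 thus ?thesis
 proof cases
  case 1
  have "((%s::real. s ^ k) has_real_derivative (of_nat k * s ^ (k - 1))) (at s)" by (auto intro!: derivative_eq_intros)
  hence "((%s::real. s ^ k) has_real_derivative (of_nat k * (max 0 s) ^ (k - 1))) (at s)" using 1 by simp
  thus ?thesis
   by (rule has_field_derivative_transform_within_open[of _ _ _ "{0<..}"]) (use 1 in auto)
 next
  case 2
  have "((%s::real. 0) has_real_derivative (of_nat k * (max 0 s) ^ (k - 1))) (at s)" using 2 assms by (simp add: power_0_left)
  thus ?thesis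
   by (rule has_field_derivative_transform_within_open[of _ _ _ "{..<0}"]) (use 2 assms in \<open>auto simp: power_0_left\<close>)
 next
  case 3
  have "((%h. max 0 h ^ k / h) ---> 0) (at (0::real))"
  proof (rule Lim_null_comparison)
   show "\<forall>\<^sub>F h in at (0::real). norm (max 0 h ^ k / h) <= \<bar>h\<bar>"
    unfolding eventually_at
   proof (intro exI[of _ 1] conjI ballI impI)
    fix h :: real assume "h ~= 0 & dist h 0 < 1"
    hence h: "\<bar>h\<bar> < 1" by simp
    have "max 0 h ^ k <= \<bar>h\<bar> ^ k" by (intro power_mono) auto
    also have "... <= \<bar>h\<bar> ^ 2" using h assms by (intro power_decreasing) auto
    finally show "norm (max 0 h ^ k / h) <= \<bar>h\<bar>" by (cases "h = 0") (auto simp: field_simps power2_eq_square)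
   qed auto
   show "((%h. \<bar>h\<bar>) ---> 0) (at (0::real))" using tendsto_rabs[OF tendsto_ident_at, of 0] by simp
  qed
  thus ?thesis using 3 assms by (simp add: DERIV_def power_0_left)
 qed
qed

lemma real_polynomial_derivative:
 assumes "real_polynomial_function P"
 shows "EX D. (ALL x. (P has_derivative D x) (at x)) & (ALL v. real_polynomial_function (%x. D x v))"
 using assms
proof induction
 case (linear f)
 thus ?case by (intro exI[of _ "%_. f"]) (auto simp: bounded_linear_imp_has_derivative)
next
 case (const c)
 thus ?case by (intro exI[of _ "%_ _. 0"]) auto
next
 case (add f g)
 then obtain D E where "ALL x. (f has_derivative D x) (at x)" "ALL v. real_polynomial_function (%x. D x v)"
  "ALL x. (g has_derivative E x) (at x)" "ALL v. real_polynomial_function (%x. E x v)" by blast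
 thus ?case by (intro exI[of _ "%x v. D x v + E x v"]) (auto intro!: has_derivative_add)
next
 case (mult f g)
 then obtain D E where "ALL x. (f has_derivative D x) (at x)" "ALL v. real_polynomial_function (%x. D x v)"
  "ALL x. (g has_derivative E x) (at x)" "ALL v. real_polynomial_function (%x. E x v)" by blast
 thus ?case using mult.hyps
  by (intro exI[of _ "%x v. f x * E x v + D x v * g x"] conjI allI has_derivative_mult real_polynomial_function.intros(3,4)) auto
qed

text \<open>A bump of class \<open>C^(k-1)\<close> supported in the ball of radius 1/4. The
  polynomial factor is kept because the derivatives have the same shape with a smaller
  \<open>k\<close>; it also serves to prescribe the value (\<open>P\<close> constant 1) or the
  derivative (\<open>P\<close> linear) at 0.\<close>

definition bump :: "nat => ('v::euclidean_space => real) => 'w::euclidean_space => 'v => 'w" where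
 "bump k P b u = (P u * (max 0 (1 - 16 * (u \<bullet> u))) ^ k) *\<^sub>R b"

lemma bump_has_derivative:
 assumes "k >= 2" "(P has_derivative D) (at u)"
 shows "(bump k P b has_derivative
  (%v. bump (k - 1) (%u. D v * (1 - 16 * (u \<bullet> u)) - real k * P u * (32 * (u \<bullet> v))) b u)) (at u)"
proof -
 let ?s = "%u::'a. 1 - 16 * (u \<bullet> u)"
 have "(?s has_derivative (%v. - 32 * (u \<bullet> v))) (at u)"
  by (auto intro!: derivative_eq_intros simp: inner_commute)
 from has_derivative_compose[OF this max_power_has_derivative[OF assms(1), unfolded has_field_derivative_def]]
 have "((%u. (max 0 (?s u)) ^ k) has_derivative (%v. real k * (max 0 (?s u)) ^ (k - 1) * (- 32 * (u \<bullet> v)))) (at u)"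
  by (simp add: mult.commute mult.left_commute)
 from has_derivative_scaleR[OF has_derivative_mult[OF assms(2) this] has_derivative_const[of b]]
 have "(bump k P b has_derivative (%v. (P u * (real k * (max 0 (?s u)) ^ (k - 1) * (- 32 * (u \<bullet> v))) + D v * (max 0 (?s u)) ^ k) *\<^sub>R b)) (at u)"
  unfolding bump_def[abs_def] by simp
 moreover have "(max 0 (?s u)) ^ k = ?s u * (max 0 (?s u)) ^ (k - 1)"
  using assms(1) by (cases k; cases "?s u >= 0") (auto simp: max_def power_0_left)
 ultimately have "(bump k P b has_derivative (%v. (P u * (real k * (max 0 (?s u)) ^ (k - 1) * (- 32 * (u \<bullet> v))) + D v * (?s u * (max 0 (?s u)) ^ (k - 1))) *\<^sub>R b)) (at u)"
  by simp
 thus ?thesis by (rule has_derivative_eq_rhs) (simp add: fun_eq_iff bump_def algebra_simps)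
qed

lemma bump_C_on:
 assumes "real_polynomial_function P" "r < k"
 shows "C_on r UNIV (bump k P b)"
 using assms
proof (induction r arbitrary: k P)
 case 0
 have "continuous_on UNIV P" using 0(1) continuous_on_polymonial_function real_polynomial_function_eq by blast
 thus ?case unfolding C_on_0 bump_def[abs_def] by (intro continuous_intros)
next
 case (Suc r)
 from real_polynomial_derivative[OF Suc.prems(1)] obtain D where D: "!!x. (P has_derivative D x) (at x)"
  "!!v. real_polynomial_function (%x. D x v)" by blast
 have k: "k >= 2" "r < k - 1" using Suc.prems(2) by auto
 show ?case
 proof (rule C_on_SucI[OF open_UNIV bump_has_derivative[OF k(1) D(1)]])
  fix v :: 'a
  have lin: "real_polynomial_function (%u. u \<bullet> w)" for w :: 'a by (rule real_polynomial_function.intros(1)[OF bounded_linear_inner_left])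
  have "real_polynomial_function (%u::'a. SUM b:Basis. (u \<bullet> b) * (u \<bullet> b))"
   by (intro real_polynomial_function_sum real_polynomial_function.intros(4) lin finite_Basis)
  hence "real_polynomial_function (%u::'a. u \<bullet> u)" by (simp flip: euclidean_inner)
  hence "real_polynomial_function (%x. D x v * (1 - 16 * (x \<bullet> x)) - real k * P x * (32 * (x \<bullet> v)))"
   by (intro real_polynomial_function_diff real_polynomial_function.intros(2,4) lin D(2) Suc.prems(1))
  from Suc.IH[OF this k(2)]
  show "C_on r UNIV (%x. bump (k - 1) (%u. D x v * (1 - 16 * (u \<bullet> u)) - real k * P u * (32 * (u \<bullet> v))) b x)"
   by (simp add: bump_def[abs_def])
 qed
qed

lemma bump_support: "norm u > 1/4 ==> k > 0 ==> bump k P b u = 0"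
proof -
 assume u: "norm u > 1/4" and k: "k > 0"
 have "(1/4)^2 < norm u ^ 2" using u by (intro power_strict_mono) auto
 thus ?thesis using k by (simp add: bump_def dot_square_norm power2_eq_square max_def power_0_left)
qed

lemma dderiv_support:
 assumes "open V" "!!x. x : V ==> h x = 0" "x : V"
 shows "dderiv vs h x = 0"
proof -
 have "dderiv vs (%_::'a. 0::'b) x = 0" for x by (induction vs) (auto simp: frechet_derivative_const)
 thus ?thesis using dderiv_cong[of V h "%_. 0" x vs] assms by simp
qed

text \<open>A family of functions supported near the points \<open>p i\<close>, of size \<open>o(w i)\<close> up to rescaling.\<close>

definition flat :: "(nat => 'v::euclidean_space) => nat => (nat => real) => (nat => 'v => 'w::euclidean_space) => bool" where
 "flat p R w h <-> (ALL i. C_on R UNIV (h i)) & (ALL i x. norm (x - p i) > norm (p i) / 4 --> h i x = 0) &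
  (ALL vs. length vs <= R --> (\<exists>ep. ep ----> 0 & (ALL i x. norm (dderiv vs (h i) x) <= ep i * (w i / norm (p i) ^ length vs))))"

lemma flat_add: "flat p R w h ==> flat p R w h' ==> flat p R w (%i x. h i x + h' i x)"
 unfolding flat_def
proof (intro conjI allI impI, goal_cases)
 case (1 i)
 thus ?case by (intro C_on_add) auto
next
 case (3 vs)
 from 3 obtain ep ep' where e: "ep ----> 0" "!!i x. norm (dderiv vs (h i) x) <= ep i * (w i / norm (p i) ^ length vs)"
  "ep' ----> 0" "!!i x. norm (dderiv vs (h' i) x) <= ep' i * (w i / norm (p i) ^ length vs)" by blast
 have "norm (dderiv vs (%x. h i x + h' i x) x) <= (ep i + ep' i) * (w i / norm (p i) ^ length vs)" for i x
 proof -
  have "C_on (length vs) UNIV (h i)" "C_on (length vs) UNIV (h' i)" using 3 C_on_le by blast+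
  hence "dderiv vs (%x. h i x + h' i x) x = dderiv vs (h i) x + dderiv vs (h' i) x" by (intro dderiv_add[OF open_UNIV]) auto
  thus ?thesis using e(2)[of i x] e(4)[of i x] norm_triangle_ineq[of "dderiv vs (h i) x" "dderiv vs (h' i) x"]
   by (simp only: distrib_right)
 qed
 thus ?case using tendsto_add[OF e(1,3)] by (intro exI[of _ "%i. ep i + ep' i"]) simp
qed simp

lemma flat_zero: "flat p R w (%_ _. 0)"
proof -
 have "C_on R UNIV (%_::'a. 0::'b)" for R by (induction R) (auto simp: C_on_0 C_on_Suc frechet_derivative_const)
 moreover have "dderiv vs (%_::'a. 0::'b) x = 0" for vs x by (rule dderiv_support[of UNIV]) auto
 ultimately show ?thesis unfolding flat_def by (auto intro!: exI[of _ "%_. 0"])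
qed

lemma flat_sum: "finite A ==> (!!a. a : A ==> flat p R w (h a)) ==> flat p R w (%i x. SUM a:A. h a i x)"
 by (induction A rule: finite_induct) (auto intro: flat_zero flat_add)

lemma flat_derivative:
 assumes "flat p (Suc R) w h"
 shows "flat p R (%i. w i / norm (p i)) (%i x. fder (h i) x v)"
 unfolding flat_def
proof (intro conjI allI impI)
 show "C_on R UNIV (%x. fder (h i) x v)" for i using assms by (auto simp: flat_def C_on_Suc)
 show "fder (h i) x v = 0" if "norm (x - p i) > norm (p i) / 4" for i x
 proof -
  have "open {x. norm (p i) / 4 < norm (x - p i)}" by (intro open_Collect_less continuous_intros)
  from dderiv_support[OF this, of "h i" x "[v]"] that assms show ?thesis by (auto simp: flat_def)
 qed
 fix vs :: "'a list" assume "length vs <= R"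
 hence "length (v # vs) <= Suc R" by simp
 with assms obtain ep where "ep ----> 0"
  "ALL i x. norm (dderiv (v # vs) (h i) x) <= ep i * (w i / norm (p i) ^ length (v # vs))" unfolding flat_def by blast
 thus "\<exists>ep. ep ----> 0 & (ALL i x. norm (dderiv vs (%x. fder (h i) x v) x)
  <= ep i * (w i / norm (p i) / norm (p i) ^ length vs))" by (auto simp: mult.commute)
qed

lemma scaled_derivative:
 assumes "(G has_derivative D) (at ((x - p) /\<^sub>R s))"
 shows "((%x. a *\<^sub>R G ((x - p) /\<^sub>R s)) has_derivative (%v. (a / s) *\<^sub>R D v)) (at x)"
proof -
 have "((%x. (x - p) /\<^sub>R s) has_derivative (%v. v /\<^sub>R s)) (at x)" by (auto intro!: derivative_eq_intros)
 from has_derivative_scaleR_right[OF has_derivative_compose[OF this assms], of a]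
 show ?thesis using linear_cmul[OF has_derivative_linear[OF assms]] by (simp add: divide_inverse)
qed

lemma scaled_C_on:
 assumes "C_on R UNIV G"
 shows "C_on R UNIV (%x. a *\<^sub>R G ((x - p) /\<^sub>R s)) &
  (ALL vs. length vs <= R --> (ALL x. dderiv vs (%x. a *\<^sub>R G ((x - p) /\<^sub>R s)) x = (a / s ^ length vs) *\<^sub>R dderiv vs G ((x - p) /\<^sub>R s)))"
 using assms
proof (induction R arbitrary: G a)
 case 0
 have "continuous_on UNIV (%x. G ((x - p) /\<^sub>R s))"
  by (rule continuous_on_compose2[of UNIV G]) (use 0 in \<open>auto simp: C_on_0 intro!: continuous_intros\<close>)
 thus ?case by (auto simp: C_on_0 intro!: continuous_intros)
next
 case (Suc R)
 let ?g = "%x. a *\<^sub>R G ((x - p) /\<^sub>R s)"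
 have d: "(?g has_derivative (%v. (a / s) *\<^sub>R fder G (((x - p) /\<^sub>R s)) v)) (at x)" for x
  by (rule scaled_derivative[OF C_on_derivative[OF Suc.prems]]) simp
 have fd: "fder ?g x v = (a / s) *\<^sub>R fder G (((x - p) /\<^sub>R s)) v" for x v
  using frechet_derivative_at[OF d] by metis
 have IH: "C_on R UNIV (%x. (a / s) *\<^sub>R fder G (((x - p) /\<^sub>R s)) v)"
  "length vs <= R ==> dderiv vs (%x. (a / s) *\<^sub>R fder G (((x - p) /\<^sub>R s)) v) x
   = (a / s / s ^ length vs) *\<^sub>R dderiv vs (%x. fder G x v) ((x - p) /\<^sub>R s)" for v vs x
  using Suc.IH[of "%x. fder G x v" "a / s"] Suc.prems by (auto simp: C_on_Suc)
 have "C_on (Suc R) UNIV ?g" by (rule C_on_SucI[OF open_UNIV d IH(1)])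
 moreover have "dderiv vs ?g x = (a / s ^ length vs) *\<^sub>R dderiv vs G ((x - p) /\<^sub>R s)" if "length vs <= Suc R" for vs x
  using that by (cases vs) (simp_all add: fd IH(2))
 ultimately show ?case by blast
qed

text \<open>Each derivative of the rescaled function costs a factor \<open>1 / norm (p i)\<close>,
  which is the denominator in \<open>flat\<close>; compactness of the support bounds the derivatives
  of \<open>G\<close> by a constant \<open>K\<close>.\<close>

lemma flat_scaled:
 fixes G :: "'v::euclidean_space => 'w::euclidean_space"
 assumes G: "C_on R UNIV G" "!!u. norm u > 1/4 ==> G u = 0" and c: "c ----> 0" and p: "!!i. p i ~= 0" and w: "!!i. w i >= 0"
 shows "flat p R w (%i x. (c i * w i) *\<^sub>R G ((x - p i) /\<^sub>R norm (p i)))"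
 unfolding flat_def
proof (intro conjI allI impI)
 show "C_on R UNIV (%x. (c i * w i) *\<^sub>R G ((x - p i) /\<^sub>R norm (p i)))" for i
  using scaled_C_on[OF G(1)] by blast
 show "(c i * w i) *\<^sub>R G ((x - p i) /\<^sub>R norm (p i)) = 0" if "norm (x - p i) > norm (p i) / 4" for i x
 proof -
  have "norm ((x - p i) /\<^sub>R norm (p i)) > 1/4" using that p[of i] by (simp add: divide_simps mult.commute)
  from G(2)[OF this] show ?thesis by simp
 qed
 fix vs :: "'v list" assume vs: "length vs <= R"
 have "continuous_on (cball 0 (1/4)) (dderiv vs G)" using G(1) vs continuous_on_subset unfolding C_on_def by blast
 hence "bounded (dderiv vs G ` cball 0 (1/4))" by (intro compact_imp_bounded compact_continuous_image) auto
 then obtain K where K: "K > 0" "ALL u:cball 0 (1/4). norm (dderiv vs G u) <= K" by (auto simp: bounded_pos)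
 have *: "norm (dderiv vs G u) <= K" for u
 proof (cases "norm u > 1/4")
  case True
  have "open {u::'v. 1/4 < norm u}" by (intro open_Collect_less continuous_intros)
  from dderiv_support[OF this, of G u vs] True G(2) K(1) show ?thesis by simp
 qed (use K in auto)
 have "norm (dderiv vs (%x. (c i * w i) *\<^sub>R G ((x - p i) /\<^sub>R norm (p i))) x)
  <= (\<bar>c i\<bar> * K) * (w i / norm (p i) ^ length vs)" for i x
 proof -
  have "norm (dderiv vs (%x. (c i * w i) *\<^sub>R G ((x - p i) /\<^sub>R norm (p i))) x)
   = (\<bar>c i\<bar> * (w i / norm (p i) ^ length vs)) * norm (dderiv vs G ((x - p i) /\<^sub>R norm (p i)))"
   using scaled_C_on[OF G(1)] vs w[of i] by (simp add: abs_mult)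
  also have "... <= (\<bar>c i\<bar> * (w i / norm (p i) ^ length vs)) * K" using w[of i] by (intro mult_left_mono *) auto
  finally show ?thesis by (simp only: mult_ac)
 qed
 moreover have "(%i. \<bar>c i\<bar> * K) ----> 0" using tendsto_mult_left_zero[OF tendsto_rabs_zero[OF c]] .
 ultimately show "\<exists>ep. ep ----> 0 & (ALL i x. norm (dderiv vs (%x. (c i * w i) *\<^sub>R G ((x - p i) /\<^sub>R norm (p i))) x)
  <= ep i * (w i / norm (p i) ^ length vs))" by blast
qed

definition superpose :: "(nat => 'v => 'w::euclidean_space) => 'v => 'w" where
 "superpose h x = (\<Sum>i. h i x)"

lemma superpose_single: "(!!j. j ~= i ==> h j x = 0) ==> superpose h x = h i x"
 unfolding superpose_def by (subst suminf_finite[of "{i}"]) auto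

section \<open>Superposition of bumps with supports in disjoint annuli\<close>

context
 fixes p :: "nat => 'v::euclidean_space"
 assumes p: "!!i. p i ~= 0" "!!i. norm (p (Suc i)) <= norm (p i) / 4"
begin

lemma norm_p_add: "norm (p (i + Suc k)) <= norm (p i) / 4"
proof (induction k)
 case (Suc k)
 have "norm (p (i + Suc (Suc k))) <= norm (p (i + Suc k)) / 4" using p(2)[of "i + Suc k"] by simp
 also have "... <= norm (p (i + Suc k))" by simp
 finally show ?case using Suc by simp
qed (use p(2)[of i] in simp)

lemma norm_p_less: "i < j ==> norm (p j) <= norm (p i) / 4"
 using norm_p_add[of i "j - Suc i"] by simp

lemma annulus:
 assumes "norm (x - p i) <= norm (p i) / 4" shows "3/4 * norm (p i) <= norm x" "norm x <= 5/4 * norm (p i)"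
 using assms norm_triangle_ineq2[of "p i" x] norm_triangle_ineq2[of x "p i"] by (auto simp: norm_minus_commute)

text \<open>Near a point other than 0, only one of the supports has to be considered.\<close>

lemma support_local:
 assumes "x ~= 0"
 shows "EX i V. open V & x : V & (ALL w:V. ALL j. j ~= i --> norm (w - p j) > norm (p j) / 4)"
proof -
 \<comment> \<open>Norms in this annulus differ by a factor below 9/4, whereas by
   \<open>annulus\<close> and \<open>norm_p_less\<close> the norms of points of two different
   supports differ by a factor of at least 12/5.\<close>
 let ?V = "{w. 2/3 * norm x < norm w} \<inter> {w. norm w < 3/2 * norm x}"
 have V: "open ?V" "x : ?V" using assms by (auto intro!: open_Int open_Collect_less continuous_intros)
 have uniq: "i = j" if "w : ?V" "norm (w - p i) <= norm (p i) / 4" "y : ?V" "norm (y - p j) <= norm (p j) / 4" for i j w y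
 proof (rule ccontr)
  have "norm (p i) > 0" "norm (p j) > 0" using p by auto
  moreover assume "i ~= j"
  ultimately show False
   using norm_p_less[of i j] norm_p_less[of j i] annulus[OF that(2)] annulus[OF that(4)] that(1,3)
   by (cases "i < j") (auto simp: not_less)
 qed
 show ?thesis
 proof (cases "EX i. EX w:?V. norm (w - p i) <= norm (p i) / 4")
  case True
  then obtain i w where "w : ?V" "norm (w - p i) <= norm (p i) / 4" by blast
  with uniq have "ALL w:?V. ALL j. j ~= i --> norm (w - p j) > norm (p j) / 4" by (meson not_less)
  thus ?thesis using V by blast
 next
  case False
  hence "ALL w:?V. ALL j. j ~= 0 --> norm (w - p j) > norm (p j) / 4" by (meson not_less)
  thus ?thesis using V by blast
 qed
qed

lemma superpose_eq: "flat p R w h ==> ALL j. j ~= i --> norm (x - p j) > norm (p j) / 4 ==> superpose h x = h i x"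
 by (rule superpose_single) (auto simp: flat_def)

lemma superpose_0: "flat p R w h ==> superpose h 0 = 0"
 using superpose_single[of 0 h 0] p(1) by (auto simp: flat_def)

lemma superpose_C_on:
 fixes h :: "nat => 'v => 'w::euclidean_space"
 assumes "flat p R w h" shows "C_on R (- {0}) (superpose h)"
proof (rule C_on_local)
 fix x :: 'v assume "x : - {0}"
 then obtain i V where V: "open V" "x : V" "ALL w:V. ALL j. j ~= i --> norm (w - p j) > norm (p j) / 4" using support_local[of x] by auto
 have "C_on R V (h i)" using assms C_on_subset[of R UNIV _ V] by (auto simp: flat_def)
 moreover have "h i y = superpose h y" if "y : V" for y using superpose_eq[OF assms, of i y] V(3) that by simp
 ultimately have "C_on R V (superpose h)" using C_on_cong[OF V(1)] by metis
 thus "EX V. open V & x : V & C_on R V (superpose h)" using V by blast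
qed

text \<open>\<open>W\<close> is the weight \<open>w\<close> as a function of the point: on the
  support of \<open>h i\<close> the norms of \<open>x\<close> and \<open>p i\<close> are comparable.
  Points near 0 meet only supports of large index, where the factor \<open>ep i\<close> is below
  \<open>eta\<close>.\<close>

lemma superpose_small:
 fixes h :: "nat => 'v => 'w::euclidean_space"
 assumes h: "flat p R w h" and "eta > 0"
  and w: "!!i x. norm (p i) <= 4/3 * norm x ==> norm x <= 5/4 * norm (p i) ==> w i <= W x" "!!i. w i >= 0" "!!x. W x >= 0"
 shows "NEAR x. norm (superpose h x) <= eta * W x"
proof -
 from h obtain ep where e: "ep ----> 0" "!!i x. norm (h i x) <= ep i * w i"
  unfolding flat_def by (auto dest!: spec[of _ "[]"])
 have "\<forall>\<^sub>F i in sequentially. ep i < eta" using order_tendstoD(2)[OF e(1)] `eta > 0` by blast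
 then obtain N where N: "!!i. i >= N ==> ep i < eta" by (auto simp: eventually_sequentially)
 have pN: "3/4 * norm (p N) > 0" using p(1) by simp
 show ?thesis
 proof (rule eventually_mono[OF eventually_norm_less[OF pN]])
  fix x :: 'v assume x: "norm x < 3/4 * norm (p N)"
  show "norm (superpose h x) <= eta * W x"
  proof (cases "superpose h x = 0")
   case True
   thus ?thesis using w(3) `eta > 0` by simp
  next
   case False
   hence "x ~= 0" using superpose_0[OF h] by auto
   from support_local[OF this] obtain i where "ALL j. j ~= i --> norm (x - p j) > norm (p j) / 4" by blast
   from superpose_eq[OF h this] have i: "superpose h x = h i x" .
   hence "norm (x - p i) <= norm (p i) / 4" using False h by (auto simp: flat_def not_less[symmetric])
   note an = annulus[OF this]
   have "~i < N" using norm_p_less[of i N] an x norm_ge_zero[of "p i"] by linarith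
   hence "ep i <= eta" using N[of i] by simp
   have "norm (h i x) <= ep i * w i" by (rule e(2))
   also have "... <= eta * w i" by (intro mult_right_mono w(2)) fact
   also have "... <= eta * W x" using an `eta > 0` by (intro mult_left_mono w(1)) auto
   finally show ?thesis using i by simp
  qed
 qed
qed

lemma superpose_derivative:
 fixes h :: "nat => 'v => 'w::euclidean_space"
 assumes "flat p (Suc R) w h" "x ~= 0"
 shows "(superpose h has_derivative (%v. superpose (%i x. fder (h i) x v) x)) (at x)"
proof -
 from support_local[OF assms(2)] obtain i V where V: "open V" "x : V" "ALL w:V. ALL j. j ~= i --> norm (w - p j) > norm (p j) / 4" by blast
 have "(h i has_derivative fder (h i) x) (at x)"
  by (rule C_on_derivative[of R UNIV]) (use assms(1) in \<open>auto simp: flat_def\<close>)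
 hence "(superpose h has_derivative fder (h i) x) (at x)"
  by (rule has_derivative_transform_within_open[OF _ V(1,2)]) (rule superpose_eq[OF assms(1), symmetric], use V(3) in blast)
 moreover have "superpose (%i x. fder (h i) x v) x = fder (h i) x v" for v
  using superpose_eq[OF flat_derivative[OF assms(1)]] V(2,3) by blast
 ultimately show ?thesis by simp
qed

text \<open>Induction on \<open>r\<close>: the derivative is the superposition of the derivatives,
  which are flat with exponent \<open>r\<close>. At 0 differentiability holds because the function
  is \<open>o(norm x ^ Suc r)\<close>.\<close>

lemma superpose_flat:
 fixes h :: "nat => 'v => 'w::euclidean_space"
 assumes "flat p r (%i. norm (p i) ^ r) h"
 shows "C_on r UNIV (superpose h) & (ALL vs. length vs <= r --> dderiv vs (superpose h) 0 = 0)"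
 using assms
proof (induction r arbitrary: h)
 case 0
 have "isCont (superpose h) x" for x
 proof (cases "x = 0")
  case True
  have "(superpose h ---> 0) (nhds 0)"
   unfolding tendsto_iff
  proof (intro allI impI)
   fix e :: real assume "e > 0"
   hence "NEAR x. norm (superpose h x) <= e / 2 * 1" by (intro superpose_small[OF 0]) auto
   thus "NEAR x. dist (superpose h x) 0 < e" by eventually_elim (use `e > 0` in simp)
  qed
  thus ?thesis using superpose_0[OF 0] True tendsto_at_iff_tendsto_nhds[of "superpose h" 0] by (simp add: isCont_def)
 next
  case False
  thus ?thesis using C_on_continuous[OF superpose_C_on[OF 0]] by (simp add: continuous_on_eq_continuous_at open_Compl)
 qed
 thus ?case using superpose_0[OF 0] by (simp add: C_on_0 continuous_at_imp_continuous_on)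
next
 case (Suc r)
 let ?d = "%v i x. fder (h i) x v"
 have "(%i. norm (p i) ^ Suc r / norm (p i)) = (%i. norm (p i) ^ r)" using p(1) by simp
 hence fl: "flat p r (%i. norm (p i) ^ r) (?d v)" for v using flat_derivative[OF Suc.prems] by simp
 have der: "(superpose h has_derivative (%v. superpose (?d v) x)) (at x)" for x
 proof (cases "x = 0")
  case True
  have "(superpose h has_derivative (%v. 0)) (at 0)"
   unfolding has_derivative_within_alt
  proof (intro conjI allI impI bounded_linear_zero)
   fix e :: real assume "e > 0"
   hence "e / (4/3) ^ Suc r > 0" by simp
   hence "NEAR x. norm (superpose h x) <= e / (4/3) ^ Suc r * (4/3 * norm x) ^ Suc r"
    by (rule superpose_small[OF Suc.prems]) (auto intro!: power_mono simp del: power_Suc)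
   moreover have "\<forall>\<^sub>F x in nhds (0::'v). norm x < 1" by (rule eventually_norm_less) simp
   ultimately have "NEAR x. norm (superpose h x) <= e * norm x"
   proof eventually_elim
    case (elim x)
    have "e / (4/3) ^ Suc r * (4/3 * norm x) ^ Suc r = e * norm x ^ Suc r" by (simp only: power_mult_distrib) simp
    also have "... <= e * norm x" using `e > 0` elim(2) by (simp add: mult_left_le power_le_one)
    finally show ?case using elim(1) by linarith
   qed
   thus "EX d>0. ALL y:UNIV. norm (y - 0) < d --> norm (superpose h y - superpose h 0 - 0) <= e * norm (y - 0)"
    using superpose_0[OF Suc.prems] by (auto simp: eventually_nhds_metric dist_norm)
  qed
  thus ?thesis using True superpose_0[OF fl] by simp
 qed (rule superpose_derivative[OF Suc.prems])
 have fd: "fder (superpose h) x v = superpose (?d v) x" for x v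
  using fun_cong[OF frechet_derivative_at[OF der]] by simp
 have "C_on (Suc r) UNIV (superpose h)"
  by (rule C_on_SucI[OF open_UNIV der]) (use Suc.IH[OF fl] in blast)
 moreover have "dderiv vs (superpose h) 0 = 0" if "length vs <= Suc r" for vs
  using that Suc.IH[OF fl] superpose_0[OF Suc.prems] by (cases vs) (auto simp: fd)
 ultimately show ?case by blast
qed

end

text \<open>Bumps with \<open>P\<close> constant 1 produce the values \<open>dlt i\<close> with
  derivative 0 at \<open>p i\<close>; bumps with linear \<open>P\<close> produce the derivatives
  \<open>B i\<close> with value 0. The coefficients \<open>c0\<close>, \<open>c1\<close> tend to 0
  because of the assumed sizes.\<close>

lemma prescribed_bumps:
 fixes p :: "nat => 'v::euclidean_space" and dlt :: "nat => 'w::euclidean_space"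
 assumes p: "!!i. p i ~= 0" "!!i. norm (p (Suc i)) <= norm (p i) / 4"
  and B: "!!i. linear (B i)" and e: "ep ----> 0" "!!i. norm (dlt i) <= ep i * norm (p i) ^ r"
  "!!i. onorm (B i) * norm (p i) <= ep i * norm (p i) ^ r"
 shows "EX h. flat p (Suc r) (%i. norm (p i) ^ r) h & (ALL i. h i (p i) = dlt i & (h i has_derivative B i) (at (p i)))"
proof -
 let ?G = "%P b. bump (r + 2) P b"
 let ?sc = "%c G i x. (c i * norm (p i) ^ r) *\<^sub>R G ((x - p i) /\<^sub>R norm (p i))"
 define c0 where "c0 b i = (dlt i \<bullet> b) / norm (p i) ^ r" for b i
 define c1 where "c1 a b i = (B i a \<bullet> b) * norm (p i) / norm (p i) ^ r" for a b i
 define h where "h i x = (SUM b:Basis. ?sc (c0 b) (?G (%_. 1) b) i x)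
  + (SUM a:Basis. SUM b:Basis. ?sc (c1 a b) (?G (%u. u \<bullet> a) b) i x)" for i x
 have c0: "c0 b ----> 0" if "b : Basis" for b
 proof (rule Lim_null_comparison[OF always_eventually e(1)], rule allI)
  fix i
  have "\<bar>dlt i \<bullet> b\<bar> <= ep i * norm (p i) ^ r" using Basis_le_norm[OF that, of "dlt i"] e(2)[of i] by linarith
  thus "norm (c0 b i) <= ep i" using p(1)[of i] by (simp add: c0_def divide_simps)
 qed
 have c1: "c1 a b ----> 0" if "a : Basis" "b : Basis" for a b
 proof (rule Lim_null_comparison[OF always_eventually e(1)], rule allI)
  fix i
  have "\<bar>B i a \<bullet> b\<bar> <= norm (B i a)" by (rule Basis_le_norm[OF that(2)])
  also have "... <= onorm (B i)" using onorm[of "B i" a] B that(1) by (simp add: linear_conv_bounded_linear)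
  finally have "\<bar>B i a \<bullet> b\<bar> * norm (p i) <= onorm (B i) * norm (p i)" by (rule mult_right_mono) simp
  with e(3)[of i] have "\<bar>B i a \<bullet> b\<bar> * norm (p i) <= ep i * norm (p i) ^ r" by linarith
  thus "norm (c1 a b i) <= ep i" using p(1)[of i] by (simp add: c1_def divide_simps abs_mult)
 qed
 have sc: "flat p (Suc r) (%i. norm (p i) ^ r) (?sc c (?G P b))" if "c ----> 0" "real_polynomial_function P" for c P and b :: 'w
  by (rule flat_scaled[OF bump_C_on[OF that(2)] _ that(1) p(1)]) (auto simp: bump_support)
 have poly: "real_polynomial_function (%u::'v. u \<bullet> a)" for a by (rule real_polynomial_function.intros(1)[OF bounded_linear_inner_left])
 have "flat p (Suc r) (%i. norm (p i) ^ r) h"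
  unfolding h_def[abs_def]
  by (intro flat_add flat_sum finite_Basis sc c0 c1 poly real_polynomial_function.intros(2)) auto
 moreover have "h i (p i) = dlt i & (h i has_derivative B i) (at (p i))" for i
 proof
  have pr: "norm (p i) ^ r ~= 0" "norm (p i) ~= 0" using p(1) by auto
  have "h i (p i) = (SUM b:Basis. (dlt i \<bullet> b) *\<^sub>R b)" using pr by (simp add: h_def bump_def c0_def)
  thus "h i (p i) = dlt i" by (simp add: euclidean_representation)
  have d: "(?G P b has_derivative (%v. D v *\<^sub>R b)) (at 0)" if "(P has_derivative D) (at 0)" for P D and b :: 'w
   using bump_has_derivative[OF _ that, of "r + 2" b] by (simp add: bump_def)
  have d': "(?sc c (?G P b) i has_derivative (%v. (c i * norm (p i) ^ r / norm (p i)) *\<^sub>R D v *\<^sub>R b)) (at (p i))"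
   if "(P has_derivative D) (at 0)" for c P D and b :: 'w
   using scaled_derivative[where G = "?G P b" and D = "%v. D v *\<^sub>R b" and x = "p i" and p = "p i" and s = "norm (p i)" and a = "c i * norm (p i) ^ r"]
    d[OF that] by simp
  have "(h i has_derivative (%v. (SUM b:Basis. (c0 b i * norm (p i) ^ r / norm (p i)) *\<^sub>R (%_. 0) v *\<^sub>R b)
   + (SUM a:Basis. SUM b:Basis. (c1 a b i * norm (p i) ^ r / norm (p i)) *\<^sub>R (v \<bullet> a) *\<^sub>R b))) (at (p i))"
   unfolding h_def[abs_def]
   by (intro has_derivative_add has_derivative_sum d' has_derivative_const
    bounded_linear.has_derivative[OF bounded_linear_inner_left has_derivative_ident])
  moreover have "(SUM a:Basis. SUM b:Basis. (c1 a b i * norm (p i) ^ r / norm (p i)) *\<^sub>R (v \<bullet> a) *\<^sub>R b) = B i v" for v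
  proof -
   have "(c1 a b i * norm (p i) ^ r / norm (p i)) *\<^sub>R (v \<bullet> a) *\<^sub>R b = (v \<bullet> a) *\<^sub>R (B i a \<bullet> b) *\<^sub>R b" for a b
    using pr by (simp add: c1_def)
   hence "(SUM a:Basis. SUM b:Basis. (c1 a b i * norm (p i) ^ r / norm (p i)) *\<^sub>R (v \<bullet> a) *\<^sub>R b)
    = (SUM a:Basis. (v \<bullet> a) *\<^sub>R B i a)" by (simp only: scaleR_sum_right[symmetric] euclidean_representation)
   also have "... = B i v"
    by (subst (2) euclidean_representation[of v, symmetric]) (simp only: linear_sum[OF B] linear_cmul[OF B])
   finally show ?thesis .
  qed
  ultimately show "(h i has_derivative B i) (at (p i))" by simp
 qed
 ultimately show ?thesis by blast
qed

text \<open>For \<open>r = 0\<close> as for \<open>r >= 1\<close>, equivalence yields values that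
  differ by \<open>o(norm x ^ r)\<close> and derivatives whose difference times
  \<open>norm x\<close> is \<open>o(norm x ^ r)\<close>. For \<open>r = 0\<close> the first estimate
  is continuity and the second is the definition; for \<open>r >= 1\<close> both come from
  \<open>taylor_difference\<close>.\<close>

lemma jets_close:
 fixes f g :: "'v::euclidean_space => 'w::euclidean_space"
 assumes U: "open U" "0 : U" and f: "C_on (Suc r) U f" "f 0 = 0"
  and g: "r_germ r g" "r_equivalent r f g" and "eta > 0"
 shows "PUNCT x. (g has_derivative fder g x) (at x) &
  (f has_derivative fder f x) (at x) & norm (g x - f x) <= eta * norm x ^ r &
  onorm (%v. fder f x v - fder g x v) * norm x <= eta * norm x ^ r"
proof -
 from g(1) obtain V where V: "open V" "0 : V" and gV: "if r = 0 then continuous_on V g & C_on 1 (V - {0}) g &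
  (%x. onorm (fder g x)) : O[at 0](%x. inverse (norm x)) else C_on r V g"
  by (auto simp: r_germ_def)
 define T where "T = U \<inter> V"
 have T: "open T" "0 : T" "T <= U" "T <= V" using U V by (auto simp: T_def)
 have in_T: "PUNCT x. x : T & x ~= 0"
  using eventually_at_in_open[OF T(1,2)] by simp
 have gd: "(g has_derivative fder g x) (at x)" if x: "x : T" "x ~= 0" for x
 proof (cases "r = 0")
  case True
  thus ?thesis using gV x T(4) by (intro C_on_derivative[of 0 "V - {0}"]) auto
 next
  case False
  thus ?thesis using gV x T(4) by (intro C_on_derivative[of "r - 1" V]) auto
 qed
 have fd: "(f has_derivative fder f x) (at x)" if "x : T" for x
  by (rule C_on_derivative[OF f(1)]) (use that T(3) in blast)
 have fT: "C_on r T f" by (rule C_on_le[OF C_on_subset[OF f(1) T(3)]]) simp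
 have gT: "C_on r T g"
  using gV C_on_subset[OF _ T(4)] continuous_on_subset[OF _ T(4)] by (cases "r = 0") (auto simp: C_on_0)
 have "dderiv vs f 0 = dderiv vs g 0" if "length vs <= r" for vs
 proof (cases "r = 0")
  case True
  thus ?thesis using that f(2) g(1) by (simp add: r_germ_def)
 next
  case False
  thus ?thesis using g(2) that by (simp add: r_equivalent_def)
 qed
 note eq = this
 have "NEAR x. norm (g x - f x) <= eta * norm x ^ r"
  by (rule taylor_difference[OF T(1,2) fT gT eq assms(7)])
 hence 1: "PUNCT x. norm (g x - f x) <= eta * norm x ^ r" by (simp add: eventually_at_filter eventually_mono)
 have 2: "PUNCT x. onorm (%v. fder f x v - fder g x v) * norm x <= eta * norm x ^ r"
 proof (cases r)
  case 0
  from g(2) 0 have "(%x. onorm (%v. fder f x v - fder g x v)) : o[at 0](%x. inverse (norm x))"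
   by (simp add: r_equivalent_def)
  from landau_o.smallD[OF this assms(7)] in_T show ?thesis
  proof eventually_elim
   case (elim x)
   have "onorm (%v. fder f x v - fder g x v) <= eta * inverse (norm x)"
    using elim(1) by simp
   thus ?case using elim(2) by (simp add: 0 field_simps)
  qed
 next
  case (Suc k)
  let ?D = "%b x. fder f x b - fder g x b"
  have small: "NEAR x. norm (?D b x) <= e * norm x ^ k" if "e > 0" for b e
  proof (rule taylor_difference[OF T(1,2), of k])
   show "dderiv vs (%x. fder g x b) 0 = dderiv vs (%x. fder f x b) 0"
    if "length vs <= k" for vs using eq[of "b # vs"] that Suc by simp
  qed (use fT gT Suc that in \<open>auto simp: C_on_Suc\<close>)
  have "NEAR x. (SUM b:Basis. norm (?D b x)) <= eta * norm x ^ k"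
   by (rule small_sum[OF finite_Basis small assms(7)]) auto
  hence "PUNCT x. (SUM b:Basis. norm (?D b x)) <= eta * norm x ^ k" by (simp add: eventually_at_filter eventually_mono)
  with in_T show ?thesis
  proof eventually_elim
   case (elim x)
   hence "x : T" "x ~= 0" by auto
   from onorm_le_sum_Basis[OF has_derivative_linear[OF has_derivative_diff[OF fd[OF this(1)] gd[OF this]]]] elim
   have "onorm (%v. ?D v x) <= eta * norm x ^ k" by linarith
   hence "onorm (%v. ?D v x) * norm x <= eta * norm x ^ k * norm x" by (rule mult_right_mono) simp
   thus ?case by (simp add: Suc mult_ac)
  qed
 qed
 from in_T 1 2 show ?thesis by eventually_elim (auto intro: gd fd)
qed

text \<open>For \<open>r >= 1\<close> this follows from \<open>superpose_flat\<close>. For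
  \<open>r = 0\<close> the derivatives of the bumps have weight \<open>1 / norm (p i)\<close>,
  comparable to \<open>1 / norm x\<close> on the support, so the derivative of the superposition is
  \<open>o(1 / norm x)\<close>.\<close>

lemma perturbed_germ:
 fixes f :: "'v::euclidean_space => 'w::euclidean_space"
 assumes U: "open U" "0 : U" and f: "C_on (Suc r) U f" "f 0 = 0"
  and p: "!!i. p i ~= 0" "!!i. norm (p (Suc i)) <= norm (p i) / 4"
  and h: "flat p (Suc r) (%i. norm (p i) ^ r) h"
 shows "r_germ r (%x. f x + superpose h x) & r_equivalent r f (%x. f x + superpose h x)"
proof -
 note sp = superpose_0[of p, OF p] superpose_C_on[of p, OF p] superpose_flat[of p, OF p] superpose_derivative[of p, OF p]
 let ?H = "superpose h" and ?g = "%x. f x + superpose h x"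
 have h': "flat p r (%i. norm (p i) ^ r) h"
  using h unfolding flat_def by (auto intro: C_on_le)
 have fr: "C_on r U f" by (rule C_on_le[OF f(1)]) simp
 have HU: "C_on r U ?H" using sp(3)[OF h'] C_on_subset by blast
 have gU: "C_on r U ?g" by (rule C_on_add[OF U(1) fr HU])
 have g0: "?g 0 = 0" using f(2) sp(1)[OF h] by simp
 show ?thesis
 proof (cases "r = 0")
  case False
  have "dderiv vs f 0 = dderiv vs ?g 0" if "length vs <= r" for vs
   using dderiv_add[OF U(1) C_on_le[OF fr that] C_on_le[OF HU that] U(2)] sp(3)[OF h'] that by simp
  thus ?thesis using False g0 gU U by (auto simp: r_germ_def r_equivalent_def)
 next
  case True
  have U0: "open (U - {0})" using U(1) by (simp add: open_delete)
  let ?N = "%x. onorm (fder ?H x)"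
  have Hd: "(?H has_derivative fder ?H x) (at x)" if "x ~= 0" for x
   by (rule C_on_derivative[of 0 "- {0}"]) (use sp(2)[OF h] True that in auto)
  have fd: "(f has_derivative fder f x) (at x)" if "x : U" for x by (rule C_on_derivative[OF f(1) that])
  have gd: "fder ?g x v = fder f x v + fder ?H x v"
   if "x : U" "x ~= 0" for x v
   using frechet_derivative_at[OF has_derivative_add[OF fd[OF that(1)] Hd[OF that(2)]]] by metis
  have in_U: "PUNCT x. x : U & x ~= 0" using eventually_at_in_open[OF U] by simp
  have small: "PUNCT x. ?N x <= eta * inverse (norm x)" if "eta > 0" for eta
  proof -
   have "NEAR x. norm (superpose (%i x. fder (h i) x b) x) <= e * inverse (norm x)" if "e > 0" for b e
   proof -
    have "1 / norm (p i) <= 5/4 * inverse (norm x)" if "norm (p i) <= 4/3 * norm x" "norm x <= 5/4 * norm (p i)" for i x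
    proof -
    have "norm (p i) > 0" using p(1) by simp
    moreover from this have "norm x > 0" using that(1) by linarith
    ultimately show ?thesis using that(2) by (simp add: field_simps)
    qed
    moreover have "flat p 0 (%i. 1 / norm (p i)) (%i x. fder (h i) x b)"
    using flat_derivative[of p 0 "%_. 1" h b] h True by simp
    ultimately have "NEAR x. norm (superpose (%i x. fder (h i) x b) x) <= e * (4/5) * (5/4 * inverse (norm x))"
    by (intro superpose_small[of p, OF p]) (use that in auto)
    thus ?thesis by simp
   qed
   hence "NEAR x. (SUM b:Basis. norm (superpose (%i x. fder (h i) x b) x)) <= eta * inverse (norm x)"
    by (intro small_sum finite_Basis that) auto
   hence "PUNCT x. (SUM b:Basis. norm (superpose (%i x. fder (h i) x b) x)) <= eta * inverse (norm x)"
    by (simp add: eventually_at_filter eventually_mono)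
   with in_U show ?thesis
   proof eventually_elim
    case (elim x)
    hence "fder ?H x = (%b. superpose (%i x. fder (h i) x b) x)"
    using frechet_derivative_at[OF sp(4)[OF h]] by metis
    thus ?case using elim onorm_le_sum_Basis[OF has_derivative_linear[OF Hd, of x]] by simp
   qed
  qed
  have "C_on 1 (U - {0}) ?g"
   using C_on_add[OF U0 C_on_subset[OF f(1), of "U - {0}"] C_on_subset[OF sp(2)[OF h], of "U - {0}"]] True by auto
  moreover have "(%x. onorm (fder ?g x)) : O[at 0](%x. inverse (norm x))"
  proof -
   let ?M = "%x. SUM b:Basis. norm (fder f x b)"
   have "isCont ?M 0" using f(1) U True
    by (intro continuous_intros) (auto simp: C_on_Suc C_on_0 continuous_on_eq_continuous_at)
   hence "PUNCT x. ?M x < ?M 0 + 1" unfolding isCont_def by (rule order_tendstoD(2)) simp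
   moreover have "\<forall>\<^sub>F x in at (0::'v). norm x < 1" unfolding eventually_at_filter by (rule eventually_mono[OF eventually_norm_less[OF zero_less_one]]) simp
   ultimately have "PUNCT x. norm (onorm (fder ?g x)) <= (?M 0 + 2) * norm (inverse (norm x))"
    using in_U small[OF zero_less_one]
   proof eventually_elim
    case (elim x)
    hence x: "x : U" "x ~= 0" by auto
    note blf = has_derivative_bounded_linear[OF fd[OF x(1)]] and blH = has_derivative_bounded_linear[OF Hd[OF x(2)]]
    have eqg: "fder ?g x = (%v. fder f x v + fder ?H x v)"
    using gd[OF x] by blast
    have "onorm (fder ?g x) <= onorm (fder f x) + ?N x"
    unfolding eqg by (rule onorm_triangle[OF blf blH])
    also have "onorm (fder f x) <= ?M x"
    by (rule onorm_le_sum_Basis[OF has_derivative_linear[OF fd[OF x(1)]]])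
    also have "?M x <= (?M 0 + 1) * inverse (norm x)"
    proof -
    have "?M x <= ?M 0 + 1" "0 <= ?M 0" using elim(1) by (simp_all add: sum_nonneg)
    moreover have "1 <= inverse (norm x)" using elim(2) x by (simp add: one_le_inverse_iff)
    moreover from calculation have "(?M 0 + 1) * 1 <= (?M 0 + 1) * inverse (norm x)"
    by (intro mult_left_mono add_nonneg_nonneg) auto
    ultimately show ?thesis by (simp only: mult_1_right)
    qed
    also have "?N x <= 1 * inverse (norm x)" using elim by simp
    finally have "onorm (fder ?g x) <= (?M 0 + 2) * inverse (norm x)" by (simp add: algebra_simps)
    moreover have "0 <= onorm (fder ?g x)"
    unfolding eqg by (rule onorm_pos_le[OF bounded_linear_add[OF blf blH]])
    ultimately show ?case by simp
   qed
   thus ?thesis by (rule bigoI)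
  qed
  moreover have "(%x. onorm (%v. fder f x v - fder ?g x v)) : o[at 0](%x. inverse (norm x))"
  proof (rule landau_o.smallI)
   fix c :: real assume "c > 0"
   from in_U small[OF this] show "PUNCT x. norm (onorm (%v. fder f x v - fder ?g x v))
    <= c * norm (inverse (norm x))"
   proof eventually_elim
    case (elim x)
    hence "(%v. fder f x v - fder ?g x v) = (%v. - fder ?H x v)"
    using gd by auto
    moreover have "onorm (%v. - fder ?H x v) = ?N x" by (simp add: onorm_neg)
    moreover have "0 <= ?N x" by (rule onorm_pos_le[OF has_derivative_bounded_linear[OF Hd]]) (use elim in simp)
    ultimately show ?case using elim by simp
   qed
  qed
  ultimately show ?thesis using True g0 gU U by (auto simp: r_germ_def r_equivalent_def C_on_0)
 qed
qed

lemma sparse_subsequence: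
 fixes q :: "nat => 'v::real_normed_vector"
 assumes "q ----> 0" "!!i. q i ~= 0"
 shows "\<exists>sig. strict_mono sig & (ALL i. norm (q (sig (Suc i))) <= norm (q (sig i)) / 4)"
proof -
 have "EX m>n. norm (q m) <= norm (q n) / 4" for n
 proof -
  have "norm (q n) / 4 > 0" using assms(2) by simp
  from LIMSEQ_D[OF assms(1) this] obtain N where "!!m. m >= N ==> norm (q m) < norm (q n) / 4" by auto
  from this[of "max N (Suc n)"] show ?thesis by (intro exI[of _ "max N (Suc n)"]) auto
 qed
 then obtain s where s: "!!n. s n > n" "!!n. norm (q (s n)) <= norm (q n) / 4" by metis
 define sig where "sig i = (s ^^ i) 0" for i
 show ?thesis
  by (intro exI[of _ sig] conjI allI strict_monoI_Suc) (simp_all only: sig_def s funpow.simps o_apply)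
qed

text \<open>A converse to \<open>jets_close\<close>: values and derivatives of the sizes found there
  can be prescribed along a subsequence. Thinning the sequence makes the norms shrink by the factor
  4, hence the supports of the bumps disjoint.\<close>

theorem germ_through_points:
 fixes f :: "'v::euclidean_space => 'w::euclidean_space"
 assumes U: "open U" "0 : U" and f: "C_on (Suc r) U f" "f 0 = 0"
  and q: "q ----> 0" "!!i. q i ~= 0" "!!i. q i : U"
  and B: "!!i. linear (B i)" and e: "ep ----> 0" "!!i. norm (y i - f (q i)) <= ep i * norm (q i) ^ r"
  "!!i. onorm (B i) * norm (q i) <= ep i * norm (q i) ^ r"
 shows "EX g (sig::nat => nat). strict_mono sig & r_germ r g & r_equivalent r f g & (ALL i. g (q (sig i)) = y (sig i) &
  (g has_derivative (%v. fder f ((q (sig i))) v + B (sig i) v)) (at (q (sig i))))"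
proof -
 from sparse_subsequence[OF q(1,2)] obtain sig where sig: "strict_mono sig" "!!i. norm (q (sig (Suc i))) <= norm (q (sig i)) / 4" by blast
 define p where "p i = q (sig i)" for i
 have p: "!!i. p i ~= 0" "!!i. norm (p (Suc i)) <= norm (p i) / 4" using q(2) sig(2) by (simp_all add: p_def)
 have "EX h. flat p (Suc r) (%i. norm (p i) ^ r) h & (ALL i. h i (p i) = y (sig i) - f (p i) & (h i has_derivative B (sig i)) (at (p i)))"
  by (rule prescribed_bumps[of p "%i. B (sig i)" "%i. ep (sig i)", OF p])
   (use B e LIMSEQ_subseq_LIMSEQ[OF e(1) sig(1)] in \<open>auto simp: p_def o_def\<close>)
 then obtain h where h: "flat p (Suc r) (%i. norm (p i) ^ r) h" "!!i. h i (p i) = y (sig i) - f (p i)" "!!i. (h i has_derivative B (sig i)) (at (p i))" by blast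
 let ?g = "%x. f x + superpose h x"
 have g: "?g (p i) = y (sig i) & (?g has_derivative (%v. fder f ((p i)) v + B (sig i) v)) (at (p i))" for i
 proof -
  from support_local[of p, OF p p(1)[of i]] obtain j V where V: "open V" "p i : V"
   and *: "ALL w:V. ALL k. k ~= j --> norm (w - p k) > norm (p k) / 4" by (elim exE conjE)
  from * V(2) have "j = i" by fastforce
  with * have H: "h i w = superpose h w" if "w : V" for w
   using superpose_eq[of p, OF p h(1), of i w] that by simp
  have "(superpose h has_derivative B (sig i)) (at (p i))"
   by (rule has_derivative_transform_within_open[OF h(3) V H])
  moreover have "(f has_derivative fder f ((p i))) (at (p i))"
   by (rule C_on_derivative[OF f(1)]) (use q(3) in \<open>simp add: p_def\<close>)
  ultimately show ?thesis using H[OF V(2), symmetric] h(2) by (auto intro!: has_derivative_add)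
 qed
 define G where "G = ?g"
 have "r_germ r G & r_equivalent r f G" unfolding G_def by (rule perturbed_germ[OF U f p h(1)])
 moreover have "ALL i. G (q (sig i)) = y (sig i) &
   (G has_derivative (%v. fder f ((q (sig i))) v + B (sig i) v)) (at (q (sig i)))"
  using g unfolding G_def p_def by (rule allI)
 ultimately show ?thesis using sig(1) by blast
qed

section \<open>Tangent spaces\<close>

lemma join_nth [simp]: "join x y $ Inl i = x $ i" "join x y $ Inr j = y $ j"
 by (simp_all add: join_def)

lemma xpart_join [simp]: "xpart (join x y) = x"
 by (simp add: xpart_def vec_eq_iff)

definition ypart :: "'a^('n::finite+'m::finite) => 'a^'m" where
 "ypart z = (\<chi> j. z $ Inr j)"

lemma ypart_join [simp]: "ypart (join x y) = y"
 by (simp add: ypart_def vec_eq_iff)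

lemma join_parts [simp]: "join (xpart z) (ypart z) = z"
 by (simp add: vec_eq_iff join_def xpart_def ypart_def split: sum.split)

lemma bounded_linear_parts:
 "bounded_linear (xpart :: 'a::euclidean_space^('n::finite+'m::finite) => _)"
 "bounded_linear (ypart :: 'a::euclidean_space^('n::finite+'m::finite) => _)"
 unfolding linear_conv_bounded_linear[symmetric] by (auto intro!: linearI simp: xpart_def ypart_def vec_eq_iff)

lemma tangent_graph:
 fixes g :: "'a::euclidean_space^'n::finite => 'a^'m::finite"
 assumes g: "(g has_derivative D) (at x)"
 shows "tangent_space (graph g) (join x (g x)) = range (%v. join v (D v))"
proof (intro subset_antisym subsetI)
 fix w :: "'a^('n+'m)" assume "w : range (%v. join v (D v))"
 then obtain v where w: "w = join v (D v)" by blast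
 define gam where "gam t = join (x + t *\<^sub>R v) (g (x + t *\<^sub>R v))" for t
 have l: "((%t. x + t *\<^sub>R v) has_derivative (%t. t *\<^sub>R v)) (at 0)" by (auto intro!: derivative_eq_intros)
 have gl: "((%t. g (x + t *\<^sub>R v)) has_derivative (%t. D (t *\<^sub>R v))) (at 0)"
  by (rule has_derivative_compose[OF l]) (simp add: g)
 have Dl: "D (t *\<^sub>R v) = t *\<^sub>R D v" for t using linear_cmul[OF has_derivative_linear[OF g]] by simp
 have "(gam has_derivative (%t. t *\<^sub>R w)) (at 0)"
 proof (rule has_derivative_vector)
  fix s show "((%t. gam t $ s) has_derivative (%t. (t *\<^sub>R w) $ s)) (at 0)"
   using bounded_linear.has_derivative[OF bounded_linear_vec_nth l] bounded_linear.has_derivative[OF bounded_linear_vec_nth gl]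
   by (cases s) (simp_all add: gam_def w Dl)
 qed
 thus "w : tangent_space (graph g) (join x (g x))"
  unfolding tangent_space_def has_vector_derivative_def by (intro CollectI exI[of _ gam]) (simp add: gam_def graph_def)
next
 fix w assume "w : tangent_space (graph g) (join x (g x))"
 then obtain gam where gam: "gam 0 = join x (g x)" "NEAR t. gam t : graph g" "(gam has_derivative (%t. t *\<^sub>R w)) (at 0)"
  by (auto simp: tangent_space_def has_vector_derivative_def)
 have xd: "((%t. xpart (gam t)) has_derivative (%t. xpart (t *\<^sub>R w))) (at 0)"
  and yd: "((%t. ypart (gam t)) has_derivative (%t. ypart (t *\<^sub>R w))) (at 0)"
  using bounded_linear.has_derivative[OF bounded_linear_parts(1) gam(3)] bounded_linear.has_derivative[OF bounded_linear_parts(2) gam(3)] by auto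
 have "((%t. g (xpart (gam t))) has_derivative (%t. D (xpart (t *\<^sub>R w)))) (at 0)"
  by (rule has_derivative_compose[OF xd]) (simp add: gam(1) g)
 note gd = this
 obtain V where V: "open V" "0 : V" "ALL t:V. gam t : graph g" using gam(2) by (auto simp: eventually_nhds)
 have "g (xpart (gam t)) = ypart (gam t)" if "t : V" for t using V(3) that by (auto simp: graph_def)
 from has_derivative_transform_within_open[OF gd V(1,2) this]
 have "((%t. ypart (gam t)) has_derivative (%t. D (xpart (t *\<^sub>R w)))) (at 0)" .
 from fun_cong[OF has_derivative_unique[OF yd this], of 1] have "ypart w = D (xpart w)" by simp
 hence "w = join (xpart w) (D (xpart w))" using join_parts[of w] by simp
 thus "w : range (%v. join v (D v))" by (rule range_eqI)
qed

lemma tangent_in_kernel: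
 assumes "v : tangent_space N z" "!!w. w : N ==> F w = 0" "(F has_derivative L) (at z)"
 shows "L v = 0"
proof -
 from assms(1) obtain gam where gam: "gam 0 = z" "NEAR t. gam t : N" "(gam has_derivative (%t. t *\<^sub>R v)) (at 0)"
  by (auto simp: tangent_space_def has_vector_derivative_def)
 have 1: "((%t. F (gam t)) has_derivative (%t. L (t *\<^sub>R v))) (at 0)"
  by (rule has_derivative_compose[OF gam(3)]) (simp add: gam(1) assms(3))
 moreover obtain V where "open V" "0 : V" "ALL t:V. gam t : N" using gam(2) by (auto simp: eventually_nhds)
 ultimately have "((%t. 0) has_derivative (%t. L (t *\<^sub>R v))) (at 0)"
  by (intro has_derivative_transform_within_open[OF 1]) (auto simp: assms(2))
 from fun_cong[OF has_derivative_unique[OF this has_derivative_const], of 1] show ?thesis by simp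
qed

lemma norm_smult: "norm (c *s v) = norm c * norm v" for v :: "'a::real_normed_field^'d::finite"
 by (simp add: norm_vec_def norm_mult L2_set_right_distrib)

text \<open>A curve in the zero set of \<open>G\<close> with tangent \<open>v\<close>: the correction \<open>w\<close> of the straight line
  is a fixed point of a map that is continuous by continuity of \<open>G\<close> and maps a ball of radius
  \<open>o(t)\<close> to itself by differentiability at the single point \<open>z\<close>.\<close>

lemma tangent_of_equations:
 fixes G :: "nat => 'a::{real_normed_field,euclidean_space}^'d::finite => 'a"
 assumes V: "open V" "z : V" and G: "!!i w. i < c ==> w : V ==> isCont (G i) w" "!!i. i < c ==> G i z = 0"
  "!!i. i < c ==> (G i has_derivative vdot (D i)) (at z)"
  and b: "ALL i:{..<c}. ALL k:{..<c}. vdot (D i) (b k) = (if i = k then 1 else 0)"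
  and v: "!!i. i < c ==> vdot (D i) v = 0"
 shows "v : tangent_space {w:V. ALL i<c. G i w = 0} z"
proof -
 let ?N = "{w:V. ALL i<c. G i w = 0}"
 have step: "\<exists>tau>0. ALL t. t ~= 0 & \<bar>t\<bar> < tau --> (EX w. norm w <= eta * \<bar>t\<bar> & z + t *\<^sub>R v + w : ?N)" if eta: "eta > 0" for eta
 proof -
  define K where "K = (SUM i<c. norm (b i)) + 1"
  have K: "K > 0" "(SUM i<c. norm (b i)) <= K" unfolding K_def using sum_nonneg[of "{..<c}" "%i. norm (b i)"] by auto
  \<comment> \<open>With this \<open>e\<close> the map \<open>P\<close> below sends the ball of
    radius \<open>eta * \<bar>t\<bar>\<close> into itself.\<close>
  define e where "e = eta / (K * (norm v + eta))"
  have ve: "norm v + eta > 0" using eta norm_ge_zero[of v] by linarith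
  have e: "e > 0" using eta K ve by (simp add: e_def)
  have "\<forall>\<^sub>F u in nhds z. ALL i:{..<c}. norm (G i u - G i z - vdot (D i) (u - z)) <= e * norm (u - z)"
  proof (intro eventually_ball_finite ballI finite_lessThan)
   fix i assume "i : {..<c}"
   hence "(G i has_derivative vdot (D i)) (at z)" using G(3) by simp
   thus "\<forall>\<^sub>F u in nhds z. norm (G i u - G i z - vdot (D i) (u - z)) <= e * norm (u - z)"
    using e unfolding has_derivative_within_alt eventually_nhds_metric by (simp add: dist_norm)
  qed
  hence "\<forall>\<^sub>F u in nhds z. u : V & (ALL i:{..<c}. norm (G i u - G i z - vdot (D i) (u - z)) <= e * norm (u - z))"
   using eventually_nhds_in_open[OF V] by eventually_elim auto
  then obtain d where d: "d > 0" "!!u. norm (u - z) < d ==> u : V & (ALL i<c. norm (G i u - vdot (D i) (u - z)) <= e * norm (u - z))"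
   using G(2) by (auto simp: eventually_nhds_metric dist_norm)
  have "EX w. norm w <= eta * \<bar>t\<bar> & z + t *\<^sub>R v + w : ?N" if t: "t ~= 0" "\<bar>t\<bar> < d / (norm v + eta)" for t
  proof -
   have tb: "\<bar>t\<bar> * (norm v + eta) < d" using t(2) ve by (simp add: field_simps)
   have tw: "norm (t *\<^sub>R v + w) <= \<bar>t\<bar> * (norm v + eta)" if "norm w <= eta * \<bar>t\<bar>" for w
    using norm_triangle_ineq[of "t *\<^sub>R v" w] that by (simp add: algebra_simps)
   define Q where "Q i w = G i (z + t *\<^sub>R v + w) - vdot (D i) w" for i w
   \<comment> \<open>\<open>Q i\<close> is the value of \<open>G i\<close> at the corrected point
     minus its linear part in \<open>w\<close>, and the \<open>b i\<close> are dual to the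
     \<open>D i\<close>. A fixed point satisfies \<open>vdot (D k) w = - Q k w\<close>, that is,
     \<open>G k\<close> vanishes at the corrected point.\<close>
   define P where "P w = - (SUM i<c. Q i w *s b i)" for w
   have near: "z + t *\<^sub>R v + w : V" "ALL i<c. norm (G i (z + t *\<^sub>R v + w) - vdot (D i) w) <= e * (\<bar>t\<bar> * (norm v + eta))"
    if w: "norm w <= eta * \<bar>t\<bar>" for w
   proof -
    have lt: "norm ((z + t *\<^sub>R v + w) - z) < d" using tw[OF w] tb by (simp add: add.assoc)
    show "z + t *\<^sub>R v + w : V" using d(2)[OF lt] by blast
    have "vdot (D i) ((z + t *\<^sub>R v + w) - z) = vdot (D i) w" if "i < c" for i
    proof -
    have "vdot (D i) (t *\<^sub>R v) = t *\<^sub>R vdot (D i) v" using linear_cmul[OF has_derivative_linear[OF G(3)[OF that]]] by simp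
    thus ?thesis using v[OF that] by (simp add: vdot_add add.assoc)
    qed
    note eq = this
    have le: "e * norm ((z + t *\<^sub>R v + w) - z) <= e * (\<bar>t\<bar> * (norm v + eta))"
    using tw[OF w] e by (simp add: add.assoc)
    show "ALL i<c. norm (G i (z + t *\<^sub>R v + w) - vdot (D i) w) <= e * (\<bar>t\<bar> * (norm v + eta))"
    proof (intro allI impI)
    fix i assume i: "i < c"
    have "norm (G i (z + t *\<^sub>R v + w) - vdot (D i) ((z + t *\<^sub>R v + w) - z)) <= e * norm ((z + t *\<^sub>R v + w) - z)"
    using d(2)[OF lt] i by blast
    thus "norm (G i (z + t *\<^sub>R v + w) - vdot (D i) w) <= e * (\<bar>t\<bar> * (norm v + eta))"
    unfolding eq[OF i] using le by linarith
    qed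
   qed
   have "P : cball 0 (eta * \<bar>t\<bar>) \<rightarrow> cball 0 (eta * \<bar>t\<bar>)"
   proof
    fix w :: "'a^'d" assume "w : cball 0 (eta * \<bar>t\<bar>)"
    hence w: "norm w <= eta * \<bar>t\<bar>" by simp
    have "norm (P w) <= (SUM i<c. e * (\<bar>t\<bar> * (norm v + eta)) * norm (b i))"
    unfolding P_def norm_minus_cancel using near(2)[OF w, folded Q_def]
    by (intro sum_norm_le) (auto simp: norm_smult intro!: mult_right_mono)
    also have "... <= e * (\<bar>t\<bar> * (norm v + eta)) * K"
    unfolding sum_distrib_left[symmetric] using K e ve by (intro mult_left_mono) auto
    also have "... = (e * (K * (norm v + eta))) * \<bar>t\<bar>" by (simp only: mult_ac)
    also have "e * (K * (norm v + eta)) = eta" using K ve by (simp add: e_def)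
    finally show "P w : cball 0 (eta * \<bar>t\<bar>)" by simp
   qed
   moreover have "continuous_on (cball 0 (eta * \<bar>t\<bar>)) P"
   proof -
    have "continuous_on (cball 0 (eta * \<bar>t\<bar>)) (%w. G i (z + t *\<^sub>R v + w))" if "i < c" for i
    proof (rule continuous_on_compose2[of V "G i"])
    show "continuous_on V (G i)" using G(1)[OF that] by (simp add: continuous_at_imp_continuous_on)
    show "(%w. z + t *\<^sub>R v + w) ` cball 0 (eta * \<bar>t\<bar>) <= V"
    by (intro image_subsetI near(1)) (simp add: dist_norm)
    qed (intro continuous_intros)
    note Gc = this
    have vc: "continuous_on S (%w. vdot (D i) w)" for i S unfolding vdot_def by (intro continuous_intros)
    have "continuous_on S (%w. h w *s u)" if "continuous_on S h" for S h and u :: "'a^'d"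
    unfolding vector_scalar_mult_def using that by (intro continuous_intros)
    note sc = this
    have "continuous_on (cball 0 (eta * \<bar>t\<bar>)) (Q i)" if "i < c" for i
    unfolding Q_def[abs_def] by (rule continuous_on_diff[OF Gc[OF that] vc])
    thus ?thesis unfolding P_def by (intro continuous_on_minus continuous_on_sum sc) simp
   qed
   moreover have "eta * \<bar>t\<bar> > 0" using eta t(1) by simp
   ultimately obtain w where w: "w : cball 0 (eta * \<bar>t\<bar>)" "P w = w" by (elim brouwer_ball[rotated 2]) auto
   have "G k (z + t *\<^sub>R v + w) = 0" if k: "k < c" for k
   proof -
    have "vdot (D k) w = vdot (D k) (P w)" using w(2) by simp
    also have "... = - (SUM i<c. Q i w * vdot (D k) (b i))"
    unfolding P_def using vdot_diff(1)[of "D k" 0] by (simp only: vdot_sum vdot_smult vdot_simps diff_0)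
    also have "... = - (SUM i<c. if i = k then Q i w else 0)"
    using b k by (intro arg_cong[of _ _ uminus] sum.cong) auto
    also have "... = - Q k w" using k by simp
    finally show ?thesis by (simp add: Q_def)
   qed
   thus ?thesis using near(1)[of w] w(1) by (intro exI[of _ w]) auto
  qed
  thus ?thesis using d(1) ve by (intro exI[of _ "d / (norm v + eta)"]) auto
 qed
 define R where "R t = {w. z + t *\<^sub>R v + w : ?N}" for t
 \<comment> \<open>The fixed point depends on \<open>eta\<close>. Choosing almost shortest
   corrections, up to \<open>t\<^sup>2\<close>, gives one curve that satisfies the bound for every
   \<open>eta\<close>.\<close>
 define m where "m t = Inf (norm ` R t)" for t
 have "EX w. (t ~= 0 & R t ~= {} --> w : R t & norm w < m t + t\<^sup>2) & (t = 0 --> w = 0)" for t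
 proof (cases "t ~= 0 & R t ~= {}")
  case True
  hence "Inf (norm ` R t) < m t + t\<^sup>2" "norm ` R t ~= {}" by (auto simp: m_def)
  from cInf_lessD[OF this(2,1)] show ?thesis using True by auto
 qed auto
 then obtain w where w: "!!t. t ~= 0 ==> R t ~= {} ==> w t : R t & norm (w t) < m t + t\<^sup>2" "w 0 = 0" by metis
 have bound: "\<exists>tau>0. ALL t. \<bar>t\<bar> < tau --> z + t *\<^sub>R v + w t : ?N & norm (w t) <= eta * \<bar>t\<bar>" if eta: "eta > 0" for eta
 proof -
  have "eta / 2 > 0" using eta by simp
  from step[OF this] obtain tau where tau: "tau > 0" "ALL t. t ~= 0 & \<bar>t\<bar> < tau --> (EX u. norm u <= eta / 2 * \<bar>t\<bar> & z + t *\<^sub>R v + u : ?N)"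
   by (elim exE conjE)
  have "z + t *\<^sub>R v + w t : ?N & norm (w t) <= eta * \<bar>t\<bar>" if t: "\<bar>t\<bar> < min tau (eta / 2)" for t
  proof (cases "t = 0")
   case True
   thus ?thesis using w(2) V(2) G(2) by simp
  next
   case False
   with t tau(2) obtain u where u: "norm u <= eta / 2 * \<bar>t\<bar>" "u : R t" by (auto simp: R_def)
   have "m t <= norm u" unfolding m_def by (rule cINF_lower[OF _ u(2)]) (auto intro: bdd_belowI[of _ 0])
   moreover have "t\<^sup>2 <= eta / 2 * \<bar>t\<bar>"
    using t mult_right_mono[of "\<bar>t\<bar>" "eta / 2" "\<bar>t\<bar>"] by (simp add: power2_eq_square)
   moreover have "w t : R t" "norm (w t) < m t + t\<^sup>2" using w(1)[OF False] u(2) by blast+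
   ultimately show ?thesis using u(1) by (auto simp: R_def)
  qed
  thus ?thesis using tau(1) eta by (intro exI[of _ "min tau (eta / 2)"]) auto
 qed
 define gam where "gam t = z + t *\<^sub>R v + w t" for t
 have "(gam has_derivative (%t. t *\<^sub>R v)) (at 0)"
  unfolding has_derivative_within_alt
 proof (intro conjI allI impI)
  show "bounded_linear (%t. t *\<^sub>R v)" by (rule bounded_linear_scaleR_left)
  fix e :: real assume "e > 0"
  from bound[OF this] show "EX d>0. ALL t:UNIV. norm (t - 0) < d --> norm (gam t - gam 0 - (t - 0) *\<^sub>R v) <= e * norm (t - 0)"
   using w(2) by (auto simp: gam_def)
 qed
 moreover have "NEAR t. gam t : ?N"
  using bound[OF zero_less_one] by (auto simp: eventually_nhds_metric gam_def)
 ultimately show ?thesis unfolding tangent_space_def has_vector_derivative_def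
  using w(2) by (intro CollectI exI[of _ gam]) (simp add: gam_def)
qed

lemma row_jacobian: "vdot (row l (jacobian F z)) v = (SUM k:UNIV. v $ k *s partial_map k F z) $ l"
 by (simp add: vdot_def row_def jacobian_def partial_map_def mult.commute)

text \<open>\<open>F\<close> vanishes on \<open>N\<close>, so its differential kills the tangent
  vectors obtained from the defining equations \<open>G\<close>; hence the rows of the Jacobian lie
  in the span of the gradients of the \<open>G i\<close>. That span has dimension at most
  \<open>c\<close>, the rank of the Jacobian, so the two spans coincide and the kernel of the
  Jacobian is tangent to \<open>N\<close>.\<close>

lemma kernel_in_tangent:
 assumes N: "submanifold c N" "z : N" "!!w. w : N ==> F w = 0" and F: "analytic_map_at F z"
  and rk: "rank (jacobian F z) = c" and v: "(SUM k:UNIV. v $ k *s partial_map k F z) = 0"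
 shows "v : tangent_space N z"
proof -
 from bspec[OF N(1)[unfolded submanifold_def] N(2)] obtain V G where V: "open V" "z : V" and G: "!!i w. i < c ==> w : V ==> analytic_at (G i) w"
  and ind: "!!a. (ALL j. (SUM i<c. a i * pd j (G i) z) = 0) ==> (ALL i<c. a i = 0)"
  and NV: "N \<inter> V = {w:V. ALL i<c. G i w = 0}" by auto
 define D where "D i = (\<chi> j. pd j (G i) z)" for i
 have "ALL i:{..<c}. a i = 0" if "(SUM i:{..<c}. a i *s D i) = 0" for a
 proof -
  have "(SUM i<c. a i * pd j (G i) z) = 0" for j using arg_cong[OF that, of "%x. x $ j"] by (simp add: D_def)
  thus ?thesis using ind[of a] by simp
 qed
 from dual_family[of "{..<c}" D, OF finite_lessThan this]
 obtain b where b: "ALL i:{..<c}. ALL k:{..<c}. vdot (D i) (b k) = (if i = k then 1 else 0)" by blast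
 have D: "(G i has_derivative vdot (D i)) (at z)" if "i < c" for i
 proof -
  have "vdot (D i) = (%h. SUM k:UNIV. h $ k * pd k (G i) z)" by (simp add: fun_eq_iff vdot_def D_def mult.commute)
  thus ?thesis using analytic_at_has_derivative[OF G[OF that V(2)]] by simp
 qed
 have tang: "u : tangent_space (N \<inter> V) z" if "!!i. i < c ==> vdot (D i) u = 0" for u
  unfolding NV
 proof (rule tangent_of_equations[OF V _ _ D b that])
  show "isCont (G i) w" if "i < c" "w : V" for i w by (rule analytic_at_isCont[OF G[OF that]])
  show "G i z = 0" if "i < c" for i using NV N(2) V(2) that by blast
 qed
 have "row l (jacobian F z) : vec.span (D ` {..<c})" for l
 proof (rule ccontr)
  assume "row l (jacobian F z) ~: vec.span (D ` {..<c})"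
  from annihilator_exists[OF this] obtain u where u: "!!i. i < c ==> vdot (D i) u = 0" "vdot (row l (jacobian F z)) u = 1" by auto
  have "(SUM k:UNIV. u $ k *s partial_map k F z) = 0"
   by (rule tangent_in_kernel[OF tang[OF u(1)] _ analytic_map_at_has_derivative[OF F]]) (use N(3) in auto)
  thus False using u(2) by (simp add: row_jacobian)
 qed
 hence sub: "vec.span (rows (jacobian F z)) <= vec.span (D ` {..<c})"
  by (intro vec.span_minimal) (auto simp: rows_def)
 have "vec.dim (D ` {..<c}) <= c"
  using vec.dim_le_card[of "D ` {..<c}" "D ` {..<c}"] card_image_le[of "{..<c}" D] by (simp add: vec.span_superset)
 hence "vec.dim (vec.span (D ` {..<c})) <= vec.dim (vec.span (rows (jacobian F z)))"
  using rk by (simp add: row_rank_def_gen)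
 from vec.subspace_dim_equal[OF vec.subspace_span vec.subspace_span sub this]
 have span: "vec.span (rows (jacobian F z)) = vec.span (D ` {..<c})" .
 have "vdot (D i) v = 0" if "i < c" for i
 proof -
  have "vec.subspace {r. vdot r v = 0}" by (simp add: vec.subspace_def vdot_add vdot_smult)
  moreover have "rows (jacobian F z) <= {r. vdot r v = 0}" using v by (auto simp: rows_def row_jacobian)
  ultimately have "vec.span (rows (jacobian F z)) <= {r. vdot r v = 0}" by (intro vec.span_minimal)
  moreover have "D i : vec.span (D ` {..<c})" using that by (intro vec.span_base) auto
  ultimately show ?thesis using span by blast
 qed
 from tang[OF this] show ?thesis unfolding tangent_space_def by (auto elim: eventually_mono)
qed

text \<open>A vector orthogonal to the kernel of \<open>A\<close> lies in the range of the adjoint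
  of \<open>A\<close>.\<close>

lemma orthogonal_to_kernel:
 fixes A :: "'v::euclidean_space => 'w::euclidean_space"
 assumes A: "linear A" and w: "!!v. A v = 0 ==> w \<bullet> v = 0"
 shows "EX l. ALL v. w \<bullet> v = l \<bullet> A v"
proof -
 let ?R = "range (adjoint A)"
 have "subspace ?R" by (rule linear_subspace_image[OF adjoint_linear[OF A] subspace_UNIV])
 obtain y u where yu: "y : span ?R" "!!x. x : span ?R ==> orthogonal u x" "w = y + u"
  using orthogonal_subspace_decomp_exists by metis
 have adj: "u \<bullet> adjoint A l = A u \<bullet> l" for l by (rule adjoint_works[OF A])
 have "A u \<bullet> l = 0" for l using yu(2)[OF span_base, of "adjoint A l"] adj[of l] by (simp add: orthogonal_def)
 hence "A u = 0" using inner_eq_zero_iff by blast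
 from w[OF this] have "y \<bullet> u + u \<bullet> u = 0" using yu(3) by (simp add: inner_add_left)
 moreover have "y \<bullet> u = 0" using yu(2)[OF yu(1)] by (simp add: orthogonal_def inner_commute)
 ultimately have "u = 0" by simp
 hence "w : span ?R" using yu(1,3) by simp
 hence "w : ?R" using span_eq_iff[of ?R] `subspace ?R` by blast
 then obtain l where "w = adjoint A l" by blast
 hence "w \<bullet> v = l \<bullet> A v" for v using adjoint_works[OF A, of v l] by (simp add: inner_commute)
 thus ?thesis by blast
qed

section \<open>Modules of germs and inequalities\<close>

text \<open>An inequality uniform in the covector \<open>alp\<close>, which passes from generators
  to modules; \<open>q alp z\<close> is later built from the norms of the pairings of
  \<open>alp\<close> with generators.\<close>

definition dominated :: "('a::{real_normed_field,euclidean_space}^'d::finite) set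
  => ('a^'p::finite => 'a^'d => real) => ('a^'d => 'a^'p) => bool" where
 "dominated Z q h <-> (EX C>=0. NEAR z. z : Z --> (ALL alp. norm (vdot alp (h z)) <= C * q alp z))"

definition bounded_by :: "('a::{real_normed_field,euclidean_space}^'d::finite) set
  => ('a^'d => real) => ('a^'d => 'a) => bool" where
 "bounded_by Z w a <-> (EX C>=0. NEAR z. z : Z --> norm (a z) <= C * w z)"

lemma bounded_byI: "NEAR z. z : Z --> norm (a z) <= w z ==> bounded_by Z w a"
 unfolding bounded_by_def by (intro exI[of _ 1]) simp

lemma analytic_bounded: "analytic_at a 0 ==> bounded_by Z (%_. 1) a"
 unfolding bounded_by_def
proof (intro exI conjI)
 assume "analytic_at a 0"
 hence "((%z. norm (a z)) ---> norm (a 0)) (nhds 0)" by (intro tendsto_norm analytic_at_imp_tendsto)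
 from order_tendstoD(2)[OF this, of "norm (a 0) + 1"]
 show "NEAR z. z : Z --> norm (a z) <= (norm (a 0) + 1) * 1" by (auto elim: eventually_mono)
qed simp

lemma dominated_smult:
 assumes "bounded_by Z w a" "dominated Z q h" "!!alp z. q alp z >= 0"
 shows "dominated Z (%alp z. w z * q alp z) (%z. a z *s h z)"
proof -
 from assms obtain C D where C: "C >= 0" "NEAR z. z : Z --> norm (a z) <= C * w z"
  and D: "D >= 0" "NEAR z. z : Z --> (ALL alp. norm (vdot alp (h z)) <= D * q alp z)"
  unfolding dominated_def bounded_by_def by blast
 from C(2) D(2) have "NEAR z. z : Z --> (ALL alp. norm (vdot alp (a z *s h z)) <= (C * D) * (w z * q alp z))"
 proof eventually_elim
  case (elim z)
  have "norm (a z) * norm (vdot alp (h z)) <= (C * w z) * (D * q alp z)" if "z : Z" for alp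
   using elim that by (intro mult_mono') auto
  thus ?case by (simp add: vdot_smult norm_mult mult_ac)
 qed
 thus ?thesis using C(1) D(1) unfolding dominated_def by (intro exI[of _ "C * D"]) simp
qed

lemma dominated_sum:
 assumes "!!i. i < (N::nat) ==> dominated Z q (g i)" "NEAR z. h z = (SUM i<N. g i z)"
 shows "dominated Z q h"
proof -
 from assms(1) have "ALL i:{..<N}. EX C>=0. NEAR z. z : Z --> (ALL alp. norm (vdot alp (g i z)) <= C * q alp z)"
  by (auto simp: dominated_def)
 from bchoice[OF this] obtain C where
  C: "ALL i:{..<N}. C i >= 0 & (NEAR z. z : Z --> (ALL alp. norm (vdot alp (g i z)) <= C i * q alp z))" ..
 have "NEAR z. ALL i:{..<N}. z : Z --> (ALL alp. norm (vdot alp (g i z)) <= C i * q alp z)"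
  by (intro eventually_ball_finite) (use C in auto)
 with assms(2) have "NEAR z. z : Z --> (ALL alp. norm (vdot alp (h z)) <= (SUM i<N. C i) * q alp z)"
  by eventually_elim (auto simp: vdot_sum sum_distrib_right intro!: sum_norm_le)
 moreover have "0 <= (SUM i<N. C i)" using C by (intro sum_nonneg) auto
 ultimately show ?thesis unfolding dominated_def by blast
qed

lemma dominated_module_gen:
 assumes G: "!!g. g : G ==> dominated Z q g" and q: "!!alp z. q alp z >= 0" and h: "h : module_gen G"
 shows "dominated Z q h"
proof -
 from h obtain N :: nat and a g where N: "ALL i<N. analytic_at (a i) 0 & g i : G" "NEAR z. h z = (SUM i<N. a i z *s g i z)"
  unfolding module_gen_def by blast
 show ?thesis
 proof (rule dominated_sum[OF _ N(2)])
  fix i assume "i < N"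
  with N(1) have "dominated Z (%alp z. 1 * q alp z) (%z. a i z *s g i z)" by (intro dominated_smult analytic_bounded G q) auto
  thus "dominated Z q (%z. a i z *s g i z)" by simp
 qed
qed

lemma dominated_submodule_gen:
 assumes "!!g. g : G ==> dominated Z q g" "!!a. a : R ==> NEAR z. z : Z --> a z = 0" "!!alp z. q alp z >= 0"
  and "h : submodule_gen R G"
 shows "dominated Z q h"
proof (rule dominated_module_gen[OF _ assms(3) assms(4)[unfolded submodule_gen_def]])
 fix g assume "g : G \<union> {%z. axis l (a z) | a l. a : R}"
 thus "dominated Z q g"
 proof (elim UnE CollectE exE conjE)
  fix a l assume a: "g = (%z. axis l (a z))" "a : R"
  have "NEAR z. z : Z --> (ALL alp. norm (vdot alp (g z)) <= 0 * q alp z)"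
   using assms(2)[OF a(2)] by eventually_elim (simp add: a(1))
  thus ?thesis unfolding dominated_def by (intro exI[of _ 0]) simp
 qed (use assms(1) in blast)
qed

lemma dominated_ideal_times:
 assumes "!!a. a : J ==> bounded_by Z w a" "!!g. g : M ==> dominated Z q g" "!!alp z. q alp z >= 0" "!!z. w z >= 0"
  "!!a. a : R ==> NEAR z. z : Z --> a z = 0" "h : ideal_times R J M"
 shows "dominated Z (%alp z. w z * q alp z) h"
proof (rule dominated_submodule_gen[OF _ assms(5) _ assms(6)[unfolded ideal_times_def]])
 fix g assume "g : {%z. a z *s h z | a h. a : J & h : M}"
 thus "dominated Z (%alp z. w z * q alp z) g" by (elim CollectE exE conjE) (simp add: dominated_smult assms(1-3))
qed (use assms(3,4) in auto)

lemma dominated_module_sum: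
 assumes "!!g. g : M ==> dominated Z q g" "!!g. g : N ==> dominated Z q' g" "!!alp z. q alp z >= 0" "!!alp z. q' alp z >= 0"
  "h : module_sum M N"
 shows "dominated Z (%alp z. q alp z + q' alp z) h"
proof -
 from assms(5) obtain g g' where g: "g : M" "g' : N" "h = (%z. g z + g' z)" by (auto simp: module_sum_def)
 from assms(1)[OF g(1)] assms(2)[OF g(2)] obtain C D where
  C: "C >= 0" "NEAR z. z : Z --> (ALL alp. norm (vdot alp (g z)) <= C * q alp z)"
  and D: "D >= 0" "NEAR z. z : Z --> (ALL alp. norm (vdot alp (g' z)) <= D * q' alp z)" unfolding dominated_def by blast
 from C(2) D(2) have "NEAR z. z : Z --> (ALL alp. norm (vdot alp (h z)) <= (C + D) * (q alp z + q' alp z))"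
 proof (eventually_elim, intro impI allI)
  fix z alp assume z: "z : Z --> (ALL alp. norm (vdot alp (g z)) <= C * q alp z)" "z : Z --> (ALL alp. norm (vdot alp (g' z)) <= D * q' alp z)" "z : Z"
  have "norm (vdot alp (h z)) <= C * q alp z + D * q' alp z"
   unfolding g(3) vdot_add using z by (intro norm_triangle_mono) auto
  moreover have "0 <= C * q' alp z" "0 <= D * q alp z" using C(1) D(1) assms(3,4) by auto
  ultimately show "norm (vdot alp (h z)) <= (C + D) * (q alp z + q' alp z)" by (simp add: algebra_simps)
 qed
 thus ?thesis using C(1) D(1) unfolding dominated_def by (intro exI[of _ "C + D"]) simp
qed

lemma dominated_pullback:
 assumes "!!g. g : M ==> dominated Z q g" "!!alp z. q alp z >= 0" "phi : curves Z" "h : module_gen ((%g. g o phi) ` M)"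
 shows "EX C>=0. NEAR t. ALL alp. norm (vdot alp (h t)) <= C * q alp (phi t)"
proof -
 have phi: "(phi ---> 0) (nhds 0)" "NEAR t. phi t : Z"
  using assms(3) analytic_map_at_imp_tendsto[of phi 0] by (auto simp: curves_def)
 have "dominated {t. phi t : Z} (%alp t. q alp (phi t)) h"
 proof (rule dominated_module_gen[OF _ _ assms(4)])
  fix g assume "g : (%g. g o phi) ` M"
  then obtain g' where g': "g' : M" "g = g' o phi" by blast
  from assms(1)[OF g'(1)] obtain C where "C >= 0" "NEAR z. z : Z --> (ALL alp. norm (vdot alp (g' z)) <= C * q alp z)"
   unfolding dominated_def by blast
  with eventually_compose[OF this(2) phi(1)] show "dominated {t. phi t : Z} (%alp t. q alp (phi t)) g"
   unfolding dominated_def g'(2) by auto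
 qed (rule assms(2))
 then obtain C where C: "C >= 0" "NEAR t. phi t : Z --> (ALL alp. norm (vdot alp (h t)) <= C * q alp (phi t))"
  unfolding dominated_def by auto
 from C(2) phi(2) have "NEAR t. ALL alp. norm (vdot alp (h t)) <= C * q alp (phi t)" by eventually_elim simp
 thus ?thesis using C(1) by blast
qed

lemma bounded_by_mult:
 assumes "bounded_by Z w a" "bounded_by Z w' b"
 shows "bounded_by Z (%z. w z * w' z) (%z. a z * b z)"
proof -
 from assms obtain C D where C: "C >= 0" "NEAR z. z : Z --> norm (a z) <= C * w z"
  and D: "D >= 0" "NEAR z. z : Z --> norm (b z) <= D * w' z" unfolding bounded_by_def by blast
 from C(2) D(2) have "NEAR z. z : Z --> norm (a z * b z) <= (C * D) * (w z * w' z)"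
 proof (eventually_elim, intro impI)
  fix z assume "z : Z --> norm (a z) <= C * w z" "z : Z --> norm (b z) <= D * w' z" "z : Z"
  hence "norm (a z) * norm (b z) <= (C * w z) * (D * w' z)" by (intro mult_mono') auto
  thus "norm (a z * b z) <= (C * D) * (w z * w' z)" by (simp add: norm_mult mult_ac)
 qed
 thus ?thesis unfolding bounded_by_def using C(1) D(1) by (intro exI[of _ "C * D"]) simp
qed

lemma bounded_by_ideal_gen:
 assumes "!!g. g : G ==> bounded_by Z w g" "a : ideal_gen G"
 shows "bounded_by Z w a"
proof -
 from assms(2) obtain N :: nat and c g where N: "ALL i<N. analytic_at (c i) 0 & g i : G" "NEAR z. a z = (SUM i<N. c i z * g i z)"
  unfolding ideal_gen_def by blast
 have "bounded_by Z (%z. 1 * w z) (%z. c i z * g i z)" if "i < N" for i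
  using N(1) that by (intro bounded_by_mult analytic_bounded assms(1)) auto
 hence "ALL i:{..<N}. EX C>=0. NEAR z. z : Z --> norm (c i z * g i z) <= C * w z"
  by (auto simp: bounded_by_def)
 from bchoice[OF this] obtain C where
  C: "ALL i:{..<N}. C i >= 0 & (NEAR z. z : Z --> norm (c i z * g i z) <= C i * w z)" ..
 have "NEAR z. ALL i:{..<N}. z : Z --> norm (c i z * g i z) <= C i * w z"
  by (intro eventually_ball_finite) (use C in auto)
 with N(2) have "NEAR z. z : Z --> norm (a z) <= (SUM i<N. C i) * w z"
  by eventually_elim (auto simp: sum_distrib_right intro!: sum_norm_le)
 moreover have "0 <= (SUM i<N. C i)" using C by (intro sum_nonneg) auto
 ultimately show ?thesis unfolding bounded_by_def by blast
qed

lemma bounded_by_m_ideal: "a : m_ideal ==> bounded_by Z (%z. norm (xpart z)) a"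
 unfolding m_ideal_def
proof (erule bounded_by_ideal_gen[rotated], elim rangeE, rule bounded_byI)
 fix g :: "'a^('b+'c) => 'a" and i assume "g = (%z. z $ Inl i)"
 hence "norm (g z) <= norm (xpart z)" for z
  using norm_nth_le[of "xpart z" i] by (simp add: xpart_def)
 thus "NEAR z. z : Z --> norm (g z) <= norm (xpart z)" by simp
qed

lemma bounded_by_m_pow: "a : m_pow r ==> bounded_by Z (%z. norm (xpart z) ^ r) a"
proof (induction r arbitrary: a)
 case (Suc r)
 show ?case
  by (rule bounded_by_ideal_gen[OF _ Suc.prems[simplified]])
   (use bounded_by_mult[OF bounded_by_m_ideal Suc.IH] in fastforce)
qed (simp add: analytic_bounded)

lemma bounded_by_I_P: "a : I_P f ==> bounded_by Z (%z. norm (ypart z - f (xpart z))) a"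
 unfolding I_P_def
proof (erule bounded_by_ideal_gen[rotated], elim rangeE, rule bounded_byI)
 fix g :: "'a^('b+'c) => 'a" and j assume "g = (%z. z $ Inr j - f (xpart z) $ j)"
 hence "norm (g z) <= norm (ypart z - f (xpart z))" for z
  using norm_nth_le[of "ypart z - f (xpart z)" j] by (simp add: ypart_def)
 thus "NEAR z. z : Z --> norm (g z) <= norm (ypart z - f (xpart z))" by simp
qed

lemma relX_vanishes: "a : relX F ==> NEAR z. z : Xset F --> a z = 0"
 unfolding relX_def ideal_gen_def
 by (elim CollectE exE conjE, erule eventually_mono) (fastforce simp: Xset_def intro!: sum.neutral)

section \<open>The two sides of the inequality for covectors\<close>

definition grad_y :: "('a::{real_normed_field,euclidean_space}^('n::finite+'m::finite) => 'a^'p::finite) => 'a^'p => 'a^('n+'m) => real" where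
 "grad_y F alp z = (SUM j:UNIV. norm (vdot alp (partial_map (Inr j) F z)))"

definition along :: "('a::{real_normed_field,euclidean_space}^('n::finite+'m::finite) => 'a^'p::finite)
  => ('a^'n => 'a^'m) => 'n => 'a^('n+'m) => 'a^'p" where
 "along F f i z = partial_map (Inl i) F z + (SUM j:UNIV. partial_map i f (xpart z) $ j *s partial_map (Inr j) F z)"

definition grad_P :: "('a::{real_normed_field,euclidean_space}^('n::finite+'m::finite) => 'a^'p::finite)
  => ('a^'n => 'a^'m) => 'a^'p => 'a^('n+'m) => real" where
 "grad_P F f alp z = (SUM i:UNIV. norm (vdot alp (along F f i z)))"

lemma grad_nonneg: "grad_y F alp z >= 0" "grad_P F f alp z >= 0"
 by (simp_all add: grad_y_def grad_P_def sum_nonneg)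

lemma dominated_JM_y: "h : JM_y F ==> dominated (Xset F) (grad_y F) h"
 unfolding JM_y_def
 by (rule dominated_submodule_gen[OF _ relX_vanishes grad_nonneg(1)])
  (auto simp: dominated_def grad_y_def intro!: exI[of _ 1] always_eventually member_le_sum)

lemma dominated_JM_P: "h : JM_P F f ==> dominated (Xset F) (grad_P F f) h"
 unfolding JM_P_def along_def[symmetric]
 by (rule dominated_submodule_gen[OF _ relX_vanishes grad_nonneg(2)])
  (auto simp: dominated_def grad_P_def intro!: exI[of _ 1] always_eventually member_le_sum)

abbreviation upper :: "nat => ('a::{real_normed_field,euclidean_space}^('n::finite+'m::finite) => 'a^'p::finite) => ('a^('n+'m) => 'a^'p) set" where
 "upper r F \<equiv> ideal_times (relX F) (m_pow r) (JM_y F)"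

abbreviation lower :: "('a::{real_normed_field,euclidean_space}^('n::finite+'m::finite) => 'a^'p::finite)
  => ('a^'n => 'a^'m) => ('a^('n+'m) => 'a^'p) set" where
 "lower F f \<equiv> module_sum (ideal_times (relX F) m_ideal (JM_P F f)) (ideal_times (relX F) (I_P f) (JM_y F))"

text \<open>The size of the pairings of \<open>alp\<close> with the generators of the module on the
  right-hand side of criterion (1), up to constants.\<close>

definition bound_P :: "('a::{real_normed_field,euclidean_space}^('n::finite+'m::finite) => 'a^'p::finite)
  => ('a^'n => 'a^'m) => 'a^'p => 'a^('n+'m) => real" where
 "bound_P F f alp z = norm (xpart z) * grad_P F f alp z + norm (ypart z - f (xpart z)) * grad_y F alp z"

lemma bound_P_nonneg: "bound_P F f alp z >= 0"
 by (simp add: bound_P_def grad_nonneg)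

lemma dominated_upper: "h : upper r F ==> dominated (Xset F) (%alp z. norm (xpart z) ^ r * grad_y F alp z) h"
 by (rule dominated_ideal_times[OF bounded_by_m_pow dominated_JM_y grad_nonneg(1) _ relX_vanishes]) auto

lemma dominated_lower: "h : lower F f ==> dominated (Xset F) (bound_P F f) h"
 unfolding bound_P_def
 by (rule dominated_module_sum[OF
    dominated_ideal_times[OF bounded_by_m_ideal dominated_JM_P grad_nonneg(2) _ relX_vanishes]
    dominated_ideal_times[OF bounded_by_I_P dominated_JM_y grad_nonneg(1) _ relX_vanishes]]) (auto simp: grad_nonneg)

lemma module_genI: "g : G ==> analytic_map_at g 0 ==> g : module_gen G"
 unfolding module_gen_def
 by (intro CollectI exI[of _ 1] exI[of _ "%_ _. 1"] exI[of _ "%_. g"]) simp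

lemma ideal_genI: "g : G ==> analytic_at g 0 ==> g : ideal_gen G"
 unfolding ideal_gen_def
 by (intro CollectI exI[of _ 1] exI[of _ "%_ _. 1"] exI[of _ "%_. g"]) simp

lemma module_gen_analytic: "h : module_gen H ==> analytic_map_at h 0"
 by (auto simp: module_gen_def)

lemma module_gen_0: "(%_. 0) : module_gen G"
 unfolding module_gen_def by (auto simp: analytic_map_at_def intro!: exI[of _ 0])

lemma ideal_timesI: "a : J ==> h : M ==> analytic_at a 0 ==> analytic_map_at h 0 ==> (%z. a z *s h z) : ideal_times R J M"
 unfolding ideal_times_def submodule_gen_def
 by (intro module_genI) (auto simp: analytic_map_at_def intro!: analytic_intros)

lemma coordinate_in_m_ideal: "(%z. z $ Inl i) : m_ideal"
 unfolding m_ideal_def by (rule ideal_genI) auto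

lemma power_in_m_pow: "(%z. (z $ Inl i) ^ r) : m_pow r"
 by (induction r) (auto intro!: ideal_genI analytic_intros coordinate_in_m_ideal)

lemma germ_module_module_gen: "germ_module (module_gen G)"
 unfolding germ_module_def
proof (intro conjI ballI allI impI)
 fix g h and c :: "'a^1 => 'a" assume gh: "g : module_gen G" "h : module_gen G" and c: "analytic_at c 0"
 from gh(1) obtain N :: nat and a u where N: "ALL i<N. analytic_at (a i) 0 & u i : G" "analytic_map_at g 0" "NEAR z. g z = (SUM i<N. a i z *s u i z)"
  unfolding module_gen_def by blast
 from gh(2) obtain M :: nat and b v where M: "ALL i<M. analytic_at (b i) 0 & v i : G" "analytic_map_at h 0" "NEAR z. h z = (SUM i<M. b i z *s v i z)"
  unfolding module_gen_def by blast
 define a' where "a' i = (if i < M then b i else (%z. - (c z * a (i - M) z)))" for i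
 define u' where "u' i = (if i < M then v i else u (i - M))" for i
 have split: "(SUM i<M + N. s i) = (SUM i<M. s i) + (SUM i<N. s (M + i))" for s :: "nat => 'a^'b" by (induction N) (simp_all add: add.assoc)
 show "(%t. h t - c t *s g t) : module_gen G"
  unfolding module_gen_def
 proof (intro CollectI exI[of _ "M + N"] exI[of _ a'] exI[of _ u'] conjI allI impI)
  show "analytic_at (a' i) 0" if "i < M + N" for i
  proof (cases "i < M")
   case False
   hence "analytic_at (a (i - M)) 0" using N(1) that by auto
   thus ?thesis using False c by (simp add: a'_def analytic_intros)
  qed (use M(1) in \<open>simp add: a'_def\<close>)
  show "u' i : G" if "i < M + N" for i using that N(1) M(1) by (auto simp: u'_def)
  show "analytic_map_at (%t. h t - c t *s g t) 0"
   using N(2) M(2) c by (auto simp: analytic_map_at_def intro!: analytic_intros)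
  show "NEAR z. h z - c z *s g z = (SUM i<M + N. a' i z *s u' i z)"
   using N(3) M(3) by eventually_elim (simp add: split a'_def u'_def vec.scale_sum_right sum_negf)
 qed
next
 fix g h :: "'a^1 => 'a^'b" assume "g : module_gen G" "analytic_map_at h 0 & (NEAR t. h t = g t)"
 moreover from this obtain N :: nat and a u where "ALL i<N. analytic_at (a i) 0 & u i : G" "NEAR z. g z = (SUM i<N. a i z *s u i z)"
  unfolding module_gen_def by blast
 moreover from calculation have "NEAR z. h z = (SUM i<N. a i z *s u i z)"
  by (auto elim: eventually_elim2)
 ultimately show "h : module_gen G" unfolding module_gen_def by blast
qed (rule module_gen_analytic)

lemma separating_covector:
 fixes h :: "'a::{real_normed_field,euclidean_space}^'d::finite => 'a^'p::finite" and phi :: "'a^1 => 'a^'d"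
 assumes h: "analytic_map_at h 0" and phi: "analytic_map_at phi 0" "phi 0 = 0"
  and no: "h o phi ~: module_gen ((%g. g o phi) ` M)" and M: "!!g. g : M ==> analytic_map_at g 0"
 shows "\<exists>alp. (PUNCT t. vdot (alp t) (h (phi t)) ~= 0) &
  (ALL g:M. (%t. vdot (alp t) (g (phi t))) : o[at 0](%t. vdot (alp t) (h (phi t))))"
proof -
 have an: "analytic_map_at (g o phi) 0" if "analytic_map_at g 0" for g
  unfolding o_def by (rule analytic_map_at_compose[of g, OF _ phi(1)]) (simp add: phi(2) that)
 from germ_module_separation[of "module_gen ((%g. g o phi) ` M)" "h o phi" UNIV, OF germ_module_module_gen an[OF h] no]
 obtain alp where alp: "PUNCT t. vdot (alp t) ((h o phi) t) ~= 0"
  "ALL g:module_gen ((%g. g o phi) ` M). (%t. vdot (alp t) (g t)) : o[at 0](%t. vdot (alp t) ((h o phi) t))"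
  using module_gen_0[of "(%g. g o phi) ` M"] by auto
 show ?thesis
 proof (intro exI[of _ alp] conjI ballI)
  fix g assume "g : M"
  hence "g o phi : module_gen ((%g. g o phi) ` M)" by (intro module_genI an M) auto
  with alp(2) show "(%t. vdot (alp t) (g (phi t))) : o[at 0](%t. vdot (alp t) (h (phi t)))" by fastforce
 qed (use alp(1) in simp)
qed

section \<open>The criterion for \<open>W\<close>\<close>

text \<open>Here \<open>1 \<bullet> x\<close> is the real part of \<open>x\<close>: every
  real-linear functional on the field is the real part of a multiplication, and every element can be
  rotated to its norm. This converts real covectors into covectors over the field.\<close>

definition conjugable :: "'a::{real_normed_field,euclidean_space} itself => bool" where
 "conjugable (T :: 'a itself) <-> (ALL a::'a. EX c. ALL b. a \<bullet> b = 1 \<bullet> (c * b)) & (ALL x::'a. \<exists>th. norm th = 1 & 1 \<bullet> (th * x) = norm x)"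

lemma sum_UNIV_sum: "(SUM s:UNIV. h s) = (SUM i:UNIV. h (Inl i)) + (SUM j:UNIV. h (Inr j))"
 for h :: "'n::finite + 'm::finite => 'b::comm_monoid_add"
 unfolding UNIV_Plus_UNIV[symmetric] by (subst sum.Plus) (simp_all add: o_def)

lemma norm_parts_le: "norm (xpart z) <= norm z" "norm (ypart z) <= norm z"
 for z :: "'a::euclidean_space^('n::finite+'m::finite)"
proof -
 have "z \<bullet> z = xpart z \<bullet> xpart z + ypart z \<bullet> ypart z"
  by (simp add: inner_vec_def sum_UNIV_sum xpart_def ypart_def)
 thus "norm (xpart z) <= norm z" "norm (ypart z) <= norm z" by (simp_all add: norm_le)
qed

lemma max_entry: "EX i. ALL k. norm (x k) <= norm (x i)" for x :: "'n::finite => 'a::real_normed_vector"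
proof -
 have "Max (range (%k. norm (x k))) : range (%k. norm (x k))" by (intro Max_in) auto
 then obtain i where "Max (range (%k. norm (x k))) = norm (x i)" by blast
 thus ?thesis using Max_ge[of "range (%k. norm (x k))"] by (intro exI[of _ i]) auto
qed

lemma max_coordinate: "EX i. norm x <= real CARD('n) * norm (x $ i)" for x :: "'a::real_normed_vector^'n::finite"
proof -
 obtain i where i: "!!k. norm (x $ k) <= norm (x $ i)" using max_entry[of "($) x"] by blast
 have "norm x <= (SUM k:UNIV. norm (x $ k))" by (rule norm_le_sum_nth)
 also have "... <= of_nat (card (UNIV::'n set)) * norm (x $ i)" by (rule sum_bounded_above) (rule i)
 finally show ?thesis by blast
qed

text \<open>The vector \<open>join v y\<close> is the sum of the lift of \<open>v\<close> along
  \<open>P\<close> and of the deviation of \<open>y\<close> from the derivative of \<open>f\<close>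
  in direction \<open>v\<close>.\<close>

lemma vdot_total:
 "vdot alp (SUM s:UNIV. join v y $ s *s partial_map s F z) = (SUM i:UNIV. v $ i * vdot alp (along F f i z)) +
  (SUM j:UNIV. (y - (SUM i:UNIV. v $ i *s partial_map i f (xpart z))) $ j * vdot alp (partial_map (Inr j) F z))"
proof -
 have "(SUM i:UNIV. v $ i * (SUM j:UNIV. partial_map i f (xpart z) $ j * vdot alp (partial_map (Inr j) F z)))
  = (SUM j:UNIV. (SUM i:UNIV. v $ i * partial_map i f (xpart z) $ j) * vdot alp (partial_map (Inr j) F z))"
  by (simp add: sum_distrib_left sum_distrib_right mult.assoc) (rule sum.swap)
 thus ?thesis
  by (simp add: sum_UNIV_sum vdot_sum vdot_add vdot_smult along_def algebra_simps sum.distrib sum_subtractf)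
qed

lemma analytic_xpart: "analytic_map_at xpart z" and analytic_ypart: "analytic_map_at ypart z"
 by (auto simp: analytic_map_at_def xpart_def ypart_def)

lemma analytic_partial_map: "analytic_map_at h z ==> analytic_map_at (partial_map s h) z"
 by (simp add: analytic_map_at_def partial_map_def analytic_at_pd)

lemma parts_0 [simp]: "xpart 0 = 0" "ypart 0 = 0"
 by (simp_all add: xpart_def ypart_def vec_eq_iff)

lemma analytic_along:
 assumes "analytic_map_at F z" "analytic_map_at f (xpart z)" shows "analytic_map_at (along F f i) z"
proof -
 have "analytic_map_at (%z. partial_map i f (xpart z)) z"
  by (rule analytic_map_at_compose[of "partial_map i f", OF _ analytic_xpart]) (rule analytic_partial_map[OF assms(2)])
 thus ?thesis using analytic_partial_map[OF assms(1)]
  unfolding analytic_map_at_def along_def by (auto intro!: analytic_intros)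
qed

text \<open>The pairings of \<open>alp\<close> with products of an ideal generator and a module
  generator. Unlike \<open>bound_P\<close> they involve no norms and are analytic in
  \<open>z\<close>, as curve selection requires.\<close>

definition bterm where
 "bterm F f s alp z = (case s of Inl (i, i') => z $ Inl i * vdot alp (along F f i' z)
   | Inr (j, j') => (z $ Inr j - f (xpart z) $ j) * vdot alp (partial_map (Inr j') F z))"

lemma bound_P_le_terms: "bound_P F f alp z <= (SUM s:UNIV. norm (bterm F f s alp z))"
proof -
 have "norm (xpart z) * grad_P F f alp z <= (SUM i:UNIV. norm (z $ Inl i)) * grad_P F f alp z"
  using norm_le_sum_nth[of "xpart z"] by (intro mult_right_mono grad_nonneg) (simp add: xpart_def)
 moreover have "norm (ypart z - f (xpart z)) * grad_y F alp z <= (SUM j:UNIV. norm (z $ Inr j - f (xpart z) $ j)) * grad_y F alp z"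
  using norm_le_sum_nth[of "ypart z - f (xpart z)"] by (intro mult_right_mono grad_nonneg) (simp add: ypart_def)
 ultimately show ?thesis unfolding bound_P_def sum_UNIV_sum
  by (simp add: bterm_def grad_P_def grad_y_def sum_product sum.cartesian_product norm_mult split_def flip: UNIV_Times_UNIV)
qed

lemma terms_le_bound_P:
 fixes z :: "'a::{real_normed_field,euclidean_space}^('n::finite+'m::finite)"
 shows "(SUM s:UNIV. norm (bterm F f s alp z)) <= (CARD('n) + CARD('m)) * bound_P F f alp z"
proof -
 have "(SUM i:UNIV. norm (z $ Inl i)) <= of_nat (card (UNIV::'n set)) * norm (xpart z)"
  using norm_nth_le[of "xpart z"] by (intro sum_bounded_above) (simp add: xpart_def)
 from mult_right_mono[OF this grad_nonneg(2)[of F f alp z]]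
 have 1: "(SUM i:UNIV. norm (z $ Inl i)) * grad_P F f alp z <= CARD('n) * (norm (xpart z) * grad_P F f alp z)" by (simp add: mult.assoc)
 have "(SUM j:UNIV. norm (z $ Inr j - f (xpart z) $ j)) <= of_nat (card (UNIV::'m set)) * norm (ypart z - f (xpart z))"
  using norm_nth_le[of "ypart z - f (xpart z)"] by (intro sum_bounded_above) (simp add: ypart_def)
 from mult_right_mono[OF this grad_nonneg(1)[of F alp z]]
 have 2: "(SUM j:UNIV. norm (z $ Inr j - f (xpart z) $ j)) * grad_y F alp z <= CARD('m) * (norm (ypart z - f (xpart z)) * grad_y F alp z)" by (simp add: mult.assoc)
 have "(SUM s:UNIV. norm (bterm F f s alp z)) = (SUM i:UNIV. norm (z $ Inl i)) * grad_P F f alp z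
  + (SUM j:UNIV. norm (z $ Inr j - f (xpart z) $ j)) * grad_y F alp z" unfolding sum_UNIV_sum
  by (simp add: bterm_def grad_P_def grad_y_def sum_product sum.cartesian_product norm_mult split_def flip: UNIV_Times_UNIV)
 moreover have "0 <= CARD('m) * (norm (xpart z) * grad_P F f alp z)" "0 <= CARD('n) * (norm (ypart z - f (xpart z)) * grad_y F alp z)"
  by (simp_all add: grad_nonneg)
 ultimately show ?thesis using 1 2 unfolding bound_P_def by (simp add: algebra_simps)
qed

definition jacobi_inequality where
 "jacobi_inequality r F f <-> (EX C>=0. NEAR z. z : Xset F -->
   (ALL alp. norm (xpart z) ^ r * grad_y F alp z <= C * bound_P F f alp z))"

lemma setting_ball:
 assumes "setting r F f"
 shows "EX d>0. EX U. ball 0 d <= U & submanifold (codim_germ (Xset F - Yset)) (Wset F \<inter> U) &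
  (ALL z. norm z < d --> analytic_map_at F z & (z : Xset F - Yset --> z : closure (Wset F)) & (r = 0 --> z : Yset --> z : Xset F)) &
  (ALL x. norm x < d --> analytic_map_at f x)"
proof -
 from assms obtain U where U: "open U" "0 : U" "submanifold (codim_germ (Xset F - Yset)) (Wset F \<inter> U)"
  "(Xset F - Yset) \<inter> U <= closure (Wset F)" unfolding setting_def by blast
 have "NEAR z. analytic_map_at F z & z : U & (r = 0 --> z : Yset --> z : Xset F)"
 proof (cases "r = 0")
  case True
  have "NEAR z. analytic_map_at F z" "NEAR z. z : Yset --> z : Xset F"
   using assms True by (auto simp: setting_def intro: analytic_map_at_nhds)
  with eventually_nhds_in_open[OF U(1,2)] show ?thesis by eventually_elim simp
 next
  case False
  have "NEAR z. analytic_map_at F z" using assms by (auto simp: setting_def intro: analytic_map_at_nhds)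
  with eventually_nhds_in_open[OF U(1,2)] show ?thesis by eventually_elim (simp add: False)
 qed
 then obtain d1 where d1: "d1 > 0" "!!z. norm z < d1 ==> analytic_map_at F z & z : U & (r = 0 --> z : Yset --> z : Xset F)"
  by (auto simp: eventually_nhds_metric dist_norm)
 have "NEAR x. analytic_map_at f x" using assms by (auto simp: setting_def intro: analytic_map_at_nhds)
 then obtain d2 where d2: "d2 > 0" "!!x. norm x < d2 ==> analytic_map_at f x" by (auto simp: eventually_nhds_metric dist_norm)
 show ?thesis using d1 d2 U(3,4) by (intro exI[of _ "min d1 d2"] conjI exI[of _ U]) auto
qed

lemma upper_term: "analytic_map_at F 0 ==> (%z. (z $ Inl i) ^ r *s partial_map (Inr j) F z) : upper r F"
 by (intro ideal_timesI power_in_m_pow analytic_partial_map)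
  (auto simp: JM_y_def submodule_gen_def intro!: module_genI analytic_partial_map analytic_intros)

lemma analytic_graph_equation:
 assumes "analytic_map_at f 0" shows "analytic_at (%z. z $ Inr j - f (xpart z) $ j) 0"
proof -
 have "analytic_map_at (%z. f (xpart z)) 0" by (rule analytic_map_at_compose[of f, OF _ analytic_xpart]) (simp add: assms)
 thus ?thesis by (auto simp: analytic_map_at_def intro!: analytic_intros)
qed

lemma lower_terms:
 assumes F: "analytic_map_at F 0" and f: "analytic_map_at f 0"
 shows "(%z. z $ Inl i *s along F f i' z) : lower F f"
  "(%z. (z $ Inr j - f (xpart z) $ j) *s partial_map (Inr j') F z) : lower F f"
proof -
 have al: "analytic_map_at (along F f i) 0" for i by (rule analytic_along) (simp_all add: F f)
 have "(%z. z $ Inl i *s along F f i' z) : ideal_times (relX F) m_ideal (JM_P F f)"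
  by (intro ideal_timesI coordinate_in_m_ideal al)
   (auto simp: JM_P_def submodule_gen_def along_def[symmetric] al intro!: module_genI)
 moreover have z: "(%z. 0) : ideal_times R J M" for R :: "('a^('b+'c) => 'a) set" and J and M :: "('a^('b+'c) => 'a^'d) set"
  unfolding ideal_times_def submodule_gen_def by (rule module_gen_0)
 ultimately show "(%z. z $ Inl i *s along F f i' z) : lower F f"
  unfolding module_sum_def by (intro CollectI exI[of _ "%z. z $ Inl i *s along F f i' z"] exI[of _ "%_. 0"]) simp
 have "(%z. (z $ Inr j - f (xpart z) $ j) *s partial_map (Inr j') F z) : ideal_times (relX F) (I_P f) (JM_y F)"
  by (intro ideal_timesI analytic_graph_equation[OF f] analytic_partial_map F)
   (auto simp: JM_y_def I_P_def submodule_gen_def intro!: module_genI ideal_genI analytic_partial_map F analytic_graph_equation[OF f])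
 with z show "(%z. (z $ Inr j - f (xpart z) $ j) *s partial_map (Inr j') F z) : lower F f"
  unfolding module_sum_def by (intro CollectI exI[of _ "%_. 0"] exI[of _ "%z. (z $ Inr j - f (xpart z) $ j) *s partial_map (Inr j') F z"]) simp
qed

text \<open>The covector becomes a second group of variables, recentred at \<open>alp0\<close>, so
  that the functions on both sides are analytic in \<open>w\<close> and
  \<open>inequality_from_curves\<close> applies. Along a curve the required estimate is
  \<open>dominated_pullback\<close> for the lower module, which is uniform in the covector.\<close>

lemma local_inequality:
 fixes F :: "'a::{real_normed_field,euclidean_space}^('n::finite+'m::finite) => 'a^'p::finite" and f :: "'a^'n => 'a^'m"
 assumes cs: "curve_selection TYPE('a^((('n+'m)+'p)+(('n\<times>'n)+('m\<times>'m))))" and F: "analytic_map_at F 0" and f: "analytic_map_at f 0"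
  and crit: "upper r F <= int_closure (curves (Xset F)) (lower F f)"
 shows "EX C>=0. NEAR w. xpart w : Xset F -->
  norm (xpart (xpart w)) ^ r * grad_y F (alp0 + ypart w) (xpart w) <= C * bound_P F f (alp0 + ypart w) (xpart w)"
proof -
 define a where "a i j w = (xpart w $ Inl i) ^ r * vdot (alp0 + ypart w) (partial_map (Inr j) F (xpart w))" for i j and w :: "'a^(('n+'m)+'p)"
 define b where "b s w = bterm F f s (alp0 + ypart w) (xpart w)" for s and w :: "'a^(('n+'m)+'p)"
 define E where "E = range (%l (w::'a^(('n+'m)+'p)). F (xpart w) $ l)"
 have va: "analytic_at (%w::'a^(('n+'m)+'p). vdot (alp0 + ypart w) (h (xpart w))) 0" if "analytic_map_at h 0" for h :: "'a^('n+'m) => 'a^'p"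
 proof -
  have "analytic_map_at (%w::'a^(('n+'m)+'p). h (xpart w)) 0" by (rule analytic_map_at_compose[of h, OF _ analytic_xpart]) (simp add: that)
  thus ?thesis unfolding vdot_def using analytic_ypart by (auto simp: analytic_map_at_def intro!: analytic_intros)
 qed
 have xa: "analytic_at (%w::'a^(('n+'m)+'p). h (xpart w)) 0" if "analytic_at h 0" for h :: "'a^('n+'m) => 'a"
  by (rule analytic_at_compose[OF _ analytic_xpart]) (simp add: that)
 have aa: "analytic_at (a i j) 0" for i j
  unfolding a_def[abs_def] by (intro analytic_intros xa va analytic_partial_map F)
 have al: "analytic_map_at (along F f i) 0" for i by (rule analytic_along) (simp_all add: F f)
 have ba: "analytic_at (b s) 0" for s
  unfolding b_def[abs_def] bterm_def
  by (cases s) (auto intro!: analytic_at_mult xa[of "%z. z $ Inl _"] xa[of "%z. z $ Inr _ - f (xpart z) $ _"] va analytic_partial_map F al analytic_graph_equation f)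
 have Ea: "finite E" "ALL e:E. analytic_at e 0" using F xa by (auto simp: E_def analytic_map_at_def)
 have Ex: "(ALL e:E. e w = 0) <-> xpart w : Xset F" for w by (auto simp: E_def Xset_def vec_eq_iff)
 have "EX C. NEAR w. (ALL e:E. e w = 0) --> norm (a i j w) <= C * (SUM s:UNIV. norm (b s w))" for i j
 proof (rule inequality_from_curves[OF cs Ea aa], use ba in blast)
  fix phi :: "'a^1 => 'a^(('n+'m)+'p)"
  assume phi: "analytic_map_at phi 0" "phi 0 = 0" "NEAR t. ALL e:E. e (phi t) = 0"
  define psi where "psi t = xpart (phi t)" for t
  have "NEAR t. psi t : Xset F" using phi(3) by eventually_elim (simp add: Ex psi_def)
  moreover have "analytic_map_at psi 0" unfolding psi_def[abs_def] by (rule analytic_map_at_compose[of xpart, OF analytic_xpart phi(1)])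
  ultimately have psi: "psi : curves (Xset F)" by (simp add: curves_def psi_def phi(2))
  let ?h = "%z. (z $ Inl i) ^ r *s partial_map (Inr j) F z"
  have "?h o psi : module_gen ((%g. g o psi) ` lower F f)"
   using crit upper_term[OF F, of i r j] psi unfolding int_closure_def by blast
  from dominated_pullback[OF dominated_lower bound_P_nonneg psi this] obtain C where
   C: "C >= 0" "NEAR t. ALL alp. norm (vdot alp ((?h o psi) t)) <= C * bound_P F f alp (psi t)" by blast
  from C(2) have "NEAR t. norm (a i j (phi t)) <= C * (SUM s:UNIV. norm (b s (phi t)))"
  proof eventually_elim
   case (elim t)
   have "norm (a i j (phi t)) <= C * bound_P F f (alp0 + ypart (phi t)) (psi t)"
    using elim[rule_format, of "alp0 + ypart (phi t)"] by (simp add: a_def psi_def vdot_smult)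
   also have "... <= C * (SUM s:UNIV. norm (b s (phi t)))"
    using bound_P_le_terms[of F f "alp0 + ypart (phi t)" "psi t"] C(1) by (intro mult_left_mono) (simp_all add: b_def psi_def)
   finally show ?case .
  qed
  with C(1) show "EX C>=0. NEAR t. norm (a i j (phi t)) <= C * (SUM s:UNIV. norm (b s (phi t)))" by blast
 qed
 hence "ALL p:UNIV. EX C. NEAR w. (ALL e:E. e w = 0) --> norm (a (fst p) (snd p) w) <= C * (SUM s:UNIV. norm (b s w))" by simp
 from bchoice[OF this] obtain C where
  C: "ALL p:UNIV. NEAR w. (ALL e:E. e w = 0) --> norm (a (fst p) (snd p) w) <= C p * (SUM s:UNIV. norm (b s w))" ..
 define K where "K = (SUM p:UNIV. \<bar>C p\<bar>) * (CARD('n) + CARD('m))"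
 have "NEAR w. ALL p:UNIV. (ALL e:E. e w = 0) --> norm (a (fst p) (snd p) w) <= C p * (SUM s:UNIV. norm (b s w))"
  by (intro eventually_ball_finite C) simp
 hence "NEAR w. xpart w : Xset F -->
  norm (xpart (xpart w)) ^ r * grad_y F (alp0 + ypart w) (xpart w) <= (CARD('n) ^ r * K) * bound_P F f (alp0 + ypart w) (xpart w)"
 proof (eventually_elim, intro impI)
  case (elim w)
  assume "xpart w : Xset F"
  note w = elim this
  let ?S = "SUM s:UNIV. norm (b s w)"
  have S: "0 <= ?S" "?S <= (CARD('n) + CARD('m)) * bound_P F f (alp0 + ypart w) (xpart w)"
   using terms_le_bound_P[of F f "alp0 + ypart w" "xpart w"] by (simp_all add: b_def sum_nonneg)
  obtain i where i: "norm (xpart (xpart w)) <= real CARD('n) * norm (xpart (xpart w) $ i)" using max_coordinate by blast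
  have "norm (xpart (xpart w)) ^ r * grad_y F (alp0 + ypart w) (xpart w)
   <= (real CARD('n) * norm (xpart w $ Inl i)) ^ r * grad_y F (alp0 + ypart w) (xpart w)"
   using i by (intro mult_right_mono power_mono grad_nonneg) (simp_all add: xpart_def)
  also have "... = real CARD('n) ^ r * (SUM j:UNIV. norm (a i j w))"
   by (simp add: a_def grad_y_def sum_distrib_left norm_mult norm_power power_mult_distrib mult_ac)
  also have "(SUM j:UNIV. norm (a i j w)) <= (SUM j:UNIV. \<bar>C (i, j)\<bar> * ?S)"
  proof (rule sum_mono)
   fix j
   have "norm (a i j w) <= C (i, j) * ?S" using w(1)[rule_format, of "(i, j)"] w(2) Ex by auto
   also have "... <= \<bar>C (i, j)\<bar> * ?S" using S(1) by (intro mult_right_mono) auto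
   finally show "norm (a i j w) <= \<bar>C (i, j)\<bar> * ?S" .
  qed
  also have "(SUM j:UNIV. \<bar>C (i, j)\<bar> * ?S) <= (SUM p:UNIV. \<bar>C p\<bar>) * ?S"
  proof -
   have "(SUM j:UNIV. \<bar>C (i, j)\<bar>) = (SUM p:range (Pair i). \<bar>C p\<bar>)" by (subst sum.reindex) (auto intro: inj_onI)
   also have "... <= (SUM p:UNIV. \<bar>C p\<bar>)" by (rule sum_mono2) auto
   finally show ?thesis using S(1) by (simp add: mult_right_mono flip: sum_distrib_right)
  qed
  also have "... <= (SUM p:UNIV. \<bar>C p\<bar>) * ((CARD('n) + CARD('m)) * bound_P F f (alp0 + ypart w) (xpart w))"
   by (intro mult_left_mono S sum_nonneg) auto
  finally show "norm (xpart (xpart w)) ^ r * grad_y F (alp0 + ypart w) (xpart w) <= (CARD('n) ^ r * K) * bound_P F f (alp0 + ypart w) (xpart w)"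
   by (simp add: K_def mult_left_mono mult.assoc)
 qed
 moreover have "0 <= CARD('n) ^ r * K" by (simp add: K_def sum_nonneg)
 ultimately show ?thesis by blast
qed

lemma grad_smult: "grad_y F (c *s alp) z = norm c * grad_y F alp z" "bound_P F f (c *s alp) z = norm c * bound_P F f alp z"
 by (simp_all add: bound_P_def grad_y_def grad_P_def vdot_smult norm_mult algebra_simps flip: sum_distrib_left)

text \<open>Both sides are homogeneous in the covector, so violations can be normalised to norm 1. A
  subsequence of these covectors converges to some \<open>alp0\<close>, where
  \<open>local_inequality\<close> gives a contradiction.\<close>

lemma criterion_imp_inequality:
 fixes F :: "'a::{real_normed_field,euclidean_space}^('n::finite+'m::finite) => 'a^'p::finite" and f :: "'a^'n => 'a^'m"
 assumes cs: "curve_selection TYPE('a^((('n+'m)+'p)+(('n\<times>'n)+('m\<times>'m))))" and F: "analytic_map_at F 0" and f: "analytic_map_at f 0"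
  and crit: "upper r F <= int_closure (curves (Xset F)) (lower F f)"
 shows "jacobi_inequality r F f"
proof (rule ccontr)
 assume no: "~jacobi_inequality r F f"
 let ?L = "%alp z. norm (xpart z) ^ r * grad_y F alp z"
 have "EX z alp. norm z < inverse (real (Suc n)) & z : Xset F & norm alp = 1 & ?L alp z > real n * bound_P F f alp z" for n
 proof (rule ccontr)
  assume none: "~?thesis"
  have "NEAR z. z : Xset F --> (ALL alp. ?L alp z <= real n * bound_P F f alp z)"
  proof (rule eventually_mono[OF eventually_norm_less[of "inverse (real (Suc n))"]], simp, intro impI allI)
   fix z alp assume z: "norm z < inverse (real (Suc n))" "z : Xset F"
   show "?L alp z <= real n * bound_P F f alp z"
   proof (cases "alp = 0")
    case True
    thus ?thesis by (simp add: bound_P_def grad_y_def grad_P_def)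
   next
    case False
    define c :: 'a where "c = of_real (inverse (norm alp))"
    have c: "norm c > 0" "norm (c *s alp) = 1" using False by (simp_all add: c_def norm_smult norm_inverse)
    with none z have "?L (c *s alp) z <= real n * bound_P F f (c *s alp) z" by (meson not_less)
    hence "norm c * ?L alp z <= norm c * (real n * bound_P F f alp z)" by (simp add: grad_smult mult_ac)
    thus ?thesis using c(1) by simp
   qed
  qed
  with no show False unfolding jacobi_inequality_def by (meson of_nat_0_le_iff)
 qed
 hence "ALL n. EX p. norm (fst p) < inverse (real (Suc n)) & fst p : Xset F & norm (snd p) = 1 &
  ?L (snd p) (fst p) > real n * bound_P F f (snd p) (fst p)" by (simp only: split_paired_Ex fst_conv snd_conv) blast
 from choice[OF this] obtain p where p: "ALL n. norm (fst (p n)) < inverse (real (Suc n)) & fst (p n) : Xset F & norm (snd (p n)) = 1 &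
  ?L (snd (p n)) (fst (p n)) > real n * bound_P F f (snd (p n)) (fst (p n))" ..
 define z alp where "z n = fst (p n)" and "alp n = snd (p n)" for n
 have z: "norm (z n) < inverse (real (Suc n))" "z n : Xset F" "norm (alp n) = 1"
  "?L (alp n) (z n) > real n * bound_P F f (alp n) (z n)" for n using p[rule_format, of n] by (simp_all add: z_def alp_def)
 have "compact (sphere (0::'a^'p) 1)" by simp
 moreover have "ALL n. alp n : sphere 0 1" using z(3) by simp
 ultimately obtain alp0 and sig :: "nat => nat" where sig: "strict_mono sig" "(alp o sig) ----> alp0"
  unfolding compact_def by blast
 have "z ----> 0" by (rule Lim_null_comparison[OF _ LIMSEQ_inverse_real_of_nat]) (intro always_eventually allI less_imp_le z(1))
 hence zl: "(%n. z (sig n)) ----> 0" using LIMSEQ_subseq_LIMSEQ[OF _ sig(1)] by (simp add: o_def)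
 have alpl: "(%n. alp (sig n) - alp0) ----> 0" using LIM_zero[OF sig(2)] by (simp add: o_def)
 have "(%n. join (z (sig n)) (alp (sig n) - alp0)) ----> 0"
 proof (rule vec_tendstoI)
  fix s show "(%n. join (z (sig n)) (alp (sig n) - alp0) $ s) ----> 0 $ s"
   using tendsto_vec_nth[OF zl] tendsto_vec_nth[OF alpl] by (cases s) auto
 qed
 note wl = this
 from local_inequality[OF cs F f crit, of alp0] obtain C where "C >= 0" and C: "NEAR w. xpart w : Xset F -->
  ?L (alp0 + ypart w) (xpart w) <= C * bound_P F f (alp0 + ypart w) (xpart w)" by blast
 obtain N where N: "real N >= C" using real_arch_simple by blast
 from eventually_compose[OF C wl] eventually_ge_at_top[of N]
 have "\<forall>\<^sub>F n in sequentially. False"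
 proof eventually_elim
  case (elim n)
  have "C <= real (sig n)" using N elim(2) seq_suble[OF sig(1), of n] by simp
  hence "C * bound_P F f (alp (sig n)) (z (sig n)) <= real (sig n) * bound_P F f (alp (sig n)) (z (sig n))"
   by (rule mult_right_mono[OF _ bound_P_nonneg])
  thus ?case using elim(1) z(2)[of "sig n"] z(4)[of "sig n"] by simp
 qed
 thus False by simp
qed

lemma norm_axis: "norm (axis i c) = norm c" for c :: "'a::real_normed_vector"
 by (simp add: norm_vec_def L2_set_def axis_def if_distrib[of norm] if_distrib[of "%x. x ^ 2"] sum.delta cong: if_cong)

lemma C_on_setting:
 assumes "!!x. norm x < d ==> analytic_map_at f x" shows "C_on r (ball 0 d) f"
 by (rule C_on_analytic) (use assms in auto)

lemma frechet_analytic: "analytic_map_at f x ==> fder f x v = (SUM i:UNIV. v $ i *s partial_map i f x)"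
 using fun_cong[OF frechet_derivative_at[OF analytic_map_at_has_derivative], of f x v] by simp

text \<open>A real covector annihilating the tangent spaces of \<open>W\<close> and of the graph gives a vector \<open>alp\<close>
 violating the inequality, since the graph is close to \<open>P\<close> to first order.\<close>

lemma inequality_imp_transverse:
 fixes F :: "'a::{real_normed_field,euclidean_space}^('n::finite+'m::finite) => 'a^'p::finite" and f :: "'a^'n => 'a^'m"
 assumes cj: "conjugable TYPE('a)" and S: "setting r F f" and ineq: "jacobi_inequality r F f"
 shows "W_is_t r F f"
 unfolding W_is_t_def
proof (intro allI impI, elim conjE)
 fix g assume g: "r_germ r g" "r_equivalent r f g"
 from setting_ball[OF S] obtain d U where d: "d > 0" "ball 0 d <= U" "submanifold (codim_germ (Xset F - Yset)) (Wset F \<inter> U)"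
  "ALL z. norm z < d --> analytic_map_at F z & (z : Xset F - Yset --> z : closure (Wset F)) & (r = 0 --> z : Yset --> z : Xset F)"
  "ALL x. norm x < d --> analytic_map_at f x" by blast
 have f0: "f 0 = 0" using S by (simp add: setting_def)
 from ineq obtain C where C: "C >= 0" "NEAR z. z : Xset F --> (ALL alp. norm (xpart z) ^ r * grad_y F alp z <= C * bound_P F f alp z)"
  unfolding jacobi_inequality_def by blast
 \<comment> \<open>Makes the final estimate read
   \<open>norm x ^ r * ?Q <= 1 / 2 * (norm x ^ r * ?Q)\<close>.\<close>
 define eta where "eta = 1 / (2 * (C + 1) * (CARD('n) + 1))"
 have eta: "eta > 0" using C(1) by (simp add: eta_def)
 have cf: "C_on (Suc r) (ball 0 d) f" by (rule C_on_setting) (use d(5) in blast)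
 let ?D = "%x v. fder f x v - fder g x v"
 have xl: "(xpart ---> (0::'a^'n)) (nhds (0::'a^('n+'m)))" using analytic_map_at_imp_tendsto[OF analytic_xpart, of 0] by simp
 have "NEAR x. x ~= 0 --> (g has_derivative fder g x) (at x) &
  (f has_derivative fder f x) (at x) & norm (g x - f x) <= eta * norm x ^ r & onorm (?D x) * norm x <= eta * norm x ^ r"
  using jets_close[OF open_ball _ cf f0 g eta] d(1) by (simp add: eventually_at_filter)
 from eventually_compose[OF this xl] C(2) eventually_norm_less[OF d(1)]
 show "NEAR z. z : graph g \<inter> Wset F --> transverse_at (graph g) (Wset F) z"
 proof (eventually_elim, intro impI)
  case (elim z)
  note jets = elim(1) and Cz = elim(2) and zd = elim(3)
  assume zW: "z : graph g \<inter> Wset F"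
  define x where "x = xpart z"
  have zx: "z = join x (g x)" using zW by (auto simp: graph_def x_def)
  have W: "z : Xset F" "x ~= 0" "rank (jacobian F z) = codim_germ (Xset F - Yset)"
   using zW by (auto simp: Wset_def Yset_def x_def)
  have gd: "(g has_derivative fder g x) (at x)" and fd: "(f has_derivative fder f x) (at x)"
   and gf: "norm (g x - f x) <= eta * norm x ^ r" and on: "onorm (?D x) * norm x <= eta * norm x ^ r"
   using jets W(2) by (auto simp: x_def)
  have Fz: "analytic_map_at F z" using d(4) zd by blast
  have "norm x < d" using zd norm_parts_le(1)[of z] by (simp add: x_def)
  hence fx: "fder f x v = (SUM i:UNIV. v $ i *s partial_map i f x)" for v
   using d(5) by (intro frechet_analytic) blast
  let ?A = "%v. SUM s:UNIV. v $ s *s partial_map s F z"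
  let ?g' = "fder g x"
  have linA: "linear ?A" by (rule has_derivative_linear[OF analytic_map_at_has_derivative[OF Fz]])
  have ling: "linear (%v. join v (?g' v))"
   using has_derivative_linear[OF gd] by (auto intro!: linearI simp: vec_eq_iff join_def linear_add linear_cmul split: sum.split)
  show "transverse_at (graph g) (Wset F) z"
  proof (rule ccontr)
   assume nt: "~transverse_at (graph g) (Wset F) z"
   define T1 where "T1 = range (%v. join v (?g' v))"
   define T2 where "T2 = {v. ?A v = 0}"
   have T2: "T2 <= tangent_space (Wset F) z"
   proof
    fix v assume "v : T2"
    hence "v : tangent_space (Wset F \<inter> U) z"
    using d(2,3) zW zd Fz W(3) by (intro kernel_in_tangent[where F = F]) (auto simp: T2_def Wset_def Xset_def)
    thus "v : tangent_space (Wset F) z" unfolding tangent_space_def by (auto elim: eventually_mono)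
   qed
   have "span (T1 \<union> T2) ~= UNIV"
   proof
    assume full: "span (T1 \<union> T2) = UNIV"
    have "subspace T1" "subspace T2" unfolding T1_def T2_def
    by (rule linear_subspace_image[OF ling subspace_UNIV], rule linear_subspace_kernel[OF linA])
    hence sub: "span T1 = T1" "span T2 = T2" by (simp_all only: span_eq_iff)
    have "EX u v. w = u + v & u : T1 & v : T2" for w
    using full span_Un[of T1 T2] unfolding sub by blast
    hence "transverse_at (graph g) (Wset F) z"
    using T2 tangent_graph[OF gd] unfolding transverse_at_def zx[symmetric] T1_def by blast
    with nt show False by simp
   qed
   then obtain u0 where u0: "u0 ~: span (T1 \<union> T2)" by blast
   obtain y w where yw: "y : span (T1 \<union> T2)" "!!v. v : span (T1 \<union> T2) ==> orthogonal w v" "u0 = y + w"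
    using orthogonal_subspace_decomp_exists by metis
   have w0: "w ~= 0" using u0 yw(1,3) by auto
   have wT: "w \<bullet> v = 0" if "v : T1 \<union> T2" for v using yw(2)[OF span_base[OF that]] by (simp add: orthogonal_def)
   \<comment> \<open>\<open>w\<close> kills the kernel of the differential of \<open>F\<close>, so
     it factors through that differential; by \<open>conjugable\<close> the factor is the real part
     of the pairing with a covector \<open>alp\<close> over the field.\<close>
   have "EX l. ALL v. w \<bullet> v = l \<bullet> ?A v" by (rule orthogonal_to_kernel[OF linA]) (use wT in \<open>simp add: T2_def\<close>)
   then obtain l where l: "!!v. w \<bullet> v = l \<bullet> ?A v" by blast
   from cj have "ALL k. EX c. ALL b. l $ k \<bullet> b = 1 \<bullet> (c * b)" unfolding conjugable_def by blast
   from choice[OF this] obtain c where c: "!!k b. l $ k \<bullet> b = 1 \<bullet> (c k * b)" by blast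
   define alp where "alp = (\<chi> k. c k)"
   have la: "l \<bullet> b = 1 \<bullet> vdot alp b" for b by (simp add: inner_vec_def vdot_def alp_def c inner_sum_right)
   define p where "p i = vdot alp (along F f i z)" for i
   define q where "q j = vdot alp (partial_map (Inr j) F z)" for j
   have tot: "w \<bullet> join v y = 1 \<bullet> ((SUM i:UNIV. v $ i * p i) + (SUM j:UNIV. (y - fder f x v) $ j * q j))" for v y
    unfolding l la vdot_total[where f = f] p_def q_def fx by (simp add: x_def)
   let ?Q = "grad_y F alp z"
   have Q: "?Q = (SUM j:UNIV. norm (q j))" by (simp add: grad_y_def q_def)
   have blD: "bounded_linear (?D x)" by (intro bounded_linear_sub has_derivative_bounded_linear[OF fd] has_derivative_bounded_linear[OF gd])
   have on0: "0 <= onorm (?D x)" by (rule onorm_pos_le[OF blD])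
   have pi: "norm (p i) <= onorm (?D x) * ?Q" for i
   proof -
    \<comment> \<open>In the direction \<open>axis i th\<close> the real part of the pairing is
      \<open>norm (p i)\<close>.\<close>
    from cj obtain th where th: "norm th = 1" "1 \<bullet> (th * p i) = norm (p i)" unfolding conjugable_def by blast
    let ?v = "axis i th :: 'a^'n"
    have "w \<bullet> join ?v (?g' ?v) = 0" by (rule wT) (simp add: T1_def)
    hence "1 \<bullet> ((SUM i:UNIV. ?v $ i * p i) + (SUM j:UNIV. (?g' ?v - fder f x ?v) $ j * q j)) = 0"
    unfolding tot .
    moreover have "(SUM k:UNIV. ?v $ k * p k) = th * p i" by (simp add: axis_def if_distrib if_distribR sum.delta cong: if_cong)
    ultimately have "norm (p i) = 1 \<bullet> (SUM j:UNIV. ?D x ?v $ j * q j)"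
    using th(2) by (simp add: inner_add_right algebra_simps sum_subtractf inner_diff_right)
    also have "... <= norm (SUM j:UNIV. ?D x ?v $ j * q j)" using norm_cauchy_schwarz[of 1 "SUM j:UNIV. ?D x ?v $ j * q j"] by simp
    also have "... <= (SUM j:UNIV. norm (?D x ?v) * norm (q j))"
    by (intro sum_norm_le) (metis norm_mult mult_right_mono norm_ge_zero norm_nth_le)
    also have "... = norm (?D x ?v) * ?Q" by (simp add: Q sum_distrib_left)
    also have "... <= (onorm (?D x) * norm ?v) * ?Q" by (intro mult_right_mono onorm[OF blD] grad_nonneg)
    also have "norm ?v = 1" using th(1) by (simp add: norm_axis)
    finally show ?thesis by simp
   qed
   have "grad_P F f alp z <= of_nat (card (UNIV::'n set)) * (onorm (?D x) * ?Q)"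
    unfolding grad_P_def p_def[symmetric] by (intro sum_bounded_above pi)
   hence gP: "norm x * grad_P F f alp z <= norm x * (CARD('n) * (onorm (?D x) * ?Q))" by (intro mult_left_mono) auto
   also have "... = CARD('n) * ((onorm (?D x) * norm x) * ?Q)" by (simp add: mult_ac)
   also have "... <= CARD('n) * ((eta * norm x ^ r) * ?Q)" by (intro mult_left_mono mult_right_mono on grad_nonneg) simp
   finally have 1: "norm x * grad_P F f alp z <= CARD('n) * ((eta * norm x ^ r) * ?Q)" .
   have "norm (ypart z - f x) * ?Q <= (eta * norm x ^ r) * ?Q"
    by (intro mult_right_mono grad_nonneg) (use gf in \<open>simp add: zx\<close>)
   with 1 have "bound_P F f alp z <= (CARD('n) + 1) * ((eta * norm x ^ r) * ?Q)"
    unfolding bound_P_def x_def by (simp add: algebra_simps)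
   hence "C * bound_P F f alp z <= (C + 1) * ((CARD('n) + 1) * ((eta * norm x ^ r) * ?Q))"
    using C(1) bound_P_nonneg[of F f alp z] by (intro mult_mono) auto
   also have "... = ((C + 1) * (CARD('n) + 1) * eta) * (norm x ^ r * ?Q)" by (simp add: mult_ac)
   also have "(C + 1) * (CARD('n) + 1) * eta = 1 / 2" using C(1) by (simp add: eta_def)
   finally have "norm x ^ r * ?Q <= 1 / 2 * (norm x ^ r * ?Q)" using Cz W(1) unfolding x_def by (meson order_trans)
   moreover have "0 <= norm x ^ r * ?Q" by (simp add: grad_nonneg)
   ultimately have "norm x ^ r * ?Q = 0" by linarith
   hence Q0: "?Q = 0" using W(2) by simp
   \<comment> \<open>Now all pairings vanish, so \<open>w\<close> is orthogonal to every vector,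
     although it was chosen nonzero.\<close>
   hence q0: "q j = 0" for j unfolding Q by (simp add: sum_nonneg_eq_0_iff)
   have p0: "p i = 0" for i using pi[of i] Q0 by simp
   have "w \<bullet> join (xpart w) (ypart w) = 0" unfolding tot p0 q0 by simp
   thus False using w0 by simp
  qed
 qed
qed

text \<open>Near \<open>z\<close> all points of \<open>Y\<close> lie in \<open>X\<close>, so
  \<open>F\<close> is constant along the \<open>y\<close> directions. For \<open>r = 0\<close> this
  keeps the chosen curve points away from \<open>Y\<close>.\<close>

lemma grad_y_on_Y:
 assumes Y: "\<forall>\<^sub>F w in nhds z. w : Yset --> w : Xset F" "z : Yset"
 shows "grad_y F alp z = 0"
proof -
 have "partial_map (Inr j) F z $ l = 0" for j l
 proof -
  have "((%t. z + axis (Inr j) t) ---> z + 0) (nhds 0)" by (intro tendsto_intros tendsto_axis)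
  from eventually_compose[OF Y(1) this[simplified]]
  have "NEAR t. F (z + axis (Inr j) t) $ l = 0"
  proof eventually_elim
   case (elim t)
   have "z + axis (Inr j) t : Yset" using Y(2) by (simp add: Yset_def xpart_def vec_eq_iff axis_def)
   thus ?case using elim by (simp add: Xset_def)
  qed
  from deriv_cong_ev[OF this refl] show ?thesis by (simp add: partial_map_def pd_def)
 qed
 thus ?thesis by (simp add: grad_y_def vdot_def)
qed

lemma points_near_0:
 fixes Q :: "nat => 'a::{real_normed_field,euclidean_space}^1 => bool"
 assumes "!!n. PUNCT t. Q n t" shows "EX t. ALL n. Q n (t n)"
proof -
 have "EX t. Q n t" for n using eventually_happens[OF assms[of n]] by simp
 thus ?thesis by metis
qed

lemma curve_near_0:
 assumes "phi : curves Z" "d > 0"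
 shows "PUNCT t. phi t : Z & norm (phi t) < d"
proof -
 have "(phi ---> 0) (nhds 0)" "NEAR t. phi t : Z"
  using assms(1) analytic_map_at_imp_tendsto[of phi 0] by (auto simp: curves_def)
 from this(2) eventually_compose[OF eventually_norm_less[OF assms(2)] this(1)]
 show ?thesis unfolding eventually_at_filter by eventually_elim simp
qed

text \<open>Conversely, along a curve on which integral dependence fails there are points of \<open>W\<close> through
  which a transversal with the given jet can be bent so that it is not transverse.\<close>

lemma transverse_imp_criterion:
 fixes F :: "'a::{real_normed_field,euclidean_space}^('n::finite+'m::finite) => 'a^'p::finite" and f :: "'a^'n => 'a^'m"
 assumes S: "setting r F f" and t: "W_is_t r F f"
 shows "upper r F <= int_closure (curves (Xset F)) (lower F f)"
proof
 fix h assume h: "h : upper r F"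
 hence ha: "analytic_map_at h 0" unfolding ideal_times_def submodule_gen_def by (rule module_gen_analytic)
 from S have F0: "analytic_map_at F 0" and f0: "analytic_map_at f 0" "f 0 = 0" by (auto simp: setting_def)
 show "h : int_closure (curves (Xset F)) (lower F f)"
 proof (rule ccontr)
  assume "h ~: int_closure (curves (Xset F)) (lower F f)"
  then obtain phi where phi: "phi : curves (Xset F)" "h o phi ~: module_gen ((%g. g o phi) ` lower F f)"
   unfolding int_closure_def using ha by blast
  have low: "analytic_map_at g 0" if "g : lower F f" for g
   using that unfolding module_sum_def ideal_times_def submodule_gen_def
   by (auto dest!: module_gen_analytic simp: analytic_map_at_def intro!: analytic_intros)
  from separating_covector[OF ha _ _ phi(2) low] phi(1) obtain alp where
   alp: "PUNCT t. vdot (alp t) (h (phi t)) ~= 0"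
    "ALL g:lower F f. (%t. vdot (alp t) (g (phi t))) : o[at 0](%t. vdot (alp t) (h (phi t)))"
   by (auto simp: curves_def)
  let ?A = "%t. norm (vdot (alp t) (h (phi t)))"
  have phil: "(phi ---> 0) (nhds 0)" using phi(1) analytic_map_at_imp_tendsto[of phi 0] by (auto simp: curves_def)
  from dominated_upper[OF h] obtain C where C: "C >= 0" "NEAR z. z : Xset F -->
   (ALL alp. norm (vdot alp (h z)) <= C * (norm (xpart z) ^ r * grad_y F alp z))" unfolding dominated_def by blast
  have C': "PUNCT t. ?A t <= C * (norm (xpart (phi t)) ^ r * grad_y F (alp t) (phi t))"
   using eventually_compose[OF C(2) phil] curve_near_0[OF phi(1) zero_less_one]
   unfolding eventually_at_filter by eventually_elim auto
  have small: "PUNCT t. bound_P F f (alp t) (phi t) <= eta * ?A t" if "eta > 0" for eta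
  proof -
   have "PUNCT t. norm (bterm F f s (alp t) (phi t)) <= e * ?A t" if "e > 0" for s e
   proof -
    obtain g where g: "g : lower F f" "!!alp z. vdot alp (g z) = bterm F f s alp z"
    proof (cases s)
    case (Inl q)
    show thesis by (rule that[OF lower_terms(1)[OF F0 f0(1), of "fst q" "snd q"]]) (simp only: Inl bterm_def vdot_smult split_def sum.case)
    next
    case (Inr q)
    show thesis by (rule that[OF lower_terms(2)[OF F0 f0(1), of "fst q" "snd q"]]) (simp only: Inr bterm_def vdot_smult split_def sum.case)
    qed
    from alp(2) g(1) have "(%t. vdot (alp t) (g (phi t))) : o[at 0](%t. vdot (alp t) (h (phi t)))" by blast
    from landau_o.smallD[OF this that] show ?thesis by (simp add: g(2))
   qed
   hence "PUNCT t. (SUM s:UNIV. norm (bterm F f s (alp t) (phi t))) <= eta * ?A t"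
    by (intro small_sum that) auto
   thus ?thesis by eventually_elim (rule order_trans[OF bound_P_le_terms])
  qed
  from setting_ball[OF S] obtain d U where d: "d > 0"
   "ALL z. norm z < d --> analytic_map_at F z & (z : Xset F - Yset --> z : closure (Wset F)) & (r = 0 --> z : Yset --> z : Xset F)"
   "ALL x. norm x < d --> analytic_map_at f x" by blast
  let ?N = "%alp z. norm (xpart z) ^ r * grad_y F alp z"
  \<comment> \<open>A strict violation of the inequality with constant \<open>Suc n\<close>, at
    distance less than \<open>d / real (Suc n)\<close> from 0. Strictness makes it an open condition
    on \<open>z\<close>.\<close>
  define good where "good n alp z <-> norm z < d / real (Suc n) & bound_P F f alp z < ?N alp z / real (Suc n)" for n alp z
  have scal: "1 / (c * N) * (c * x) = x / N" if "c ~= 0" for c N x :: real using that by simp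
  have "PUNCT t. phi t : Xset F - Yset & good n (alp t) (phi t)" for n
  proof -
   \<comment> \<open>This factor absorbs the constant \<open>C\<close> in the bound
     \<open>C'\<close> of \<open>?A\<close>; \<open>C + 1\<close> is positive also for
     \<open>C = 0\<close>.\<close>
   have "1 / ((C + 1) * real (Suc n)) > 0" "d / real (Suc n) > 0" using C(1) d(1) by auto
   from small[OF this(1)] curve_near_0[OF phi(1) this(2)] C' alp(1) show ?thesis
   proof eventually_elim
    case (elim t)
    let ?n = "?N (alp t) (phi t)"
    have A: "?A t > 0" using elim(4) by simp
    have dn: "norm (phi t) < d" using elim(2) by (rule_tac less_le_trans[of _ "d / real (Suc n)"]) (use d(1) in \<open>auto simp: field_simps\<close>)
    have "0 <= ?n" by (simp add: grad_nonneg)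
    moreover have "?n ~= 0"
    proof
    assume "?n = 0"
    with elim(3) A show False by simp
    qed
    ultimately have n: "?n > 0" by linarith
    hence n: "?n > 0" "?A t < (C + 1) * ?n" using elim(3) by (auto simp: distrib_right)
    have "bound_P F f (alp t) (phi t) <= 1 / ((C + 1) * real (Suc n)) * ?A t" by (rule elim(1))
    also have "... < 1 / ((C + 1) * real (Suc n)) * ((C + 1) * ?n)" using n(2) C(1) by (intro mult_strict_left_mono) auto
    also have "... = ?n / real (Suc n)" using scal[of "C + 1"] C(1) by simp
    finally have "good n (alp t) (phi t)" using elim(2) by (simp add: good_def)
    moreover have "phi t ~: Yset"
    proof
    assume Y: "phi t : Yset"
    show False
    proof (cases "r = 0")
    case True
    have "\<forall>\<^sub>F w in nhds (phi t). w : ball 0 d" by (rule eventually_nhds_in_open) (use dn in auto)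
    hence "\<forall>\<^sub>F w in nhds (phi t). w : Yset --> w : Xset F" by eventually_elim (use d(2) True in auto)
    from grad_y_on_Y[OF this Y] n(1) show False by simp
    next
    case False
    thus False using n(1) Y by (simp add: Yset_def power_0_left)
    qed
    qed
    ultimately show ?case using elim(2) by blast
   qed
  qed
  then obtain t where t': "!!n. phi (t n) : Xset F - Yset & good n (alp (t n)) (phi (t n))"
   using points_near_0[of "%n t. phi t : Xset F - Yset & good n (alp t) (phi t)"] by blast
  have dn: "norm z < d" if "norm z < d / real (Suc n)" for z :: "'a^('n+'m)" and n
   using that d(1) by (rule_tac less_le_trans[of _ "d / real (Suc n)"]) (auto simp: field_simps)
  define bet where "bet n = alp (t n)" for n
  \<comment> \<open>The curve runs in \<open>X\<close> but may avoid \<open>W\<close>; as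
    \<open>W\<close> is dense and \<open>good\<close> is open, the point can be moved into
    \<open>W\<close> with the covector kept.\<close>
  have "EX z:Wset F. good n (bet n) z" for n
  proof -
   let ?z = "phi (t n)"
   have z: "norm ?z < d / real (Suc n)" "bound_P F f (bet n) ?z < ?N (bet n) ?z / real (Suc n)" "?z : Xset F - Yset"
    using t'[of n] by (auto simp: good_def bet_def)
   have Fz: "analytic_map_at F ?z" and fz: "analytic_map_at f (xpart ?z)"
    using d(2,3) dn[OF z(1)] norm_parts_le(1)[of ?z] by (auto intro: le_less_trans)
   have c: "((%z. vdot (bet n) (k z)) ---> vdot (bet n) (k ?z)) (nhds ?z)" if "analytic_map_at k ?z" for k :: "'a^('n+'m) => 'a^'p"
    unfolding vdot_def by (intro tendsto_intros analytic_map_at_imp_tendsto[OF that])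
   have xt: "(xpart ---> xpart ?z) (nhds ?z)" "(ypart ---> ypart ?z) (nhds ?z)"
    by (rule analytic_map_at_imp_tendsto[OF analytic_xpart], rule analytic_map_at_imp_tendsto[OF analytic_ypart])
   have ft: "((%z. f (xpart z)) ---> f (xpart ?z)) (nhds ?z)"
    by (rule filterlim_compose[OF analytic_map_at_imp_tendsto[OF fz] xt(1)])
   have "((%z. bound_P F f (bet n) z - ?N (bet n) z / real (Suc n)) ---> bound_P F f (bet n) ?z - ?N (bet n) ?z / real (Suc n)) (nhds ?z)"
    unfolding bound_P_def grad_y_def grad_P_def
    by (intro tendsto_intros c xt ft analytic_partial_map Fz analytic_along[OF Fz fz]) simp
   from order_tendstoD(2)[OF this, of 0] z(2)
   have "\<forall>\<^sub>F w in nhds ?z. bound_P F f (bet n) w - ?N (bet n) w / real (Suc n) < 0" by simp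
   moreover have "\<forall>\<^sub>F w in nhds ?z. w : ball 0 (d / real (Suc n))" by (rule eventually_nhds_in_open) (use z(1) in auto)
   ultimately have "\<forall>\<^sub>F w in nhds ?z. good n (bet n) w" by eventually_elim (auto simp: good_def)
   then obtain V where V: "open V" "?z : V" "ALL w:V. good n (bet n) w" by (auto simp: eventually_nhds)
   have "?z : closure (Wset F)" using d(2) dn[OF z(1)] z(3) by blast
   thus ?thesis using V closure_iff_nhds_not_empty[of ?z "Wset F"] by blast
  qed
  then obtain z where z: "!!n. z n : Wset F" "!!n. good n (bet n) (z n)" by metis
  define q where "q n = xpart (z n)" for n
  have zd: "norm (z n) < d / real (Suc n)" for n using z(2) by (simp add: good_def)
  have ql: "q ----> 0"
  proof (rule Lim_null_comparison)
   show "\<forall>\<^sub>F n in sequentially. norm (q n) <= d * inverse (real (Suc n))"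
    unfolding q_def divide_inverse[symmetric] by (intro always_eventually allI order_trans[OF norm_parts_le(1) less_imp_le[OF zd]])
   show "(%n. d * inverse (real (Suc n))) ----> 0" using tendsto_mult_right_zero[OF LIMSEQ_inverse_real_of_nat] .
  qed
  have q0: "q n ~= 0" for n using z(1)[of n] by (simp add: Wset_def Yset_def q_def)
  have qd: "norm (q n) < d" for n using norm_parts_le(1)[of "z n"] dn[OF zd, of n] by (simp add: q_def)
  define G where "G j n = vdot (bet n) (partial_map (Inr j) F (z n))" for j n
  define H where "H i n = vdot (bet n) (along F f i (z n))" for i n
  let ?Q = "%n. grad_y F (bet n) (z n)"
  have Qpos: "?Q n > 0" for n
  proof -
   have "0 < ?N (bet n) (z n) / real (Suc n)" using z(2)[of n] bound_P_nonneg[of F f "bet n" "z n"] by (simp add: good_def)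
   hence "?Q n ~= 0" by auto
   thus ?thesis using grad_nonneg(1)[of F "bet n" "z n"] by simp
  qed
  \<comment> \<open>The largest entry of the \<open>y\<close> gradient, used as the pivot in
    \<open>B\<close>.\<close>
  have "EX j. ?Q n <= CARD('m) * norm (G j n)" for n
  proof -
   obtain j where "!!k. norm (G k n) <= norm (G j n)" using max_entry[of "%k. G k n"] by blast
   hence "?Q n <= of_nat (card (UNIV::'m set)) * norm (G j n)"
    unfolding grad_y_def G_def by (intro sum_bounded_above)
   thus ?thesis by blast
  qed
  then obtain j where j: "!!n. ?Q n <= CARD('m) * norm (G (j n) n)" by metis
  have Gj: "G (j n) n ~= 0" for n using j[of n] Qpos[of n] by auto
  \<comment> \<open>A correction of the derivative in the single direction \<open>j n\<close>,
    chosen so that \<open>bet n\<close> kills all tangent vectors of the new graph at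
    \<open>z n\<close>. Its size is governed by the pairings \<open>H\<close> along
    \<open>P\<close>, which the violated inequality makes small.\<close>
  define B where "B n v = (axis (j n) (- (SUM i:UNIV. v $ i * H i n) / G (j n) n) :: 'a^'m)" for n and v :: "'a^'n"
  define ep where "ep n = CARD('m) * inverse (real (Suc n))" for n
  have ep: "ep ----> 0" unfolding ep_def[abs_def] using tendsto_mult_right_zero[OF LIMSEQ_inverse_real_of_nat] .
  have key: "norm (q n) * grad_P F f (bet n) (z n) + norm (ypart (z n) - f (q n)) * ?Q n <= inverse (real (Suc n)) * norm (q n) ^ r * ?Q n" for n
   using z(2)[of n] by (simp add: good_def bound_P_def q_def divide_inverse mult_ac)
  have "EX g (sig::nat => nat). strict_mono sig & r_germ r g & r_equivalent r f g & (ALL i. g (q (sig i)) = ypart (z (sig i)) &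
   (g has_derivative (%v. fder f ((q (sig i))) v + B (sig i) v)) (at (q (sig i))))"
  proof (rule germ_through_points[where U = "ball 0 d" and ep = ep])
   show "open (ball (0::'a^'n) d)" "(0::'a^'n) : ball 0 d" "f 0 = 0" "q ----> 0" "ep ----> 0"
    using d(1) f0(2) ql ep by auto
   show "C_on (Suc r) (ball 0 d) f" by (rule C_on_setting) (use d(3) in blast)
   show "q n ~= 0" "q n : ball 0 d" for n using qd q0 by auto
   show "linear (B n)" for n
   proof (rule linearI)
    have add: "(SUM i:UNIV. (v + w) $ i * H i n) = (SUM i:UNIV. v $ i * H i n) + (SUM i:UNIV. w $ i * H i n)" for v w
    by (simp add: distrib_right sum.distrib)
    show "B n (v + w) = B n v + B n w" for v w
    unfolding B_def add vec_eq_iff axis_def by (simp add: add_divide_distrib diff_divide_distrib)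
    have scale: "(SUM i:UNIV. (c *\<^sub>R v) $ i * H i n) = c *\<^sub>R (SUM i:UNIV. v $ i * H i n)" for c v
    by (simp add: scaleR_sum_right)
    show "B n (c *\<^sub>R v) = c *\<^sub>R B n v" for c v
    unfolding B_def scale vec_eq_iff axis_def by (simp add: divide_inverse)
   qed
   fix n
   have "norm (ypart (z n) - f (q n)) * ?Q n <= (inverse (real (Suc n)) * norm (q n) ^ r) * ?Q n"
    using key[of n] mult_nonneg_nonneg[OF norm_ge_zero[of "q n"] grad_nonneg(2)[of F f "bet n" "z n"]] by linarith
   hence "norm (ypart (z n) - f (q n)) <= inverse (real (Suc n)) * norm (q n) ^ r" using Qpos[of n] by simp
   also have "... <= ep n * norm (q n) ^ r" unfolding ep_def by (intro mult_right_mono) auto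
   finally show "norm (ypart (z n) - f (q n)) <= ep n * norm (q n) ^ r" .
   let ?P = "grad_P F f (bet n) (z n)"
   have "onorm (B n) <= ?P / norm (G (j n) n)"
   proof (rule onorm_le)
    fix v :: "'a^'n"
    have "norm (SUM i:UNIV. v $ i * H i n) <= (SUM i:UNIV. norm v * norm (H i n))"
    by (intro sum_norm_le) (simp add: norm_mult mult_right_mono norm_nth_le)
    hence "norm (SUM i:UNIV. v $ i * H i n) <= ?P * norm v" by (simp add: grad_P_def H_def sum_distrib_left mult.commute)
    thus "norm (B n v) <= ?P / norm (G (j n) n) * norm v"
    by (simp add: B_def norm_axis norm_divide divide_right_mono)
   qed
   hence "onorm (B n) * norm (q n) <= ?P / norm (G (j n) n) * norm (q n)" by (rule mult_right_mono) simp
   also have "... = (norm (q n) * ?P) / norm (G (j n) n)" by simp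
   also have "... <= (inverse (real (Suc n)) * norm (q n) ^ r * ?Q n) / norm (G (j n) n)"
    using key[of n] mult_nonneg_nonneg[OF norm_ge_zero[of "ypart (z n) - f (q n)"] grad_nonneg(1)[of F "bet n" "z n"]]
    by (intro divide_right_mono) auto
   also have "... <= (inverse (real (Suc n)) * norm (q n) ^ r * (CARD('m) * norm (G (j n) n))) / norm (G (j n) n)"
    using j[of n] by (intro divide_right_mono mult_left_mono) auto
   also have "... = ep n * norm (q n) ^ r" using Gj[of n] by (simp add: ep_def)
   finally show "onorm (B n) * norm (q n) <= ep n * norm (q n) ^ r" .
  qed
  then obtain g and sig :: "nat => nat" where sig: "strict_mono sig" and g: "r_germ r g" "r_equivalent r f g"
   and g': "!!i. g (q (sig i)) = ypart (z (sig i))"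
    "!!i. (g has_derivative (%v. fder f ((q (sig i))) v + B (sig i) v)) (at (q (sig i)))" by blast
  have "z ----> 0"
  proof (rule Lim_null_comparison)
   show "\<forall>\<^sub>F n in sequentially. norm (z n) <= d * inverse (real (Suc n))"
    using zd by (intro always_eventually allI) (auto simp: divide_inverse intro: less_imp_le)
   show "(%n. d * inverse (real (Suc n))) ----> 0" using tendsto_mult_right_zero[OF LIMSEQ_inverse_real_of_nat] .
  qed
  from LIMSEQ_subseq_LIMSEQ[OF this sig] have zl: "(%i. z (sig i)) ----> 0" by (simp add: o_def)
  from t g have "NEAR z. z : graph g \<inter> Wset F --> transverse_at (graph g) (Wset F) z" unfolding W_is_t_def by blast
  from eventually_happens[OF eventually_compose[OF this zl]] obtain i where
   i: "z (sig i) : graph g \<inter> Wset F --> transverse_at (graph g) (Wset F) (z (sig i))" by auto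
  define n where "n = sig i"
  have zg: "z n = join (q n) (g (q n))" using g'(1)[of i] by (simp add: n_def q_def)
  have Fz: "analytic_map_at F (z n)" using d(2) dn[OF zd] by blast
  have fq: "fder f ((q n)) v = (SUM i:UNIV. v $ i *s partial_map i f (q n))" for v
   using d(3) qd by (intro frechet_analytic) blast
  let ?A' = "%v. vdot (bet n) (SUM s:UNIV. v $ s *s partial_map s F (z n))"
  have "z n : graph g" unfolding zg graph_def by blast
  hence "z n : graph g \<inter> Wset F" using z(1) by blast
  with i have tr: "transverse_at (graph g) (Wset F) (z n)" by (simp add: n_def)
  \<comment> \<open>\<open>bet n\<close>, composed with the differential of \<open>F\<close>, kills
    the tangent spaces of the graph and of \<open>W\<close>, but not this vector, whose pairing is
    \<open>G (j n) n\<close>.\<close>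
  hence "join 0 (axis (j n) 1) : {u + v |u v. u : tangent_space (graph g) (z n) & v : tangent_space (Wset F) (z n)}"
   unfolding transverse_at_def by simp
  then obtain u v where uv: "join 0 (axis (j n) 1) = u + v" "u : tangent_space (graph g) (z n)" "v : tangent_space (Wset F) (z n)"
   by blast
  have "(SUM s:UNIV. v $ s *s partial_map s F (z n)) = 0"
   by (rule tangent_in_kernel[OF uv(3) _ analytic_map_at_has_derivative[OF Fz]]) (simp add: Wset_def Xset_def)
  hence v0: "?A' v = 0" by simp
  obtain w where w: "u = join w (fder f ((q n)) w + B n w)"
   using uv(2) tangent_graph[OF g'(2)[of i]] unfolding zg n_def[symmetric] by blast
  have "?A' u = (SUM i:UNIV. w $ i * H i n) + (SUM k:UNIV. B n w $ k * G k n)"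
   unfolding w vdot_total[where f = f] by (simp add: fq G_def H_def flip: q_def)
  also have "(SUM k:UNIV. B n w $ k * G k n) = - (SUM i:UNIV. w $ i * H i n)"
   using Gj[of n] by (simp add: B_def axis_def if_distrib if_distribR sum.delta cong: if_cong)
  finally have u0: "?A' u = 0" by simp
  have "?A' (join 0 (axis (j n) 1)) = ?A' u + ?A' v"
   unfolding uv(1) by (simp add: vector_sadd_rdistrib sum.distrib vdot_add)
  also have "?A' (join 0 (axis (j n) 1)) = G (j n) n"
   unfolding vdot_total[where f = f] by (simp add: G_def axis_def if_distrib if_distribR sum.delta cong: if_cong)
  finally show False using u0 v0 Gj by simp
 qed
qed

section \<open>The criterion for \<open>X\<close>\<close>

text \<open>Off \<open>Y\<close> the rank on \<open>X\<close> is at most \<open>c\<close>: it equals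
  \<open>c\<close> on the dense set \<open>W\<close>, and larger rank is an open condition. So near
  0, \<open>S\<close> consists of the points of \<open>X\<close> with \<open>x = 0\<close> or with
  all minors of size \<open>c\<close> vanishing.\<close>

lemma S_equations:
 fixes F :: "'a::{real_normed_field,euclidean_space}^('n::finite+'m::finite) => 'a^'p::finite" and f :: "'a^'n => 'a^'m"
 assumes S: "setting r F f"
 shows "EX E. finite E & (ALL e:E. analytic_at e 0) & (NEAR z. z : Sset F <-> (ALL e:E. e z = 0))"
proof -
 define c where "c = codim_germ (Xset F - Yset)"
 \<comment> \<open>For one minor, the products with all coordinates of \<open>x\<close> vanish
   exactly if \<open>x = 0\<close> or the minor is 0.\<close>
 define mn where "mn p z = z $ Inl (fst p) * det (bordered (fst (snd p)) (snd (snd p)) (jacobian F z))"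
  for p :: "'n \<times> 'p set \<times> ('p => 'n + 'm)" and z
 define E where "E = range (%l z. F z $ l) \<union> mn ` {p. card (fst (snd p)) = c}"
 from S have F0: "analytic_map_at F 0" by (simp add: setting_def)
 have ja: "analytic_at (%z. jacobian F z $ l $ k) w" if "analytic_map_at F w" for l k w
  using that by (simp add: jacobian_def analytic_map_at_def analytic_at_pd)
 from setting_ball[OF S] obtain d U where d: "d > 0"
  "ALL z. norm z < d --> analytic_map_at F z & (z : Xset F - Yset --> z : closure (Wset F)) & (r = 0 --> z : Yset --> z : Xset F)" by blast
 have "analytic_at (mn p) 0" for p
  unfolding mn_def[abs_def] using ja[OF F0] by (intro analytic_at_mult analytic_at_minor) auto
 hence an: "ALL e:E. analytic_at e 0" using F0 by (auto simp: E_def analytic_map_at_def)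
 have "z : Sset F <-> (ALL e:E. e z = 0)" if z: "norm z < d" for z
 proof (cases "z : Xset F")
  case False
  thus ?thesis by (auto simp: E_def Sset_def Xset_def vec_eq_iff)
 next
  case True
  have mz: "(ALL e:E. e z = 0) <-> xpart z = 0 | ~c <= rank (jacobian F z)"
  proof -
   have "(ALL e:E. e z = 0) <-> (ALL i I t. card I = c --> z $ Inl i = 0 | det (bordered I t (jacobian F z)) = 0)"
   proof (intro iffI allI impI ballI)
    fix i t and I :: "'p set" assume "ALL e:E. e z = 0" "card I = c"
    moreover from this(2) have "mn (i, I, t) : E" by (auto simp: E_def)
    ultimately have "mn (i, I, t) z = 0" by blast
    thus "z $ Inl i = 0 | det (bordered I t (jacobian F z)) = 0" by (simp add: mn_def)
   next
    fix e assume *: "ALL i I t. card I = c --> z $ Inl i = 0 | det (bordered I t (jacobian F z)) = 0" and "e : E"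
    then consider l where "e = (%z. F z $ l)" | p where "e = mn p" "card (fst (snd p)) = c" unfolding E_def by blast
    thus "e z = 0"
    proof cases
    case 1
    thus ?thesis using True by (simp add: Xset_def)
    next
    case 2
    thus ?thesis using *[rule_format, of "fst (snd p)" "fst p" "snd (snd p)"] by (auto simp: mn_def)
    qed
   qed
   moreover have "xpart z = 0 <-> (ALL i. z $ Inl i = 0)" by (simp add: xpart_def vec_eq_iff)
   ultimately show ?thesis unfolding rank_ge_iff_minor by blast
  qed
  have "rank (jacobian F z) <= c" if "xpart z ~= 0"
  proof (rule ccontr)
   assume "~rank (jacobian F z) <= c"
   hence "Suc c <= rank (jacobian F z)" by simp
   moreover have "ALL i j. isCont (%z. jacobian F z $ i $ j) z" using analytic_at_isCont[OF ja] d(2) z by blast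
   ultimately have "\<forall>\<^sub>F w in nhds z. Suc c <= rank (jacobian F w)" by (intro eventually_rank_ge)
   then obtain V where V: "open V" "z : V" "ALL w:V. Suc c <= rank (jacobian F w)" by (auto simp: eventually_nhds)
   have "z : closure (Wset F)" using d(2) z True that by (auto simp: Yset_def)
   then obtain w where "w : Wset F" "w : V" using V closure_iff_nhds_not_empty[of z "Wset F"] by blast
   thus False using V(3) by (auto simp: Wset_def c_def)
  qed
  thus ?thesis unfolding mz using True by (auto simp: Sset_def Wset_def Yset_def c_def)
 qed
 hence "NEAR z. z : Sset F <-> (ALL e:E. e z = 0)"
  by (intro eventually_mono[OF eventually_norm_less[OF d(1)]])
 moreover have "finite E" by (simp add: E_def)
 ultimately show ?thesis using an by blast
qed

abbreviation upper_S where "upper_S r F \<equiv> ideal_times (relS F) (m_pow r) (O_S F)"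
abbreviation lower_S where "lower_S F f \<equiv> ideal_times (relS F) (I_P f) (O_S F)"

lemma relS_vanishes: "a : relS F ==> NEAR z. z : Sset F --> a z = 0"
 by (simp add: relS_def)

lemma vdot_1: "vdot alp v = alp $ 1 * v $ 1" and norm_1: "norm w = norm (w $ 1)"
 for alp v :: "'a::comm_ring_1^1" and w :: "'b::real_normed_vector^1"
 by (simp_all add: vdot_def norm_vec_def L2_set_def)

lemma dominated_O_S: "h : O_S F ==> dominated Z (%alp z. norm alp) h"
proof -
 assume "h : O_S F"
 hence "bounded_by Z (%_. 1) (%z. h z $ 1)" by (intro analytic_bounded) (simp add: O_S_def analytic_map_at_def)
 then obtain C where C: "C >= 0" "NEAR z. z : Z --> norm (h z $ 1) <= C * 1" unfolding bounded_by_def by blast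
 from C(2) have "NEAR z. z : Z --> (ALL alp. norm (vdot alp (h z)) <= C * norm alp)"
 proof (eventually_elim, intro impI allI)
  fix z and alp :: "'a^1" assume "z : Z --> norm (h z $ 1) <= C * 1" "z : Z"
  hence "norm (h z $ 1) * norm (alp $ 1) <= C * norm (alp $ 1)" by (intro mult_right_mono) auto
  thus "norm (vdot alp (h z)) <= C * norm alp" by (simp add: vdot_1 norm_1 norm_mult mult.commute)
 qed
 with C(1) show ?thesis unfolding dominated_def by blast
qed

lemma dominated_upper_S: "h : upper_S r F ==> dominated (Sset F) (%alp z. norm (xpart z) ^ r * norm alp) h"
 by (rule dominated_ideal_times[OF bounded_by_m_pow dominated_O_S _ _ relS_vanishes]) auto

lemma dominated_lower_S: "h : lower_S F f ==> dominated (Sset F) (%alp z. norm (ypart z - f (xpart z)) * norm alp) h"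
 by (rule dominated_ideal_times[OF bounded_by_I_P dominated_O_S _ _ relS_vanishes]) auto

lemma S_terms:
 shows "(%z. (z $ Inl k) ^ r *s vec 1) : upper_S r F"
  "analytic_map_at f 0 ==> (%z. (z $ Inr j - f (xpart z) $ j) *s vec 1) : lower_S F f"
 by (intro ideal_timesI power_in_m_pow; auto simp: O_S_def analytic_map_at_def intro!: analytic_intros)
  (intro ideal_timesI analytic_graph_equation; auto simp: O_S_def I_P_def analytic_map_at_def intro!: ideal_genI analytic_graph_equation[unfolded analytic_map_at_def])

text \<open>On \<open>S\<close>, the inclusion bounds \<open>norm x ^ r\<close> off \<open>Y\<close>
  by a multiple of \<open>norm (y - f x)\<close>, while on a graph with the same jet
  \<open>norm (y - f x)\<close> is \<open>o(norm x ^ r)\<close>; together they leave only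
  \<open>x = 0\<close>.\<close>

lemma inclusion_imp_isolated:
 fixes F :: "'a::{real_normed_field,euclidean_space}^('n::finite+'m::finite) => 'a^'p::finite" and f :: "'a^'n => 'a^'m"
 assumes cs: "curve_selection TYPE('a^(('n+'m)+'m))" and S: "setting r F f"
  and incl: "upper_S r F <= int_closure (if r = 0 then curves (Sset F) - curves Yset else curves (Sset F)) (lower_S F f)"
  and g: "r_germ r g" "r_equivalent r f g"
 shows "NEAR z. z : graph g \<inter> Sset F <-> z = 0"
proof -
 from S have F0: "F 0 = 0" and f0: "analytic_map_at f 0" "f 0 = 0" by (auto simp: setting_def)
 from S_equations[OF S] obtain E where E: "finite E" "ALL e:E. analytic_at e 0" "NEAR z. z : Sset F <-> (ALL e:E. e z = 0)" by blast
 \<comment> \<open>The additional factor \<open>z $ Inl k\<close> makes \<open>?a\<close> vanish on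
   \<open>Y\<close> also for \<open>r = 0\<close>, so that only curves outside \<open>Y\<close> have
   to be tested.\<close>
 let ?a = "%k (z::'a^('n+'m)). (z $ Inl k) ^ Suc r" and ?b = "%k j z. (z $ Inr j - f (xpart z) $ j) * z $ Inl k"
 have "EX C. NEAR z. (ALL e:E. e z = 0) --> norm (?a k z) <= C * (SUM j:UNIV. norm (?b k j z))" for k
 proof (rule inequality_from_curves[OF cs E(1,2)])
  show "analytic_at (?a k) 0" by (intro analytic_intros)
  show "ALL j. analytic_at (?b k j) 0" by (intro allI analytic_at_mult analytic_graph_equation f0(1) analytic_at_nth)
  fix phi :: "'a^1 => 'a^('n+'m)"
  assume phi: "analytic_map_at phi 0" "phi 0 = 0" "NEAR t. ALL e:E. e (phi t) = 0" "NEAR t. t ~= 0 --> ?a k (phi t) ~= 0"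
  have "(phi ---> 0) (nhds 0)" using analytic_map_at_imp_tendsto[OF phi(1)] phi(2) by simp
  from eventually_compose[OF E(3) this] phi(3)
  have "NEAR t. phi t : Sset F" by eventually_elim simp
  hence phiS: "phi : curves (Sset F)" by (simp add: curves_def phi)
  have "phi ~: curves Yset"
  proof
   assume "phi : curves Yset"
   hence "NEAR t. phi t : Yset" by (simp add: curves_def)
   with phi(4) have "\<forall>\<^sub>F t in at (0::'a^1). False"
    unfolding eventually_at_filter by eventually_elim (auto simp: Yset_def xpart_def vec_eq_iff)
   thus False by simp
  qed
  hence pb: "(%z. (z $ Inl k) ^ r *s vec 1) o phi : module_gen ((%g. g o phi) ` lower_S F f)"
   using incl S_terms(1)[of k r F] phiS unfolding int_closure_def by (auto split: if_splits)
  have "EX C>=0. NEAR t. ALL alp. norm (vdot alp (((%z. (z $ Inl k) ^ r *s (vec 1 :: 'a^1)) o phi) t)) <= C * (norm (ypart (phi t) - f (xpart (phi t))) * norm alp)"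
   by (rule dominated_pullback[OF dominated_lower_S _ phiS pb]) auto
  then obtain C where C: "C >= 0" "NEAR t. ALL alp.
   norm (vdot alp (((%z. (z $ Inl k) ^ r *s (vec 1 :: 'a^1)) o phi) t)) <= C * (norm (ypart (phi t) - f (xpart (phi t))) * norm alp)" by blast
  from C(2) have "NEAR t. norm (?a k (phi t)) <= C * (SUM j:UNIV. norm (?b k j (phi t)))"
  proof eventually_elim
   case (elim t)
   let ?x = "norm (phi t $ Inl k)"
   have "?x ^ r <= C * norm (ypart (phi t) - f (xpart (phi t)))"
    using elim[rule_format, of "vec 1"] by (simp add: vdot_1 norm_1 norm_power)
   also have "... <= C * (SUM j:UNIV. norm (phi t $ Inr j - f (xpart (phi t)) $ j))"
    using norm_le_sum_nth[of "ypart (phi t) - f (xpart (phi t))"] C(1) by (intro mult_left_mono) (simp_all add: ypart_def)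
   finally have "?x ^ r * ?x <= C * (SUM j:UNIV. norm (phi t $ Inr j - f (xpart (phi t)) $ j)) * ?x" by (rule mult_right_mono) simp
   thus ?case by (simp add: norm_mult norm_power mult.commute mult.left_commute flip: sum_distrib_left)
  qed
  with C(1) show "EX C>=0. NEAR t. norm (?a k (phi t)) <= C * (SUM j:UNIV. norm (?b k j (phi t)))" by blast
 qed
 hence "ALL k. EX C. NEAR z. (ALL e:E. e z = 0) --> norm (?a k z) <= C * (SUM j:UNIV. norm (?b k j z))" by (rule allI)
 from choice[OF this] obtain C where C: "ALL k. NEAR z. (ALL e:E. e z = 0) --> norm (?a k z) <= C k * (SUM j:UNIV. norm (?b k j z))" ..
 define K where "K = (SUM k:UNIV. \<bar>C k\<bar>) + 1"
 have K: "K > 0" "C k < K" for k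
 proof -
  show "K > 0" unfolding K_def by (intro add_nonneg_pos sum_nonneg) auto
  have "\<bar>C k\<bar> <= (SUM k:UNIV. \<bar>C k\<bar>)" by (rule member_le_sum) auto
  thus "C k < K" by (simp add: K_def)
 qed
 define eta where "eta = 1 / (2 * K * CARD('m) * CARD('n) ^ r)"
 have eta: "eta > 0" using K(1) by (simp add: eta_def)
 from setting_ball[OF S] obtain d U where d: "d > 0" "ALL x. norm x < d --> analytic_map_at f x" by blast
 have cf: "C_on (Suc r) (ball 0 d) f" by (rule C_on_setting) (use d(2) in blast)
 have "NEAR x. x ~= 0 --> norm (g x - f x) <= eta * norm x ^ r"
  using jets_close[OF open_ball _ cf f0(2) g eta] d(1) by (simp add: eventually_at_filter eventually_mono)
 moreover have "(xpart ---> (0::'a^'n)) (nhds (0::'a^('n+'m)))" using analytic_map_at_imp_tendsto[OF analytic_xpart, of 0] by simp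
 ultimately have jet: "\<forall>\<^sub>F z in nhds (0::'a^('n+'m)). xpart z ~= 0 --> norm (g (xpart z) - f (xpart z)) <= eta * norm (xpart z) ^ r"
  by (rule eventually_compose)
 have g0: "g 0 = 0" using g(1) by (simp add: r_germ_def)
 have "NEAR z. ALL k:UNIV. (ALL e:E. e z = 0) --> norm (?a k z) <= C k * (SUM j:UNIV. norm (?b k j z))"
  by (intro eventually_ball_finite) (use C in auto)
 from this E(3) jet show ?thesis
 proof eventually_elim
  case (elim z)
  show ?case
  proof
   assume z: "z : graph g \<inter> Sset F"
   hence y: "ypart z = g (xpart z)" by (auto simp: graph_def)
   show "z = 0"
   proof (cases "xpart z = 0")
    case True
    hence "ypart z = 0" using y g0 by simp
    with True have "join (xpart z) (ypart z) = 0" by (simp only:) (simp add: vec_eq_iff join_def split: sum.split)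
    thus ?thesis by simp
   next
    case False
    obtain k where k: "norm (xpart z) <= CARD('n) * norm (z $ Inl k)"
    using max_coordinate[of "xpart z"] by (auto simp: xpart_def)
    hence xk: "norm (z $ Inl k) > 0" using False by (auto intro: ccontr)
    let ?y = "norm (ypart z - f (xpart z))"
    have "norm (?a k z) <= C k * (SUM j:UNIV. norm (?b k j z))" using elim(1,2) z by blast
    also have "... <= K * (SUM j:UNIV. norm (?b k j z))" using K(2)[of k] by (intro mult_right_mono sum_nonneg) auto
    also have "(SUM j:UNIV. norm (?b k j z)) <= of_nat (card (UNIV::'m set)) * (?y * norm (z $ Inl k))"
    using norm_nth_le[of "ypart z - f (xpart z)"]
    by (intro sum_bounded_above) (simp add: norm_mult mult_right_mono ypart_def)
    also have "?y <= eta * norm (xpart z) ^ r" using elim(3) False y by simp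
    also have "norm (xpart z) ^ r <= (CARD('n) * norm (z $ Inl k)) ^ r" using k by (intro power_mono) auto
    finally have "norm (?a k z) <= K * (CARD('m) * (eta * (CARD('n) * norm (z $ Inl k)) ^ r * norm (z $ Inl k)))"
    using K(1) eta by (simp add: mult_left_mono mult_right_mono)
    also have "... = (K * CARD('m) * CARD('n) ^ r * eta) * norm (?a k z)"
    by (simp add: power_mult_distrib norm_mult norm_power mult_ac)
    also have "K * CARD('m) * CARD('n) ^ r * eta = 1 / 2" using K(1) by (simp add: eta_def)
    finally have "norm (?a k z) <= 1 / 2 * norm (?a k z)" .
    moreover have "norm (?a k z) > 0" using xk by simp
    ultimately show ?thesis by linarith
   qed
  next
   assume "z = 0"
   moreover have "0 : graph g" unfolding graph_def
    by (rule range_eqI[of _ _ 0]) (simp add: g0 vec_eq_iff join_def split: sum.split)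
   ultimately show "z : graph g \<inter> Sset F" by (simp add: Sset_def Xset_def Wset_def Yset_def F0)
  qed
 qed
qed

text \<open>As for \<open>W\<close>, with a single scalar as covector: failure along a curve gives
  points of \<open>S\<close> with \<open>norm (y - f x)\<close> of order
  \<open>o(norm x ^ r)\<close>, and a graph with the given jet passes through infinitely many of
  them. Only values are prescribed, so the derivative correction is 0.\<close>

lemma isolated_imp_inclusion:
 assumes S: "setting r F f"
  and t: "!!g. r_germ r g ==> r_equivalent r f g ==> NEAR z. z : graph g \<inter> Sset F <-> z = 0"
 shows "upper_S r F <= int_closure (if r = 0 then curves (Sset F) - curves Yset else curves (Sset F)) (lower_S F f)"
proof
 fix h assume h: "h : upper_S r F"
 hence ha: "analytic_map_at h 0" unfolding ideal_times_def submodule_gen_def by (rule module_gen_analytic)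
 from S have f0: "analytic_map_at f 0" "f 0 = 0" by (auto simp: setting_def)
 show "h : int_closure (if r = 0 then curves (Sset F) - curves Yset else curves (Sset F)) (lower_S F f)"
 proof (rule ccontr)
  assume "~?thesis"
  then obtain phi where phi: "phi : curves (Sset F)" "r = 0 ==> phi ~: curves Yset" "h o phi ~: module_gen ((%g. g o phi) ` lower_S F f)"
   unfolding int_closure_def using ha by (auto split: if_splits)
  have phia: "analytic_map_at phi 0" "phi 0 = 0" using phi(1) by (auto simp: curves_def)
  have low: "analytic_map_at g 0" if "g : lower_S F f" for g
   using that unfolding ideal_times_def submodule_gen_def by (rule module_gen_analytic)
  from separating_covector[OF ha phia phi(3) low] obtain alp where
   alp: "PUNCT t. vdot (alp t) (h (phi t)) ~= 0"
    "ALL g:lower_S F f. (%t. vdot (alp t) (g (phi t))) : o[at 0](%t. vdot (alp t) (h (phi t)))" by blast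
  let ?A = "%t. norm (vdot (alp t) (h (phi t)))" and ?y = "%z. norm (ypart z - f (xpart z))"
  from dominated_upper_S[OF h] obtain C where C: "C >= 0" "NEAR z. z : Sset F -->
   (ALL alp. norm (vdot alp (h z)) <= C * (norm (xpart z) ^ r * norm alp))" unfolding dominated_def by blast
  have phil: "(phi ---> 0) (nhds 0)" using analytic_map_at_imp_tendsto[OF phia(1)] phia(2) by simp
  have C': "PUNCT t. ?A t <= C * (norm (xpart (phi t)) ^ r * norm (alp t))"
   using eventually_compose[OF C(2) phil] curve_near_0[OF phi(1) zero_less_one]
   unfolding eventually_at_filter by eventually_elim auto
  have small: "PUNCT t. (SUM j:UNIV. norm ((phi t $ Inr j - f (xpart (phi t)) $ j) * alp t $ 1)) <= eta * ?A t" if "eta > 0" for eta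
  proof (intro small_sum that)
   fix j e assume "e > (0::real)"
   from landau_o.smallD[OF bspec[OF alp(2) S_terms(2)[OF f0(1), of j]] this]
   show "PUNCT t. norm ((phi t $ Inr j - f (xpart (phi t)) $ j) * alp t $ 1) <= e * ?A t"
    by eventually_elim (simp add: vdot_1 mult.commute)
  qed auto
  \<comment> \<open>For \<open>r = 0\<close> the curve is not contained in \<open>Y\<close>, so it
    leaves \<open>Y\<close> at once; for \<open>r > 0\<close> the violated inequality itself
    excludes \<open>x = 0\<close>.\<close>
  have x0: "PUNCT t. r = 0 --> xpart (phi t) ~= 0"
  proof (cases "r = 0")
   case True
   have "~(ALL i. NEAR t. phi t $ Inl i = 0)"
   proof
    assume "ALL i. NEAR t. phi t $ Inl i = 0"
    hence "NEAR t. ALL i:UNIV. phi t $ Inl i = 0" by (intro eventually_ball_finite) auto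
    hence "NEAR t. phi t : Yset" by eventually_elim (simp add: Yset_def xpart_def vec_eq_iff)
    thus False using phi(2)[OF True] phia by (simp add: curves_def)
   qed
   then obtain i where i: "~(NEAR t. phi t $ Inl i = 0)" by blast
   have "NEAR t. t ~= 0 --> phi t $ Inl i ~= 0"
    by (rule nonzero_near_0[OF _ i]) (use phia(1) in \<open>simp add: analytic_map_at_def\<close>)
   thus ?thesis unfolding eventually_at_filter by eventually_elim (auto simp: xpart_def vec_eq_iff)
  qed simp
  from setting_ball[OF S] obtain d U where d: "d > 0" "ALL x. norm x < d --> analytic_map_at f x" by blast
  define good where "good n z <-> z : Sset F & norm z < d * inverse (real (Suc n)) & xpart z ~= 0 &
   ?y z <= inverse (real (Suc n)) * norm (xpart z) ^ r" for n z
  have "PUNCT t. good n (phi t)" for n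
  proof -
   have pos: "inverse ((C + 1) * real (Suc n)) > 0" "d * inverse (real (Suc n)) > 0" using C(1) d(1) by auto
   from small[OF pos(1)] curve_near_0[OF phi(1) pos(2)] C' alp(1) x0 show ?thesis
   proof eventually_elim
    case (elim t)
    let ?n = "norm (xpart (phi t)) ^ r" and ?w = "norm (alp t)"
    have A: "?A t > 0" using elim(4) by simp
    have "?n * ?w ~= 0"
    proof
    assume "?n * ?w = 0"
    with elim(3) A show False by simp
    qed
    hence "?n ~= 0" "?w ~= 0" by auto
    moreover have "?n >= 0" "?w >= 0" by auto
    ultimately have n: "?n > 0" "?w > 0" by linarith+
    have "?y (phi t) * ?w <= (SUM j:UNIV. norm (phi t $ Inr j - f (xpart (phi t)) $ j)) * ?w"
    using norm_le_sum_nth[of "ypart (phi t) - f (xpart (phi t))"] by (intro mult_right_mono) (simp_all add: ypart_def)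
    also have "... <= inverse ((C + 1) * real (Suc n)) * ?A t" using elim(1) by (simp add: norm_mult sum_distrib_right norm_1[of "alp t"])
    also have "... <= inverse ((C + 1) * real (Suc n)) * ((C + 1) * (?n * ?w))"
    proof (intro mult_left_mono)
    show "?A t <= (C + 1) * (?n * ?w)" using elim(3) mult_pos_pos[OF n] by (simp add: distrib_right)
    qed (use pos(1) in simp)
    also have "... = (inverse (real (Suc n)) * ?n) * ?w"
    proof -
    have "C + 1 ~= 0" using C(1) by simp
    thus ?thesis by (simp only: inverse_mult_distrib mult_ac) simp
    qed
    finally have "?y (phi t) <= inverse (real (Suc n)) * ?n" using n(2) by simp
    moreover have "xpart (phi t) ~= 0" using elim(5) n(1) by (cases "r = 0") (auto simp: power_0_left)
    ultimately show ?case using elim(2) by (simp add: good_def)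
   qed
  qed
  from points_near_0[of "%n t. good n (phi t)", OF this] obtain s where s: "!!n. good n (phi (s n))" by blast
  define z where "z n = phi (s n)" for n
  define q where "q n = xpart (z n)" for n
  have z: "z n : Sset F" "norm (z n) < d * inverse (real (Suc n))" "q n ~= 0" "norm (ypart (z n) - f (q n)) <= inverse (real (Suc n)) * norm (q n) ^ r" for n
   using s[of n] by (auto simp: good_def z_def q_def)
  have dl: "(%n. d * inverse (real (Suc n))) ----> 0" using tendsto_mult_right_zero[OF LIMSEQ_inverse_real_of_nat] .
  have zl: "z ----> 0" by (rule Lim_null_comparison[OF _ dl]) (intro always_eventually allI less_imp_le z(2))
  have ql: "q ----> 0" unfolding q_def
   by (rule Lim_null_comparison[OF _ dl]) (intro always_eventually allI order_trans[OF norm_parts_le(1) less_imp_le[OF z(2)]])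
  have qd: "norm (q n) < d" for n
  proof -
   have "d * inverse (real (Suc n)) <= d * 1" using d(1) by (intro mult_left_mono) (auto simp: field_simps)
   thus ?thesis using norm_parts_le(1)[of "z n"] z(2)[of n] by (simp add: q_def)
  qed
  have "EX g (sig::nat => nat). strict_mono sig & r_germ r g & r_equivalent r f g & (ALL i. g (q (sig i)) = ypart (z (sig i)) &
   (g has_derivative (%v. fder f ((q (sig i))) v + (%_ _. 0) (sig i) v)) (at (q (sig i))))"
  proof (rule germ_through_points[where U = "ball 0 d" and ep = "%n. inverse (real (Suc n))"])
   show "C_on (Suc r) (ball 0 d) f" by (rule C_on_setting) (use d(2) in blast)
  qed (use d(1) f0(2) ql z(3,4) qd LIMSEQ_inverse_real_of_nat in \<open>auto simp: onorm_zero linear_zero\<close>)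
  then obtain g and sig :: "nat => nat" where sig: "strict_mono sig" and g: "r_germ r g" "r_equivalent r f g"
   and g': "!!i. g (q (sig i)) = ypart (z (sig i))" by blast
  from LIMSEQ_subseq_LIMSEQ[OF zl sig] have "(%i. z (sig i)) ----> 0" by (simp add: o_def)
  from eventually_happens[OF eventually_compose[OF t[OF g] this]] obtain i where
   i: "z (sig i) : graph g \<inter> Sset F <-> z (sig i) = 0" by auto
  have "z (sig i) = join (q (sig i)) (g (q (sig i)))" unfolding g' by (simp add: q_def)
  hence "z (sig i) : graph g" unfolding graph_def by (rule range_eqI)
  with i z(1,3)[of "sig i"] show False by (simp add: q_def)
 qed
qed

section \<open>Specialisation to the real and complex fields\<close>

lemma conjugable_real: "conjugable TYPE(real)"
 unfolding conjugable_def
proof (intro conjI allI)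
 fix x :: real
 show "\<exists>th. norm th = 1 & 1 \<bullet> (th * x) = norm x" by (intro exI[of _ "if x >= 0 then 1 else -1"]) auto
qed auto

lemma conjugable_complex: "conjugable TYPE(complex)"
 unfolding conjugable_def
proof (intro conjI allI)
 fix a :: complex
 show "EX c. ALL b. a \<bullet> b = 1 \<bullet> (c * b)" by (intro exI[of _ "cnj a"]) (simp add: inner_complex_def)
 show "\<exists>th. norm th = 1 & 1 \<bullet> (th * a) = norm a"
 proof (cases "a = 0")
  case False
  have "cnj (sgn a) * a = of_real (norm a)" using False
   by (simp add: sgn_div_norm scaleR_conv_of_real complex_norm_square[symmetric] mult.commute[of "cnj a"] power2_eq_square field_simps)
  thus ?thesis using False by (intro exI[of _ "cnj (sgn a)"]) (simp add: norm_sgn inner_complex_def)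
 qed (auto intro: exI[of _ 1])
qed

theorem theorem2p7:
  shows
   "(\<forall>r (F :: real^('n::finite+'m::finite) \<Rightarrow> real^'p::finite) (f :: real^'n \<Rightarrow> real^'m).
      setting r F f \<longrightarrow>
        (W_is_t r F f \<longleftrightarrow>
           ideal_times (relX F) (m_pow r) (JM_y F)
             \<subseteq> int_closure (curves (Xset F))
                 (module_sum (ideal_times (relX F) m_ideal (JM_P F f))
                             (ideal_times (relX F) (I_P f) (JM_y F)))) \<and>
        (X_is_t r F f \<longleftrightarrow> W_is_t r F f \<and>
           ideal_times (relS F) (m_pow r) (O_S F)
             \<subseteq> int_closure (if r = 0 then curves (Sset F) - curves Yset else curves (Sset F))
                 (ideal_times (relS F) (I_P f) (O_S F))))
    \<and>
    (\<forall>r (F :: complex^('n::finite+'m::finite) \<Rightarrow> complex^'p::finite) (f :: complex^'n \<Rightarrow> complex^'m).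
      setting r F f \<longrightarrow>
        (W_is_t r F f \<longleftrightarrow>
           ideal_times (relX F) (m_pow r) (JM_y F)
             \<subseteq> int_closure (curves (Xset F))
                 (module_sum (ideal_times (relX F) m_ideal (JM_P F f))
                             (ideal_times (relX F) (I_P f) (JM_y F)))) \<and>
        (X_is_t r F f \<longleftrightarrow> W_is_t r F f \<and>
           ideal_times (relS F) (m_pow r) (O_S F)
             \<subseteq> int_closure (if r = 0 then curves (Sset F) - curves Yset else curves (Sset F))
                 (ideal_times (relS F) (I_P f) (O_S F))))"
proof -
 \<comment> \<open>The argument is uniform in the field; of the field it uses
   \<open>conjugable\<close> and curve selection in two auxiliary spaces.\<close>
 have gen: "(W_is_t r F f <-> upper r F <= int_closure (curves (Xset F)) (lower F f)) &
   (X_is_t r F f <-> W_is_t r F f &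
    upper_S r F <= int_closure (if r = 0 then curves (Sset F) - curves Yset else curves (Sset F)) (lower_S F f))"
  if S: "setting r F f" and cj: "conjugable TYPE('a)"
   and cs: "curve_selection TYPE('a^((('n+'m)+'p)+(('n\<times>'n)+('m\<times>'m))))" "curve_selection TYPE('a^(('n+'m)+'m))"
  for r and F :: "'a::{real_normed_field,euclidean_space}^('n+'m) => 'a^'p" and f :: "'a^'n => 'a^'m"
 proof -
  have F0: "analytic_map_at F 0" and f0: "analytic_map_at f 0" using S by (auto simp: setting_def)
  have "W_is_t r F f <-> upper r F <= int_closure (curves (Xset F)) (lower F f)"
   using inequality_imp_transverse[OF cj S criterion_imp_inequality[OF cs(1) F0 f0]] transverse_imp_criterion[OF S] by blast
  moreover have "(ALL g. r_germ r g & r_equivalent r f g --> (NEAR z. z : graph g \<inter> Sset F <-> z = 0)) <->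
    upper_S r F <= int_closure (if r = 0 then curves (Sset F) - curves Yset else curves (Sset F)) (lower_S F f)"
   using inclusion_imp_isolated[OF cs(2) S] isolated_imp_inclusion[OF S] by blast
  ultimately show ?thesis unfolding X_is_t_def by blast
 qed
 show ?thesis
  by (intro conjI[OF allI[OF allI[OF allI[OF impI]]] allI[OF allI[OF allI[OF impI]]]])
   (rule gen; simp add: conjugable_real conjugable_complex curve_selection_real curve_selection_complex)+
qed

end
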